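(* Let $E$ be a locally complete lcHs over $\mathbb{K}$. Then the following holds: a) $\bigl(\sum_{n\in\mathbb{N}_{0}^{d},|n|\leq k}\mathscr{F}^{E}_{n}h_{n}\bigr)_{k\in\mathbb{N}}$ is a Schauder decomposition of $\mathcal{S}(\mathbb{R}^{d},E)$ and \[ f=\sum_{n\in\mathbb{N}_{0}^{d}}\widehat{f}(n)h_{n},\quad f\in\mathcal{S}(\mathbb{R}^{d},E). \] b) The map \[ \mathscr{F}^{E}\colon\mathcal{S}(\mathbb{R}^{d},E)\to s(\mathbb{N}_{0}^{d},E),\;\mathscr{F}^{E}(f):=\bigl(\widehat{f}(n)\bigr)_{n\in\mathbb{N}_{0}^{d}}, \] is an isomorphism and $\mathscr{F}^{E}=S_{s(\mathbb{N}_{0}^{d})}\circ(\mathscr{F}^{\mathbb{K}}\varepsilon\operatorname{id}_{E})\circ S_{\mathcal{S}(\mathbb{R}^{d})}^{-1}$.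
   Context: $\mathbb{K}=\mathbb{R}$ or $\mathbb{C}$, $d\in\mathbb{N}$. An lcHs is a non-trivial locally convex Hausdorff space over $\mathbb{K}$; the topology of $E$ is given by a directed system of seminorms $(p_\alpha)_{\alpha\in\mathfrak{A}}$. $E$ is locally complete if for every closed bounded absolutely convex $D\subset E$ the space $E_D:=\bigcup_n nD$, normed by the gauge of $D$, is a Banach space. Isomorphisms are linear and topological. $\mathcal{S}(\mathbb{R}^{d},E)$ is the space of $f\in\mathcal{C}^{\infty}(\mathbb{R}^{d},E)$ with $\sup_{x\in\mathbb{R}^{d},|\beta|\le m}p_\alpha((\partial^{\beta})^{E}f(x))(1+|x|^{2})^{m/2}<\infty$ for all $m\in\mathbb{N}_0$, $\alpha\in\mathfrak{A}$, with the topology of these seminorms. $s(\mathbb{N}_0^{d},E)$ is the space of $x=(x_k)\in E^{\mathbb{N}_0^{d}}$ with $\sup_{k}p_\alpha(x_k)(1+|k|^{2})^{j/2}<\infty$ for all $j\in\mathbb{N}$, $\alpha\in\mathfrak{A}$, with these seminorms ($|k|$ Euclidean norm). For $E=\mathbb{K}$ write $\mathcal{S}(\mathbb{R}^{d})$, $s(\mathbb{N}_0^{d})$. Hermite functions: for $n\in\mathbb{N}_0$, $h_n(x):=(2^{n}n!\sqrt{\pi})^{-1/2}\bigl(x-\tfrac{d}{dx}\bigr)^{n}e^{-x^{2}/2}$, $x\in\mathbb{R}$; for $n\in\mathbb{N}_0^{d}$, $h_n(x):=\prod_{k=1}^{d}h_{n_k}(x_k)$, $x\in\mathbb{R}^{d}$.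 For $f\in\mathcal{S}(\mathbb{R}^{d},E)$, $\widehat{f}(n):=\mathscr{F}^{E}_n(f):=\int_{\mathbb{R}^{d}}f(x)h_n(x)\,dx\in E$ as a Pettis integral, i.e. the unique element with $e'(\widehat f(n))=\int_{\mathbb{R}^{d}}e'(f(x))h_n(x)\,dx$ for all $e'\in E'$ (it exists since $E$ is locally complete). $\mathscr{F}^{E}_nh_n$ denotes the operator $f\mapsto\widehat f(n)h_n$. For an lcHs $F$, $F'_\kappa$ is $F'$ with the topology of uniform convergence on absolutely convex compact subsets of $F$; $F\varepsilon E:=L_e(F'_\kappa,E)$ carries the topology of uniform convergence on equicontinuous subsets of $F'$; for $T\in L(F_1,F_2)$, $(T\varepsilon\operatorname{id}_E)(u):=u\circ T^{t}$. For a space $\mathcal{F}(\Omega)$ of scalar functions, $S_{\mathcal{F}(\Omega)}(u):=[x\mapsto u(\delta_x)]$, $u\in\mathcal{F}(\Omega)\varepsilon E$, with $\delta_x(f)=f(x)$; here $S_{\mathcal{S}(\mathbb{R}^{d})}\colon\mathcal{S}(\mathbb{R}^{d})\varepsilon E\to\mathcal{S}(\mathbb{R}^{d},E)$ and $S_{s(\mathbb{N}_0^{d})}\colon s(\mathbb{N}_0^{d})\varepsilon E\to s(\mathbb{N}_0^{d},E)$ are isomorphisms. A Schauder decomposition of an lcHs $X$ is a sequence $(P_k)_{k\in\mathbb{N}}$ of continuous linear projections on $X$ such that $P_kP_j=P_{\min(j,k)}$, $P_k\neq P_j$ for $k\neq j$, and $P_kx\to x$ for each $x\in X$. *)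

theory Defs
  imports "HOL-Analysis.Analysis" "HOL-Library.Function_Algebras"
begin

(* The scalar field K is the reals or the complex numbers, up to isomorphism; the multiplicative
   norm is then the usual absolute value. *)

class real_or_complex = real_normed_field + euclidean_space +
  assumes real_or_complex:
    "(\<forall>z. \<exists>a. z = a *\<^sub>R 1) \<or>
     (\<exists>i. i * i = - 1 \<and> (\<forall>z. \<exists>a b. z = a *\<^sub>R 1 + b *\<^sub>R i))"

instance real :: real_or_complex
  by standard simp

instance complex :: real_or_complex
proof
  have "z = Re z *\<^sub>R 1 + Im z *\<^sub>R \<i>" for z :: complex
    by (simp add: complex_eq_iff)
  moreover have "\<i> * \<i> = - 1"
    by simp
  ultimately show "(\<forall>z::complex. \<exists>a. z = a *\<^sub>R 1) \<or>
     (\<exists>i::complex. i * i = - 1 \<and> (\<forall>z. \<exists>a b. z = a *\<^sub>R 1 + b *\<^sub>R i))"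
    by blast
qed

(* A space is a linear subspace "car" of an ambient K-vector space (the whole type, with scalar
   multiplication "scl"), topologised by a set "sn" of seminorms. Only the values on "car" of the
   elements of "sn" matter. Function spaces live in function types with pointwise addition. *)

record ('k, 'v) lcs =
  car :: "'v set"
  scl :: "'k \<Rightarrow> 'v \<Rightarrow> 'v"
  sn :: "('v \<Rightarrow> real) set"

definition lctop :: "('k, 'v::ab_group_add) lcs \<Rightarrow> 'v topology" where
  "lctop X = topology_generated_by
     (insert (car X) {{y \<in> car X. p (y - x) < r} | p x r. p \<in> sn X \<and> x \<in> car X \<and> 0 < r})"

lemma topspace_lctop [simp]: "topspace (lctop X) = car X"
  unfolding lctop_def by auto

definition seminorm_on :: "('k::real_or_complex, 'v::ab_group_add) lcs \<Rightarrow> ('v \<Rightarrow> real) \<Rightarrow> bool" where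
  "seminorm_on X p \<longleftrightarrow>
     (\<forall>x\<in>car X. \<forall>y\<in>car X. p (x + y) \<le> p x + p y) \<and>
     (\<forall>a. \<forall>x\<in>car X. p (scl X a x) = norm a * p x)"

definition lcHs :: "('k::real_or_complex, 'v::ab_group_add) lcs \<Rightarrow> bool" where
  "lcHs X \<longleftrightarrow>
     vector_space (scl X) \<and> module.subspace (scl X) (car X) \<and>
     (\<exists>x\<in>car X. x \<noteq> 0) \<and>
     (\<forall>p\<in>sn X. seminorm_on X p) \<and>
     (\<forall>p\<in>sn X. \<forall>q\<in>sn X. \<exists>r\<in>sn X. \<exists>C. \<forall>x\<in>car X. p x \<le> C * r x \<and> q x \<le> C * r x) \<and>
     Hausdorff_space (lctop X)"

definition scalar_lcs :: "('k::real_or_complex, 'k) lcs" where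
  "scalar_lcs = \<lparr>car = UNIV, scl = (*), sn = {norm}\<rparr>"

definition absconvex :: "('k::real_or_complex, 'v::ab_group_add) lcs \<Rightarrow> 'v set \<Rightarrow> bool" where
  "absconvex X D \<longleftrightarrow> D \<noteq> {} \<and> D \<subseteq> car X \<and>
     (\<forall>x\<in>D. \<forall>y\<in>D. \<forall>a b. norm a + norm b \<le> 1 \<longrightarrow> scl X a x + scl X b y \<in> D)"

definition bounded_in :: "('k, 'v::ab_group_add) lcs \<Rightarrow> 'v set \<Rightarrow> bool" where
  "bounded_in X D \<longleftrightarrow> D \<subseteq> car X \<and> (\<forall>p\<in>sn X. bdd_above (p ` D))"

definition gauge_span :: "('k::real_or_complex, 'v::ab_group_add) lcs \<Rightarrow> 'v set \<Rightarrow> 'v set" where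
  "gauge_span X D = (\<Union>n::nat. scl X (of_nat n) ` D)"

definition gauge_of :: "('k::real_or_complex, 'v::ab_group_add) lcs \<Rightarrow> 'v set \<Rightarrow> 'v \<Rightarrow> real" where
  "gauge_of X D x = Inf {t. 0 < t \<and> x \<in> scl X (of_real t) ` D}"

(* For bounded absolutely convex D in a Hausdorff space the gauge is automatically a norm on its
   span, so being a Banach space means completeness. *)

definition locally_complete :: "('k::real_or_complex, 'v::ab_group_add) lcs \<Rightarrow> bool" where
  "locally_complete X \<longleftrightarrow>
     (\<forall>D. closedin (lctop X) D \<and> bounded_in X D \<and> absconvex X D \<longrightarrow>
       (\<forall>\<sigma>::nat \<Rightarrow> 'v. range \<sigma> \<subseteq> gauge_span X D \<and>
          (\<forall>\<epsilon>>0. \<exists>N. \<forall>m\<ge>N. \<forall>n\<ge>N. gauge_of X D (\<sigma> m - \<sigma> n) < \<epsilon>) \<longrightarrow>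
          (\<exists>x\<in>gauge_span X D. (\<lambda>n. gauge_of X D (\<sigma> n - x)) \<longlonglongrightarrow> 0)))"

definition linear_lcs ::
  "('k::real_or_complex, 'v::ab_group_add) lcs \<Rightarrow> ('k, 'w::ab_group_add) lcs \<Rightarrow> ('v \<Rightarrow> 'w) \<Rightarrow> bool" where
  "linear_lcs X Y T \<longleftrightarrow> T ` car X \<subseteq> car Y \<and>
     (\<forall>x\<in>car X. \<forall>y\<in>car X. T (x + y) = T x + T y) \<and>
     (\<forall>a. \<forall>x\<in>car X. T (scl X a x) = scl Y a (T x))"

definition cont_linear_lcs ::
  "('k::real_or_complex, 'v::ab_group_add) lcs \<Rightarrow> ('k, 'w::ab_group_add) lcs \<Rightarrow> ('v \<Rightarrow> 'w) \<Rightarrow> bool" where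
  "cont_linear_lcs X Y T \<longleftrightarrow> linear_lcs X Y T \<and> continuous_map (lctop X) (lctop Y) T"

definition isomorphism_lcs ::
  "('k::real_or_complex, 'v::ab_group_add) lcs \<Rightarrow> ('k, 'w::ab_group_add) lcs \<Rightarrow> ('v \<Rightarrow> 'w) \<Rightarrow> bool" where
  "isomorphism_lcs X Y T \<longleftrightarrow> linear_lcs X Y T \<and> homeomorphic_map (lctop X) (lctop Y) T"

(* The sequence is indexed by k = 1, 2, ...; P 0 is irrelevant. *)

definition schauder_decomposition ::
  "('k::real_or_complex, 'v::ab_group_add) lcs \<Rightarrow> (nat \<Rightarrow> 'v \<Rightarrow> 'v) \<Rightarrow> bool" where
  "schauder_decomposition X P \<longleftrightarrow> lcHs X \<and>
     (\<forall>k\<ge>1. cont_linear_lcs X X (P k)) \<and>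
     (\<forall>k\<ge>1. \<forall>j\<ge>1. \<forall>x\<in>car X. P k (P j x) = P (min j k) x) \<and>
     (\<forall>k\<ge>1. \<forall>j\<ge>1. k \<noteq> j \<longrightarrow> (\<exists>x\<in>car X. P k x \<noteq> P j x)) \<and>
     (\<forall>x\<in>car X. limitin (lctop X) (\<lambda>k. P k x) x sequentially)"

(* Elements of spaces of operators are normalised to vanish off the domain, so that equality of
   operators is equality of HOL functions. *)

definition ops :: "('k::real_or_complex, 'v::ab_group_add) lcs \<Rightarrow> ('k, 'w::ab_group_add) lcs \<Rightarrow> ('v \<Rightarrow> 'w) set" where
  "ops X Y = {T. cont_linear_lcs X Y T \<and> (\<forall>x. x \<notin> car X \<longrightarrow> T x = 0)}"

definition dual :: "('k::real_or_complex, 'v::ab_group_add) lcs \<Rightarrow> ('v \<Rightarrow> 'k) set" where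
  "dual X = ops X scalar_lcs"

definition dual_kappa :: "('k::real_or_complex, 'v::ab_group_add) lcs \<Rightarrow> ('k, 'v \<Rightarrow> 'k) lcs" where
  "dual_kappa X =
     \<lparr>car = dual X, scl = (\<lambda>a y x. a * y x),
      sn = {\<lambda>y. SUP x\<in>K. norm (y x) | K. absconvex X K \<and> compactin (lctop X) K}\<rparr>"

definition equicontinuous :: "('k::real_or_complex, 'v::ab_group_add) lcs \<Rightarrow> ('v \<Rightarrow> 'k) set \<Rightarrow> bool" where
  "equicontinuous X M \<longleftrightarrow> M \<subseteq> dual X \<and>
     (\<forall>\<epsilon>>0. \<exists>U. openin (lctop X) U \<and> 0 \<in> U \<and> (\<forall>y\<in>M. \<forall>x\<in>U. norm (y x) < \<epsilon>))"

definition eps_product ::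
  "('k::real_or_complex, 'v::ab_group_add) lcs \<Rightarrow> ('k, 'e::ab_group_add) lcs \<Rightarrow> ('k, ('v \<Rightarrow> 'k) \<Rightarrow> 'e) lcs" where
  "eps_product X E =
     \<lparr>car = ops (dual_kappa X) E, scl = (\<lambda>a u y. scl E a (u y)),
      sn = {\<lambda>u. SUP y\<in>M. p (u y) | M p. equicontinuous X M \<and> M \<noteq> {} \<and> p \<in> sn E}\<rparr>"

definition transp ::
  "('k::real_or_complex, 'v::ab_group_add) lcs \<Rightarrow> ('v \<Rightarrow> 'w::ab_group_add) \<Rightarrow> ('w \<Rightarrow> 'k) \<Rightarrow> 'v \<Rightarrow> 'k" where
  "transp X T y = (\<lambda>x. if x \<in> car X then y (T x) else 0)"

definition eps_id ::
  "('k::real_or_complex, 'v::ab_group_add) lcs \<Rightarrow> ('k, 'w::ab_group_add) lcs \<Rightarrow> ('v \<Rightarrow> 'w) \<Rightarrow>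
    (('v \<Rightarrow> 'k) \<Rightarrow> 'e::ab_group_add) \<Rightarrow> ('w \<Rightarrow> 'k) \<Rightarrow> 'e" where
  "eps_id X Y T u = (\<lambda>y. if y \<in> dual Y then u (transp X T y) else 0)"

definition point_eval :: "('k::real_or_complex, 'a \<Rightarrow> 'k) lcs \<Rightarrow> 'a \<Rightarrow> ('a \<Rightarrow> 'k) \<Rightarrow> 'k" where
  "point_eval F x = (\<lambda>f. if f \<in> car F then f x else 0)"

definition S_map ::
  "('k::real_or_complex, 'a \<Rightarrow> 'k) lcs \<Rightarrow> ((('a \<Rightarrow> 'k) \<Rightarrow> 'k) \<Rightarrow> 'e) \<Rightarrow> 'a \<Rightarrow> 'e" where
  "S_map F u = (\<lambda>x. u (point_eval F x))"

definition has_partial ::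
  "('k::real_or_complex, 'e::ab_group_add) lcs \<Rightarrow> 'd::finite \<Rightarrow> (real^'d \<Rightarrow> 'e) \<Rightarrow> real^'d \<Rightarrow> 'e \<Rightarrow> bool" where
  "has_partial E i f x l \<longleftrightarrow>
     limitin (lctop E) (\<lambda>h::real. scl E (of_real (1 / h)) (f (x + axis i h) - f x)) l (at 0)"

definition partial ::
  "('k::real_or_complex, 'e::ab_group_add) lcs \<Rightarrow> 'd::finite \<Rightarrow> (real^'d \<Rightarrow> 'e) \<Rightarrow> real^'d \<Rightarrow> 'e" where
  "partial E i f = (\<lambda>x. THE l. has_partial E i f x l)"

primrec Ck :: "('k::real_or_complex, 'e::ab_group_add) lcs \<Rightarrow> nat \<Rightarrow> (real^'d::finite \<Rightarrow> 'e) set" where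
  "Ck E 0 = {f. continuous_map euclidean (lctop E) f}"
| "Ck E (Suc k) = {f. continuous_map euclidean (lctop E) f \<and>
     (\<forall>i. (\<forall>x. \<exists>l. has_partial E i f x l) \<and> partial E i f \<in> Ck E k)}"

definition Cinf :: "('k::real_or_complex, 'e::ab_group_add) lcs \<Rightarrow> (real^'d::finite \<Rightarrow> 'e) set" where
  "Cinf E = (\<Inter>k. Ck E k)"

(* The order on the index type 'd fixes the order of differentiation: for coordinates 1 < ... < d
   this is D_1^(beta_1) (... (D_d^(beta_d) f)). *)

definition multi_partial ::
  "('k::real_or_complex, 'e::ab_group_add) lcs \<Rightarrow> nat^'d::{finite,linorder} \<Rightarrow> (real^'d::{finite,linorder} \<Rightarrow> 'e) \<Rightarrow> real^'d::{finite,linorder} \<Rightarrow> 'e" where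
  "multi_partial E \<beta> f =
     foldr (\<lambda>i. partial E i ^^ (\<beta> $ i)) (sorted_list_of_set UNIV) f"

definition mlength :: "nat^'d::finite \<Rightarrow> nat" where
  "mlength \<beta> = (\<Sum>i\<in>UNIV. \<beta> $ i)"

definition enorm :: "nat^'d::finite \<Rightarrow> real" where
  "enorm n = sqrt (\<Sum>i\<in>UNIV. (real (n $ i))\<^sup>2)"

definition schwartz_values ::
  "('k::real_or_complex, 'e::ab_group_add) lcs \<Rightarrow> nat \<Rightarrow> ('e \<Rightarrow> real) \<Rightarrow> (real^'d::{finite,linorder} \<Rightarrow> 'e) \<Rightarrow> real set" where
  "schwartz_values E m p f =
     {p (multi_partial E \<beta> f x) * (1 + (norm x)\<^sup>2) powr (real m / 2) | x \<beta>. mlength \<beta> \<le> m}"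

definition schwartz ::
  "('k::real_or_complex, 'e::ab_group_add) lcs \<Rightarrow> ('k, real^'d::{finite,linorder} \<Rightarrow> 'e) lcs" where
  "schwartz E =
     \<lparr>car = {f \<in> Cinf E. \<forall>m. \<forall>p\<in>sn E. bdd_above (schwartz_values E m p f)},
      scl = (\<lambda>a f x. scl E a (f x)),
      sn = {\<lambda>f. Sup (schwartz_values E m p f) | m p. p \<in> sn E}\<rparr>"

definition rapid_values ::
  "nat \<Rightarrow> ('e \<Rightarrow> real) \<Rightarrow> (nat^'d::finite \<Rightarrow> 'e) \<Rightarrow> real set" where
  "rapid_values j p x = range (\<lambda>k. p (x k) * (1 + (enorm k)\<^sup>2) powr (real j / 2))"

definition rapid ::
  "('k::real_or_complex, 'e::ab_group_add) lcs \<Rightarrow> ('k, nat^'d::finite \<Rightarrow> 'e) lcs" where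
  "rapid E =
     \<lparr>car = {x. range x \<subseteq> car E \<and> (\<forall>j\<ge>1. \<forall>p\<in>sn E. bdd_above (rapid_values j p x))},
      scl = (\<lambda>a x k. scl E a (x k)),
      sn = {\<lambda>x. Sup (rapid_values j p x) | j p. 1 \<le> j \<and> p \<in> sn E}\<rparr>"

definition hermite1 :: "nat \<Rightarrow> real \<Rightarrow> real" where
  "hermite1 n x =
     ((\<lambda>g t. t * g t - deriv g t) ^^ n) (\<lambda>t. exp (- t\<^sup>2 / 2)) x / sqrt (2 ^ n * fact n * sqrt pi)"

definition hermite :: "nat^'d::finite \<Rightarrow> real^'d \<Rightarrow> real" where
  "hermite n x = (\<Prod>i\<in>UNIV. hermite1 (n $ i) (x $ i))"

definition has_pettis_integral ::
  "('k::real_or_complex, 'e::ab_group_add) lcs \<Rightarrow> (real^'d::finite \<Rightarrow> 'e) \<Rightarrow> 'e \<Rightarrow> bool" where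
  "has_pettis_integral E g y \<longleftrightarrow> y \<in> car E \<and>
     (\<forall>e'\<in>dual E. integrable lborel (\<lambda>x. e' (g x)) \<and> e' y = (\<integral>x. e' (g x) \<partial>lborel))"

(* The Hermite coefficient is a Pettis integral; it exists for Schwartz functions with values in a
   locally complete space. *)

definition hermite_coeff ::
  "('k::real_or_complex, 'e::ab_group_add) lcs \<Rightarrow> nat^'d::finite \<Rightarrow> (real^'d \<Rightarrow> 'e) \<Rightarrow> 'e" where
  "hermite_coeff E n f = (THE y. has_pettis_integral E (\<lambda>x. scl E (of_real (hermite n x)) (f x)) y)"

definition hermite_transform ::
  "('k::real_or_complex, 'e::ab_group_add) lcs \<Rightarrow> (real^'d::finite \<Rightarrow> 'e) \<Rightarrow> nat^'d \<Rightarrow> 'e" where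
  "hermite_transform E f = (\<lambda>n. hermite_coeff E n f)"

definition hermite_component ::
  "('k::real_or_complex, 'e::ab_group_add) lcs \<Rightarrow> nat^'d::finite \<Rightarrow> (real^'d \<Rightarrow> 'e) \<Rightarrow> real^'d \<Rightarrow> 'e" where
  "hermite_component E n f = (\<lambda>x. scl E (of_real (hermite n x)) (hermite_coeff E n f))"

end

theory Submission
  imports Defs "HOL-Probability.Probability"
begin

text \<open>Local completeness is used only to sum geometrically small increments: a sequence with
  \<open>p (\<sigma> (N + 1) - \<sigma> N) \<le> C\<^sub>p 2\<^sup>-\<^sup>N\<close> for all seminorms converges, because \<open>{x. p x \<le> C\<^sub>p for all p}\<close> is a
  closed bounded disk whose span is a Banach space. This yields the Pettis integrals as limits of
  dyadic Riemann sums, and the series \<open>G y = \<Sum> y\<^sub>n h\<^sub>n\<close> of rapidly decreasing sequences \<open>y\<close>. By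
  Hahn--Banach all estimates reduce to the scalar functions \<open>e' \<circ> f\<close>. There the ladder operators
  \<open>x \<plusminus> d/dx\<close> give the decay of the coefficients, and polynomial growth in \<open>n\<close> of the weighted
  derivatives of \<open>h\<^sub>n\<close> makes \<open>G\<close> continuous; orthonormality and completeness of the Hermite functions
  show that \<open>G\<close> is inverse to the transform.

  For the epsilon product, the coefficient functional \<open>f \<mapsto> \<integral> f h\<^sub>n\<close> is a limit of combinations of point
  evaluations, uniformly on compact sets. So every \<open>u\<close> representing \<open>f\<close> sends it to the \<open>n\<close>-th
  coefficient of \<open>f\<close>. Such a \<open>u\<close> is \<open>y \<mapsto> \<Sum> y(h\<^sub>n) f\<^sub>n\<close>, where \<open>f\<^sub>n\<close> are the coefficients of \<open>f\<close>; it is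
  continuous because \<open>G\<close> maps \<open>{a. |a\<^sub>n| \<le> p(f\<^sub>n)}\<close>, compact by Tychonoff, to a compact disk.\<close>

section \<open>Spaces topologised by seminorms\<close>

text \<open>In a space that is merely locally complete, Cauchy sequences need not converge. This
  shapes the proof: a vector is always produced as the limit of a sequence whose increments are of
  order \<open>2 ^ -N\<close>, and is then identified by its images under functionals. Hence box and
  mesh of the Riemann sums are dyadic, and series are grouped into dyadic shells of the weight.
  Constants may depend on a seminorm that dominates a functional, never on the functional itself;
  otherwise a scalar estimate could not be carried back to \<open>p\<close>.

  Decay of coefficients rests on the operator \<open>(x - d/dx) (x + d/dx)\<close>, which multiplies
  the n-th coefficient by \<open>2 n\<close>. Growth of \<open>h_n\<close> is measured in the
  supremum norm and comes from Sonin's monotone quantity. The constant 1/8 of the completeness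
  argument is small enough for the factor \<open>exp (- 3/8 x^2)\<close> left over in every
  \<open>h_n\<close> to dominate all partial sums of the exponential series at once.

  The scalar field is an instance of the same theory as \<open>E\<close>, which supplies the test
  functions of the epsilon product. The inverse of \<open>S\<close> is a chosen preimage; all
  preimages of \<open>f\<close> agree on the coefficient functionals.\<close>

locale seminormed =
  fixes X :: "('k::real_or_complex, 'v::ab_group_add) lcs"
  assumes vs: "vector_space (scl X)"
    and subsp: "module.subspace (scl X) (car X)"
    and sn_seminorm: "\<And>p. p \<in> sn X \<Longrightarrow> seminorm_on X p"
begin

interpretation V: vector_space "scl X" by (rule vs)

lemma zero_in [simp]: "0 \<in> car X"
  using subsp by (rule V.subspace_0)

lemma add_in [simp]: "x \<in> car X \<Longrightarrow> y \<in> car X \<Longrightarrow> x + y \<in> car X"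
  using subsp by (rule V.subspace_add)

lemma diff_in [simp]: "x \<in> car X \<Longrightarrow> y \<in> car X \<Longrightarrow> x - y \<in> car X"
  using subsp by (rule V.subspace_diff)

lemma neg_in [simp]: "x \<in> car X \<Longrightarrow> - x \<in> car X"
  using subsp by (rule V.subspace_neg)

lemma scl_in [simp]: "x \<in> car X \<Longrightarrow> scl X a x \<in> car X"
  using subsp by (rule V.subspace_scale)

lemma sum_in [simp]: "(\<And>i. i \<in> A \<Longrightarrow> f i \<in> car X) \<Longrightarrow> sum f A \<in> car X"
  using subsp by (rule V.subspace_sum)

lemmas scl_rules = V.scale_right_distrib V.scale_left_distrib V.scale_right_diff_distrib
  V.scale_left_diff_distrib V.scale_scale V.scale_minus_left V.scale_minus_right

lemma scl_simps [simp]: "scl X 1 x = x" "scl X 0 x = 0" "scl X a 0 = 0"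
  by auto

lemmas scl_sum_right = V.scale_sum_right

context
  fixes p :: "'v \<Rightarrow> real"
  assumes p: "seminorm_on X p"
begin

lemma p_triangle: "x \<in> car X \<Longrightarrow> y \<in> car X \<Longrightarrow> p (x + y) \<le> p x + p y"
  using p by (auto simp: seminorm_on_def)

lemma p_scl: "x \<in> car X \<Longrightarrow> p (scl X a x) = norm a * p x"
  using p by (auto simp: seminorm_on_def)

lemma p_zero: "p 0 = 0"
  using p_scl[of 0 0] by simp

lemma p_neg: "x \<in> car X \<Longrightarrow> p (- x) = p x"
  using p_scl[of x "-1"] by (simp add: scl_rules)

lemma p_nonneg: "x \<in> car X \<Longrightarrow> 0 \<le> p x"
  using p_triangle[of x "- x"] by (simp add: p_neg p_zero)

lemma p_diff: "x \<in> car X \<Longrightarrow> y \<in> car X \<Longrightarrow> p (x - y) \<le> p x + p y"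
  using p_triangle[of x "- y"] by (simp add: p_neg)

lemma p_diff_commute: "x \<in> car X \<Longrightarrow> y \<in> car X \<Longrightarrow> p (x - y) = p (y - x)"
  using p_neg[of "x - y"] by simp

lemma p_diff_triangle:
  "x \<in> car X \<Longrightarrow> y \<in> car X \<Longrightarrow> z \<in> car X \<Longrightarrow> p (x - z) \<le> p (x - y) + p (y - z)"
  using p_triangle[of "x - y" "y - z"] by simp

lemma p_abs_diff: "x \<in> car X \<Longrightarrow> y \<in> car X \<Longrightarrow> \<bar>p x - p y\<bar> \<le> p (x - y)"
  using p_triangle[of "x - y" y] p_triangle[of "y - x" x] p_diff_commute[of x y] by simp

lemma p_sum: "(\<And>i. i \<in> A \<Longrightarrow> f i \<in> car X) \<Longrightarrow> p (sum f A) \<le> (\<Sum>i\<in>A. p (f i))"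
proof (induction A rule: infinite_finite_induct)
  case (insert i A)
  then show ?case
    using p_triangle[of "f i" "sum f A"] by auto
qed (auto simp: p_zero)

end

section \<open>Convergence and continuity in terms of seminorms\<close>

lemma limitin_lctop_iff:
  "limitin (lctop X) f l F \<longleftrightarrow>
     l \<in> car X \<and> (\<forall>\<^sub>F z in F. f z \<in> car X) \<and> (\<forall>p\<in>sn X. ((\<lambda>z. p (f z - l)) \<longlongrightarrow> 0) F)"
    (is "_ \<longleftrightarrow> ?R")
proof
  assume L: "limitin (lctop X) f l F"
  then have l: "l \<in> car X" by (auto dest: limitin_topspace)
  have ev: "\<forall>\<^sub>F z in F. f z \<in> U" if "openin (lctop X) U" "l \<in> U" for U
    using L that by (auto simp: limitin_def)
  have e1: "\<forall>\<^sub>F z in F. f z \<in> car X"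
    using ev[of "car X"] l openin_topspace[of "lctop X"] by simp
  have "((\<lambda>z. p (f z - l)) \<longlongrightarrow> 0) F" if p: "p \<in> sn X" for p
  proof (rule tendstoI)
    fix e :: real assume e: "0 < e"
    have "openin (lctop X) {y \<in> car X. p (y - l) < e}"
      unfolding lctop_def openin_topology_generated_by_iff
      by (rule generate_topology_on.Basis) (use p l e in blast)
    then have "\<forall>\<^sub>F z in F. f z \<in> {y \<in> car X. p (y - l) < e}"
      by (rule ev) (use l e p_zero[OF sn_seminorm[OF p]] in simp)
    then show "\<forall>\<^sub>F z in F. dist (p (f z - l)) 0 < e"
      by eventually_elim (use l p_nonneg[OF sn_seminorm[OF p]] in simp)
  qed
  then show ?R using l e1 by blast
next
  assume R: ?R
  have "l \<in> U \<longrightarrow> (\<forall>\<^sub>F z in F. f z \<in> U)" if "openin (lctop X) U" for U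
    using that unfolding lctop_def openin_topology_generated_by_iff
  proof (induction rule: generate_topology_on.induct)
    case (Int a b)
    then show ?case by (auto intro: eventually_conj)
  next
    case (UN K)
    show ?case
    proof
      assume "l \<in> \<Union>K"
      then obtain k where "k \<in> K" "l \<in> k" by blast
      then have "\<forall>\<^sub>F z in F. f z \<in> k" using UN by blast
      then show "\<forall>\<^sub>F z in F. f z \<in> \<Union>K"
        by eventually_elim (use \<open>k \<in> K\<close> in blast)
    qed
  next
    case (Basis s)
    show ?case
    proof (cases "s = car X")
      case False
      then obtain p x r where s: "s = {y \<in> car X. p (y - x) < r}" "p \<in> sn X" "x \<in> car X"
        using Basis by blast
      show ?thesis
      proof
        assume l: "l \<in> s"
        have "((\<lambda>z. p (f z - l)) \<longlongrightarrow> 0) F" using R s by blast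
        then have "\<forall>\<^sub>F z in F. p (f z - l) < r - p (l - x)"
          by (rule order_tendstoD) (use l s in simp)
        moreover have "\<forall>\<^sub>F z in F. f z \<in> car X" using R by blast
        ultimately show "\<forall>\<^sub>F z in F. f z \<in> s"
        proof eventually_elim
          case (elim z)
          then show ?case
            using p_diff_triangle[OF sn_seminorm[OF s(2)], of "f z" l x] s R by auto
        qed
      qed
    qed (use R in simp)
  qed simp
  then show "limitin (lctop X) f l F"
    using R by (auto simp: limitin_def)
qed

text \<open>The identity map is continuous, so the limit criterion applied to it describes the
  filter \<open>atin (lctop X) x\<close> itself; continuity of other maps is then a comparison of
  limits.\<close>

lemma atin_lctop:
  assumes "x \<in> car X"
  shows "\<forall>\<^sub>F z in atin (lctop X) x. z \<in> car X"
    and "p \<in> sn X \<Longrightarrow> ((\<lambda>z. p (z - x)) \<longlongrightarrow> 0) (atin (lctop X) x)"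
proof -
  have "continuous_map (lctop X) (lctop X) (\<lambda>z. z)" by simp
  then have "limitin (lctop X) (\<lambda>z. z) x (atin (lctop X) x)"
    using assms unfolding continuous_map_atin by simp
  then show "\<forall>\<^sub>F z in atin (lctop X) x. z \<in> car X"
    and "p \<in> sn X \<Longrightarrow> ((\<lambda>z. p (z - x)) \<longlongrightarrow> 0) (atin (lctop X) x)"
    by (auto simp: limitin_lctop_iff)
qed

lemma continuous_map_seminorm:
  assumes "p \<in> sn X"
  shows "continuous_map (lctop X) euclideanreal p"
  unfolding continuous_map_atin
proof safe
  fix x assume "x \<in> topspace (lctop X)"
  then have x: "x \<in> car X" by simp
  have "((\<lambda>z. p z - p x) \<longlongrightarrow> 0) (atin (lctop X) x)"
  proof (rule Lim_null_comparison)
    show "\<forall>\<^sub>F z in atin (lctop X) x. norm (p z - p x) \<le> p (z - x)"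
      using atin_lctop(1)[OF x]
      by eventually_elim (use p_abs_diff[OF sn_seminorm[OF assms]] x in simp)
  qed (rule atin_lctop(2)[OF x assms])
  then show "limitin euclideanreal p (p x) (atin (lctop X) x)"
    using LIM_zero_iff by (simp, fastforce)
qed

end

lemma cont_linear_lcsI:
  assumes X: "seminormed X" and Y: "seminormed Y" and T: "linear_lcs X Y T"
    and bound: "\<And>q. q \<in> sn Y \<Longrightarrow> \<exists>p\<in>sn X. \<exists>C. \<forall>x\<in>car X. q (T x) \<le> C * p x"
  shows "cont_linear_lcs X Y T"
proof -
  interpret X: seminormed X by (rule X)
  interpret Y: seminormed Y by (rule Y)
  have T_in: "T x \<in> car Y" if "x \<in> car X" for x
    using T that by (auto simp: linear_lcs_def)
  have T_diff: "T (x - y) = T x - T y" if "x \<in> car X" "y \<in> car X" for x y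
  proof -
    have "T (x - y + y) = T (x - y) + T y"
      using T that X.diff_in unfolding linear_lcs_def by blast
    then show ?thesis by simp
  qed
  have "continuous_map (lctop X) (lctop Y) T"
    unfolding continuous_map_atin
  proof safe
    fix x assume "x \<in> topspace (lctop X)"
    then have x: "x \<in> car X" by simp
    have "((\<lambda>z. q (T z - T x)) \<longlongrightarrow> 0) (atin (lctop X) x)" if q: "q \<in> sn Y" for q
    proof -
      obtain p C where p: "p \<in> sn X" and C: "\<And>x. x \<in> car X \<Longrightarrow> q (T x) \<le> C * p x"
        using bound[OF q] by blast
      show ?thesis
      proof (rule Lim_null_comparison)
        show "\<forall>\<^sub>F z in atin (lctop X) x. norm (q (T z - T x)) \<le> C * p (z - x)"
          using X.atin_lctop(1)[OF x]
        proof eventually_elim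
          case (elim z)
          then show ?case
            using C[of "z - x"] Y.p_nonneg[OF Y.sn_seminorm[OF q], of "T z - T x"] T_in x
            by (simp add: T_diff)
        qed
        show "((\<lambda>z. C * p (z - x)) \<longlongrightarrow> 0) (atin (lctop X) x)"
          using tendsto_mult_right_zero[OF X.atin_lctop(2)[OF x p]] .
      qed
    qed
    then show "limitin (lctop Y) T (T x) (atin (lctop X) x)"
      unfolding Y.limitin_lctop_iff using T_in x X.atin_lctop(1)[OF x]
      by (auto elim: eventually_mono)
  qed
  then show ?thesis using T by (simp add: cont_linear_lcs_def)
qed

text \<open>Directedness is what bounds a continuous map by a single seminorm
  (\<open>cont_linear_lcs_bound\<close>). The weaker \<open>seminormed\<close> is kept apart to
  serve for \<open>rapid X\<close> and \<open>dual_kappa X\<close>, which are handled only through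
  their seminorms.\<close>

locale lcspace = seminormed X for X :: "('k::real_or_complex, 'v::ab_group_add) lcs" +
  assumes nontrivial: "\<exists>x\<in>car X. x \<noteq> 0"
    and directed: "\<And>p q. p \<in> sn X \<Longrightarrow> q \<in> sn X \<Longrightarrow>
      \<exists>r\<in>sn X. \<exists>C. \<forall>x\<in>car X. p x \<le> C * r x \<and> q x \<le> C * r x"
    and Hausdorff: "Hausdorff_space (lctop X)"

lemma lcHs_iff_lcspace: "lcHs X \<longleftrightarrow> lcspace X"
  unfolding lcHs_def lcspace_def lcspace_axioms_def seminormed_def by blast

lemma (in seminormed) Hausdorff_lctop:
  assumes "\<And>x. x \<in> car X \<Longrightarrow> (\<And>p. p \<in> sn X \<Longrightarrow> p x = 0) \<Longrightarrow> x = 0"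
  shows "Hausdorff_space (lctop X)"
  unfolding Hausdorff_space_def
proof (intro allI impI)
  fix x y assume "x \<in> topspace (lctop X) \<and> y \<in> topspace (lctop X) \<and> x \<noteq> y"
  then have xy: "x \<in> car X" "y \<in> car X" "x - y \<noteq> 0" by auto
  then obtain p where p: "p \<in> sn X" "p (x - y) \<noteq> 0"
    using assms[of "x - y"] by auto
  note sp = sn_seminorm[OF p(1)]
  define r where "r = p (x - y) / 2"
  have r: "0 < r" using p p_nonneg[OF sp, of "x - y"] xy by (simp add: r_def)
  let ?B = "\<lambda>x. {y \<in> car X. p (y - x) < r}"
  have "openin (lctop X) (?B z)" if "z \<in> car X" for z
    unfolding lctop_def openin_topology_generated_by_iff
    by (rule generate_topology_on.Basis) (use p that r in blast)
  moreover have "disjnt (?B x) (?B y)"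
  proof -
    have False if "z \<in> car X" "p (z - x) < r" "p (z - y) < r" for z
      using that p_diff_triangle[OF sp, of x z y] p_diff_commute[OF sp, of x z] xy
      unfolding r_def by simp
    then show ?thesis by (auto simp: disjnt_def)
  qed
  ultimately show "\<exists>U V. openin (lctop X) U \<and> openin (lctop X) V \<and> x \<in> U \<and> y \<in> V \<and> disjnt U V"
    using xy r p_zero[OF sp] by (intro exI[of _ "?B x"] exI[of _ "?B y"]) simp
qed

context lcspace
begin

text \<open>If every seminorm vanishes at \<open>x\<close>, the constant sequence 0 converges to
  \<open>x\<close> as well as to 0.\<close>

lemma separating:
  assumes x: "x \<in> car X" and p: "\<And>p. p \<in> sn X \<Longrightarrow> p x = 0"
  shows "x = 0"
proof (rule limitin_Hausdorff_unique)
  show "limitin (lctop X) (\<lambda>_. 0) 0 sequentially" by (simp add: limitin_lctop_iff p_zero[OF sn_seminorm])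
  show "limitin (lctop X) (\<lambda>_. 0) x sequentially"
    unfolding limitin_lctop_iff
  proof (intro conjI ballI)
    fix q assume q: "q \<in> sn X"
    then have "q (0 - x) = 0" using p p_neg[OF sn_seminorm[OF q] x] by simp
    then show "(\<lambda>_. q (0 - x)) \<longlonglongrightarrow> 0" by simp
  qed (use x in auto)
qed (simp_all add: Hausdorff)

lemma eqI:
  assumes "x \<in> car X" "y \<in> car X" "\<And>p. p \<in> sn X \<Longrightarrow> p (x - y) = 0"
  shows "x = y"
  using separating[of "x - y"] assms by simp

lemma sn_nonempty: "sn X \<noteq> {}"
  using nontrivial separating by blast

text \<open>The balls only generate the topology as a subbasis; directedness replaces an
  intersection of two of them by one ball of a larger seminorm.\<close>

lemma nhd_seminorm_ball:
  assumes U: "openin (lctop X) U" "x \<in> U"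
  shows "\<exists>p\<in>sn X. \<exists>r>0. {y \<in> car X. p (y - x) < r} \<subseteq> U"
proof -
  have xin: "x \<in> car X" using openin_subset[OF U(1)] U(2) by auto
  show ?thesis
  using U unfolding lctop_def openin_topology_generated_by_iff
proof (induction rule: generate_topology_on.induct)
  case (Int a b)
  then have IH: "\<exists>p\<in>sn X. \<exists>r>0. {y \<in> car X. p (y - x) < r} \<subseteq> a"
    "\<exists>p\<in>sn X. \<exists>r>0. {y \<in> car X. p (y - x) < r} \<subseteq> b" by blast+
  obtain p r where p: "p \<in> sn X" "r > 0" "{y \<in> car X. p (y - x) < r} \<subseteq> a"
    using IH(1) by blast
  obtain q s where q: "q \<in> sn X" "s > 0" "{y \<in> car X. q (y - x) < s} \<subseteq> b"
    using IH(2) by blast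
  obtain t C where t: "t \<in> sn X" and C: "\<And>x. x \<in> car X \<Longrightarrow> p x \<le> C * t x \<and> q x \<le> C * t x"
    using directed[OF p(1) q(1)] by blast
  \<comment> \<open>The constant given by \<open>directed\<close> may fail to be positive, and the
    new radius is a quotient by it.\<close>
  define D where "D = max C 1"
  have D: "p x \<le> D * t x \<and> q x \<le> D * t x" if "x \<in> car X" for x
  proof -
    have "C * t x \<le> D * t x"
      using p_nonneg[OF sn_seminorm[OF t] that] by (intro mult_right_mono) (auto simp: D_def)
    then show ?thesis using C[OF that] by linarith
  qed
  have "D > 0" by (auto simp: D_def)
  have "{y \<in> car X. t (y - x) < min r s / D} \<subseteq> a \<inter> b"
  proof
    fix y assume y: "y \<in> {y \<in> car X. t (y - x) < min r s / D}"
    then have "D * t (y - x) < min r s"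
      using \<open>D > 0\<close> by (simp add: field_simps)
    then have "p (y - x) < r" "q (y - x) < s"
      using D[of "y - x"] y xin by auto
    then show "y \<in> a \<inter> b" using p(3) q(3) y by auto
  qed
  then show ?case using t \<open>D > 0\<close> p(2) q(2) by (intro bexI[of _ t] exI[of _ "min r s / D"]) auto
next
  case (UN K)
  then obtain k where "k \<in> K" "x \<in> k" by blast
  then obtain p r where "p \<in> sn X" "r > 0" "{y \<in> car X. p (y - x) < r} \<subseteq> k"
    using UN by meson
  then show ?case using \<open>k \<in> K\<close> by blast
next
  case (Basis s)
  show ?case
  proof (cases "s = car X")
    case True
    then show ?thesis using sn_nonempty zero_less_one by blast
  next
    case False
    then obtain p z r where s: "s = {y \<in> car X. p (y - z) < r}" "p \<in> sn X" "z \<in> car X"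
      using Basis by blast
    have "{y \<in> car X. p (y - x) < r - p (x - z)} \<subseteq> s"
    proof
      fix y assume "y \<in> {y \<in> car X. p (y - x) < r - p (x - z)}"
      then show "y \<in> s"
        using p_diff_triangle[OF sn_seminorm[OF s(2)], of y x z] s Basis by auto
    qed
    then show ?thesis
      using s Basis by (intro bexI[of _ p] exI[of _ "r - p (x - z)"]) auto
  qed
qed simp
qed

end

lemma cont_linear_lcs_bound:
  assumes X: "lcspace X" and Y: "seminormed Y" and T: "cont_linear_lcs X Y T" and q: "q \<in> sn Y"
  shows "\<exists>p\<in>sn X. \<exists>C\<ge>0. \<forall>x\<in>car X. q (T x) \<le> C * p x"
proof -
  interpret X: lcspace X by (rule X)
  interpret Y: seminormed Y by (rule Y)
  note sq = Y.sn_seminorm[OF q]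
  have lin: "linear_lcs X Y T" and cont: "continuous_map (lctop X) (lctop Y) T"
    using T by (auto simp: cont_linear_lcs_def)
  have T_in: "T x \<in> car Y" if "x \<in> car X" for x
    using lin that by (auto simp: linear_lcs_def)
  have T_scl: "T (scl X a x) = scl Y a (T x)" if "x \<in> car X" for a x
    using lin that by (auto simp: linear_lcs_def)
  have T0: "T 0 = 0" using T_scl[of 0 0] by simp
  let ?U = "{x \<in> topspace (lctop X). T x \<in> {y \<in> car Y. q (y - 0) < 1}}"
  have "openin (lctop Y) {y \<in> car Y. q (y - 0) < 1}"
    unfolding lctop_def openin_topology_generated_by_iff
    by (rule generate_topology_on.Basis) (use q Y.zero_in in \<open>blast intro: zero_less_one\<close>)
  then have "openin (lctop X) ?U"
    using cont by (rule openin_continuous_map_preimage[rotated])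
  moreover have "0 \<in> ?U" by (simp add: T0 Y.p_zero[OF sq])
  ultimately obtain p r where p: "p \<in> sn X" "r > 0" "{y \<in> car X. p (y - 0) < r} \<subseteq> ?U"
    using X.nhd_seminorm_ball by meson
  note sp = X.sn_seminorm[OF p(1)]
  \<comment> \<open>Were the bound false at \<open>x\<close>, the multiple of \<open>x\<close>
    normalised to \<open>q (T x) = 1\<close> would lie in the ball \<open>p < r\<close>, on which
    \<open>q (T x) < 1\<close>.\<close>
  have "q (T x) \<le> (2 / r) * p x" if x: "x \<in> car X" for x
  proof (rule ccontr)
    assume neg: "\<not> q (T x) \<le> (2 / r) * p x"
    have p0: "0 \<le> p x" using X.p_nonneg[OF sp x] .
    then have qpos: "0 < q (T x)" using neg p(2)
      by (meson divide_nonneg_pos le_less_trans mult_nonneg_nonneg not_le zero_le_numeral)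
    define c :: real where "c = 1 / q (T x)"
    have c: "norm (of_real c :: 'a) = c" unfolding norm_of_real using qpos by (simp add: c_def)
    have "p (scl X (of_real c) x) = c * p x"
      using X.p_scl[OF sp x] c by simp
    also have "\<dots> < r"
    proof -
      have "2 * p x < r * q (T x)" using neg p(2) by (simp add: field_simps not_le)
      then have "p x < r * q (T x)" using p0 by linarith
      then show ?thesis using qpos by (simp add: c_def field_simps)
    qed
    finally have "scl X (of_real c) x \<in> {y \<in> car X. p (y - 0) < r}" using x by simp
    then have "q (T (scl X (of_real c) x)) < 1" using p(3) by auto
    then show False
      using Y.p_scl[OF sq T_in[OF x], of "of_real c"] c qpos by (simp add: T_scl x c_def)
  qed
  then show ?thesis
    using p by (intro bexI[of _ p] exI[of _ "2 / r"]) auto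
qed

section \<open>The Hahn--Banach theorem\<close>

lemma real_or_complex_cases:
  obtains (real) "\<And>z::'k::real_or_complex. \<exists>a. z = of_real a"
  | (complex) i :: "'k::real_or_complex" where "i * i = - 1" "\<And>z::'k::real_or_complex. \<exists>a b. z = of_real a + of_real b * i"
  using real_or_complex[where 'a="'k"] by (auto simp: of_real_def)

text \<open>The class fixes no formula for the norm, only its multiplicativity. Powers of an element
  with \<open>a^2 + b^2 = 1\<close> keep that form, so their norms stay below 2, which forces norm
  at most 1; the product with the conjugate then forces equality, and scaling does the rest.\<close>

lemma norm_complex_like:
  fixes i :: "'k::real_normed_field"
  assumes i: "i * i = - 1"
  shows "norm (of_real a + of_real b * i) = sqrt (a\<^sup>2 + b\<^sup>2)"
proof -
  have "norm i * norm i = norm (- 1 :: 'k)" unfolding i[symmetric] by (rule norm_mult[symmetric])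
  then have ni: "norm i = 1"
    by (metis abs_norm_cancel norm_minus_cancel norm_one real_sqrt_abs2 real_sqrt_one)
  have unit: "norm (of_real a + of_real b * i) \<le> 1" if "a\<^sup>2 + b\<^sup>2 = 1" for a b
  proof (rule ccontr)
    let ?c = "of_real a + of_real b * i :: 'k"
    assume "\<not> norm ?c \<le> 1"
    then obtain n where n: "2 < norm ?c ^ n"
      using real_arch_pow[of "norm ?c" 2] by auto
    have "\<exists>u v. ?c ^ n = of_real u + of_real v * i \<and> u\<^sup>2 + v\<^sup>2 = 1"
    proof (induction n)
      case 0
      show ?case by (rule exI[of _ 1], rule exI[of _ 0]) simp
    next
      case (Suc n)
      then obtain u v where uv: "?c ^ n = of_real u + of_real v * i" "u\<^sup>2 + v\<^sup>2 = 1" by blast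
      have "?c ^ Suc n = of_real (a * u) + of_real (b * v) * (i * i) + of_real (a * v + b * u) * i"
        unfolding power_Suc uv(1) by (simp add: algebra_simps)
      also have "\<dots> = of_real (a * u - b * v) + of_real (a * v + b * u) * i"
        by (simp add: i algebra_simps)
      finally have "?c ^ Suc n = of_real (a * u - b * v) + of_real (a * v + b * u) * i" .
      moreover have "(a * u - b * v)\<^sup>2 + (a * v + b * u)\<^sup>2 = (a\<^sup>2 + b\<^sup>2) * (u\<^sup>2 + v\<^sup>2)"
        by (simp add: power2_eq_square algebra_simps)
      ultimately show ?case using uv that by (metis mult_1)
    qed
    then obtain u v where uv: "?c ^ n = of_real u + of_real v * i" "u\<^sup>2 + v\<^sup>2 = 1" by blast
    have "u\<^sup>2 \<le> 1" "v\<^sup>2 \<le> 1"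
      using uv(2) zero_le_power2[of u] zero_le_power2[of v] by linarith+
    then have "\<bar>u\<bar> \<le> 1" "\<bar>v\<bar> \<le> 1" by (auto simp: abs_square_le_1)
    then have "norm (?c ^ n) \<le> 2"
      unfolding uv(1) by (intro order.trans[OF norm_triangle_ineq]) (simp add: norm_mult ni)
    then show False using n by (simp add: norm_power)
  qed
  have one: "norm (of_real a + of_real b * i) = 1" if ab: "a\<^sup>2 + b\<^sup>2 = 1" for a b
  proof -
    have "(of_real a + of_real b * i) * (of_real a + of_real (- b) * i) =
      of_real (a\<^sup>2) - of_real (b\<^sup>2) * (i * i)"
      by (simp add: power2_eq_square algebra_simps)
    also have "\<dots> = of_real (a\<^sup>2 + b\<^sup>2)" by (simp add: i)
    finally have "norm (of_real a + of_real b * i) * norm (of_real a + of_real (- b) * i) = 1"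
      using ab by (metis norm_mult norm_one of_real_1)
    moreover have "norm (of_real a + of_real b * i) \<le> 1" "norm (of_real a + of_real (- b) * i) \<le> 1"
      using unit[of a b] unit[of a "- b"] ab by auto
    ultimately show ?thesis
      by (metis antisym mult_left_le norm_ge_zero)
  qed
  show ?thesis
  proof (cases "a\<^sup>2 + b\<^sup>2 = 0")
    case True
    then have "a = 0" "b = 0" by (auto simp: sum_power2_eq_zero_iff)
    then show ?thesis by simp
  next
    case False
    define r where "r = sqrt (a\<^sup>2 + b\<^sup>2)"
    have r: "r > 0" "r\<^sup>2 = a\<^sup>2 + b\<^sup>2"
      using False by (auto simp: r_def sum_power2_gt_zero_iff intro: order.not_eq_order_implies_strict)
    have "(a / r)\<^sup>2 + (b / r)\<^sup>2 = 1"
      using r False by (simp add: power_divide flip: add_divide_distrib)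
    then have "norm (of_real (a / r) + of_real (b / r) * i) = 1" by (rule one)
    moreover have "of_real (r * (a / r)) + of_real (r * (b / r)) * i =
        of_real r * (of_real (a / r) + of_real (b / r) * i)"
      by (simp only: of_real_mult distrib_left mult.assoc)
    then have "of_real a + of_real b * i = of_real r * (of_real (a / r) + of_real (b / r) * i)"
      using r by simp
    ultimately show ?thesis using r by (simp add: norm_mult r_def)
  qed
qed

section \<open>Dominated extension of real functionals\<close>

context seminormed
begin

abbreviation rscl :: "real \<Rightarrow> 'v \<Rightarrow> 'v" where
  "rscl r \<equiv> scl X (of_real r)"

text \<open>A real-linear functional on a subspace, encoded by its graph so that extension is
  inclusion and Zorn's lemma applies to unions of chains. Single-valuedness is a consequence: the
  difference of two values at a point is a value at 0, where \<open>p\<close> vanishes, and the same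
  holds for its negative.\<close>

definition dominated_graph :: "('v \<Rightarrow> real) \<Rightarrow> ('v \<times> real) set \<Rightarrow> bool" where
  "dominated_graph p G \<longleftrightarrow> G \<noteq> {} \<and>
     (\<forall>(x, a)\<in>G. x \<in> car X \<and> a \<le> p x) \<and>
     (\<forall>(x, a)\<in>G. \<forall>(y, b)\<in>G. (x + y, a + b) \<in> G) \<and>
     (\<forall>(x, a)\<in>G. \<forall>r. (rscl r x, r * a) \<in> G)"

lemma dominated_graph_extend:
  assumes p: "seminorm_on X p" and G: "dominated_graph p G" and z: "z \<in> car X"
  shows "\<exists>G' c. dominated_graph p G' \<and> G \<subseteq> G' \<and> (z, c) \<in> G'"
proof -
  have Gin: "x \<in> car X" and Gle: "a \<le> p x" if "(x, a) \<in> G" for x a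
    using G that by (auto simp: dominated_graph_def)
  have Gadd: "(x + y, a + b) \<in> G" if "(x, a) \<in> G" "(y, b) \<in> G" for x y a b
    using G that unfolding dominated_graph_def by blast
  have Gscl: "(rscl r x, r * a) \<in> G" if "(x, a) \<in> G" for x a r
    using G that unfolding dominated_graph_def by blast
  obtain x0 a0 where x0: "(x0, a0) \<in> G" using G by (auto simp: dominated_graph_def)
  have G0: "(0, 0) \<in> G" using Gscl[OF x0, of 0] by simp
  have sep: "a - p (x - z) \<le> p (y + z) - b" if "(x, a) \<in> G" "(y, b) \<in> G" for x a y b
  proof -
    have "a + b \<le> p (x + y)" using Gle[OF Gadd[OF that]] .
    also have "\<dots> \<le> p (x - z) + p (y + z)"
      using p_triangle[OF p, of "x - z" "y + z"] z that[THEN Gin] by (simp add: algebra_simps)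
    finally show ?thesis by simp
  qed
  \<comment> \<open>By \<open>sep\<close> all numbers \<open>a - p (x - z)\<close> lie below all
    numbers \<open>p (y + z) - b\<close>. The value \<open>c\<close> at \<open>z\<close> has to lie
    between the two families; the upper inequality, rescaled, gives domination for positive
    multiples of \<open>z\<close> and the lower one for negative multiples.\<close>
  define S where "S = (\<lambda>(x, a). a - p (x - z)) ` G"
  define c where "c = Sup S"
  have bdd: "bdd_above S" unfolding S_def
    by (rule bdd_aboveI[of _ "p z"]) (use sep[OF _ G0] in auto)
  have c1: "a - p (x - z) \<le> c" if "(x, a) \<in> G" for x a
    unfolding c_def by (rule cSup_upper[OF _ bdd]) (use that in \<open>force simp: S_def\<close>)
  have c2: "c \<le> p (y + z) - b" if "(y, b) \<in> G" for y b
    unfolding c_def by (rule cSup_least) (use sep[OF _ that] G0 in \<open>auto simp: S_def\<close>)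
  define G' where "G' = {(x + rscl t z, a + t * c) | x a t. (x, a) \<in> G}"
  have le: "a + t * c \<le> p (x + rscl t z)" if xa: "(x, a) \<in> G" for x a t
  proof (cases t "0 :: real" rule: linorder_cases)
    case equal
    then show ?thesis using Gle[OF xa] by simp
  next
    case greater
    have "c \<le> p (rscl (1 / t) x + z) - 1 / t * a" by (rule c2[OF Gscl[OF xa]])
    moreover have "rscl (1 / t) x + z = rscl (1 / t) (x + rscl t z)"
      using greater by (simp add: scl_rules)
    ultimately have "c \<le> 1 / t * p (x + rscl t z) - 1 / t * a"
      using p_scl[OF p, of "x + rscl t z" "of_real (1 / t)"] greater z Gin[OF xa]
      by (simp add: norm_divide)
    then show ?thesis using greater by (simp add: field_simps)
  next
    case less
    have "1 / (- t) * a - p (rscl (1 / (- t)) x - z) \<le> c" by (rule c1[OF Gscl[OF xa]])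
    moreover have "rscl (1 / (- t)) x - z = rscl (1 / (- t)) (x + rscl t z)"
      using less by (simp add: scl_rules)
    ultimately have "1 / (- t) * a - 1 / (- t) * p (x + rscl t z) \<le> c"
      using p_scl[OF p, of "x + rscl t z" "of_real (1 / (- t))"] less z Gin[OF xa]
      by (simp add: norm_divide)
    then show ?thesis using less by (simp add: field_simps)
  qed
  have "dominated_graph p G'"
    unfolding dominated_graph_def
  proof (intro conjI)
    show "G' \<noteq> {}" using G0 unfolding G'_def by blast
    show "\<forall>(x, a)\<in>G'. x \<in> car X \<and> a \<le> p x"
      using le Gin z by (auto simp: G'_def)
    show "\<forall>(x, a)\<in>G'. \<forall>(y, b)\<in>G'. (x + y, a + b) \<in> G'"
    proof clarify
      fix x a y b assume "(x, a) \<in> G'" "(y, b) \<in> G'"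
      then obtain x' a' s y' b' t where
        "(x', a') \<in> G" "x = x' + rscl s z" "a = a' + s * c"
        "(y', b') \<in> G" "y = y' + rscl t z" "b = b' + t * c"
        unfolding G'_def by blast
      then show "(x + y, a + b) \<in> G'"
        using Gadd[of x' a' y' b'] unfolding G'_def
        by (intro CollectI exI[of _ "x' + y'"] exI[of _ "a' + b'"] exI[of _ "s + t"])
           (simp add: scl_rules algebra_simps)
    qed
    show "\<forall>(x, a)\<in>G'. \<forall>r. (rscl r x, r * a) \<in> G'"
    proof clarify
      fix x a r assume "(x, a) \<in> G'"
      then obtain x' a' s where "(x', a') \<in> G" "x = x' + rscl s z" "a = a' + s * c"
        unfolding G'_def by blast
      then show "(rscl r x, r * a) \<in> G'"
        using Gscl[of x' a' r] unfolding G'_def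
        by (intro CollectI exI[of _ "rscl r x'"] exI[of _ "r * a'"] exI[of _ "r * s"])
           (simp add: scl_rules algebra_simps)
    qed
  qed
  moreover have "G \<subseteq> G'"
  proof clarify
    fix x a assume "(x, a) \<in> G"
    then show "(x, a) \<in> G'" unfolding G'_def
      by (intro CollectI exI[of _ x] exI[of _ a] exI[of _ 0]) simp
  qed
  moreover have "(z, c) \<in> G'" unfolding G'_def
    by (intro CollectI exI[of _ 0] exI[of _ 1]) (simp add: G0)
  ultimately show ?thesis by blast
qed

lemma real_Hahn_Banach:
  assumes p: "seminorm_on X p" and x0: "x0 \<in> car X"
  shows "\<exists>\<phi>. \<phi> x0 = p x0 \<and> (\<forall>x\<in>car X. \<phi> x \<le> p x) \<and>
    (\<forall>x\<in>car X. \<forall>y\<in>car X. \<phi> (x + y) = \<phi> x + \<phi> y) \<and> (\<forall>r. \<forall>x\<in>car X. \<phi> (rscl r x) = r * \<phi> x)"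
proof -
  define A where "A = {G. dominated_graph p G \<and> (x0, p x0) \<in> G}"
  define G0 where "G0 = range (\<lambda>t. (rscl t x0, t * p x0))"
  have "dominated_graph p G0"
    unfolding dominated_graph_def
  proof (intro conjI)
    show "\<forall>(x, a)\<in>G0. x \<in> car X \<and> a \<le> p x"
      using x0 p_nonneg[OF p x0] by (auto simp: G0_def p_scl[OF p] intro!: mult_right_mono)
    show "\<forall>(x, a)\<in>G0. \<forall>(y, b)\<in>G0. (x + y, a + b) \<in> G0"
    proof clarify
      fix x a y b assume "(x, a) \<in> G0" "(y, b) \<in> G0"
      then obtain s t where "x = rscl s x0" "a = s * p x0" "y = rscl t x0" "b = t * p x0"
        by (auto simp: G0_def)
      then show "(x + y, a + b) \<in> G0"
        unfolding G0_def by (intro range_eqI[of _ _ "s + t"]) (simp add: scl_rules distrib_right)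
    qed
    show "\<forall>(x, a)\<in>G0. \<forall>r. (rscl r x, r * a) \<in> G0"
    proof clarify
      fix x a r assume "(x, a) \<in> G0"
      then obtain s where "x = rscl s x0" "a = s * p x0"
        by (auto simp: G0_def)
      then show "(rscl r x, r * a) \<in> G0"
        unfolding G0_def by (intro range_eqI[of _ _ "r * s"]) (simp add: scl_rules)
    qed
  qed (auto simp: G0_def)
  moreover have "(x0, p x0) \<in> G0" by (auto simp: G0_def image_iff intro: exI[of _ 1])
  ultimately have ne: "A \<noteq> {}" by (auto simp: A_def)
  have "\<exists>M\<in>A. \<forall>G\<in>A. M \<subseteq> G \<longrightarrow> G = M"
  proof (rule subset_Zorn_nonempty[OF ne])
    fix \<C> assume C: "\<C> \<noteq> {}" "subset.chain A \<C>"
    have D: "dominated_graph p G" "(x0, p x0) \<in> G" if "G \<in> \<C>" for G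
      using C that by (auto simp: subset.chain_def A_def)
    have "dominated_graph p (\<Union>\<C>)"
      unfolding dominated_graph_def
    proof (intro conjI)
      show "\<Union>\<C> \<noteq> {}" using C D by blast
      show "\<forall>(x, a)\<in>\<Union>\<C>. x \<in> car X \<and> a \<le> p x"
        using D unfolding dominated_graph_def by blast
      show "\<forall>(x, a)\<in>\<Union>\<C>. \<forall>r. (rscl r x, r * a) \<in> \<Union>\<C>"
        using D unfolding dominated_graph_def by blast
      show "\<forall>(x, a)\<in>\<Union>\<C>. \<forall>(y, b)\<in>\<Union>\<C>. (x + y, a + b) \<in> \<Union>\<C>"
      proof clarify
        fix x a y b G H assume *: "(x, a) \<in> G" "G \<in> \<C>" "(y, b) \<in> H" "H \<in> \<C>"
        then have "G \<subseteq> H \<or> H \<subseteq> G" using C(2) by (auto simp: subset.chain_def)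
        then obtain K where "K \<in> \<C>" "(x, a) \<in> K" "(y, b) \<in> K" using * by blast
        then show "(x + y, a + b) \<in> \<Union>\<C>" using D(1) unfolding dominated_graph_def by blast
      qed
    qed
    then show "\<Union>\<C> \<in> A" using C D by (auto simp: A_def)
  qed
  then obtain M where M: "dominated_graph p M" "(x0, p x0) \<in> M"
    and max: "\<And>G. dominated_graph p G \<Longrightarrow> (x0, p x0) \<in> G \<Longrightarrow> M \<subseteq> G \<Longrightarrow> G = M"
    by (auto simp: A_def)
  have Min: "x \<in> car X" and Mle: "a \<le> p x" if "(x, a) \<in> M" for x a
    using M that by (auto simp: dominated_graph_def)
  have Madd: "(x + y, a + b) \<in> M" if "(x, a) \<in> M" "(y, b) \<in> M" for x y a b
    using M that unfolding dominated_graph_def by blast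
  have Mscl: "(rscl r x, r * a) \<in> M" if "(x, a) \<in> M" for x a r
    using M that unfolding dominated_graph_def by blast
  have total: "\<exists>a. (x, a) \<in> M" if x: "x \<in> car X" for x
  proof -
    obtain G' c where "dominated_graph p G'" "M \<subseteq> G'" "(x, c) \<in> G'"
      using dominated_graph_extend[OF p M(1) x] by blast
    then show ?thesis using max[of G'] M(2) by blast
  qed
  have le: "a \<le> b" if "(x, a) \<in> M" "(x, b) \<in> M" for x a b
  proof -
    have "(0, a - b) \<in> M"
      using Madd[OF that(1) Mscl[OF that(2), of "-1"]] by (simp add: scl_rules)
    then show ?thesis using Mle[of 0 "a - b"] p_zero[OF p] by simp
  qed
  then have unique: "a = b" if "(x, a) \<in> M" "(x, b) \<in> M" for x a b
    using that by (meson antisym)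
  define \<phi> where "\<phi> x = (SOME a. (x, a) \<in> M)" for x
  have \<phi>: "(x, \<phi> x) \<in> M" if "x \<in> car X" for x
    unfolding \<phi>_def using total[OF that] by (rule someI_ex)
  show ?thesis
  proof (intro exI conjI ballI allI)
    show "\<phi> x0 = p x0" by (rule unique[OF \<phi>[OF x0] M(2)])
    show "\<phi> x \<le> p x" if "x \<in> car X" for x by (rule Mle[OF \<phi>[OF that]])
    show "\<phi> (x + y) = \<phi> x + \<phi> y" if "x \<in> car X" "y \<in> car X" for x y
      by (rule unique[OF \<phi> Madd[OF \<phi> \<phi>]]) (use that in auto)
    show "\<phi> (rscl r x) = r * \<phi> x" if "x \<in> car X" for r x
      by (rule unique[OF \<phi> Mscl[OF \<phi>]]) (use that in auto)
  qed
qed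

end

section \<open>The scalar field as a space, dual spaces, and the theorem for scalar
  functionals\<close>

lemma lctop_scalar [simp]: "lctop (scalar_lcs :: ('k::real_or_complex, 'k) lcs) = euclidean"
proof (rule topology_eq[THEN iffD2], safe)
  fix U :: "'k set"
  have eq: "{y. norm (y - x) < r} = ball x r" for x :: 'k and r
    by (auto simp: dist_norm norm_minus_commute)
  {
    assume "openin (lctop scalar_lcs) U"
    then show "openin euclidean U"
      unfolding lctop_def openin_topology_generated_by_iff
      by (induction rule: generate_topology_on.induct) (auto simp: scalar_lcs_def eq)
  next
    assume "openin euclidean U"
    then have U: "open U" by simp
    have "U = \<Union>{V. V \<subseteq> U \<and> (\<exists>x r. 0 < r \<and> V = {y. norm (y - x) < r})}" (is "_ = \<Union>?K")
    proof
      show "U \<subseteq> \<Union>?K"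
      proof
        fix x assume "x \<in> U"
        then obtain r where "r > 0" "ball x r \<subseteq> U" using U open_contains_ball by blast
        then show "x \<in> \<Union>?K" unfolding eq
          by (intro UnionI[of "ball x r"]) auto
      qed
    qed blast
    moreover have "openin (lctop scalar_lcs) (\<Union>?K)"
      unfolding lctop_def openin_topology_generated_by_iff
      by (rule generate_topology_on.UN, rule generate_topology_on.Basis)
         (auto simp: scalar_lcs_def)
    ultimately show "openin (lctop scalar_lcs) U" by simp
  }
qed

lemma scalar_lcs_simps [simp]:
  "car scalar_lcs = UNIV" "scl scalar_lcs = (*)" "sn scalar_lcs = {norm}"
  by (auto simp: scalar_lcs_def)

lemma lcspace_scalar: "lcspace (scalar_lcs :: ('k::real_or_complex, 'k) lcs)"
proof -
  have vs: "vector_space ((*) :: 'k \<Rightarrow> 'k \<Rightarrow> 'k)"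
    by (rule vector_space_over_itself.vector_space_axioms)
  interpret S: seminormed "scalar_lcs :: ('k, 'k) lcs"
    by (rule seminormed.intro)
       (auto simp: vs module.subspace_def[OF vector_space_over_itself.module_axioms] seminorm_on_def norm_mult norm_triangle_ineq)
  show ?thesis
  proof
    show "\<exists>x\<in>car (scalar_lcs :: ('k, 'k) lcs). x \<noteq> 0" using one_neq_zero by auto
    show "Hausdorff_space (lctop (scalar_lcs :: ('k, 'k) lcs))"
      by (rule S.Hausdorff_lctop) auto
  qed (auto intro!: exI[of _ 1])
qed

lemma seminormed_scalar: "seminormed (scalar_lcs :: ('k::real_or_complex, 'k) lcs)"
  using lcspace_scalar by (rule lcspace.axioms)

lemma dual_iff:
  "y \<in> dual X \<longleftrightarrow> cont_linear_lcs X scalar_lcs y \<and> (\<forall>x. x \<notin> car X \<longrightarrow> y x = 0)"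
  by (auto simp: dual_def ops_def)

context seminormed
begin

lemma dualD:
  assumes "y \<in> dual X"
  shows "x \<in> car X \<Longrightarrow> z \<in> car X \<Longrightarrow> y (x + z) = y x + y z"
    and "x \<in> car X \<Longrightarrow> y (scl X a x) = a * y x"
    and "x \<notin> car X \<Longrightarrow> y x = 0"
    and "y 0 = 0"
    and "x \<in> car X \<Longrightarrow> z \<in> car X \<Longrightarrow> y (x - z) = y x - y z"
    and "(\<And>i. i \<in> A \<Longrightarrow> f i \<in> car X) \<Longrightarrow> y (sum f A) = (\<Sum>i\<in>A. y (f i))"
proof -
  have lin: "linear_lcs X scalar_lcs y" using assms by (auto simp: dual_iff cont_linear_lcs_def)
  show add: "y (x + z) = y x + y z" if "x \<in> car X" "z \<in> car X" for x z
    using lin that by (auto simp: linear_lcs_def)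
  show scl: "y (scl X a x) = a * y x" if "x \<in> car X" for a x
    using lin that by (auto simp: linear_lcs_def)
  show "y x = 0" if "x \<notin> car X" for x using assms that by (auto simp: dual_iff)
  show zero: "y 0 = 0" using scl[of 0 0] by simp
  show "y (x - z) = y x - y z" if "x \<in> car X" "z \<in> car X" for x z
    using add[of "x - z" z] that by simp
  show "y (sum f A) = (\<Sum>i\<in>A. y (f i))" if "\<And>i. i \<in> A \<Longrightarrow> f i \<in> car X" for f and A :: "'b set"
    using that by (induction A rule: infinite_finite_induct) (auto simp: zero add)
qed

lemma dualI:
  assumes "\<And>x z. x \<in> car X \<Longrightarrow> z \<in> car X \<Longrightarrow> y (x + z) = y x + y z"
    and "\<And>a x. x \<in> car X \<Longrightarrow> y (scl X a x) = a * y x"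
    and "\<And>x. x \<notin> car X \<Longrightarrow> y x = 0"
    and "p \<in> sn X" "\<And>x. x \<in> car X \<Longrightarrow> norm (y x) \<le> C * p x"
  shows "y \<in> dual X"
  unfolding dual_iff
proof (intro conjI allI impI cont_linear_lcsI seminormed_scalar)
  show "linear_lcs X scalar_lcs y" using assms by (auto simp: linear_lcs_def)
  show "\<exists>p\<in>sn X. \<exists>C. \<forall>x\<in>car X. q (y x) \<le> C * p x" if "q \<in> sn scalar_lcs" for q
    using that assms(4,5) by (auto intro!: bexI[of _ p] exI[of _ C])
qed (use assms in \<open>auto intro: seminormed_axioms\<close>)

lemma Hahn_Banach:
  assumes p: "p \<in> sn X" and x0: "x0 \<in> car X"
  shows "\<exists>y\<in>dual X. norm (y x0) = p x0 \<and> (\<forall>x\<in>car X. norm (y x) \<le> p x)"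
proof -
  note sp = sn_seminorm[OF p]
  obtain \<phi> where \<phi>0: "\<phi> x0 = p x0" and \<phi>le: "\<And>x. x \<in> car X \<Longrightarrow> \<phi> x \<le> p x"
    and \<phi>add: "\<And>x y. x \<in> car X \<Longrightarrow> y \<in> car X \<Longrightarrow> \<phi> (x + y) = \<phi> x + \<phi> y"
    and \<phi>scl: "\<And>r x. x \<in> car X \<Longrightarrow> \<phi> (rscl r x) = r * \<phi> x"
    using real_Hahn_Banach[OF sp x0] by blast
  \<comment> \<open>The last two clauses stand in for the statement that \<open>\<phi>\<close> is
    the real part of \<open>y\<close>. In this form they make sense over both fields, and they are
    what the rotation argument below uses.\<close>
  have "\<exists>y::'v \<Rightarrow> 'k. (\<forall>x\<in>car X. \<forall>z\<in>car X. y (x + z) = y x + y z) \<and>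
    (\<forall>a. \<forall>x\<in>car X. y (scl X a x) = a * y x) \<and>
    (\<forall>x\<in>car X. \<bar>\<phi> x\<bar> \<le> norm (y x)) \<and>
    (\<forall>x\<in>car X. \<forall>r. y x = of_real r \<longrightarrow> \<phi> x = r)"
  proof (cases rule: real_or_complex_cases[where 'k='k])
    case real
    have "\<phi> (scl X a x) *\<^sub>R 1 = a * of_real (\<phi> x)" if x: "x \<in> car X" for a x
    proof -
      obtain r where "a = of_real r" using real by blast
      then show ?thesis using \<phi>scl[OF x] by (simp flip: of_real_def)
    qed
    then show ?thesis
      by (intro exI[of _ "\<lambda>x. of_real (\<phi> x)"]) (auto simp: \<phi>add of_real_def algebra_simps)
  next
    case (complex i)
    \<comment> \<open>A complex-linear functional is recovered from its real part by
      \<open>y x = \<phi> x - i \<phi> (i x)\<close>.\<close>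
    define y where "y x = of_real (\<phi> x) + of_real (- \<phi> (scl X i x)) * i" for x
    have y_add: "y (x + z) = y x + y z" if "x \<in> car X" "z \<in> car X" for x z
      using that by (simp add: y_def \<phi>add scl_rules algebra_simps)
    have y_rscl: "y (rscl r x) = of_real r * y x" if "x \<in> car X" for r x
    proof -
      have "scl X i (rscl r x) = rscl r (scl X i x)" by (simp add: scl_rules mult.commute)
      then show ?thesis using that by (simp add: y_def \<phi>scl algebra_simps)
    qed
    have y_i: "y (scl X i x) = i * y x" if "x \<in> car X" for x
    proof -
      have "\<phi> (- x) = - \<phi> x" using \<phi>scl[OF that, of "-1"] by (simp add: scl_rules)
      moreover have "scl X i (scl X i x) = - x" by (simp add: scl_rules complex(1))
      ultimately have "y (scl X i x) = of_real (\<phi> (scl X i x)) + of_real (\<phi> x) * i"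
        by (simp add: y_def)
      also have "\<dots> = of_real (- \<phi> (scl X i x)) * (i * i) + of_real (\<phi> x) * i"
        by (simp add: complex(1))
      also have "\<dots> = i * y x" by (simp add: y_def algebra_simps)
      finally show ?thesis .
    qed
    have y_scl: "y (scl X a x) = a * y x" if x: "x \<in> car X" for a x
    proof -
      obtain r s where a: "a = of_real r + of_real s * i" using complex(2) by blast
      have "scl X a x = rscl r x + rscl s (scl X i x)" by (simp add: a scl_rules)
      then show ?thesis using x by (simp add: y_add y_rscl y_i a algebra_simps)
    qed
    have n: "norm (y x) = sqrt ((\<phi> x)\<^sup>2 + (\<phi> (scl X i x))\<^sup>2)" for x
      unfolding y_def by (subst norm_complex_like[OF complex(1)]) simp
    have "\<phi> x = r" if "y x = of_real r" for x r
    proof -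
      have "of_real (\<phi> x - r) + of_real (- \<phi> (scl X i x)) * i = 0"
        using that by (simp add: y_def algebra_simps)
      then have "sqrt ((\<phi> x - r)\<^sup>2 + (- \<phi> (scl X i x))\<^sup>2) = 0"
        by (metis norm_complex_like[OF complex(1)] norm_zero)
      then show ?thesis by (simp add: sum_power2_eq_zero_iff)
    qed
    then show ?thesis
      using y_add y_scl n by (intro exI[of _ y]) auto
  qed
  then obtain y :: "'v \<Rightarrow> 'k" where y_add: "\<And>x z. x \<in> car X \<Longrightarrow> z \<in> car X \<Longrightarrow> y (x + z) = y x + y z"
    and y_scl: "\<And>a x. x \<in> car X \<Longrightarrow> y (scl X a x) = a * y x"
    and y_ge: "\<And>x. x \<in> car X \<Longrightarrow> \<bar>\<phi> x\<bar> \<le> norm (y x)"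
    and y_re: "\<And>x r. x \<in> car X \<Longrightarrow> y x = of_real r \<Longrightarrow> \<phi> x = r"
    by blast
  have y_le: "norm (y x) \<le> p x" if x: "x \<in> car X" for x
  proof (cases "y x = 0")
    case False
    \<comment> \<open>Rotate \<open>x\<close> by a scalar of modulus 1 so that the value of \<open>y\<close> becomes real.\<close>
    define c where "c = of_real (norm (y x)) / y x"
    have c: "norm c = 1" using False by (simp add: c_def norm_divide)
    have "y (scl X c x) = of_real (norm (y x))" using False x by (simp add: y_scl c_def)
    then have "norm (y x) = \<phi> (scl X c x)" using y_re x by simp
    also have "\<dots> \<le> p x" using \<phi>le[of "scl X c x"] x p_scl[OF sp x, of c] c by simp
    finally show ?thesis .
  qed (use p_nonneg[OF sp x] in simp)
  define y' where "y' x = (if x \<in> car X then y x else 0)" for x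
  have "y' \<in> dual X"
    by (rule dualI[OF _ _ _ p, of _ 1]) (auto simp: y'_def y_add y_scl y_le)
  moreover have "norm (y' x0) = p x0"
    using y_ge[OF x0] y_le[OF x0] \<phi>0 p_nonneg[OF sp x0] x0 by (simp add: y'_def)
  moreover have "norm (y' x) \<le> p x" if "x \<in> car X" for x
    using y_le that by (simp add: y'_def)
  ultimately show ?thesis by blast
qed

text \<open>The gateway from scalar to vector-valued estimates: \<open>p\<close> is the pointwise
  maximum of the functionals it dominates. A scalar bound passes to \<open>p\<close> as soon as it
  is uniform over these functionals.\<close>

lemma seminorm_le_by_dual:
  assumes p: "p \<in> sn X" and x: "x \<in> car X"
    and "\<And>y. y \<in> dual X \<Longrightarrow> (\<And>z. z \<in> car X \<Longrightarrow> norm (y z) \<le> p z) \<Longrightarrow> norm (y x) \<le> B"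
  shows "p x \<le> B"
  using Hahn_Banach[OF p x] assms by metis

end

context lcspace
begin

lemma dual_separates:
  assumes "x \<in> car X" "z \<in> car X" "\<And>y. y \<in> dual X \<Longrightarrow> y x = y z"
  shows "x = z"
proof (rule eqI)
  fix p assume p: "p \<in> sn X"
  have "p (x - z) \<le> 0"
    by (rule seminorm_le_by_dual[OF p]) (use assms in \<open>auto simp: dualD\<close>)
  then show "p (x - z) = 0" using p_nonneg[OF sn_seminorm[OF p], of "x - z"] assms by simp
qed (use assms in auto)

lemma dual_bound:
  assumes "y \<in> dual X"
  shows "\<exists>p\<in>sn X. \<exists>C\<ge>0. \<forall>x\<in>car X. norm (y x) \<le> C * p x"
  using cont_linear_lcs_bound[OF lcspace_axioms seminormed_scalar, of y norm] assms
  by (simp add: dual_iff)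

end

section \<open>Local completeness and weak sums\<close>

definition fast_complete :: "('k::real_or_complex, 'v::ab_group_add) lcs \<Rightarrow> bool" where
  "fast_complete X \<longleftrightarrow> (\<forall>\<sigma>::nat \<Rightarrow> 'v. range \<sigma> \<subseteq> car X \<longrightarrow>
     (\<forall>p\<in>sn X. \<exists>C. \<forall>N. p (\<sigma> (Suc N) - \<sigma> N) \<le> C * (1 / 2) ^ N) \<longrightarrow>
     (\<exists>x\<in>car X. \<forall>p\<in>sn X. (\<lambda>N. p (\<sigma> N - x)) \<longlonglongrightarrow> 0))"

lemma (in seminormed) geometric_increments:
  assumes p: "p \<in> sn X" and \<sigma>: "\<And>N. \<sigma> N \<in> car X"
    and C: "\<And>N. p (\<sigma> (Suc N) - \<sigma> N) \<le> C * (1 / 2) ^ N" and mn: "m \<le> n"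
  shows "p (\<sigma> n - \<sigma> m) \<le> 2 * C * (1 / 2) ^ m"
proof -
  note sp = sn_seminorm[OF p]
  have C0: "0 \<le> C" using p_nonneg[OF sp, of "\<sigma> (Suc 0) - \<sigma> 0"] C[of 0] \<sigma> by simp
  \<comment> \<open>The subtracted term is the tail still to come. It shrinks by exactly the next
    increment bound, so the induction closes.\<close>
  have "p (\<sigma> n - \<sigma> m) \<le> 2 * C * (1 / 2) ^ m - 2 * C * (1 / 2) ^ n"
    using mn
  proof (induction n rule: dec_induct)
    case base
    then show ?case by (simp add: p_zero[OF sp])
  next
    case (step n)
    have "p (\<sigma> (Suc n) - \<sigma> m) \<le> p (\<sigma> (Suc n) - \<sigma> n) + p (\<sigma> n - \<sigma> m)"
      by (rule p_diff_triangle[OF sp]) (use \<sigma> in auto)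
    then show ?case using step.IH C[of n] by simp
  qed
  moreover have "0 \<le> 2 * C * (1 / 2) ^ n" using C0 by simp
  ultimately show ?thesis by linarith
qed

lemma locally_complete_imp_fast_complete:
  assumes X: "lcspace X" and lc: "locally_complete X"
  shows "fast_complete X"
  unfolding fast_complete_def
proof (intro allI impI)
  interpret lcspace X by (rule X)
  fix \<sigma> :: "nat \<Rightarrow> 'b"
  assume \<sigma>: "range \<sigma> \<subseteq> car X" and "\<forall>p\<in>sn X. \<exists>C. \<forall>N. p (\<sigma> (Suc N) - \<sigma> N) \<le> C * (1 / 2) ^ N"
  then obtain C where C: "\<And>p N. p \<in> sn X \<Longrightarrow> p (\<sigma> (Suc N) - \<sigma> N) \<le> C p * (1 / 2) ^ N" by metis
  have \<sigma>_in: "\<sigma> N \<in> car X" for N using \<sigma> by auto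
  define D where "D = {x \<in> car X. \<forall>p\<in>sn X. p x \<le> C p}"
  have C0: "0 \<le> C p" if "p \<in> sn X" for p
    using p_nonneg[OF sn_seminorm[OF that], of "\<sigma> (Suc 0) - \<sigma> 0"] C[OF that, of 0] \<sigma>_in by simp
  \<comment> \<open>By homogeneity, lying in \<open>t D\<close> means
    \<open>p x \<le> t * C p\<close> for every \<open>p\<close>. This and \<open>scaleD'\<close>
    translate between the gauge of \<open>D\<close> and the family of seminorms.\<close>
  have scaleD: "x \<in> scl X (of_real t) ` D"
    if x: "x \<in> car X" and t: "0 < t" and le: "\<And>p. p \<in> sn X \<Longrightarrow> p x \<le> t * C p" for x t
  proof
    show "x = scl X (of_real t) (scl X (of_real (1 / t)) x)" using t by (simp add: scl_rules)
    have "p (scl X (of_real (1 / t)) x) \<le> C p" if p: "p \<in> sn X" for p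
    proof -
      have "p (scl X (of_real (1 / t)) x) = (1 / t) * p x"
        using p_scl[OF sn_seminorm[OF p] x, of "of_real (1 / t)"] t by (simp add: norm_divide)
      also have "\<dots> \<le> (1 / t) * (t * C p)" using le[OF p] t by (intro mult_left_mono) auto
      finally show ?thesis using t by simp
    qed
    then show "scl X (of_real (1 / t)) x \<in> D" using x by (simp add: D_def)
  qed
  have scaleD': "p x \<le> t * C p" if "x \<in> scl X (of_real t) ` D" "0 \<le> t" "p \<in> sn X" for x t p
  proof -
    obtain z where z: "z \<in> D" "x = scl X (of_real t) z" using \<open>x \<in> _\<close> by blast
    then have "p z \<le> C p" using \<open>p \<in> sn X\<close> by (simp add: D_def)
    then have "t * p z \<le> t * C p" using \<open>0 \<le> t\<close> by (rule mult_left_mono)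
    then show ?thesis
      using p_scl[OF sn_seminorm[OF \<open>p \<in> sn X\<close>], of z "of_real t"] z \<open>0 \<le> t\<close> by (simp add: D_def)
  qed
  have "closedin (lctop X) (\<Inter>p\<in>sn X. {x \<in> topspace (lctop X). p x \<in> {..C p}})"
    using sn_nonempty
    by (intro closedin_INT closedin_continuous_map_preimage[OF continuous_map_seminorm]) auto
  moreover have "(\<Inter>p\<in>sn X. {x \<in> topspace (lctop X). p x \<in> {..C p}}) = D"
    using sn_nonempty by (auto simp: D_def)
  ultimately have "closedin (lctop X) D" by simp
  moreover have "bounded_in X D"
    by (auto simp: bounded_in_def D_def intro!: bdd_aboveI[of _ "C _"])
  moreover have "absconvex X D"
    unfolding absconvex_def
  proof (intro conjI ballI allI impI)
    show "D \<noteq> {}" using C0 by (auto simp: D_def p_zero[OF sn_seminorm] intro!: exI[of _ 0])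
    show "D \<subseteq> car X" by (auto simp: D_def)
    fix x y and a b :: 'a assume *: "x \<in> D" "y \<in> D" "norm a + norm b \<le> 1"
    have "p (scl X a x + scl X b y) \<le> C p" if p: "p \<in> sn X" for p
    proof -
      note sp = sn_seminorm[OF p]
      have "p (scl X a x + scl X b y) \<le> norm a * p x + norm b * p y"
        using p_triangle[OF sp, of "scl X a x" "scl X b y"] * by (simp add: D_def p_scl[OF sp])
      also have "\<dots> \<le> norm a * C p + norm b * C p"
        using * p by (intro add_mono mult_left_mono) (auto simp: D_def)
      also have "\<dots> \<le> 1 * C p"
        using mult_right_mono[OF *(3) C0[OF p]] by (simp add: distrib_right)
      finally show ?thesis by simp
    qed
    then show "scl X a x + scl X b y \<in> D" using * by (simp add: D_def)
  qed
  \<comment> \<open>Only differences of members of the sequence are controlled by \<open>C\<close>,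
    so the sequence is shifted to start at 0 and thus to stay in the span of
    \<open>D\<close>.\<close>
  moreover define \<tau> where "\<tau> N = \<sigma> N - \<sigma> 0" for N
  have \<tau>_in: "\<tau> N \<in> car X" for N using \<sigma>_in by (simp add: \<tau>_def)
  have diff: "p (\<tau> m - \<tau> n) \<le> 2 * (1 / 2) ^ N * C p" if "N \<le> m" "N \<le> n" "p \<in> sn X" for m n N p
  proof -
    have *: "p (\<sigma> j - \<sigma> i) \<le> 2 * (1 / 2) ^ N * C p" if "i \<le> j" "N \<le> i" for i j
    proof -
      have "p (\<sigma> j - \<sigma> i) \<le> 2 * C p * (1 / 2) ^ i"
        using geometric_increments[OF \<open>p \<in> sn X\<close> \<sigma>_in C[OF \<open>p \<in> sn X\<close>] that(1)] .
      also have "\<dots> \<le> 2 * C p * (1 / 2) ^ N"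
        using C0[OF \<open>p \<in> sn X\<close>] that by (intro mult_left_mono power_decreasing) auto
      finally show ?thesis by (simp add: mult_ac)
    qed
    have "p (\<sigma> m - \<sigma> n) \<le> 2 * (1 / 2) ^ N * C p"
    proof (cases "n \<le> m")
      case False
      then show ?thesis
        using *[of m n] that p_diff_commute[OF sn_seminorm[OF that(3)], of "\<sigma> m" "\<sigma> n"] \<sigma>_in by simp
    qed (use * that in auto)
    then show ?thesis by (simp add: \<tau>_def)
  qed
  moreover have "range \<tau> \<subseteq> gauge_span X D"
  proof clarify
    fix N
    have "\<tau> N \<in> scl X (of_real 2) ` D"
      using diff[of 0 N 0] by (intro scaleD \<tau>_in) (auto simp: \<tau>_def)
    then show "\<tau> N \<in> gauge_span X D"
      unfolding gauge_span_def by (intro UN_I[of 2]) auto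
  qed
  moreover have "\<forall>\<epsilon>>0. \<exists>N. \<forall>m\<ge>N. \<forall>n\<ge>N. gauge_of X D (\<tau> m - \<tau> n) < \<epsilon>"
  proof (intro allI impI)
    fix \<epsilon> :: real assume "0 < \<epsilon>"
    then obtain N where N: "(1 / 2) ^ N < \<epsilon> / 2"
      using real_arch_pow_inv[of "\<epsilon> / 2" "1 / 2"] by auto
    have "gauge_of X D (\<tau> m - \<tau> n) < \<epsilon>" if "N \<le> m" "N \<le> n" for m n
    proof -
      have "gauge_of X D (\<tau> m - \<tau> n) \<le> 2 * (1 / 2) ^ N"
        unfolding gauge_of_def
      proof (rule cInf_lower)
        show "2 * (1 / 2) ^ N \<in> {t. 0 < t \<and> \<tau> m - \<tau> n \<in> scl X (of_real t) ` D}"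
          using diff[OF that] \<tau>_in by (intro CollectI conjI scaleD) auto
      qed (auto intro: bdd_belowI[of _ 0])
      then show ?thesis using N by simp
    qed
    then show "\<exists>N. \<forall>m\<ge>N. \<forall>n\<ge>N. gauge_of X D (\<tau> m - \<tau> n) < \<epsilon>" by blast
  qed
  ultimately have "\<exists>x\<in>gauge_span X D. (\<lambda>n. gauge_of X D (\<tau> n - x)) \<longlonglongrightarrow> 0"
    using lc[unfolded locally_complete_def, THEN spec[of _ D], THEN mp, THEN spec[of _ \<tau>], THEN mp]
    by blast
  then obtain x where x: "x \<in> gauge_span X D"
    and lim: "(\<lambda>n. gauge_of X D (\<tau> n - x)) \<longlonglongrightarrow> 0"
    by blast
  obtain k :: nat where k: "x \<in> scl X (of_nat k) ` D" using x by (auto simp: gauge_span_def)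
  then have x_in: "x \<in> car X" by (auto simp: D_def)
  have px: "p x \<le> real k * C p" if "p \<in> sn X" for p
    using scaleD'[of x "real k" p] k that by simp
  have "(\<lambda>N. p (\<sigma> N - (x + \<sigma> 0))) \<longlonglongrightarrow> 0" if p: "p \<in> sn X" for p
  proof (rule LIMSEQ_I)
    fix r :: real assume r: "0 < r"
    define \<delta> where "\<delta> = r / (C p + 1)"
    have \<delta>: "0 < \<delta>" "\<delta> * C p < r" using r C0[OF p] by (auto simp: \<delta>_def field_simps)
    obtain n0 where n0: "\<And>n. n0 \<le> n \<Longrightarrow> gauge_of X D (\<tau> n - x) < \<delta>"
      using order_tendstoD(2)[OF lim \<delta>(1)] by (auto simp: eventually_sequentially)
    have "norm (p (\<sigma> n - (x + \<sigma> 0)) - 0) < r" if n: "n0 \<le> n" for n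
    proof -
      \<comment> \<open>The difference lies in some multiple of \<open>D\<close>: \<open>k\<close>
        comes from \<open>x\<close>, and 2 from the geometric series for \<open>\<tau> n\<close>.
        The infimum in the gauge therefore ranges over a nonempty set, and a gauge below
        \<open>\<delta>\<close> yields a scaling factor below \<open>\<delta>\<close>.\<close>
      have "\<tau> n - x \<in> scl X (of_real (real k + 2)) ` D"
      proof (rule scaleD)
        fix q assume q: "q \<in> sn X"
        show "q (\<tau> n - x) \<le> (real k + 2) * C q"
          using p_diff[OF sn_seminorm[OF q] \<tau>_in x_in, of n] diff[of 0 n 0 q] px[OF q] q
          by (simp add: \<tau>_def algebra_simps)
      qed (use \<tau>_in x_in in auto)
      then have "real k + 2 \<in> {t. 0 < t \<and> \<tau> n - x \<in> scl X (of_real t) ` D}"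
        by simp
      then have "{t. 0 < t \<and> \<tau> n - x \<in> scl X (of_real t) ` D} \<noteq> {}" by blast
      then obtain t where t: "0 < t" "\<tau> n - x \<in> scl X (of_real t) ` D" "t < \<delta>"
        using cInf_lessD[OF _ n0[OF n, unfolded gauge_of_def]] by blast
      have "p (\<tau> n - x) \<le> t * C p" using scaleD'[OF t(2)] t(1) p by simp
      also have "\<dots> \<le> \<delta> * C p" using t C0[OF p] by (intro mult_right_mono) auto
      also have "\<dots> < r" by (rule \<delta>)
      finally have "p (\<tau> n - x) < r" .
      moreover have "0 \<le> p (\<tau> n - x)"
        using p_nonneg[OF sn_seminorm[OF p], of "\<tau> n - x"] \<tau>_in x_in by simp
      moreover have eq: "\<tau> n - x = \<sigma> n - (x + \<sigma> 0)" by (simp add: \<tau>_def)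
      ultimately show ?thesis unfolding eq by simp
    qed
    then show "\<exists>n0. \<forall>n\<ge>n0. norm (p (\<sigma> n - (x + \<sigma> 0)) - 0) < r" by (intro exI[of _ n0] allI impI)
  qed
  then show "\<exists>x\<in>car X. \<forall>p\<in>sn X. (\<lambda>N. p (\<sigma> N - x)) \<longlonglongrightarrow> 0"
    using x_in \<sigma>_in by (intro bexI[of _ "x + \<sigma> 0"]) auto
qed

text \<open>The common setting for \<open>E\<close> and for the scalar field, so that Hermite
  coefficients and series need to be developed only once; the scalar instance provides the test
  functions of the epsilon product.\<close>

locale fc_space = lcspace X for X :: "('k::real_or_complex, 'v::ab_group_add) lcs" +
  assumes fast_complete: "fast_complete X"

lemma fc_space_scalar: "fc_space (scalar_lcs :: ('k::real_or_complex, 'k) lcs)"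
proof -
  interpret lcspace "scalar_lcs :: ('k, 'k) lcs" by (rule lcspace_scalar)
  have "fast_complete (scalar_lcs :: ('k, 'k) lcs)"
    unfolding fast_complete_def
  proof (intro allI impI)
    fix \<sigma> :: "nat \<Rightarrow> 'k"
    assume "\<forall>p\<in>sn scalar_lcs. \<exists>C. \<forall>N. p (\<sigma> (Suc N) - \<sigma> N) \<le> C * (1 / 2) ^ N"
    then obtain C where C: "\<And>N. norm (\<sigma> (Suc N) - \<sigma> N) \<le> C * (1 / 2) ^ N" by auto
    have "summable (\<lambda>N. C * (1 / 2 :: real) ^ N)" by (intro summable_mult summable_geometric) simp
    then have "summable (\<lambda>N. \<sigma> (Suc N) - \<sigma> N)"
      by (rule summable_comparison_test[rotated]) (use C in blast)
    then have "convergent (\<lambda>n. \<Sum>N<n. \<sigma> (Suc N) - \<sigma> N)" by (simp add: summable_iff_convergent)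
    then have "convergent (\<lambda>n. \<sigma> n - \<sigma> 0)" by (simp add: sum_lessThan_telescope)
    then obtain l where "(\<lambda>n. \<sigma> n - \<sigma> 0) \<longlonglongrightarrow> l" by (auto simp: convergent_def)
    then have "(\<lambda>n. norm (\<sigma> n - \<sigma> 0 - l)) \<longlonglongrightarrow> 0"
      by (intro tendsto_norm_zero LIM_zero)
    then have "(\<lambda>n. norm (\<sigma> n - (l + \<sigma> 0))) \<longlonglongrightarrow> 0"
      by (simp add: algebra_simps)
    then show "\<exists>x\<in>car scalar_lcs. \<forall>p\<in>sn scalar_lcs. (\<lambda>N. p (\<sigma> N - x)) \<longlonglongrightarrow> 0" by auto
  qed
  then show ?thesis by unfold_locales
qed

section \<open>Weights on multi-indices and their summability\<close>

definition wt :: "nat^'d::finite \<Rightarrow> real" where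
  "wt n = 1 + (\<Sum>i\<in>UNIV. (real (n $ i))\<^sup>2)"

lemma wt_ge_1 [simp]: "1 \<le> wt n"
  unfolding wt_def by (simp add: sum_nonneg)

lemma wt_pos [simp]: "0 < wt n" and wt_nonneg [simp]: "0 \<le> wt n" and wt_neq_0 [simp]: "wt n \<noteq> 0"
  using wt_ge_1[of n] by linarith+

lemma wt_enorm: "1 + (enorm n)\<^sup>2 = wt n"
  by (simp add: wt_def enorm_def sum_nonneg)

lemma component_le_wt: "(real (n $ i))\<^sup>2 + 1 \<le> wt n"
  unfolding wt_def using member_le_sum[of i UNIV "\<lambda>i. (real (n $ i))\<^sup>2"] by simp

lemma box_image: "{n :: nat^'d::finite. \<forall>i. n $ i \<le> K} = (\<lambda>f. \<chi> i. f i) ` (PiE UNIV (\<lambda>_. {..K}))"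
proof safe
  fix n :: "nat^'d" assume "\<forall>i. n $ i \<le> K"
  then show "n \<in> (\<lambda>f. \<chi> i. f i) ` (PiE UNIV (\<lambda>_. {..K}))"
    by (intro image_eqI[of _ _ "vec_nth n"]) auto
qed auto

lemma finite_box: "finite {n :: nat^'d::finite. \<forall>i. n $ i \<le> K}"
  unfolding box_image by (intro finite_imageI finite_PiE) auto

lemma finite_wt_le: "finite {n :: nat^'d::finite. wt n \<le> c}"
proof (rule finite_subset[OF _ finite_box[of "nat \<lceil>c\<rceil>"]], safe)
  fix n :: "nat^'d" and i assume n: "wt n \<le> c"
  have "real (n $ i) \<le> (real (n $ i))\<^sup>2 + 1"
    using zero_le_power2[of "real (n $ i) - 1"] by (simp add: power2_eq_square algebra_simps)
  then have "real (n $ i) \<le> c" using component_le_wt[of n i] n by linarith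
  then show "n $ i \<le> nat \<lceil>c\<rceil>" by linarith
qed

text \<open>The weight dominates each \<open>1 + n_i^2\<close>, so its \<open>CARD('d)\<close>-th
  power dominates their product. Over a box the sum of the product factors into one-dimensional
  sums, each bounded by a convergent series.\<close>

lemma summable_wt: "(\<lambda>n::nat^'d::finite. 1 / wt n ^ CARD('d)) summable_on UNIV"
proof (rule nonneg_bdd_above_summable_on)
  define S where "S = (\<Sum>k. 2 * (1 / (real k + 1)\<^sup>2))"
  have sm: "summable (\<lambda>k. 2 * (1 / (real k + 1)\<^sup>2))"
    using inverse_squares_sums by (intro summable_mult) (auto simp: sums_iff add.commute)
  have 1: "(\<Sum>k\<le>K. 1 / (1 + (real k)\<^sup>2)) \<le> S" for K
  proof -
    have "1 / (1 + (real k)\<^sup>2) \<le> 2 * (1 / (real k + 1)\<^sup>2)" for k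
    proof -
      have "(real k + 1)\<^sup>2 \<le> 2 * (1 + (real k)\<^sup>2)"
        using zero_le_power2[of "real k - 1"] by (simp add: power2_eq_square algebra_simps)
      moreover have "0 < (real k + 1)\<^sup>2" "0 < 1 + (real k)\<^sup>2" by (simp_all add: add_pos_nonneg)
      ultimately show ?thesis by (simp add: field_simps)
    qed
    then have "(\<Sum>k\<le>K. 1 / (1 + (real k)\<^sup>2)) \<le> (\<Sum>k\<le>K. 2 * (1 / (real k + 1)\<^sup>2))"
      by (intro sum_mono)
    also have "\<dots> \<le> S" unfolding S_def by (rule sum_le_suminf[OF sm]) auto
    finally show ?thesis .
  qed
  show "bdd_above (sum (\<lambda>n::nat^'d. 1 / wt n ^ CARD('d)) ` {F. F \<subseteq> UNIV \<and> finite F})"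
  proof (rule bdd_aboveI2)
    fix F :: "(nat^'d) set" assume "F \<in> {F. F \<subseteq> UNIV \<and> finite F}"
    then have F: "finite F" by simp
    define K where "K = Max (insert 0 ((\<lambda>(n, i). n $ i) ` (F \<times> UNIV)))"
    have FK: "F \<subseteq> {n. \<forall>i. n $ i \<le> K}"
      unfolding K_def using F by (auto intro!: Max_ge)
    have inj: "inj_on (\<lambda>f. \<chi> i. f i :: nat^'d) A" for A
      by (rule inj_onI) (metis ext vec_lambda_inverse UNIV_I)
    have "(\<Sum>n\<in>F. 1 / wt n ^ CARD('d)) \<le> (\<Sum>n\<in>{n::nat^'d. \<forall>i. n $ i \<le> K}. 1 / wt n ^ CARD('d))"
      using FK by (intro sum_mono2 finite_box) auto
    also have "\<dots> \<le> (\<Sum>n\<in>{n::nat^'d. \<forall>i. n $ i \<le> K}. \<Prod>i\<in>UNIV. 1 / (1 + (real (n $ i))\<^sup>2))"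
    proof (rule sum_mono)
      fix n :: "nat^'d"
      have "1 / wt n ^ CARD('d) = (\<Prod>i\<in>(UNIV::'d set). 1 / wt n)" by (simp add: power_one_over)
      also have "\<dots> \<le> (\<Prod>i\<in>UNIV. 1 / (1 + (real (n $ i))\<^sup>2))"
        using component_le_wt[of n]
        by (intro prod_mono conjI frac_le) (auto simp: add.commute add_pos_nonneg)
      finally show "1 / wt n ^ CARD('d) \<le> (\<Prod>i\<in>UNIV. 1 / (1 + (real (n $ i))\<^sup>2))" .
    qed
    also have "\<dots> = (\<Sum>f\<in>PiE UNIV (\<lambda>_::'d. {..K}). \<Prod>i\<in>UNIV. 1 / (1 + (real (f i))\<^sup>2))"
      unfolding box_image by (subst sum.reindex[OF inj]) simp
    also have "\<dots> = (\<Prod>i\<in>(UNIV::'d set). \<Sum>k\<le>K. 1 / (1 + (real k)\<^sup>2))"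
      by (rule prod_sum_PiE[symmetric]) auto
    also have "\<dots> \<le> (\<Prod>i\<in>(UNIV::'d set). S)"
      using 1 by (intro prod_mono conjI sum_nonneg) auto
    finally show "(\<Sum>n\<in>F. 1 / wt n ^ CARD('d)) \<le> (\<Prod>i\<in>(UNIV::'d set). S)" .
  qed
qed simp

text \<open>Since the weight is at least 1, its half-integer powers in the definition interleave
  with integer powers, and the latter are used from here on.\<close>

lemma rapid_values_bdd_iff:
  fixes y :: "nat^'d::finite \<Rightarrow> 'e"
  assumes nn: "\<And>n. 0 \<le> p (y n)"
  shows "(\<forall>j\<ge>1. bdd_above (rapid_values j p y)) \<longleftrightarrow> (\<forall>j. \<exists>C. \<forall>n. p (y n) * wt n ^ j \<le> C)"
proof safe
  fix j assume "\<forall>j\<ge>1. bdd_above (rapid_values j p y)"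
  \<comment> \<open>The exponent is \<open>2 * j + 2\<close> and not \<open>2 * j\<close> because
    the seminorms start at index 1.\<close>
  then have "bdd_above (rapid_values (2 * j + 2) p y)" by simp
  then obtain C where C: "\<And>n. p (y n) * wt n powr (real (2 * j + 2) / 2) \<le> C"
    unfolding rapid_values_def bdd_above_def wt_enorm by auto
  have "p (y n) * wt n ^ j \<le> C" for n
  proof -
    have e: "real (2 * j + 2) / 2 = real (j + 1)" by simp
    have "p (y n) * wt n ^ (j + 1) \<le> C"
      using C[of n] unfolding e powr_realpow[OF wt_pos] .
    moreover have "p (y n) * wt n ^ j \<le> p (y n) * wt n ^ (j + 1)"
      using nn by (intro mult_left_mono power_increasing) auto
    ultimately show ?thesis by linarith
  qed
  then show "\<exists>C. \<forall>n. p (y n) * wt n ^ j \<le> C" by blast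
next
  fix j :: nat assume "\<forall>j. \<exists>C. \<forall>n. p (y n) * wt n ^ j \<le> C"
  then obtain C where C: "\<And>n. p (y n) * wt n ^ j \<le> C" by blast
  have "p (y n) * wt n powr (real j / 2) \<le> C" for n
  proof -
    have "wt n powr (real j / 2) \<le> wt n powr real j" by (rule powr_mono) auto
    also have "\<dots> = wt n ^ j" by (rule powr_realpow) simp
    finally have "p (y n) * wt n powr (real j / 2) \<le> p (y n) * wt n ^ j" by (rule mult_left_mono[OF _ nn])
    then show ?thesis using C[of n] by linarith
  qed
  then show "bdd_above (rapid_values j p y)"
    unfolding rapid_values_def wt_enorm by (auto intro: bdd_aboveI2[where M = C])
qed

lemma filterlim_wt_le: "filterlim (\<lambda>N. {n :: nat^'d::finite. wt n \<le> 2 ^ N}) (finite_subsets_at_top UNIV) sequentially"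
proof (rule filterlim_finite_subsets_at_top[THEN iffD2], intro allI impI)
  fix F :: "(nat^'d) set" assume "finite F \<and> F \<subseteq> UNIV"
  then have F: "finite F" by simp
  have "\<forall>\<^sub>F N in sequentially. wt n \<le> 2 ^ N" for n :: "nat^'d"
  proof -
    obtain N0 where N0: "wt n < 2 ^ N0" using real_arch_pow[of 2 "wt n"] by auto
    have "wt n \<le> 2 ^ N" if "N0 \<le> N" for N
      using N0 power_increasing[OF that, of "2::real"] by linarith
    then show ?thesis by (auto simp: eventually_sequentially)
  qed
  then have "\<forall>\<^sub>F N in sequentially. \<forall>n\<in>F. wt n \<le> 2 ^ N"
    using F by (simp add: eventually_ball_finite)
  then show "\<forall>\<^sub>F N in sequentially. finite {n. wt n \<le> 2 ^ N} \<and> F \<subseteq> {n. wt n \<le> 2 ^ N} \<and> {n. wt n \<le> 2 ^ N} \<subseteq> UNIV"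
    by eventually_elim (use finite_wt_le in auto)
qed

section \<open>Rapidly decreasing sequences\<close>

context seminormed
begin

lemma rapid_iff:
  "y \<in> car (rapid X) \<longleftrightarrow>
     (\<forall>n. y n \<in> car X) \<and> (\<forall>p\<in>sn X. \<forall>j. \<exists>C. \<forall>n. p (y n) * wt n ^ j \<le> C)"
proof -
  have "(\<forall>j\<ge>1. bdd_above (rapid_values j p y)) \<longleftrightarrow> (\<forall>j. \<exists>C. \<forall>n. p (y n) * wt n ^ j \<le> C)"
    if "p \<in> sn X" "range y \<subseteq> car X" for p
    using that by (intro rapid_values_bdd_iff p_nonneg[OF sn_seminorm]) auto
  moreover have "y \<in> car (rapid X) \<longleftrightarrow>
      range y \<subseteq> car X \<and> (\<forall>p\<in>sn X. \<forall>j\<ge>1. bdd_above (rapid_values j p y))"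
    unfolding rapid_def by auto
  moreover have "range y \<subseteq> car X \<longleftrightarrow> (\<forall>n. y n \<in> car X)" by auto
  ultimately show ?thesis by (metis (no_types, lifting))
qed

lemma rapid_in: "y \<in> car (rapid X) \<Longrightarrow> y n \<in> car X"
  by (simp add: rapid_iff)

lemma rapid_bound:
  assumes "y \<in> car (rapid X)" "p \<in> sn X"
  obtains C where "0 \<le> C" "\<And>n. wt n ^ j * p (y n) \<le> C"
proof -
  have "\<exists>C. \<forall>n. p (y n) * wt n ^ j \<le> C" using assms unfolding rapid_iff by blast
  then obtain C where C: "\<And>n. p (y n) * wt n ^ j \<le> C" by blast
  moreover have "0 \<le> p (y 0) * wt 0 ^ j"
    using p_nonneg[OF sn_seminorm[OF assms(2)], of "y 0"] assms(1) by (simp add: rapid_iff)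
  then have "0 \<le> C" by (rule order.trans) (rule C)
  ultimately show thesis by (intro that[of C]) (auto simp: mult.commute)
qed

lemma rapid_summable:
  fixes y :: "nat^'d::finite \<Rightarrow> 'v"
  assumes y: "y \<in> car (rapid X)" and p: "p \<in> sn X"
  shows "(\<lambda>n. wt n ^ j * p (y n)) summable_on UNIV"
proof -
  obtain C where C: "0 \<le> C" "\<And>n. wt n ^ (j + CARD('d)) * p (y n) \<le> C"
    using rapid_bound[OF y p] by blast
  have nn: "0 \<le> p (y n)" for n using p_nonneg[OF sn_seminorm[OF p] rapid_in[OF y]] .
  have "(\<lambda>n. norm (wt n ^ j * p (y n))) summable_on UNIV"
  proof (rule Infinite_Sum.abs_summable_on_comparison_test[where g = "\<lambda>n. C * (1 / wt n ^ CARD('d))"])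
    have "(\<lambda>n::nat^'d. C * (1 / wt n ^ CARD('d))) summable_on UNIV"
      by (intro summable_on_cmult_right summable_wt)
    then show "(\<lambda>n::nat^'d. norm (C * (1 / wt n ^ CARD('d)))) summable_on UNIV"
      using C by simp
    fix n :: "nat^'d"
    have "wt n ^ j * p (y n) \<le> C * (1 / wt n ^ CARD('d))"
      using C(2)[of n] by (simp add: power_add field_simps)
    then show "norm (wt n ^ j * p (y n)) \<le> norm (C * (1 / wt n ^ CARD('d)))"
      using nn[of n] C(1) by simp
  qed
  then show ?thesis using nn by simp
qed

text \<open>Multipliers of polynomial growth act on rapidly decreasing sequences. Constants,
  indicator functions of index sets, and the values at a point of the derivatives of the Hermite
  functions are all of this kind.\<close>

lemma rapid_mult:
  fixes y :: "nat^'d::finite \<Rightarrow> 'v"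
  assumes y: "y \<in> car (rapid X)" and a: "\<And>n. norm (a n) \<le> C * wt n ^ k"
  shows "(\<lambda>n. scl X (a n) (y n)) \<in> car (rapid X)"
  unfolding rapid_iff
proof (intro conjI allI ballI)
  fix p j assume p: "p \<in> sn X"
  obtain B where B: "0 \<le> B" "\<And>n. wt n ^ (k + j) * p (y n) \<le> B" using rapid_bound[OF y p] by blast
  have "0 < wt (0 :: nat^'d) ^ k" by simp
  then have C: "0 \<le> C" using order.trans[OF norm_ge_zero a[of 0]] by (meson linorder_not_le mult_neg_pos)
  have "p (scl X (a n) (y n)) * wt n ^ j \<le> C * B" for n
  proof -
    have nn: "0 \<le> p (y n)" using p_nonneg[OF sn_seminorm[OF p] rapid_in[OF y]] .
    have "p (scl X (a n) (y n)) * wt n ^ j = norm (a n) * (wt n ^ j * p (y n))"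
      using p_scl[OF sn_seminorm[OF p] rapid_in[OF y]] by simp
    also have "\<dots> \<le> C * wt n ^ k * (wt n ^ j * p (y n))"
      using a nn by (intro mult_right_mono) auto
    also have "\<dots> = C * (wt n ^ (k + j) * p (y n))" by (simp add: power_add)
    also have "\<dots> \<le> C * B" using B C by (intro mult_left_mono) auto
    finally show ?thesis .
  qed
  then show "\<exists>C. \<forall>n. p (scl X (a n) (y n)) * wt n ^ j \<le> C" by blast
qed (use y in \<open>simp add: rapid_iff\<close>)

lemma rapid_add:
  assumes "y \<in> car (rapid X)" "z \<in> car (rapid X)"
  shows "y + z \<in> car (rapid X)"
  unfolding rapid_iff
proof (intro conjI allI ballI)
  fix p j assume p: "p \<in> sn X"
  obtain B where B: "\<And>n. wt n ^ j * p (y n) \<le> B" using rapid_bound[OF assms(1) p] by blast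
  obtain C where C: "\<And>n. wt n ^ j * p (z n) \<le> C" using rapid_bound[OF assms(2) p] by blast
  have "p ((y + z) n) * wt n ^ j \<le> B + C" for n
  proof -
    have "p ((y + z) n) * wt n ^ j \<le> (p (y n) + p (z n)) * wt n ^ j"
      using p_triangle[OF sn_seminorm[OF p]] assms[THEN rapid_in] by (intro mult_right_mono) auto
    then show ?thesis using B[of n] C[of n] by (simp add: algebra_simps)
  qed
  then show "\<exists>C. \<forall>n. p ((y + z) n) * wt n ^ j \<le> C" by blast
qed (use assms in \<open>simp add: rapid_iff\<close>)

lemma rapid_scl: "y \<in> car (rapid X) \<Longrightarrow> (\<lambda>n. scl X a (y n)) \<in> car (rapid X)"
  using rapid_mult[of y "\<lambda>_. a" "norm a" 0] by simp

lemma rapid_restrict: "y \<in> car (rapid X) \<Longrightarrow> (\<lambda>n. if n \<in> A then y n else 0) \<in> car (rapid X)"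
proof -
  assume "y \<in> car (rapid X)"
  moreover have "(\<lambda>n. if n \<in> A then y n else 0) = (\<lambda>n. scl X (if n \<in> A then 1 else 0) (y n))"
    by auto
  moreover have "norm (if n \<in> A then 1 else 0 :: 'k) \<le> 1 * wt n ^ 0" for n by simp
  ultimately show ?thesis using rapid_mult[of y "\<lambda>n. if n \<in> A then 1 else 0" 1 0] by simp
qed

lemma rapid_single: "x \<in> car X \<Longrightarrow> (\<lambda>n. if n = m then x else 0) \<in> car (rapid X)"
  unfolding rapid_iff
proof (intro conjI allI ballI)
  fix p j assume x: "x \<in> car X" and p: "p \<in> sn X"
  have "p (if n = m then x else 0) * wt n ^ j \<le> p x * wt m ^ j" for n
    using p_nonneg[OF sn_seminorm[OF p] x] by (simp add: p_zero[OF sn_seminorm[OF p]])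
  then show "\<exists>C. \<forall>n. p (if n = m then x else 0) * wt n ^ j \<le> C" by blast
qed simp

end

section \<open>Weak sums\<close>

context lcspace
begin

lemma dual_abs_summable:
  fixes y :: "nat^'d::finite \<Rightarrow> 'v"
  assumes y: "y \<in> car (rapid X)" and u: "u \<in> dual X"
  shows "(\<lambda>n. norm (u (y n))) summable_on UNIV"
proof -
  obtain p C where p: "p \<in> sn X" and C: "0 \<le> C" "\<And>x. x \<in> car X \<Longrightarrow> norm (u x) \<le> C * p x"
    using dual_bound[OF u] by blast
  show ?thesis
  proof (rule Infinite_Sum.abs_summable_on_comparison_test)
    have "(\<lambda>n. C * p (y n)) summable_on UNIV"
      using rapid_summable[OF y p, of 0] by (intro summable_on_cmult_right) simp
    then show "(\<lambda>n. norm (C * p (y n))) summable_on UNIV"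
      using C(1) p_nonneg[OF sn_seminorm[OF p] rapid_in[OF y]] by simp
    show "norm (u (y n)) \<le> norm (C * p (y n))" for n
      using C(2)[OF rapid_in[OF y, of n]] by (simp add: abs_if)
  qed
qed

text \<open>Defined through unordered sums of scalars: no enumeration of the indices is chosen, and
  identities between sums reduce to scalar ones by \<open>wsum_eqI\<close>.\<close>

definition wsum :: "(nat^'d::finite \<Rightarrow> 'v) \<Rightarrow> 'v" where
  "wsum y = (THE s. s \<in> car X \<and> (\<forall>u\<in>dual X. ((\<lambda>n. u (y n)) has_sum u s) UNIV))"

lemma wsum_eqI:
  assumes "s \<in> car X" "\<And>u. u \<in> dual X \<Longrightarrow> ((\<lambda>n. u (y n)) has_sum u s) UNIV"
  shows "wsum y = s"
  unfolding wsum_def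
proof (rule the_equality)
  fix t assume t: "t \<in> car X \<and> (\<forall>u\<in>dual X. ((\<lambda>n. u (y n)) has_sum u t) UNIV)"
  show "t = s" by (rule dual_separates) (use t assms has_sum_unique in blast)+
qed (use assms in blast)

end

context fc_space
begin

text \<open>Terms are grouped into the shells \<open>2 ^ N < wt n \<le> 2 ^ (N + 1)\<close>. There
  \<open>p (y n)\<close> is at most \<open>wt n * p (y n) * 2 ^ -N\<close>, and the sum of
  \<open>wt n * p (y n)\<close> is finite, so the partial sums have geometric increments.\<close>

lemma wsum_exists:
  fixes y :: "nat^'d::finite \<Rightarrow> 'v"
  assumes y: "y \<in> car (rapid X)"
  shows "\<exists>s\<in>car X. \<forall>u\<in>dual X. ((\<lambda>n. u (y n)) has_sum u s) UNIV"
proof -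
  define A where "A N = {n :: nat^'d. wt n \<le> 2 ^ N}" for N :: nat
  have finA: "finite (A N)" for N by (simp add: A_def finite_wt_le)
  define \<sigma> where "\<sigma> N = (\<Sum>n\<in>A N. y n)" for N
  have y_in: "y n \<in> car X" for n by (rule rapid_in[OF y])
  have inc: "\<exists>C. \<forall>N. p (\<sigma> (Suc N) - \<sigma> N) \<le> C * (1 / 2) ^ N" if p: "p \<in> sn X" for p
  proof (intro exI allI)
    fix N
    have nn: "0 \<le> p (y n)" for n using p_nonneg[OF sn_seminorm[OF p] y_in] .
    have sub: "A N \<subseteq> A (Suc N)" unfolding A_def
      by (intro Collect_mono impI, erule order.trans) simp
    have "\<sigma> (Suc N) - \<sigma> N = (\<Sum>n\<in>A (Suc N) - A N. y n)"
      unfolding \<sigma>_def by (simp add: sum_diff[OF finA sub])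
    then have "p (\<sigma> (Suc N) - \<sigma> N) \<le> (\<Sum>n\<in>A (Suc N) - A N. p (y n))"
      using p_sum[OF sn_seminorm[OF p], of "A (Suc N) - A N" y] y_in by simp
    also have "\<dots> \<le> (\<Sum>n\<in>A (Suc N) - A N. wt n * p (y n) * (1 / 2) ^ N)"
    proof (rule sum_mono)
      fix n assume "n \<in> A (Suc N) - A N"
      then have "2 ^ N * p (y n) \<le> wt n * p (y n)"
        using nn by (intro mult_right_mono) (auto simp: A_def)
      then show "p (y n) \<le> wt n * p (y n) * (1 / 2) ^ N" by (simp add: field_simps power_one_over)
    qed
    also have "\<dots> = (\<Sum>n\<in>A (Suc N) - A N. wt n ^ 1 * p (y n)) * (1 / 2) ^ N"
      by (simp add: sum_distrib_right)
    also have "\<dots> \<le> (\<Sum>\<^sub>\<infinity>n. wt n ^ 1 * p (y n)) * (1 / 2) ^ N"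
      using nn finA by (intro mult_right_mono finite_sum_le_infsum rapid_summable[OF y p]) auto
    finally show "p (\<sigma> (Suc N) - \<sigma> N) \<le> (\<Sum>\<^sub>\<infinity>n. wt n ^ 1 * p (y n)) * (1 / 2) ^ N" .
  qed
  have \<sigma>_in: "range \<sigma> \<subseteq> car X" by (auto simp: \<sigma>_def y_in)
  have "\<forall>p\<in>sn X. \<exists>C. \<forall>N. p (\<sigma> (Suc N) - \<sigma> N) \<le> C * (1 / 2) ^ N" using inc by blast
  then have "\<exists>s\<in>car X. \<forall>p\<in>sn X. (\<lambda>N. p (\<sigma> N - s)) \<longlonglongrightarrow> 0"
    using fast_complete[unfolded fast_complete_def, THEN spec, THEN mp, OF \<sigma>_in] by (rule rev_mp)
  then obtain s where s: "s \<in> car X" "\<And>p. p \<in> sn X \<Longrightarrow> (\<lambda>N. p (\<sigma> N - s)) \<longlonglongrightarrow> 0"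
    by blast
  have "((\<lambda>n. u (y n)) has_sum u s) UNIV" if u: "u \<in> dual X" for u
  proof -
    obtain p C where p: "p \<in> sn X" and C: "0 \<le> C" "\<And>x. x \<in> car X \<Longrightarrow> norm (u x) \<le> C * p x"
      using dual_bound[OF u] by blast
    have "(\<lambda>N. u (\<sigma> N) - u s) \<longlonglongrightarrow> 0"
    proof (rule Lim_null_comparison)
      show "\<forall>\<^sub>F N in sequentially. norm (u (\<sigma> N) - u s) \<le> C * p (\<sigma> N - s)"
      proof (rule always_eventually, rule allI)
        fix N
        have "\<sigma> N \<in> car X" using \<sigma>_in by auto
        then show "norm (u (\<sigma> N) - u s) \<le> C * p (\<sigma> N - s)"
          using C(2)[of "\<sigma> N - s"] s(1) dualD(5)[OF u, of "\<sigma> N" s] by simp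
      qed
      show "(\<lambda>N. C * p (\<sigma> N - s)) \<longlonglongrightarrow> 0"
        using tendsto_mult_right_zero[OF s(2)[OF p]] .
    qed
    then have lim: "(\<lambda>N. u (\<sigma> N)) \<longlonglongrightarrow> u s" by (rule LIM_zero_cancel)
    \<comment> \<open>Absolute convergence provides the unordered sum \<open>t\<close>; the
      particular partial sums over \<open>A N\<close> identify it as \<open>u s\<close>.\<close>
    obtain t where t: "((\<lambda>n. u (y n)) has_sum t) UNIV"
      using Infinite_Sum.abs_summable_summable[OF dual_abs_summable[OF y u]] by (auto simp: summable_on_def)
    have "(\<lambda>N. \<Sum>n\<in>A N. u (y n)) \<longlonglongrightarrow> t"
      unfolding A_def by (rule filterlim_compose[OF t[unfolded has_sum_def] filterlim_wt_le])
    then have "(\<lambda>N. u (\<sigma> N)) \<longlonglongrightarrow> t" by (simp add: \<sigma>_def dualD(6)[OF u] y_in)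
    then have "t = u s" using lim LIMSEQ_unique by blast
    then show ?thesis using t by simp
  qed
  then show ?thesis using s(1) by blast
qed

context
  fixes y :: "nat^'d::finite \<Rightarrow> 'v"
  assumes y: "y \<in> car (rapid X)"
begin

lemma wsum_in: "wsum y \<in> car X"
  and wsum_dual: "u \<in> dual X \<Longrightarrow> ((\<lambda>n. u (y n)) has_sum u (wsum y)) UNIV"
proof -
  obtain s where s: "s \<in> car X" "\<And>u. u \<in> dual X \<Longrightarrow> ((\<lambda>n. u (y n)) has_sum u s) UNIV"
    using wsum_exists[OF y] by blast
  then have "wsum y = s" by (rule wsum_eqI)
  then show "wsum y \<in> car X" "u \<in> dual X \<Longrightarrow> ((\<lambda>n. u (y n)) has_sum u (wsum y)) UNIV"
    using s by auto
qed

lemma wsum_seminorm_le: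
  assumes p: "p \<in> sn X"
  shows "p (wsum y) \<le> (\<Sum>\<^sub>\<infinity>n. p (y n))"
proof (rule seminorm_le_by_dual[OF p wsum_in])
  fix u assume u: "u \<in> dual X" and le: "\<And>z. z \<in> car X \<Longrightarrow> norm (u z) \<le> p z"
  have "norm (u (wsum y)) = norm (\<Sum>\<^sub>\<infinity>n. u (y n))" using infsumI[OF wsum_dual[OF u]] by simp
  also have "\<dots> \<le> (\<Sum>\<^sub>\<infinity>n. norm (u (y n)))" by (rule Infinite_Sum.norm_infsum_bound[OF dual_abs_summable[OF y u]])
  also have "\<dots> \<le> (\<Sum>\<^sub>\<infinity>n. p (y n))"
    using rapid_summable[OF y p, of 0] le rapid_in[OF y]
    by (intro infsum_mono dual_abs_summable[OF y u]) auto
  finally show "norm (u (wsum y)) \<le> (\<Sum>\<^sub>\<infinity>n. p (y n))" .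
qed

lemma wsum_scl: "wsum (\<lambda>n. scl X a (y n)) = scl X a (wsum y)"
proof (rule wsum_eqI)
  show "((\<lambda>n. u (scl X a (y n))) has_sum u (scl X a (wsum y))) UNIV" if "u \<in> dual X" for u
    using has_sum_cmult_right[OF wsum_dual[OF that], of a] that
    by (simp add: dualD(2) wsum_in rapid_in[OF y])
qed (simp add: wsum_in)

lemma wsum_add:
  assumes z: "z \<in> car (rapid X)"
  shows "wsum (\<lambda>n. y n + z n) = wsum y + wsum z"
proof (rule wsum_eqI)
  obtain t where t: "t \<in> car X" "\<And>u. u \<in> dual X \<Longrightarrow> ((\<lambda>n. u (z n)) has_sum u t) UNIV"
    using wsum_exists[OF z] by blast
  then have tz: "wsum z = t" by (rule wsum_eqI)
  then show "wsum y + wsum z \<in> car X" using t wsum_in by simp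
  show "((\<lambda>n. u (y n + z n)) has_sum u (wsum y + wsum z)) UNIV" if "u \<in> dual X" for u
    using has_sum_add[OF wsum_dual[OF that] t(2)[OF that]] t(1) that
    by (simp add: dualD(1) wsum_in rapid_in[OF y] rapid_in[OF z] tz)
qed

end

lemma wsum_finite:
  assumes "finite A" "\<And>n. n \<in> A \<Longrightarrow> y n \<in> car X" "\<And>n. n \<notin> A \<Longrightarrow> y n = 0"
  shows "wsum y = sum y A"
proof (rule wsum_eqI)
  fix u assume u: "u \<in> dual X"
  have "((\<lambda>n. u (y n)) has_sum (\<Sum>n\<in>A. u (y n))) A" using assms(1) by simp
  then have "((\<lambda>n. u (y n)) has_sum (\<Sum>n\<in>A. u (y n))) UNIV"
    by (subst has_sum_cong_neutral[of A UNIV]) (use assms(3) dualD(4)[OF u] in auto)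
  then show "((\<lambda>n. u (y n)) has_sum u (sum y A)) UNIV"
    using dualD(6)[OF u, of A y] assms(2) by simp
qed (use assms in auto)

end

section \<open>Hermite functions of one variable\<close>

text \<open>The physicists' Hermite polynomials.\<close>

fun Hpoly :: "nat \<Rightarrow> real poly" where
  "Hpoly 0 = 1"
| "Hpoly (Suc n) = [:0, 2:] * Hpoly n - pderiv (Hpoly n)"

lemma poly_gauss_deriv:
  "((\<lambda>x. poly p x * exp (- x\<^sup>2 / 2)) has_real_derivative
     (poly (pderiv p) x - x * poly p x) * exp (- x\<^sup>2 / 2)) (at x)"
  by (auto intro!: derivative_eq_intros simp: algebra_simps poly_DERIV)

lemma hermite_iterate:
  "((\<lambda>g t. t * g t - deriv g t) ^^ n) (\<lambda>t. exp (- t\<^sup>2 / 2)) = (\<lambda>x. poly (Hpoly n) x * exp (- x\<^sup>2 / 2))"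
proof (induction n)
  case (Suc n)
  show ?case
    unfolding funpow.simps o_def Suc DERIV_imp_deriv[OF poly_gauss_deriv]
    by (simp add: fun_eq_iff algebra_simps)
qed simp

lemma pderiv_Hpoly: "pderiv (Hpoly (Suc n)) = smult (2 * real (Suc n)) (Hpoly n)"
proof (induction n)
  case (Suc n)
  have "pderiv (Hpoly (Suc (Suc n))) =
    smult 2 (Hpoly (Suc n)) + [:0, 2:] * pderiv (Hpoly (Suc n)) - pderiv (pderiv (Hpoly (Suc n)))"
    by (subst Hpoly.simps(2)) (simp add: pderiv_diff pderiv_mult pderiv_pCons pderiv_smult algebra_simps del: Hpoly.simps)
  also have "\<dots> = smult 2 (Hpoly (Suc n)) + smult (2 * real (Suc n)) ([:0, 2:] * Hpoly n - pderiv (Hpoly n))"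
    by (simp only: Suc pderiv_smult smult_diff_right mult_smult_right add_diff_eq)
  also have "\<dots> = smult 2 (Hpoly (Suc n)) + smult (2 * real (Suc n)) (Hpoly (Suc n))"
    by (simp only: Hpoly.simps)
  also have "\<dots> = smult (2 * real (Suc (Suc n))) (Hpoly (Suc n))"
    by (simp only: smult_add_left[symmetric]) (simp add: algebra_simps)
  finally show ?case .
qed (simp add: pderiv_diff pderiv_mult pderiv_pCons)

text \<open>The matrix entries of multiplication by \<open>x\<close> and of \<open>d/dx\<close> in
  the basis of Hermite functions. Since \<open>ladder 0 = 0\<close>, the truncated index
  \<open>n - 1\<close> at \<open>n = 0\<close> always appears with factor 0.\<close>

definition ladder :: "nat \<Rightarrow> real" where
  "ladder n = sqrt (real n / 2)"

lemma ladder_0 [simp]: "ladder 0 = 0" and ladder_nonneg [simp]: "0 \<le> ladder n"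
  and ladder_sq: "ladder n * ladder n = real n / 2" and ladder_Suc_pos [simp]: "0 < ladder (Suc n)" and ladder_Suc_neq_0 [simp]: "ladder (Suc n) \<noteq> 0"
  by (simp_all add: ladder_def)

lemma ladder_le: "ladder n \<le> 1 + real n" and ladder_Suc_le: "ladder (Suc n) \<le> 1 + real n"
proof -
  have "sqrt x \<le> y" if "x \<le> y\<^sup>2" "0 \<le> y" for x y :: real
    using that real_sqrt_le_mono[of x "y\<^sup>2"] by simp
  then show "ladder n \<le> 1 + real n" "ladder (Suc n) \<le> 1 + real n"
    unfolding ladder_def by (auto simp: power2_eq_square algebra_simps)
qed

lemma hermite1_eq:
  "hermite1 n x = poly (Hpoly n) x * exp (- x\<^sup>2 / 2) / sqrt (2 ^ n * fact n * sqrt pi)"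
  unfolding hermite1_def hermite_iterate ..

lemma hermite_norm_Suc:
  "sqrt (2 ^ Suc n * fact (Suc n) * sqrt pi) = 2 * ladder (Suc n) * sqrt (2 ^ n * fact n * sqrt pi)"
proof -
  have "2 * ladder (Suc n) = sqrt (2 * real (Suc n))"
  proof -
    have "2 * ladder (Suc n) = sqrt 4 * sqrt (real (Suc n) / 2)" by (simp add: ladder_def)
    also have "\<dots> = sqrt (4 * (real (Suc n) / 2))" by (rule real_sqrt_mult[symmetric])
    finally show ?thesis by simp
  qed
  then show ?thesis by (simp only: real_sqrt_mult[symmetric]) (simp add: algebra_simps)
qed

lemma hermite1_Suc:
  "2 * ladder (Suc n) * hermite1 (Suc n) x =
     poly (Hpoly (Suc n)) x * exp (- x\<^sup>2 / 2) / sqrt (2 ^ n * fact n * sqrt pi)"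
  unfolding hermite1_eq[of "Suc n"] hermite_norm_Suc using ladder_Suc_pos[of n]
  by (simp del: Hpoly.simps)

lemma hermite1_pred:
  "2 * ladder n * hermite1 (n - 1) x =
     poly (pderiv (Hpoly n)) x * exp (- x\<^sup>2 / 2) / sqrt (2 ^ n * fact n * sqrt pi)"
proof (cases n)
  case (Suc m)
  have "2 * real (Suc m) = 2 * ladder (Suc m) * (2 * ladder (Suc m))"
    using ladder_sq[of "Suc m"] by simp
  then show ?thesis
    unfolding Suc pderiv_Hpoly hermite_norm_Suc using ladder_Suc_pos[of m]
    by (simp add: hermite1_eq del: Hpoly.simps of_nat_Suc)
qed simp

lemma hermite1_mult_x: "x * hermite1 n x = ladder n * hermite1 (n - 1) x + ladder (Suc n) * hermite1 (Suc n) x"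
proof -
  have "2 * ladder n * hermite1 (n - 1) x + 2 * ladder (Suc n) * hermite1 (Suc n) x = 2 * (x * hermite1 n x)"
    unfolding hermite1_Suc hermite1_pred hermite1_eq[of n]
    by (simp add: field_simps flip: add_divide_distrib)
  then show ?thesis by simp
qed

lemma hermite1_deriv:
  "(hermite1 n has_real_derivative (ladder n * hermite1 (n - 1) x - ladder (Suc n) * hermite1 (Suc n) x)) (at x)"
proof -
  let ?c = "sqrt (2 ^ n * fact n * sqrt pi)"
  have "((\<lambda>x. poly (Hpoly n) x * exp (- x\<^sup>2 / 2) / ?c) has_real_derivative
      (poly (pderiv (Hpoly n)) x - x * poly (Hpoly n) x) * exp (- x\<^sup>2 / 2) / ?c) (at x)"
    by (intro DERIV_cdivide poly_gauss_deriv)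
  moreover have "(poly (pderiv (Hpoly n)) x - x * poly (Hpoly n) x) * exp (- x\<^sup>2 / 2) / ?c =
      2 * ladder n * hermite1 (n - 1) x - x * hermite1 n x"
    unfolding hermite1_pred hermite1_eq[of n] by (simp add: algebra_simps diff_divide_distrib)
  moreover have "\<dots> = ladder n * hermite1 (n - 1) x - ladder (Suc n) * hermite1 (Suc n) x"
    unfolding hermite1_mult_x by simp
  moreover have "(\<lambda>x. poly (Hpoly n) x * exp (- x\<^sup>2 / 2) / ?c) = hermite1 n"
    by (rule ext) (rule hermite1_eq[symmetric])
  ultimately show ?thesis by (simp only:)
qed

text \<open>Derivatives are given by their expansion in neighbouring Hermite functions and not as
  limits, so that bounds on them follow from bounds on the functions by induction on the
  order.\<close>

primrec hermite1_d :: "nat \<Rightarrow> nat \<Rightarrow> real \<Rightarrow> real" where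
  "hermite1_d 0 n = hermite1 n"
| "hermite1_d (Suc b) n = (\<lambda>x. ladder n * hermite1_d b (n - 1) x - ladder (Suc n) * hermite1_d b (Suc n) x)"

lemma hermite1_d_deriv: "(hermite1_d b n has_real_derivative hermite1_d (Suc b) n x) (at x)"
proof (induction b arbitrary: n)
  case 0
  show ?case using hermite1_deriv[of n x] by simp
next
  case (Suc b)
  show ?case unfolding hermite1_d.simps(2)[of "Suc b"] hermite1_d.simps(2)[of b n]
    by (intro DERIV_diff DERIV_cmult Suc)
qed

lemma continuous_hermite1_d [continuous_intros]:
  "continuous_on A g \<Longrightarrow> continuous_on A (\<lambda>x. hermite1_d b n (g x))"
  by (rule continuous_on_compose2[of UNIV "hermite1_d b n"])
     (auto intro!: DERIV_isCont[OF hermite1_d_deriv] continuous_at_imp_continuous_on)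

text \<open>The equation of the harmonic oscillator. Applying the recursions for \<open>x\<close>
  and for the derivative twice, the terms at distance two from \<open>n\<close> agree, and the
  remaining ones are evaluated by \<open>ladder_sq\<close>.\<close>

lemma hermite1_ode: "hermite1_d 2 n x = (x\<^sup>2 - (2 * real n + 1)) * hermite1 n x"
proof -
  have d2: "hermite1_d 2 n x =
    ladder n * (ladder (n - 1) * hermite1 (n - 2) x - ladder (Suc (n - 1)) * hermite1 (Suc (n - 1)) x) -
    ladder (Suc n) * (ladder (Suc n) * hermite1 n x - ladder (Suc (Suc n)) * hermite1 (Suc (Suc n)) x)"
    by (simp add: numeral_2_eq_2)
  have "x\<^sup>2 * hermite1 n x = x * (x * hermite1 n x)" by (simp add: power2_eq_square)
  also have "\<dots> = ladder n * (x * hermite1 (n - 1) x) + ladder (Suc n) * (x * hermite1 (Suc n) x)"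
    unfolding hermite1_mult_x[of x n] by (simp add: algebra_simps)
  also have "\<dots> = ladder n * (ladder (n - 1) * hermite1 (n - 2) x + ladder (Suc (n - 1)) * hermite1 (Suc (n - 1)) x) +
    ladder (Suc n) * (ladder (Suc n) * hermite1 n x + ladder (Suc (Suc n)) * hermite1 (Suc (Suc n)) x)"
    unfolding hermite1_mult_x[of x "n - 1"] hermite1_mult_x[of x "Suc n"] by (simp add: numeral_2_eq_2)
  finally have x2: "x\<^sup>2 * hermite1 n x = \<dots>" .
  \<comment> \<open>At \<open>n = 0\<close> the index \<open>Suc (n - 1)\<close> is 1 and not
    \<open>n\<close>; both sides vanish there because \<open>ladder 0 = 0\<close>.\<close>
  have "ladder n * (ladder (Suc (n - 1)) * hermite1 (Suc (n - 1)) x) = real n / 2 * hermite1 n x"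
  proof (cases n)
    case (Suc m)
    then show ?thesis using ladder_sq[of n] by (simp add: mult.assoc[symmetric])
  qed simp
  moreover have "ladder (Suc n) * (ladder (Suc n) * hermite1 n x) = real (Suc n) / 2 * hermite1 n x"
    using ladder_sq[of "Suc n"] by (simp add: mult.assoc[symmetric])
  ultimately have "hermite1_d 2 n x - x\<^sup>2 * hermite1 n x = - 2 * (real n / 2 * hermite1 n x) - 2 * (real (Suc n) / 2 * hermite1 n x)"
    unfolding d2 x2 right_diff_distrib distrib_left by linarith
  also have "\<dots> = - (2 * real n + 1) * hermite1 n x" by (simp add: field_simps)
  finally show ?thesis by (simp add: algebra_simps)
qed

text \<open>At 0 the three-term recursion connects \<open>n\<close> directly with
  \<open>n + 2\<close>, with a factor of modulus \<open>ladder (n + 1) / ladder (n + 2)\<close>,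
  which is at most 1.\<close>

lemma hermite1_at_0: "\<bar>hermite1 n 0\<bar> \<le> 1"
proof (induction n rule: induct_nat_012)
  case 0
  have "1 \<le> sqrt (sqrt pi)" using pi_gt3 by simp
  then show ?case by (simp add: hermite1_eq)
next
  case 1
  show ?case by (simp add: hermite1_eq)
next
  case (ge2 n)
  have "ladder (Suc n) * hermite1 n 0 = - (ladder (Suc (Suc n)) * hermite1 (Suc (Suc n)) 0)"
    using hermite1_mult_x[of 0 "Suc n"] by simp
  then have "ladder (Suc (Suc n)) * \<bar>hermite1 (Suc (Suc n)) 0\<bar> = ladder (Suc n) * \<bar>hermite1 n 0\<bar>"
    by (metis abs_minus_cancel abs_mult abs_of_nonneg ladder_nonneg)
  also have "\<dots> \<le> ladder (Suc (Suc n)) * 1"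
    using ge2 by (intro mult_mono) (auto simp: ladder_def)
  finally show ?case by (simp only: mult_le_cancel_left_pos[OF ladder_Suc_pos])
qed

text \<open>By the differential equation the left-hand side has derivative \<open>- 2 x h\<^sub>n(x)\<^sup>2\<close>, so it is largest at \<open>0\<close>.\<close>

lemma hermite1_Sonin:
  "(hermite1_d 1 n x)\<^sup>2 + (2 * real n + 1 - x\<^sup>2) * (hermite1 n x)\<^sup>2 \<le> 4 * real n + 1"
proof -
  define Q where "Q x = (hermite1_d 1 n x)\<^sup>2 + (2 * real n + 1 - x\<^sup>2) * (hermite1 n x)\<^sup>2" for x
  have DQ: "(Q has_real_derivative - 2 * x * (hermite1 n x)\<^sup>2) (at x)" for x
  proof -
    have "(hermite1_d 1 n has_real_derivative hermite1_d 2 n x) (at x)"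
      using hermite1_d_deriv[of 1 n x] by (simp add: numeral_2_eq_2)
    moreover have "(hermite1 n has_real_derivative hermite1_d 1 n x) (at x)"
      using hermite1_d_deriv[of 0 n x] by simp
    ultimately have "(Q has_real_derivative
      2 * hermite1_d 1 n x * hermite1_d 2 n x + ((- 2 * x) * (hermite1 n x)\<^sup>2 +
        (2 * real n + 1 - x\<^sup>2) * (2 * hermite1 n x * hermite1_d 1 n x))) (at x)"
      unfolding Q_def by (auto intro!: derivative_eq_intros simp del: hermite1_d.simps)
    then show ?thesis unfolding hermite1_ode by (simp add: algebra_simps del: hermite1_d.simps)
  qed
  have "Q x \<le> Q 0"
  proof (cases "0 \<le> x")
    case True
    show ?thesis
      by (rule DERIV_nonpos_imp_nonincreasing[OF True]) (use DQ in \<open>fastforce simp: mult_nonneg_nonneg\<close>)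
  next
    case False
    show ?thesis
      by (rule DERIV_nonneg_imp_nondecreasing[of x 0]) (use DQ False in \<open>fastforce simp: mult_nonpos_nonneg\<close>)+
  qed
  also have "Q 0 \<le> 4 * real n + 1"
  proof -
    have sq: "(hermite1 k 0)\<^sup>2 \<le> 1" for k using hermite1_at_0[of k] by (simp add: abs_square_le_1)
    \<comment> \<open>At 0 the recursion for \<open>x * hermite1 n x\<close> says that the two
      ladder terms are opposite, so the derivative is twice the lower one.\<close>
    have "hermite1_d 1 n 0 = 2 * (ladder n * hermite1 (n - 1) 0)"
      using hermite1_mult_x[of 0 n] by simp
    then have "(hermite1_d 1 n 0)\<^sup>2 = (2 * (ladder n * hermite1 (n - 1) 0))\<^sup>2" by (simp only:)
    also have "\<dots> = 4 * (ladder n * ladder n) * (hermite1 (n - 1) 0)\<^sup>2"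
      by (simp add: power2_eq_square)
    also have "\<dots> = 2 * real n * (hermite1 (n - 1) 0)\<^sup>2" by (simp add: ladder_sq)
    also have "\<dots> \<le> 2 * real n * 1" by (intro mult_left_mono sq) auto
    finally have d1: "(hermite1_d 1 n 0)\<^sup>2 \<le> 2 * real n * 1" .
    have "Q 0 = (hermite1_d 1 n 0)\<^sup>2 + (2 * real n + 1) * (hermite1 n 0)\<^sup>2"
      by (simp add: Q_def del: hermite1_d.simps)
    also have "\<dots> \<le> 2 * real n * 1 + (2 * real n + 1) * 1"
      by (intro add_mono d1 mult_left_mono sq) auto
    also have "\<dots> = 4 * real n + 1" by simp
    finally show ?thesis .
  qed
  finally show ?thesis by (simp add: Q_def)
qed

text \<open>Horner's scheme: a factor \<open>x\<close> is absorbed by half of the exponent, so the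
  claim for \<open>\<delta>\<close> calls the induction hypothesis at
  \<open>\<delta> / 2\<close>.\<close>

lemma poly_le_exp_square:
  fixes p :: "real poly"
  assumes "0 < \<delta>"
  shows "\<exists>C\<ge>0. \<forall>x. \<bar>poly p x\<bar> \<le> C * exp (\<delta> * x\<^sup>2)"
  using assms
proof (induction p arbitrary: \<delta>)
  case 0
  show ?case by (intro exI[of _ 0]) simp
next
  case (pCons a p)
  obtain C where C: "C \<ge> 0" "\<And>x. \<bar>poly p x\<bar> \<le> C * exp (\<delta> / 2 * x\<^sup>2)"
    using pCons.IH[of "\<delta> / 2"] pCons.prems by auto
  define D where "D = \<bar>a\<bar> + (1 + 2 / \<delta>) * C"
  have "\<bar>poly (pCons a p) x\<bar> \<le> D * exp (\<delta> * x\<^sup>2)" for x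
  proof -
    have "\<bar>x\<bar> \<le> 1 + x\<^sup>2" using zero_le_power2[of "\<bar>x\<bar> - 1"] by (simp add: power2_eq_square algebra_simps)
    also have "\<dots> \<le> (1 + 2 / \<delta>) * (1 + \<delta> / 2 * x\<^sup>2)"
      using pCons.prems by (simp add: field_simps add_pos_pos)
    also have "\<dots> \<le> (1 + 2 / \<delta>) * exp (\<delta> / 2 * x\<^sup>2)"
      using pCons.prems by (intro mult_left_mono exp_ge_add_one_self) auto
    finally have x: "\<bar>x\<bar> \<le> (1 + 2 / \<delta>) * exp (\<delta> / 2 * x\<^sup>2)" .
    have "\<bar>poly (pCons a p) x\<bar> \<le> \<bar>a\<bar> + \<bar>x\<bar> * \<bar>poly p x\<bar>"
      using abs_triangle_ineq[of a "x * poly p x"] by (simp add: abs_mult)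
    also have "\<dots> \<le> \<bar>a\<bar> * exp (\<delta> * x\<^sup>2) + ((1 + 2 / \<delta>) * exp (\<delta> / 2 * x\<^sup>2)) * (C * exp (\<delta> / 2 * x\<^sup>2))"
      using C x pCons.prems by (intro add_mono mult_mono) (auto simp: mult_le_cancel_left1)
    also have "\<dots> = D * exp (\<delta> * x\<^sup>2)"
    proof -
      have "exp (\<delta> / 2 * x\<^sup>2) * exp (\<delta> / 2 * x\<^sup>2) = exp (\<delta> * x\<^sup>2)" by (simp flip: exp_add)
      then show ?thesis by (simp add: D_def algebra_simps)
    qed
    finally show ?thesis .
  qed
  moreover have "0 \<le> D" using C pCons.prems by (simp add: D_def)
  ultimately show ?case by blast
qed

lemma hermite1_gauss_bound: "\<exists>C\<ge>0. \<forall>x. \<bar>hermite1 n x\<bar> \<le> C * exp (- (3 / 8) * x\<^sup>2)"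
proof -
  \<comment> \<open>Spending 1/8 of the Gaussian exponent 1/2 on the polynomial leaves 3/8, which
    still exceeds the 1/4 lost in \<open>hermite_null_gauss\<close>.\<close>
  obtain C where C: "C \<ge> 0" "\<And>x. \<bar>poly (Hpoly n) x\<bar> \<le> C * exp (1 / 8 * x\<^sup>2)"
    using poly_le_exp_square[of "1 / 8" "Hpoly n"] by auto
  define c where "c = sqrt (2 ^ n * fact n * sqrt pi)"
  have c: "0 < c" by (simp add: c_def)
  have "\<bar>hermite1 n x\<bar> \<le> C / c * exp (- (3 / 8) * x\<^sup>2)" for x
  proof -
    have "\<bar>hermite1 n x\<bar> = \<bar>poly (Hpoly n) x\<bar> * exp (- x\<^sup>2 / 2) / c"
      unfolding hermite1_eq c_def[symmetric] using c by (simp add: abs_mult)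
    also have "\<dots> \<le> C * exp (1 / 8 * x\<^sup>2) * exp (- x\<^sup>2 / 2) / c"
      using C c by (intro divide_right_mono mult_right_mono) auto
    also have "\<dots> = C / c * exp (- (3 / 8) * x\<^sup>2)"
      by (simp add: mult.assoc flip: exp_add)
    finally show ?thesis .
  qed
  then show ?thesis using C c by (intro exI[of _ "C / c"]) auto
qed

text \<open>Gaussian decay provides a point \<open>m\<close> where the square is maximal, and the
  derivative vanishes at \<open>m\<close>. If \<open>m^2 \<le> 2 n\<close>, Sonin's inequality
  bounds the maximum. Otherwise the recursion gives \<open>m^2 h_n(m)^2 = 2 n h_{n-1}(m)^2\<close>,
  and the induction hypothesis for \<open>n - 1\<close> contradicts a large maximum.\<close>

lemma hermite1_sq_le: "(hermite1 n x)\<^sup>2 \<le> 4 * real n + 1"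
proof (induction n arbitrary: x rule: less_induct)
  case (less n)
  show ?case
  proof (rule ccontr)
    let ?f = "\<lambda>x. (hermite1 n x)\<^sup>2"
    assume neg: "\<not> ?f x \<le> 4 * real n + 1"
    define F where "F = ?f x"
    have F: "4 * real n + 1 < F" "0 < F" using neg by (auto simp: F_def)
    obtain C where C: "0 \<le> C" "\<And>x. \<bar>hermite1 n x\<bar> \<le> C * exp (- (3 / 8) * x\<^sup>2)"
      using hermite1_gauss_bound[of n] by blast
    \<comment> \<open>The choice gives \<open>C^2 < F * (1 + 3/4 * R)\<close>, and
      \<open>R \<le> t^2\<close> when \<open>|t| > R\<close>. So the Gaussian bound, weakened by
      \<open>exp s \<ge> 1 + s\<close>, stays below \<open>F\<close> outside the interval, and a
      maximum on the interval is a global one.\<close>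
    define R where "R = 1 + 2 * C\<^sup>2 / F"
    have R: "1 \<le> R" using F by (simp add: R_def)
    have small: "?f t < F" if t: "R < \<bar>t\<bar>" for t
    proof -
      have "R \<le> t\<^sup>2"
        using t R mult_mono[of R "\<bar>t\<bar>" 1 "\<bar>t\<bar>"] by (simp add: power2_eq_square)
      have "?f t \<le> (C * exp (- (3 / 8) * t\<^sup>2))\<^sup>2"
        using C(2)[of t] by (rule power2_le_iff_abs_le[THEN iffD2, rotated]) (use C in simp)
      also have "\<dots> = C\<^sup>2 * exp (- (3 / 4 * t\<^sup>2))"
        by (simp add: power_mult_distrib flip: exp_of_nat_mult)
      also have "\<dots> \<le> C\<^sup>2 * (1 / (1 + 3 / 4 * t\<^sup>2))"
      proof (rule mult_left_mono)
        have "1 + 3 / 4 * t\<^sup>2 \<le> exp (3 / 4 * t\<^sup>2)" by (rule exp_ge_add_one_self)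
        moreover have "0 < 1 + 3 / 4 * t\<^sup>2" by (simp add: add_pos_nonneg)
        ultimately show "exp (- (3 / 4 * t\<^sup>2)) \<le> 1 / (1 + 3 / 4 * t\<^sup>2)"
          by (simp add: exp_minus inverse_eq_divide frac_le)
      qed simp
      also have "\<dots> < F"
      proof -
        have "F * R = F + 2 * C\<^sup>2" using F by (simp add: R_def algebra_simps)
        then have "F * (1 + 3 / 4 * R) = 7 / 4 * F + 3 / 2 * C\<^sup>2" by (simp add: algebra_simps)
        then have "C\<^sup>2 < F * (1 + 3 / 4 * R)" using F zero_le_power2[of C] by linarith
        also have "\<dots> \<le> F * (1 + 3 / 4 * t\<^sup>2)" using F \<open>R \<le> t\<^sup>2\<close> by simp
        finally have "C\<^sup>2 < F * (1 + 3 / 4 * t\<^sup>2)" .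
        moreover have "0 < 1 + 3 / 4 * t\<^sup>2" by (simp add: add_pos_nonneg)
        ultimately show ?thesis by (simp add: divide_less_eq)
      qed
      finally show ?thesis .
    qed
    have xR: "x \<in> {- R..R}" using small[of x] by (force simp: F_def)
    have "continuous_on {- R..R} (\<lambda>x. hermite1_d 0 n x)" by (intro continuous_intros)
    then have cont: "continuous_on {- R..R} ?f" by (auto intro!: continuous_intros)
    obtain m where m: "m \<in> {- R..R}" "\<And>t. t \<in> {- R..R} \<Longrightarrow> ?f t \<le> ?f m"
      using continuous_attains_sup[OF _ _ cont] xR by (metis compact_Icc empty_iff)
    have mF: "F \<le> ?f m" using m(2)[OF xR] by (simp add: F_def)
    have max: "?f t \<le> ?f m" for t
    proof (cases "R < \<bar>t\<bar>")
      case True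
      then show ?thesis using small[of t] mF by linarith
    next
      case False
      then have "t \<in> {- R..R}" by (auto simp: not_less abs_le_iff)
      then show ?thesis by (rule m(2))
    qed
    have "(hermite1 n has_real_derivative hermite1_d 1 n m) (at m)"
      using hermite1_d_deriv[of 0 n m] by simp
    then have "(?f has_real_derivative 2 * hermite1 n m * hermite1_d 1 n m) (at m)"
      by (auto intro!: derivative_eq_intros simp del: hermite1_d.simps)
    then have "2 * hermite1 n m * hermite1_d 1 n m = 0"
      by (rule DERIV_local_max[of _ _ _ 1]) (use max in auto)
    then have d0: "hermite1_d 1 n m = 0" using mF F by auto
    have sonin: "(2 * real n + 1 - m\<^sup>2) * ?f m \<le> 4 * real n + 1"
      using hermite1_Sonin[of n m] d0 by simp
    show False
    proof (cases "m\<^sup>2 \<le> 2 * real n")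
      case True
      then have "1 * ?f m \<le> (2 * real n + 1 - m\<^sup>2) * ?f m" by (intro mult_right_mono) auto
      then show False using sonin mF F by linarith
    next
      case False
      \<comment> \<open>A vanishing derivative makes the two ladder terms equal, so the recursion
        can be written with the lower one alone.\<close>
      have "m * hermite1 n m = 2 * (ladder n * hermite1 (n - 1) m)"
        using hermite1_mult_x[of m n] d0 by simp
      then have "(m * hermite1 n m)\<^sup>2 = (2 * (ladder n * hermite1 (n - 1) m))\<^sup>2" by (simp only:)
      then have "m\<^sup>2 * ?f m = 4 * (ladder n * ladder n) * (hermite1 (n - 1) m)\<^sup>2"
        by (simp add: power2_eq_square algebra_simps)
      then have eq: "m\<^sup>2 * ?f m = 2 * real n * (hermite1 (n - 1) m)\<^sup>2" by (simp add: ladder_sq)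
      show False
      proof (cases n)
        case 0
        then show False using eq False mF F by auto
      next
        case (Suc k)
        have "(hermite1 (n - 1) m)\<^sup>2 \<le> 4 * real k + 1" using less[of k m] Suc by simp
        then have "(hermite1 (n - 1) m)\<^sup>2 \<le> F" using F Suc by simp
        then have "m\<^sup>2 * ?f m \<le> 2 * real n * F" unfolding eq by (intro mult_left_mono) auto
        also have "\<dots> < m\<^sup>2 * F" using False F by (intro mult_strict_right_mono) auto
        also have "\<dots> \<le> m\<^sup>2 * ?f m" using mF by (intro mult_left_mono) auto
        finally show False by simp
      qed
    qed
  qed
qed

text \<open>Multiplication by \<open>x\<close> has \<open>s = 1\<close> and differentiation has
  \<open>s = - 1\<close>; either raises the degree of a polynomial bound in \<open>n\<close> by one.
  The factor \<open>2 ^ k\<close> comes from \<open>2 + n \<le> 2 * (1 + n)\<close>.\<close>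

lemma ladder_combination_bound:
  fixes f :: "nat \<Rightarrow> real"
  assumes f: "\<And>n. \<bar>f n\<bar> \<le> C * (1 + real n) ^ k" and s: "\<bar>s\<bar> = 1"
  shows "\<bar>ladder n * f (n - 1) + s * (ladder (Suc n) * f (Suc n))\<bar> \<le> (C + C * 2 ^ k) * (1 + real n) ^ Suc k"
proof -
  have C: "0 \<le> C" using order.trans[OF abs_ge_zero f[of 0]] by simp
  have "\<bar>f (n - 1)\<bar> \<le> C * (1 + real n) ^ k"
    by (rule order.trans[OF f]) (use C in \<open>auto intro!: mult_left_mono power_mono\<close>)
  then have 1: "ladder n * \<bar>f (n - 1)\<bar> \<le> (1 + real n) * (C * (1 + real n) ^ k)"
    by (intro mult_mono ladder_le) auto
  have "\<bar>f (Suc n)\<bar> \<le> C * (2 * (1 + real n)) ^ k"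
    by (rule order.trans[OF f]) (use C in \<open>auto intro!: mult_left_mono power_mono\<close>)
  then have 2: "ladder (Suc n) * \<bar>f (Suc n)\<bar> \<le> (1 + real n) * (C * (2 * (1 + real n)) ^ k)"
    by (intro mult_mono ladder_Suc_le) auto
  have "\<bar>ladder n * f (n - 1) + s * (ladder (Suc n) * f (Suc n))\<bar> \<le>
      \<bar>ladder n * f (n - 1)\<bar> + \<bar>s * (ladder (Suc n) * f (Suc n))\<bar>" by (rule abs_triangle_ineq)
  also have "\<dots> = ladder n * \<bar>f (n - 1)\<bar> + ladder (Suc n) * \<bar>f (Suc n)\<bar>"
    using s by (simp add: abs_mult)
  also have "\<dots> \<le> (1 + real n) * (C * (1 + real n) ^ k) + (1 + real n) * (C * (2 * (1 + real n)) ^ k)"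
    using 1 2 by (rule add_mono)
  also have "\<dots> = (C + C * 2 ^ k) * (1 + real n) ^ Suc k"
    unfolding power_mult_distrib by (simp add: algebra_simps)
  finally show ?thesis .
qed

text \<open>The recursion for \<open>hermite1_d\<close> has coefficients independent of
  \<open>x\<close>, so derivatives can be removed while \<open>x ^ a\<close> is kept fixed. The
  power itself is reduced only at \<open>b = 0\<close>, by \<open>hermite1_mult_x\<close>.\<close>

lemma hermite1_power_bound: "\<exists>C k. \<forall>n x. \<bar>x ^ a * hermite1_d b n x\<bar> \<le> C * (1 + real n) ^ k"
proof (induction b)
  case 0
  show ?case
  proof (induction a)
    case 0
    have "\<bar>hermite1 n x\<bar> \<le> 4 * (1 + real n) ^ 1" for n x
    proof -
      have "(hermite1 n x)\<^sup>2 \<le> (4 * (1 + real n))\<^sup>2"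
        using hermite1_sq_le[of n x] by (rule order.trans) (simp add: power2_eq_square algebra_simps)
      then show ?thesis using abs_le_square_iff[of "hermite1 n x" "4 * (1 + real n)"] by simp
    qed
    then show ?case by (intro exI[of _ 4] exI[of _ 1]) simp
  next
    case (Suc a)
    then obtain C k where C: "\<And>n x. \<bar>x ^ a * hermite1_d 0 n x\<bar> \<le> C * (1 + real n) ^ k" by blast
    have "\<bar>x ^ Suc a * hermite1_d 0 n x\<bar> \<le> (C + C * 2 ^ k) * (1 + real n) ^ Suc k" for n x
    proof -
      have "x ^ Suc a * hermite1_d 0 n x = x ^ a * (x * hermite1 n x)" by simp
      also have "\<dots> = ladder n * (x ^ a * hermite1_d 0 (n - 1) x) +
          1 * (ladder (Suc n) * (x ^ a * hermite1_d 0 (Suc n) x))"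
        unfolding hermite1_mult_x by (simp add: algebra_simps)
      finally show ?thesis
        using ladder_combination_bound[where f = "\<lambda>n. x ^ a * hermite1_d 0 n x" and s = 1, OF C] by simp
    qed
    then show ?case by blast
  qed
next
  case (Suc b)
  then obtain C k where C: "\<And>n x. \<bar>x ^ a * hermite1_d b n x\<bar> \<le> C * (1 + real n) ^ k" by blast
  have "\<bar>x ^ a * hermite1_d (Suc b) n x\<bar> \<le> (C + C * 2 ^ k) * (1 + real n) ^ Suc k" for n x
  proof -
    have "x ^ a * hermite1_d (Suc b) n x = ladder n * (x ^ a * hermite1_d b (n - 1) x) +
        (- 1) * (ladder (Suc n) * (x ^ a * hermite1_d b (Suc n) x))"
      by (simp add: algebra_simps)
    then show ?thesis
      using ladder_combination_bound[where f = "\<lambda>n. x ^ a * hermite1_d b n x" and s = "- 1", OF C] by simp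
  qed
  then show ?case by blast
qed

lemma hermite1_weight_bound:
  "\<exists>C k. \<forall>n x. (1 + x\<^sup>2) ^ m * \<bar>hermite1_d b n x\<bar> \<le> C * (1 + real n) ^ k"
proof -
  obtain C0 k0 where 0: "\<And>n x. \<bar>x ^ 0 * hermite1_d b n x\<bar> \<le> C0 * (1 + real n) ^ k0"
    using hermite1_power_bound[of 0 b] by blast
  obtain C1 k1 where 1: "\<And>n x. \<bar>x ^ (2 * m) * hermite1_d b n x\<bar> \<le> C1 * (1 + real n) ^ k1"
    using hermite1_power_bound[of "2 * m" b] by blast
  have C: "0 \<le> C0" "0 \<le> C1"
    using order.trans[OF abs_ge_zero 0[of 0 0]] order.trans[OF abs_ge_zero 1[of 0 0]] by auto
  have "(1 + x\<^sup>2) ^ m * \<bar>hermite1_d b n x\<bar> \<le> 2 ^ m * (C0 + C1) * (1 + real n) ^ (k0 + k1)" for n x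
  proof -
    have w: "(1 + x\<^sup>2) ^ m \<le> 2 ^ m * (1 + x ^ (2 * m))"
    proof (cases "x\<^sup>2 \<le> 1")
      case True
      then have "(1 + x\<^sup>2) ^ m \<le> 2 ^ m" by (intro power_mono) auto
      also have "\<dots> \<le> 2 ^ m * (1 + x ^ (2 * m))" by (simp add: power_mult)
      finally show ?thesis .
    next
      case False
      then have "(1 + x\<^sup>2) ^ m \<le> (2 * x\<^sup>2) ^ m" by (intro power_mono) auto
      also have "\<dots> \<le> 2 ^ m * (1 + x ^ (2 * m))" by (simp add: power_mult power_mult_distrib)
      finally show ?thesis .
    qed
    have "(1 + x\<^sup>2) ^ m * \<bar>hermite1_d b n x\<bar> \<le> 2 ^ m * (1 + x ^ (2 * m)) * \<bar>hermite1_d b n x\<bar>"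
      using w by (rule mult_right_mono) simp
    also have "\<dots> = 2 ^ m * (\<bar>x ^ 0 * hermite1_d b n x\<bar> + \<bar>x ^ (2 * m) * hermite1_d b n x\<bar>)"
      by (simp add: algebra_simps abs_mult power_mult)
    also have "\<dots> \<le> 2 ^ m * (C0 * (1 + real n) ^ k0 + C1 * (1 + real n) ^ k1)"
      by (intro mult_left_mono add_mono 0 1) auto
    also have "\<dots> \<le> 2 ^ m * (C0 * (1 + real n) ^ (k0 + k1) + C1 * (1 + real n) ^ (k0 + k1))"
      using C by (intro mult_left_mono add_mono power_increasing) auto
    finally show ?thesis by (simp add: algebra_simps)
  qed
  then show ?thesis by blast
qed

section \<open>Hermite functions of several variables\<close>

definition upd :: "nat^'d::finite \<Rightarrow> 'd \<Rightarrow> nat \<Rightarrow> nat^'d" where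
  "upd n i k = (\<chi> j. if j = i then k else n $ j)"

lemma upd_nth [simp]: "upd n i k $ j = (if j = i then k else n $ j)"
  by (simp add: upd_def)

lemma upd_upd [simp]: "upd (upd n i k) i l = upd n i l" and upd_same [simp]: "upd n i (n $ i) = n"
  by (simp_all add: vec_eq_iff)

definition hermite_d :: "nat^'d::finite \<Rightarrow> nat^'d \<Rightarrow> real^'d \<Rightarrow> real" where
  "hermite_d \<beta> n x = (\<Prod>i\<in>UNIV. hermite1_d (\<beta> $ i) (n $ i) (x $ i))"

lemma hermite_d_0 [simp]: "hermite_d 0 n = hermite n"
  by (simp add: fun_eq_iff hermite_d_def hermite_def)

lemma hermite_d_split:
  "hermite_d (upd \<beta> i b) (upd n i k) x =
     hermite1_d b k (x $ i) * (\<Prod>j\<in>UNIV - {i}. hermite1_d (\<beta> $ j) (n $ j) (x $ j))"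
  unfolding hermite_d_def by (subst prod.remove[of _ i]) auto

lemma hermite_split:
  "hermite (upd n i k) x = hermite1 k (x $ i) * (\<Prod>j\<in>UNIV - {i}. hermite1 (n $ j) (x $ j))"
  unfolding hermite_def by (subst prod.remove[of _ i]) auto

lemma continuous_hermite_d [continuous_intros]: "continuous_on A (hermite_d \<beta> n)"
  unfolding hermite_d_def by (intro continuous_intros)

lemma hermite_d_Suc:
  "hermite_d (upd \<beta> i (Suc (\<beta> $ i))) n x =
     ladder (n $ i) * hermite_d \<beta> (upd n i (n $ i - 1)) x -
     ladder (Suc (n $ i)) * hermite_d \<beta> (upd n i (Suc (n $ i))) x"
  using hermite_d_split[of \<beta> i "Suc (\<beta> $ i)" n "n $ i" x]
    hermite_d_split[of \<beta> i "\<beta> $ i" n "n $ i - 1" x] hermite_d_split[of \<beta> i "\<beta> $ i" n "Suc (n $ i)" x]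
  by (simp add: algebra_simps)

lemma hermite_mult_x:
  "x $ i * hermite n x =
     ladder (n $ i) * hermite (upd n i (n $ i - 1)) x + ladder (Suc (n $ i)) * hermite (upd n i (Suc (n $ i))) x"
proof -
  have "x $ i * hermite n x = (x $ i * hermite1 (n $ i) (x $ i)) * (\<Prod>j\<in>UNIV - {i}. hermite1 (n $ j) (x $ j))"
    using hermite_split[of n i "n $ i" x] by (simp only: upd_same mult.assoc)
  then show ?thesis
    unfolding hermite1_mult_x[of "x $ i"] hermite_split by (simp add: algebra_simps)
qed

section \<open>Partial derivatives of functions with values in a normed space\<close>

definition has_pd :: "'d::finite \<Rightarrow> (real^'d \<Rightarrow> 'b::real_normed_vector) \<Rightarrow> real^'d \<Rightarrow> 'b \<Rightarrow> bool" where
  "has_pd i \<phi> x l \<longleftrightarrow> ((\<lambda>t. \<phi> (x + axis i t)) has_vector_derivative l) (at 0)"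

lemma axis_add: "axis i (s + t) = axis i s + (axis i t :: real^'d)"
  by (simp add: vec_eq_iff axis_def)

lemma axis_0 [simp]: "axis i 0 = (0 :: real^'d)"
  by (simp add: vec_eq_iff axis_def)

lemma has_pd_at:
  assumes "has_pd i \<phi> (x + axis i t) l"
  shows "((\<lambda>t. \<phi> (x + axis i t)) has_vector_derivative l) (at t)"
proof -
  have "((\<lambda>s. s - t) has_vector_derivative 1) (at t)"
    by (auto intro!: derivative_eq_intros)
  moreover have "((\<lambda>s. \<phi> (x + axis i t + axis i s)) has_vector_derivative l) (at (t - t))"
    using assms by (simp add: has_pd_def)
  ultimately have "((\<lambda>s. \<phi> (x + axis i t + axis i s)) \<circ> (\<lambda>s. s - t) has_vector_derivative 1 *\<^sub>R l) (at t)"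
    by (rule vector_diff_chain_at)
  moreover have "(\<lambda>s. \<phi> (x + axis i t + axis i s)) \<circ> (\<lambda>s. s - t) = (\<lambda>s. \<phi> (x + axis i s))"
    by (simp add: fun_eq_iff add.assoc flip: axis_add)
  ultimately show ?thesis by simp
qed

text \<open>The quotient form is the one that matches \<open>has_partial\<close>, where the limit is
  taken in \<open>lctop\<close>; the vector derivative gives access to one-variable calculus along a
  line.\<close>

lemma has_pd_iff:
  "has_pd i \<phi> x l \<longleftrightarrow> ((\<lambda>t. (1 / t) *\<^sub>R (\<phi> (x + axis i t) - \<phi> x)) \<longlongrightarrow> l) (at 0)"
proof -
  have "has_pd i \<phi> x l \<longleftrightarrow>
      ((\<lambda>h. norm (\<phi> (x + axis i h) - \<phi> x - h *\<^sub>R l) / norm h) \<longlongrightarrow> 0) (at 0)"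
    unfolding has_pd_def has_vector_derivative_def has_derivative_at
    by (simp add: bounded_linear_scaleR_left)
  also have "\<dots> \<longleftrightarrow> ((\<lambda>h. norm ((1 / h) *\<^sub>R (\<phi> (x + axis i h) - \<phi> x) - l)) \<longlongrightarrow> 0) (at 0)"
  proof (rule tendsto_cong)
    have "\<forall>\<^sub>F h in at 0. h \<noteq> (0 :: real)" by (rule eventually_neq_at_within)
    then show "\<forall>\<^sub>F h in at 0. norm (\<phi> (x + axis i h) - \<phi> x - h *\<^sub>R l) / norm h =
        norm ((1 / h) *\<^sub>R (\<phi> (x + axis i h) - \<phi> x) - l)"
    proof eventually_elim
      case (elim h)
      then have "(1 / h) *\<^sub>R (\<phi> (x + axis i h) - \<phi> x) - l =
          (1 / h) *\<^sub>R (\<phi> (x + axis i h) - \<phi> x - h *\<^sub>R l)"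
        by (simp add: scaleR_diff_right)
      then show ?case by simp
    qed
  qed
  also have "\<dots> \<longleftrightarrow> ((\<lambda>t. (1 / t) *\<^sub>R (\<phi> (x + axis i t) - \<phi> x)) \<longlongrightarrow> l) (at 0)"
    by (simp add: tendsto_norm_zero_iff LIM_zero_iff)
  finally show ?thesis .
qed

lemma hermite_d_has_pd: "has_pd i (hermite_d \<beta> n) x (hermite_d (upd \<beta> i (Suc (\<beta> $ i))) n x)"
proof -
  define r where "r = (\<Prod>j\<in>UNIV - {i}. hermite1_d (\<beta> $ j) (n $ j) (x $ j))"
  have "hermite_d \<beta> n (x + axis i t) = hermite1_d (\<beta> $ i) (n $ i) (x $ i + t) * r" for t
  proof -
    have "(\<Prod>j\<in>UNIV - {i}. hermite1_d (\<beta> $ j) (n $ j) ((x + axis i t) $ j)) = r"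
      unfolding r_def by (rule prod.cong) (auto simp: axis_def)
    then show ?thesis
      using hermite_d_split[of \<beta> i "\<beta> $ i" n "n $ i" "x + axis i t"] by (simp add: axis_def)
  qed
  moreover have "((\<lambda>t. hermite1_d (\<beta> $ i) (n $ i) (x $ i + t) * r) has_real_derivative
      hermite1_d (Suc (\<beta> $ i)) (n $ i) (x $ i) * r) (at 0)"
  proof -
    have "((\<lambda>t. hermite1_d (\<beta> $ i) (n $ i) (x $ i + t)) has_real_derivative
        hermite1_d (Suc (\<beta> $ i)) (n $ i) (x $ i)) (at 0)"
      using hermite1_d_deriv[of "\<beta> $ i" "n $ i" "x $ i"] DERIV_shift[of "hermite1_d (\<beta> $ i) (n $ i)" _ 0 "x $ i"]
      by (simp add: add.commute del: hermite1_d.simps)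
    then show ?thesis by (rule DERIV_cmult_right)
  qed
  moreover have "hermite_d (upd \<beta> i (Suc (\<beta> $ i))) n x = hermite1_d (Suc (\<beta> $ i)) (n $ i) (x $ i) * r"
    using hermite_d_split[of \<beta> i "Suc (\<beta> $ i)" n "n $ i" x] by (simp add: r_def del: hermite1_d.simps)
  ultimately show ?thesis
    by (simp add: has_pd_def has_real_derivative_iff_has_vector_derivative del: hermite1_d.simps)
qed

section \<open>Weights on the Euclidean space and integrability\<close>

definition wx :: "'a::real_normed_vector \<Rightarrow> real" where
  "wx x = 1 + (norm x)\<^sup>2"

lemma wx_ge_1 [simp]: "1 \<le> wx x" and wx_pos [simp]: "0 < wx x" and wx_nonneg [simp]: "0 \<le> wx x"
  and wx_neq_0 [simp]: "wx x \<noteq> 0"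
proof -
  show "1 \<le> wx x" by (simp add: wx_def)
  then show "0 < wx x" "0 \<le> wx x" "wx x \<noteq> 0" by linarith+
qed

lemma continuous_wx [continuous_intros]: "continuous_on A wx"
  unfolding wx_def by (intro continuous_intros)

lemma one_plus_sum_le_prod:
  assumes "\<And>i. i \<in> S \<Longrightarrow> 0 \<le> (a i :: real)"
  shows "1 + sum a S \<le> (\<Prod>i\<in>S. 1 + a i)"
  using assms
proof (induction S rule: infinite_finite_induct)
  case (insert i S)
  have "1 + (a i + sum a S) \<le> (1 + a i) * (1 + sum a S)"
    using insert.prems by (simp add: algebra_simps sum_nonneg)
  also have "\<dots> \<le> (1 + a i) * (\<Prod>i\<in>S. 1 + a i)"
    using insert by (intro mult_left_mono) auto
  finally show ?case using insert by simp
qed auto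

lemma wx_vec: "wx (x :: real^'d::finite) = 1 + (\<Sum>i\<in>UNIV. (x $ i)\<^sup>2)"
  by (simp add: wx_def norm_vec_def L2_set_def sum_nonneg)

lemma component_le_wx: "\<bar>x $ i\<bar> \<le> wx (x :: real^'d::finite)"
proof -
  have "\<bar>x $ i\<bar> \<le> norm x" by (rule component_le_norm_cart)
  also have "\<dots> \<le> wx x"
  proof -
    have "2 * norm x \<le> 1 + (norm x)\<^sup>2"
      using zero_le_power2[of "norm x - 1"] by (simp add: power2_eq_square algebra_simps)
    then show ?thesis unfolding wx_def using norm_ge_zero[of x] by linarith
  qed
  finally show ?thesis .
qed

text \<open>Over a bounded distance the weight changes by a bounded factor. Used with
  \<open>r = 1\<close> along the steps of a difference quotient and with \<open>r = CARD('d)\<close>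
  inside a grid cell.\<close>

lemma wx_near: "norm (x - y) \<le> r \<Longrightarrow> wx x \<le> (2 + 2 * r\<^sup>2) * wx y"
proof -
  assume r: "norm (x - y) \<le> r"
  have "norm x \<le> norm y + r" using norm_triangle_ineq[of y "x - y"] r by simp
  then have "(norm x)\<^sup>2 \<le> (norm y + r)\<^sup>2" by (intro power_mono) auto
  also have "\<dots> \<le> 2 * (norm y)\<^sup>2 + 2 * r\<^sup>2"
    using zero_le_power2[of "norm y - r"] by (simp add: power2_eq_square algebra_simps)
  also have "\<dots> + 1 \<le> (2 + 2 * r\<^sup>2) * wx y" by (simp add: wx_def algebra_simps)
  finally show ?thesis by (simp add: wx_def)
qed

text \<open>The weight is at most the product of the \<open>1 + x_i^2\<close>, so the estimate
  splits into one-variable bounds, one for each coordinate; the exponents in \<open>wt n\<close> add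
  up.\<close>

lemma hermite_d_bound:
  "\<exists>C\<ge>0. \<exists>k. \<forall>n x. wx x ^ m * \<bar>hermite_d \<beta> n x\<bar> \<le> C * wt (n :: nat^'d::finite) ^ k"
proof -
  have "\<forall>i. \<exists>C k. \<forall>n x. (1 + x\<^sup>2) ^ m * \<bar>hermite1_d (\<beta> $ i) n x\<bar> \<le> C * (1 + real n) ^ k"
    using hermite1_weight_bound by blast
  then obtain C k where C: "\<And>i n x. (1 + x\<^sup>2) ^ m * \<bar>hermite1_d (\<beta> $ i) n x\<bar> \<le> C i * (1 + real n) ^ k i"
    by metis
  have C0: "0 \<le> C i" for i
  proof -
    have "0 \<le> (1 + 0\<^sup>2) ^ m * \<bar>hermite1_d (\<beta> $ i) 0 0\<bar>" by simp
    also have "\<dots> \<le> C i * (1 + real 0) ^ k i" by (rule C)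
    finally show ?thesis by simp
  qed
  have "wx x ^ m * \<bar>hermite_d \<beta> n x\<bar> \<le> prod C UNIV * wt n ^ sum k UNIV" for n x
  proof -
    have "wx x ^ m \<le> (\<Prod>i\<in>UNIV. 1 + (x $ i)\<^sup>2) ^ m"
      unfolding wx_vec by (intro power_mono one_plus_sum_le_prod) (simp_all add: add_nonneg_nonneg sum_nonneg)
    then have "wx x ^ m * \<bar>hermite_d \<beta> n x\<bar> \<le> (\<Prod>i\<in>UNIV. 1 + (x $ i)\<^sup>2) ^ m * \<bar>hermite_d \<beta> n x\<bar>"
      by (rule mult_right_mono) simp
    also have "\<dots> = (\<Prod>i\<in>UNIV. (1 + (x $ i)\<^sup>2) ^ m * \<bar>hermite1_d (\<beta> $ i) (n $ i) (x $ i)\<bar>)"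
      by (simp add: hermite_d_def prod.distrib prod_power_distrib abs_prod)
    also have "\<dots> \<le> (\<Prod>i\<in>UNIV. C i * wt n ^ k i)"
    proof (rule prod_mono)
      fix i
      have "1 + real (n $ i) \<le> (real (n $ i))\<^sup>2 + 1"
        by (cases "n $ i") (auto simp: power2_eq_square)
      then have "1 + real (n $ i) \<le> wt n" using component_le_wt[of n i] by linarith
      then have "C i * (1 + real (n $ i)) ^ k i \<le> C i * wt n ^ k i"
        using C0[of i] by (intro mult_left_mono power_mono) auto
      then show "0 \<le> (1 + (x $ i)\<^sup>2) ^ m * \<bar>hermite1_d (\<beta> $ i) (n $ i) (x $ i)\<bar> \<and>
          (1 + (x $ i)\<^sup>2) ^ m * \<bar>hermite1_d (\<beta> $ i) (n $ i) (x $ i)\<bar> \<le> C i * wt n ^ k i"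
        using C[of "x $ i" i "n $ i"] by (auto intro: order.trans)
    qed
    also have "\<dots> = prod C UNIV * wt n ^ sum k UNIV" by (simp add: prod.distrib power_sum)
    finally show ?thesis .
  qed
  moreover have "0 \<le> prod C UNIV" using C0 by (simp add: prod_nonneg)
  ultimately show ?thesis by blast
qed

text \<open>The continuous counterpart of \<open>summable_wt\<close>: the weight dominates each
  \<open>1 + x_b^2\<close>, and the product of the reciprocals is integrated factor by
  factor.\<close>

lemma integrable_wx: "integrable lborel (\<lambda>x::real^'d::finite. 1 / wx x ^ CARD('d))"
proof (rule integrableI_bounded)
  have m: "wx \<in> borel_measurable (borel :: (real^'d) measure)"
    by (intro borel_measurable_continuous_onI continuous_intros)
  then show "(\<lambda>x::real^'d. 1 / wx x ^ CARD('d)) \<in> borel_measurable lborel" by simp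
  have "set_integrable lborel UNIV (\<lambda>x::real. inverse (1 + x\<^sup>2))"
    using integrable_inverse_1_plus_square by simp
  then have "integrable lborel (\<lambda>x::real. inverse (1 + x\<^sup>2))" by (simp add: set_integrable_def)
  then have fin: "(\<integral>\<^sup>+x. ennreal (norm (inverse (1 + x\<^sup>2))) \<partial>(lborel :: real measure)) < \<infinity>"
    by (simp add: integrable_iff_bounded)
  have "(\<integral>\<^sup>+x. ennreal (norm (1 / wx x ^ CARD('d))) \<partial>(lborel :: (real^'d) measure)) \<le>
      (\<integral>\<^sup>+x. (\<Prod>b\<in>Basis. ennreal (norm (inverse (1 + (x \<bullet> b)\<^sup>2)))) \<partial>(lborel :: (real^'d) measure))"
  proof (rule nn_integral_mono)
    fix x :: "real^'d"
    have "inverse (wx x) \<le> inverse (1 + (x \<bullet> b)\<^sup>2)" if "b \<in> Basis" for b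
    proof -
      have "\<bar>x \<bullet> b\<bar> \<le> norm x" using that by (rule Basis_le_norm)
      then have "(x \<bullet> b)\<^sup>2 \<le> (norm x)\<^sup>2" by (simp add: abs_le_square_iff[symmetric])
      then show ?thesis by (intro le_imp_inverse_le) (auto simp: wx_def add_pos_nonneg)
    qed
    then have "(\<Prod>b\<in>(Basis :: (real^'d) set). inverse (wx x)) \<le> (\<Prod>b\<in>Basis. inverse (1 + (x \<bullet> b)\<^sup>2))"
      by (intro prod_mono) auto
    then have "1 / wx x ^ CARD('d) \<le> (\<Prod>b\<in>Basis. norm (inverse (1 + (x \<bullet> b)\<^sup>2)))"
      by (simp add: divide_inverse power_inverse)
    then show "ennreal (norm (1 / wx x ^ CARD('d))) \<le> (\<Prod>b\<in>Basis. ennreal (norm (inverse (1 + (x \<bullet> b)\<^sup>2))))"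
      by (simp add: prod_ennreal ennreal_leI)
  qed
  also have "\<dots> = (\<Prod>b\<in>(Basis :: (real^'d) set). (\<integral>\<^sup>+x. ennreal (norm (inverse (1 + x\<^sup>2))) \<partial>(lborel :: real measure)))"
    by (rule nn_integral_lborel_prod) auto
  also have "\<dots> < \<infinity>" using fin by (simp add: power_less_top_ennreal)
  finally show "(\<integral>\<^sup>+x. ennreal (norm (1 / wx x ^ CARD('d))) \<partial>(lborel :: (real^'d) measure)) < \<infinity>" .
qed

definition wx_mass :: "'d::finite itself \<Rightarrow> real" where
  "wx_mass _ = integral\<^sup>L lborel (\<lambda>x::real^'d. 1 / wx x ^ CARD('d))"

lemma wx_mass_nonneg: "0 \<le> wx_mass TYPE('d::finite)"
  unfolding wx_mass_def by (rule integral_nonneg_AE) auto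

lemma integral_decay:
  fixes \<phi> :: "real^'d::finite \<Rightarrow> 'b::{banach, second_countable_topology}"
  assumes m: "continuous_on UNIV \<phi>" and B: "\<And>x. wx x ^ CARD('d) * norm (\<phi> x) \<le> B"
  shows "integrable lborel \<phi>" and "norm (integral\<^sup>L lborel \<phi>) \<le> B * wx_mass TYPE('d)"
proof -
  have le: "norm (\<phi> x) \<le> B * (1 / wx x ^ CARD('d))" for x
    using B[of x] by (simp add: field_simps)
  have i: "integrable lborel (\<lambda>x::real^'d. B * (1 / wx x ^ CARD('d)))"
    using integrable_wx by (rule integrable_mult_right)
  have "\<phi> \<in> borel_measurable lborel" using borel_measurable_continuous_onI[OF m] by simp
  then show int: "integrable lborel \<phi>"
    by (rule Bochner_Integration.integrable_bound[OF i])
       (unfold real_norm_def, rule AE_I2, rule order.trans[OF le abs_ge_self])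
  have "norm (integral\<^sup>L lborel \<phi>) \<le> (\<integral>x. norm (\<phi> x) \<partial>lborel)" by (rule integral_norm_bound)
  also have "\<dots> \<le> integral\<^sup>L lborel (\<lambda>x::real^'d. B * (1 / wx x ^ CARD('d)))"
    by (rule integral_mono[OF integrable_norm[OF int] i]) (rule le)
  also have "\<dots> = B * wx_mass TYPE('d)" unfolding wx_mass_def by (rule integral_mult_right_zero)
  finally show "norm (integral\<^sup>L lborel \<phi>) \<le> B * wx_mass TYPE('d)" .
qed

section \<open>Rapidly decreasing continuous functions\<close>

definition decays :: "(real^'d::finite \<Rightarrow> 'b::{banach, second_countable_topology}) \<Rightarrow> bool" where
  "decays \<phi> \<longleftrightarrow> continuous_on UNIV \<phi> \<and> (\<forall>m. \<exists>C. \<forall>x. wx x ^ m * norm (\<phi> x) \<le> C)"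

lemma decaysI:
  "continuous_on UNIV \<phi> \<Longrightarrow> (\<And>m. \<exists>C. \<forall>x. wx x ^ m * norm (\<phi> x) \<le> C) \<Longrightarrow> decays \<phi>"
  by (simp add: decays_def)

lemma decays_continuous: "decays \<phi> \<Longrightarrow> continuous_on UNIV \<phi>"
  by (simp add: decays_def)

lemma decays_bound:
  assumes "decays \<phi>"
  obtains C where "0 \<le> C" "\<And>x. wx x ^ m * norm (\<phi> x) \<le> C"
proof -
  obtain C where C: "\<And>x. wx x ^ m * norm (\<phi> x) \<le> C" using assms by (auto simp: decays_def)
  moreover have "0 \<le> wx 0 ^ m * norm (\<phi> 0)" by simp
  then have "0 \<le> C" by (rule order.trans) (rule C)
  ultimately show thesis by (intro that)
qed

lemma decays_integrable: "decays \<phi> \<Longrightarrow> integrable lborel \<phi>"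
  by (meson decays_bound decays_continuous integral_decay(1))

lemma decays_mult:
  fixes g :: "real^'d::finite \<Rightarrow> real"
  assumes \<phi>: "decays \<phi>" and g: "continuous_on UNIV g" "\<And>x. \<bar>g x\<bar> \<le> C * wx x ^ k"
  shows "decays (\<lambda>x. g x *\<^sub>R \<phi> x)"
proof (rule decaysI)
  show "continuous_on UNIV (\<lambda>x. g x *\<^sub>R \<phi> x)" by (intro continuous_intros g decays_continuous \<phi>)
  fix m
  obtain B where B: "0 \<le> B" "\<And>x. wx x ^ (m + k) * norm (\<phi> x) \<le> B" using decays_bound[OF \<phi>] by blast
  have C: "0 \<le> C" using order.trans[OF abs_ge_zero g(2)[of 0]] by (simp add: wx_def)
  have "wx x ^ m * norm (g x *\<^sub>R \<phi> x) \<le> C * B" for x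
  proof -
    have "wx x ^ m * norm (g x *\<^sub>R \<phi> x) \<le> wx x ^ m * (C * wx x ^ k * norm (\<phi> x))"
      using mult_right_mono[OF g(2)[of x] norm_ge_zero[of "\<phi> x"]] by (intro mult_left_mono) auto
    also have "\<dots> = C * (wx x ^ (m + k) * norm (\<phi> x))" by (simp add: power_add)
    also have "\<dots> \<le> C * B" using B C by (intro mult_left_mono) auto
    finally show ?thesis .
  qed
  then show "\<exists>C. \<forall>x. wx x ^ m * norm (g x *\<^sub>R \<phi> x) \<le> C" by blast
qed

lemma decays_add:
  assumes "decays \<phi>" "decays \<psi>"
  shows "decays (\<lambda>x. \<phi> x + \<psi> x)"
proof (rule decaysI)
  show "continuous_on UNIV (\<lambda>x. \<phi> x + \<psi> x)" by (intro continuous_intros decays_continuous assms)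
  fix m
  obtain B where B: "\<And>x. wx x ^ m * norm (\<phi> x) \<le> B" using decays_bound[OF assms(1)] by blast
  obtain C where C: "\<And>x. wx x ^ m * norm (\<psi> x) \<le> C" using decays_bound[OF assms(2)] by blast
  have "wx x ^ m * norm (\<phi> x + \<psi> x) \<le> B + C" for x
    using mult_left_mono[OF norm_triangle_ineq[of "\<phi> x" "\<psi> x"], of "wx x ^ m"] B[of x] C[of x]
    by (simp add: distrib_left)
  then show "\<exists>C. \<forall>x. wx x ^ m * norm (\<phi> x + \<psi> x) \<le> C" by blast
qed

lemma decays_scaleR: "decays \<phi> \<Longrightarrow> decays (\<lambda>x. c *\<^sub>R \<phi> x)"
  using decays_mult[of \<phi> "\<lambda>_. c" "\<bar>c\<bar>" 0] by simp

lemma decays_mult_x: "decays \<phi> \<Longrightarrow> decays (\<lambda>x. (x $ i) *\<^sub>R \<phi> x)"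
  by (rule decays_mult[of _ _ 1 1]) (auto intro!: continuous_intros component_le_wx)

lemma hermite_d_bounded: "\<exists>C\<ge>0. \<forall>x. wx x ^ m * \<bar>hermite_d \<beta> n x\<bar> \<le> C"
proof -
  obtain C k where C: "0 \<le> C" "\<And>n x. wx x ^ m * \<bar>hermite_d \<beta> n x\<bar> \<le> C * wt n ^ k"
    using hermite_d_bound[of m \<beta>] by blast
  then show ?thesis by (intro exI[of _ "C * wt n ^ k"]) auto
qed

lemma decays_hermite_d: "decays (hermite_d \<beta> n)"
  using hermite_d_bounded[of _ \<beta> n] by (intro decaysI continuous_intros) auto

lemma decays_hermite: "decays (hermite n)"
  using decays_hermite_d[of 0 n] by simp

lemma continuous_hermite [continuous_intros]: "continuous_on A (hermite n)"
  using continuous_hermite_d[of A 0 n] by simp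

lemma decays_hermite_d_scaleR: "decays \<phi> \<Longrightarrow> decays (\<lambda>x. hermite_d \<beta> n x *\<^sub>R \<phi> x)"
proof -
  assume \<phi>: "decays \<phi>"
  obtain C where "\<And>x. wx x ^ 0 * \<bar>hermite_d \<beta> n x\<bar> \<le> C" using hermite_d_bounded by meson
  then show ?thesis by (intro decays_mult[OF \<phi>, of _ C 0] continuous_intros) auto
qed

lemma decays_hermite_scaleR: "decays \<phi> \<Longrightarrow> decays (\<lambda>x. hermite n x *\<^sub>R \<phi> x)"
  using decays_hermite_d_scaleR[of \<phi> 0 n] by simp

lemma has_pd_bound:
  assumes d: "\<And>x. has_pd i \<phi> x (\<phi>' x)" and B: "\<And>t. \<bar>t\<bar> \<le> \<bar>h\<bar> \<Longrightarrow> norm (\<phi>' (x + axis i t)) \<le> B"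
  shows "norm (\<phi> (x + axis i h) - \<phi> x) \<le> B * \<bar>h\<bar>"
proof -
  let ?g = "\<lambda>t. \<phi> (x + axis i t)"
  have "norm (?g h - ?g 0) \<le> B * norm (h - 0)"
  proof (rule differentiable_bound[of "{- \<bar>h\<bar>..\<bar>h\<bar>}" ?g "\<lambda>t s. s *\<^sub>R \<phi>' (x + axis i t)"])
    fix t assume t: "t \<in> {- \<bar>h\<bar>..\<bar>h\<bar>}"
    show "(?g has_derivative (\<lambda>s. s *\<^sub>R \<phi>' (x + axis i t))) (at t within {- \<bar>h\<bar>..\<bar>h\<bar>})"
      using has_pd_at[OF d, of x t] unfolding has_vector_derivative_def by (rule has_derivative_at_withinI)
    show "onorm (\<lambda>s. s *\<^sub>R \<phi>' (x + axis i t)) \<le> B"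
    proof (rule onorm_le)
      fix s :: real
      have "\<bar>t\<bar> \<le> \<bar>h\<bar>" using t by auto
      then show "norm (s *\<^sub>R \<phi>' (x + axis i t)) \<le> B * norm s"
        using B[of t] mult_left_mono[of "norm (\<phi>' (x + axis i t))" B "\<bar>s\<bar>"] by (simp add: mult.commute)
    qed
  qed auto
  then show ?thesis by simp
qed

lemma norm_axis_real [simp]: "norm (axis i t :: real^'d::finite) = \<bar>t\<bar>"
proof -
  have "axis i t = t *\<^sub>R (axis i 1 :: real^'d)" by (simp add: vec_eq_iff axis_def)
  then show ?thesis by simp
qed

text \<open>The integral of a difference quotient vanishes by translation invariance.\<close>

lemma integral_pd_eq_0:
  fixes \<phi> :: "real^'d::finite \<Rightarrow> 'b::{banach, second_countable_topology}"
  assumes \<phi>: "decays \<phi>" and \<phi>': "decays \<phi>'" and d: "\<And>x. has_pd i \<phi> x (\<phi>' x)"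
  shows "integral\<^sup>L lborel \<phi>' = 0"
proof -
  define h :: "nat \<Rightarrow> real" where "h k = 1 / real (Suc k)" for k
  have h: "0 < h k" "h k \<le> 1" for k by (auto simp: h_def)
  have h0: "h \<longlonglongrightarrow> 0" unfolding h_def by real_asymp
  define D where "D k x = (1 / h k) *\<^sub>R (\<phi> (axis i (h k) + x) - \<phi> x)" for k x
  have m\<phi>: "\<phi> \<in> borel_measurable borel" by (rule borel_measurable_continuous_onI[OF decays_continuous[OF \<phi>]])
  have int: "integrable lborel \<phi>" by (rule decays_integrable[OF \<phi>])
  have int_shift: "integrable lborel (\<lambda>x. \<phi> (c + x))" and eq_shift: "(\<integral>x. \<phi> (c + x) \<partial>lborel) = integral\<^sup>L lborel \<phi>" for c
  proof -
    have "integrable (distr lborel borel ((+) c)) \<phi>" using int by (simp add: lborel_distr_plus)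
    then show "integrable lborel (\<lambda>x. \<phi> (c + x))" by (subst (asm) integrable_distr_eq) (use m\<phi> in auto)
    have "integral\<^sup>L (distr lborel borel ((+) c)) \<phi> = (\<integral>x. \<phi> (c + x) \<partial>lborel)"
      by (rule integral_distr) (use m\<phi> in auto)
    then show "(\<integral>x. \<phi> (c + x) \<partial>lborel) = integral\<^sup>L lborel \<phi>" by (simp add: lborel_distr_plus)
  qed
  have D0: "integral\<^sup>L lborel (D k) = 0" for k
    unfolding D_def using int_shift int eq_shift by simp
  obtain C where C: "0 \<le> C" "\<And>x. wx x ^ CARD('d) * norm (\<phi>' x) \<le> C" using decays_bound[OF \<phi>'] by blast
  \<comment> \<open>A majorant valid for all step sizes. As \<open>h k \<le> 1\<close>, the weight
    changes along the segment by at most the factor \<open>4 = 2 + 2 * 1^2\<close> of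
    \<open>wx_near\<close>.\<close>
  have bound: "norm (D k x) \<le> (C * 4 ^ CARD('d)) * (1 / wx x ^ CARD('d))" for k x
  proof -
    have "norm (\<phi>' (x + axis i t)) \<le> C * 4 ^ CARD('d) / wx x ^ CARD('d)" if "\<bar>t\<bar> \<le> \<bar>h k\<bar>" for t
    proof -
      have "wx x \<le> 4 * wx (x + axis i t)"
        using wx_near[of x "x + axis i t" 1] that h[of k] by simp
      then have "wx x ^ CARD('d) \<le> 4 ^ CARD('d) * wx (x + axis i t) ^ CARD('d)"
        unfolding power_mult_distrib[symmetric] by (rule power_mono) simp
      then have "wx x ^ CARD('d) * norm (\<phi>' (x + axis i t)) \<le>
          4 ^ CARD('d) * (wx (x + axis i t) ^ CARD('d) * norm (\<phi>' (x + axis i t)))"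
        using mult_right_mono[OF _ norm_ge_zero] by (simp add: mult.assoc[symmetric])
      also have "\<dots> \<le> 4 ^ CARD('d) * C" by (intro mult_left_mono C) auto
      finally show ?thesis by (simp add: field_simps)
    qed
    then have "norm (\<phi> (x + axis i (h k)) - \<phi> x) \<le> C * 4 ^ CARD('d) / wx x ^ CARD('d) * \<bar>h k\<bar>"
      by (rule has_pd_bound[OF d])
    moreover have "axis i (h k) + x = x + axis i (h k)" by (rule add.commute)
    ultimately show ?thesis using h[of k] unfolding D_def norm_scaleR by (simp add: field_simps)
  qed
  have lim: "(\<lambda>k. D k x) \<longlonglongrightarrow> \<phi>' x" for x
  proof -
    have "filterlim h (at 0) sequentially"
      unfolding filterlim_at using h0 h(1) by (auto simp: less_imp_neq[symmetric])
    then have "(\<lambda>k. (1 / h k) *\<^sub>R (\<phi> (x + axis i (h k)) - \<phi> x)) \<longlonglongrightarrow> \<phi>' x"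
      using d[of x] unfolding has_pd_iff by (rule filterlim_compose[rotated])
    then show ?thesis by (simp add: D_def add.commute)
  qed
  have "(\<lambda>k. integral\<^sup>L lborel (D k)) \<longlonglongrightarrow> integral\<^sup>L lborel \<phi>'"
  proof (rule integral_dominated_convergence)
    show "\<phi>' \<in> borel_measurable lborel"
      using borel_measurable_continuous_onI[OF decays_continuous[OF \<phi>']] by simp
    show "D k \<in> borel_measurable lborel" for k unfolding D_def using m\<phi> by simp
    show "integrable lborel (\<lambda>x::real^'d. (C * 4 ^ CARD('d)) * (1 / wx x ^ CARD('d)))"
      using integrable_wx by (rule integrable_mult_right)
  qed (use bound lim in auto)
  then show ?thesis by (simp add: D0 LIMSEQ_const_iff)
qed

lemma has_pd_scaleR:
  fixes g :: "real^'d::finite \<Rightarrow> real" and \<phi> :: "real^'d \<Rightarrow> 'b::real_normed_vector"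
  assumes "has_pd i g x g'" "has_pd i \<phi> x \<phi>'"
  shows "has_pd i (\<lambda>x. g x *\<^sub>R \<phi> x) x (g' *\<^sub>R \<phi> x + g x *\<^sub>R \<phi>')"
proof -
  have "((\<lambda>t. g (x + axis i t) *\<^sub>R \<phi> (x + axis i t)) has_vector_derivative
      (g (x + axis i 0) *\<^sub>R \<phi>' + g' *\<^sub>R \<phi> (x + axis i 0))) (at 0)"
    using assms unfolding has_pd_def has_real_derivative_iff_has_vector_derivative[symmetric]
    by (rule has_vector_derivative_scaleR)
  then show ?thesis by (simp add: has_pd_def add.commute)
qed

lemma has_pd_add: "has_pd i \<phi> x l \<Longrightarrow> has_pd i \<psi> x m \<Longrightarrow> has_pd i (\<lambda>x. \<phi> x + \<psi> x) x (l + m)"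
  unfolding has_pd_def by (rule has_vector_derivative_add)

lemma has_pd_scaleR_const: "has_pd i \<phi> x l \<Longrightarrow> has_pd i (\<lambda>x. c *\<^sub>R \<phi> x) x (c *\<^sub>R l)"
  unfolding has_pd_def by (intro bounded_linear.has_vector_derivative[OF bounded_linear_scaleR_right])

lemma has_pd_component: "has_pd i (\<lambda>x. x $ i) x 1"
  unfolding has_pd_def by (auto intro!: derivative_eq_intros simp: axis_def)

lemma hermite_has_pd:
  "has_pd i (hermite n) x
     (ladder (n $ i) * hermite (upd n i (n $ i - 1)) x - ladder (Suc (n $ i)) * hermite (upd n i (Suc (n $ i))) x)"
  using hermite_d_has_pd[of i 0 n x] hermite_d_Suc[of 0 i n x] by simp

section \<open>Coefficients, ladder operators and orthonormality\<close>

definition coef :: "(real^'d::finite \<Rightarrow> 'b::{banach, second_countable_topology}) \<Rightarrow> nat^'d \<Rightarrow> 'b" where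
  "coef \<phi> n = integral\<^sup>L lborel (\<lambda>x. hermite n x *\<^sub>R \<phi> x)"

lemma integrable_hermite: "decays \<phi> \<Longrightarrow> integrable lborel (\<lambda>x. hermite n x *\<^sub>R \<phi> x)"
  by (intro decays_integrable decays_hermite_scaleR)

lemma coef_add: "decays \<phi> \<Longrightarrow> decays \<psi> \<Longrightarrow> coef (\<lambda>x. \<phi> x + \<psi> x) n = coef \<phi> n + coef \<psi> n"
  by (simp add: coef_def scaleR_add_right integrable_hermite)

lemma coef_scaleR: "coef (\<lambda>x. c *\<^sub>R \<phi> x) n = c *\<^sub>R coef \<phi> n"
  unfolding coef_def scaleR_left_commute[of _ c]
  by (rule integral_scaleR_right)

lemma coef_mult_x:
  assumes "decays \<phi>"
  shows "coef (\<lambda>x. (x $ i) *\<^sub>R \<phi> x) n =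
    ladder (n $ i) *\<^sub>R coef \<phi> (upd n i (n $ i - 1)) + ladder (Suc (n $ i)) *\<^sub>R coef \<phi> (upd n i (Suc (n $ i)))"
proof -
  have "hermite n x *\<^sub>R (x $ i) *\<^sub>R \<phi> x =
      ladder (n $ i) *\<^sub>R (hermite (upd n i (n $ i - 1)) x *\<^sub>R \<phi> x) +
      ladder (Suc (n $ i)) *\<^sub>R (hermite (upd n i (Suc (n $ i))) x *\<^sub>R \<phi> x)" for x
    using hermite_mult_x[of x i n] by (simp add: mult.commute flip: scaleR_add_left)
  then show ?thesis using assms by (simp add: coef_def integrable_hermite del: scaleR_scaleR)
qed

text \<open>Integration by parts: the derivative of the product with \<open>hermite n\<close> has
  integral 0, and the derivative of \<open>hermite n\<close> is a combination of its two
  neighbours.\<close>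

lemma coef_pd:
  assumes "decays \<phi>" "decays \<phi>'" "\<And>x. has_pd i \<phi> x (\<phi>' x)"
  shows "coef \<phi>' n =
    ladder (Suc (n $ i)) *\<^sub>R coef \<phi> (upd n i (Suc (n $ i))) - ladder (n $ i) *\<^sub>R coef \<phi> (upd n i (n $ i - 1))"
proof -
  let ?h = "hermite n" and ?h' = "hermite_d (upd 0 i 1) n"
  have h': "?h' x = ladder (n $ i) * hermite (upd n i (n $ i - 1)) x - ladder (Suc (n $ i)) * hermite (upd n i (Suc (n $ i))) x" for x
    using hermite_d_Suc[of 0 i n x] by simp
  have "integral\<^sup>L lborel (\<lambda>x. ?h' x *\<^sub>R \<phi> x + ?h x *\<^sub>R \<phi>' x) = 0"
  proof (rule integral_pd_eq_0)
    show "decays (\<lambda>x. ?h x *\<^sub>R \<phi> x)" by (intro decays_hermite_scaleR assms)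
    show "decays (\<lambda>x. ?h' x *\<^sub>R \<phi> x + ?h x *\<^sub>R \<phi>' x)"
      by (intro decays_add decays_hermite_scaleR decays_hermite_d_scaleR assms)
    show "has_pd i (\<lambda>x. ?h x *\<^sub>R \<phi> x) x (?h' x *\<^sub>R \<phi> x + ?h x *\<^sub>R \<phi>' x)" for x
      unfolding h' by (intro has_pd_scaleR hermite_has_pd assms)
  qed
  moreover have "integral\<^sup>L lborel (\<lambda>x. ?h' x *\<^sub>R \<phi> x + ?h x *\<^sub>R \<phi>' x) =
      integral\<^sup>L lborel (\<lambda>x. ?h' x *\<^sub>R \<phi> x) + coef \<phi>' n"
    unfolding coef_def
    by (intro Bochner_Integration.integral_add decays_integrable decays_hermite_scaleR decays_hermite_d_scaleR assms)
  moreover have "integral\<^sup>L lborel (\<lambda>x. ?h' x *\<^sub>R \<phi> x) =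
      ladder (n $ i) *\<^sub>R coef \<phi> (upd n i (n $ i - 1)) - ladder (Suc (n $ i)) *\<^sub>R coef \<phi> (upd n i (Suc (n $ i)))"
    unfolding coef_def h' using assms(1)
    by (simp add: scaleR_diff_left integrable_hermite flip: scaleR_scaleR)
  ultimately show ?thesis by (simp add: algebra_simps add_eq_0_iff)
qed

text \<open>In \<open>x_i \<phi> - d_i \<phi>\<close> the contributions of the upper neighbour
  cancel, in \<open>coef_lower\<close> those of the lower one. The factors \<open>- 1\<close> and
  \<open>1\<close> are written out to match the parameter \<open>s\<close> of
  \<open>lad\<close>.\<close>

lemma coef_raise:
  assumes "decays \<phi>" "decays \<phi>'" "\<And>x. has_pd i \<phi> x (\<phi>' x)"
  shows "coef (\<lambda>x. (x $ i) *\<^sub>R \<phi> x + (- 1) *\<^sub>R \<phi>' x) n = (2 * ladder (n $ i)) *\<^sub>R coef \<phi> (upd n i (n $ i - 1))"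
  using coef_add[OF decays_mult_x[OF assms(1), of i] decays_scaleR[OF assms(2), of "- 1"]]
  unfolding coef_scaleR coef_mult_x[OF assms(1)] coef_pd[OF assms] by (simp add: scaleR_2 flip: scaleR_scaleR)

lemma coef_lower:
  assumes "decays \<phi>" "decays \<phi>'" "\<And>x. has_pd i \<phi> x (\<phi>' x)"
  shows "coef (\<lambda>x. (x $ i) *\<^sub>R \<phi> x + 1 *\<^sub>R \<phi>' x) n = (2 * ladder (Suc (n $ i))) *\<^sub>R coef \<phi> (upd n i (Suc (n $ i)))"
  using coef_add[OF decays_mult_x[OF assms(1), of i] decays_scaleR[OF assms(2), of 1]]
  unfolding coef_scaleR coef_mult_x[OF assms(1)] coef_pd[OF assms] by (simp add: scaleR_2 flip: scaleR_scaleR)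

text \<open>The square of \<open>hermite1 0\<close> is the density of the normal distribution with
  variance 1/2, and the integral over the space is a product of one-dimensional ones.\<close>

lemma coef_hermite_0: "coef (hermite (0 :: nat^'d::finite)) 0 = (1 :: real)"
proof -
  define f where "f t = (hermite1 0 t)\<^sup>2" for t
  have f: "f t = normal_density 0 (1 / sqrt 2) t" for t
    by (simp add: f_def hermite1_eq normal_density_def power_divide exp_double[symmetric] real_sqrt_divide)
  have "(\<integral>\<^sup>+t. ennreal (f t) \<partial>lborel) = 1"
    unfolding f by (subst nn_integral_eq_integral) auto
  have "(\<integral>\<^sup>+x. ennreal (hermite 0 x * hermite 0 x) \<partial>(lborel :: (real^'d) measure)) =
      (\<integral>\<^sup>+x. (\<Prod>b\<in>Basis. ennreal (f (x \<bullet> b))) \<partial>(lborel :: (real^'d) measure))"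
  proof (rule nn_integral_cong)
    fix x :: "real^'d"
    have B: "(Basis :: (real^'d) set) = (\<lambda>i. axis i 1) ` UNIV" by (auto simp: Basis_vec_def)
    have inj: "inj (\<lambda>i. axis i 1 :: real^'d)" by (rule injI) (simp add: axis_eq_axis)
    have "(\<Prod>b\<in>Basis. f (x \<bullet> b)) = (\<Prod>i\<in>UNIV. f (x $ i))"
      unfolding B by (subst prod.reindex[OF inj]) (simp add: inner_axis)
    also have "\<dots> = hermite 0 x * hermite 0 x"
      by (simp add: hermite_def f_def power2_eq_square prod.distrib)
    finally show "ennreal (hermite 0 x * hermite 0 x) = (\<Prod>b\<in>Basis. ennreal (f (x \<bullet> b)))"
      by (simp add: prod_ennreal f_def)
  qed
  also have "\<dots> = (\<Prod>b\<in>(Basis :: (real^'d) set). (\<integral>\<^sup>+t. ennreal (f t) \<partial>lborel))"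
    by (rule nn_integral_lborel_prod) (auto simp: f)
  also have "\<dots> = 1" using \<open>(\<integral>\<^sup>+t. ennreal (f t) \<partial>lborel) = 1\<close> by simp
  finally have nn: "(\<integral>\<^sup>+x. ennreal (hermite 0 x * hermite 0 x) \<partial>(lborel :: (real^'d) measure)) = 1" .
  have "coef (hermite (0 :: nat^'d)) 0 = enn2real (\<integral>\<^sup>+x. ennreal (hermite 0 x * hermite 0 x) \<partial>(lborel :: (real^'d) measure))"
    unfolding coef_def using decays_integrable[OF decays_hermite_scaleR[OF decays_hermite, of 0 0]]
    by (subst integral_eq_nn_integral) (auto dest: borel_measurable_integrable)
  then show ?thesis using nn by simp
qed

text \<open>The lowering operator annihilates \<open>hermite 0\<close>, so \<open>coef_lower\<close>
  makes its coefficients away from index 0 vanish. A function with \<open>m $ i > 0\<close> is a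
  multiple of a raised one of smaller degree, and \<open>coef_raise\<close> transfers the operator
  to the index \<open>n\<close>; when \<open>n $ i = 0\<close> the factor \<open>ladder 0\<close>
  gives 0.\<close>

lemma coef_hermite: "coef (hermite m) n = (if m = (n :: nat^'d::finite) then 1 else 0 :: real)"
proof (induction "sum (($) m) UNIV" arbitrary: m n)
  case 0
  then have m: "m = 0" by (simp add: vec_eq_iff)
  show ?case
  proof (cases "n = 0")
    case False
    then obtain i where i: "n $ i \<noteq> 0" by (auto simp: vec_eq_iff)
    define n' where "n' = upd n i (n $ i - 1)"
    have n: "upd n' i (Suc (n' $ i)) = n" using i by (simp add: n'_def vec_eq_iff)
    have "has_pd i (hermite 0) x (hermite_d (upd 0 i 1) 0 x)" for x
      using hermite_d_has_pd[of i 0 0 x] by simp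
    then have "coef (\<lambda>x. (x $ i) *\<^sub>R hermite 0 x + 1 *\<^sub>R hermite_d (upd 0 i 1) 0 x) n' =
        (2 * ladder (Suc (n' $ i))) *\<^sub>R coef (hermite 0) n"
      using coef_lower[OF decays_hermite decays_hermite_d, of i 0 "upd 0 i 1" 0 n'] n by simp
    moreover have "(\<lambda>x. (x $ i) *\<^sub>R hermite 0 x + 1 *\<^sub>R hermite_d (upd 0 i 1) 0 x) = (\<lambda>x. 0)"
      using hermite_mult_x[of _ i 0] hermite_d_Suc[of 0 i 0] by (simp add: fun_eq_iff)
    ultimately have "(2 * ladder (Suc (n' $ i))) *\<^sub>R coef (hermite 0) n = coef (\<lambda>x. 0 :: real) n'"
      by (simp only:)
    then show ?thesis using False m by (simp add: coef_def)
  qed (simp add: m coef_hermite_0)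
next
  case (Suc k)
  then have "\<exists>i. m $ i \<noteq> 0" by (metis sum.neutral nat.distinct(1))
  then obtain i where i: "m $ i \<noteq> 0" by blast
  define m' where "m' = upd m i (m $ i - 1)"
  have m: "upd m' i (Suc (m' $ i)) = m" and m'i: "Suc (m' $ i) = m $ i" using i by (simp_all add: m'_def vec_eq_iff)
  have "sum (($) m) UNIV = m $ i + sum (($) m) (UNIV - {i})"
    "sum (($) m') UNIV = m' $ i + sum (($) m') (UNIV - {i})"
    by (simp_all add: sum.remove)
  moreover have "sum (($) m') (UNIV - {i}) = sum (($) m) (UNIV - {i})"
    by (rule sum.cong) (auto simp: m'_def)
  ultimately have k: "k = sum (($) m') UNIV" using Suc(2) m'i by simp
  have "has_pd i (hermite m') x (hermite_d (upd 0 i 1) m' x)" for x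
    using hermite_d_has_pd[of i 0 m' x] by simp
  then have "coef (\<lambda>x. (x $ i) *\<^sub>R hermite m' x + (- 1) *\<^sub>R hermite_d (upd 0 i 1) m' x) n =
      (2 * ladder (n $ i)) *\<^sub>R coef (hermite m') (upd n i (n $ i - 1))"
    by (intro coef_raise decays_hermite decays_hermite_d)
  moreover have "(\<lambda>x. (x $ i) *\<^sub>R hermite m' x + (- 1) *\<^sub>R hermite_d (upd 0 i 1) m' x) =
      (\<lambda>x. (2 * ladder (m $ i)) *\<^sub>R hermite m x)"
    using hermite_mult_x[of _ i m'] hermite_d_Suc[of 0 i m'] m m'i by (simp add: fun_eq_iff)
  ultimately have "coef (\<lambda>x. (2 * ladder (m $ i)) *\<^sub>R hermite m x) n =
      (2 * ladder (n $ i)) *\<^sub>R coef (hermite m') (upd n i (n $ i - 1))"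
    by (simp only:)
  then have eq: "ladder (m $ i) * coef (hermite m) n =
      ladder (n $ i) * coef (hermite m') (upd n i (n $ i - 1))"
    unfolding coef_scaleR by simp
  have pos: "0 < ladder (m $ i)" using m'i ladder_Suc_pos by metis
  show ?case
  proof (cases "n $ i")
    case 0
    then show ?thesis using eq pos i by auto
  next
    case (Suc l)
    have "(m' = upd n i (n $ i - 1)) = (m = n)"
    proof
      assume eq: "m' = upd n i (n $ i - 1)"
      have "m $ j = n $ j" for j
        using arg_cong[OF eq, of "\<lambda>v. v $ j"] i Suc by (cases "j = i") (auto simp: m'_def)
      then show "m = n" by (simp add: vec_eq_iff)
    qed (simp add: m'_def)
    then show ?thesis using eq pos Suc.hyps(1)[OF k, of "upd n i (n $ i - 1)"] by auto
  qed
qed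

definition coef_const :: "'d::finite itself \<Rightarrow> real" where
  "coef_const d = (1 + wx_mass d) / 2"

lemma coef_const_nonneg: "0 \<le> coef_const TYPE('d::finite)"
  using wx_mass_nonneg[where 'd = 'd] by (simp add: coef_const_def)

text \<open>The bound has to be uniform in \<open>n\<close>. By \<open>2 a b \<le> a^2 + b^2\<close>
  the function \<open>hermite n\<close> enters only through the integral of its square, which is 1;
  this explains \<open>coef_const\<close>.\<close>

lemma coef_bound:
  fixes \<phi> :: "real^'d::finite \<Rightarrow> 'b::{banach, second_countable_topology}"
  assumes m: "continuous_on UNIV \<phi>" and B: "\<And>x. wx x ^ CARD('d) * norm (\<phi> x) \<le> B"
  shows "norm (coef \<phi> n) \<le> coef_const TYPE('d) * B"
proof -
  have B0: "0 \<le> B" using B[of 0] order.trans[OF mult_nonneg_nonneg] by (metis norm_ge_zero wx_nonneg zero_le_power)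
  let ?g = "\<lambda>x. (B / 2) * (hermite n x * hermite n x + 1 / wx x ^ CARD('d))"
  have le: "norm (hermite n x *\<^sub>R \<phi> x) \<le> ?g x" for x
  proof -
    define w where "w = 1 / wx x ^ CARD('d)"
    have w: "0 \<le> w" "w \<le> 1" by (auto simp: w_def)
    have "norm (\<phi> x) \<le> B * w" using B[of x] by (simp add: w_def field_simps)
    then have "norm (hermite n x *\<^sub>R \<phi> x) \<le> \<bar>hermite n x\<bar> * (B * w)" by (simp add: mult_left_mono)
    also have "\<dots> = B * (\<bar>hermite n x\<bar> * w)" by simp
    also have "\<dots> \<le> B * ((hermite n x * hermite n x + w) / 2)"
    proof (rule mult_left_mono[OF _ B0])
      have "2 * (\<bar>hermite n x\<bar> * w) \<le> \<bar>hermite n x\<bar> * \<bar>hermite n x\<bar> + w * w"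
        using zero_le_power2[of "\<bar>hermite n x\<bar> - w"] by (simp add: power2_eq_square algebra_simps)
      also have "w * w \<le> w" using w by (simp add: mult_left_le)
      finally show "\<bar>hermite n x\<bar> * w \<le> (hermite n x * hermite n x + w) / 2" by (simp flip: abs_mult)
    qed
    finally show ?thesis by (simp add: w_def)
  qed
  have ih: "integrable lborel (\<lambda>x. hermite n x * hermite n x)"
    using decays_integrable[OF decays_hermite_scaleR[OF decays_hermite, of n n]] by simp
  have ig: "integrable lborel ?g" using ih integrable_wx[where 'd = 'd] by (intro integrable_mult_right Bochner_Integration.integrable_add)
  have "continuous_on UNIV (\<lambda>x. hermite n x *\<^sub>R \<phi> x)" by (intro continuous_intros m)
  then have ms: "(\<lambda>x. hermite n x *\<^sub>R \<phi> x) \<in> borel_measurable lborel"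
    using borel_measurable_continuous_onI by auto
  have int: "integrable lborel (\<lambda>x. hermite n x *\<^sub>R \<phi> x)"
    by (rule Bochner_Integration.integrable_bound[OF ig ms])
       (unfold real_norm_def[of "?g _"], rule AE_I2, rule order.trans[OF le abs_ge_self])
  have "norm (coef \<phi> n) \<le> (\<integral>x. norm (hermite n x *\<^sub>R \<phi> x) \<partial>lborel)"
    unfolding coef_def by (rule integral_norm_bound)
  also have "\<dots> \<le> integral\<^sup>L lborel ?g" by (rule integral_mono[OF integrable_norm[OF int] ig]) (rule le)
  also have "\<dots> = (B / 2) * (coef (hermite n) n + wx_mass TYPE('d))"
    unfolding integral_mult_right_zero Bochner_Integration.integral_add[OF ih integrable_wx] coef_def wx_mass_def
    by simp
  finally show ?thesis by (simp add: coef_hermite coef_const_def algebra_simps)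
qed

section \<open>Decay and completeness of Hermite coefficients\<close>

text \<open>The iterated derivatives in one fixed direction. Decay of the coefficients in
  \<open>n $ i\<close> requires only derivatives in direction \<open>i\<close>, so mixed derivatives
  never enter the coefficient estimate.\<close>

definition pd_seq :: "'d::finite \<Rightarrow> (nat \<Rightarrow> real^'d \<Rightarrow> 'b::{banach, second_countable_topology}) \<Rightarrow> bool" where
  "pd_seq i F \<longleftrightarrow> (\<forall>b. decays (F b)) \<and> (\<forall>b x. has_pd i (F b) x (F (Suc b) x))"

text \<open>If \<open>F b\<close> is the \<open>b\<close>-th derivative of \<open>\<phi>\<close> in direction \<open>i\<close>, then \<open>lad i s F b\<close> is that of
  \<open>x\<^sub>i \<phi> + s \<partial>\<^sub>i \<phi>\<close>.\<close>

definition lad ::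
  "'d::finite \<Rightarrow> real \<Rightarrow> (nat \<Rightarrow> real^'d \<Rightarrow> 'b::{banach, second_countable_topology}) \<Rightarrow> nat \<Rightarrow> real^'d \<Rightarrow> 'b" where
  "lad i s F b x = (x $ i) *\<^sub>R F b x + real b *\<^sub>R F (b - 1) x + s *\<^sub>R F (Suc b) x"

lemma pd_seq_lad:
  assumes "pd_seq i F"
  shows "pd_seq i (lad i s F)"
  unfolding pd_seq_def
proof (intro conjI allI)
  have dec: "decays (F b)" and pd: "has_pd i (F b) x (F (Suc b) x)" for b x
    using assms by (auto simp: pd_seq_def)
  show "decays (lad i s F b)" for b
    unfolding lad_def[abs_def] by (intro decays_add decays_scaleR decays_mult_x dec)
  show "has_pd i (lad i s F b) x (lad i s F (Suc b) x)" for b x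
  proof -
    have "has_pd i (lad i s F b) x
        (((1 *\<^sub>R F b x + (x $ i) *\<^sub>R F (Suc b) x) + real b *\<^sub>R F (Suc (b - 1)) x) + s *\<^sub>R F (Suc (Suc b)) x)"
      unfolding lad_def[abs_def]
      by (intro has_pd_add has_pd_scaleR_const has_pd_scaleR has_pd_component pd)
    \<comment> \<open>At \<open>b = 0\<close> the index \<open>Suc (b - 1)\<close> is 1 and not
      \<open>b\<close>, but the factor \<open>real b\<close> is 0.\<close>
    moreover have e: "real b *\<^sub>R F (Suc (b - 1)) x = real b *\<^sub>R F b x" by (cases b) auto
    ultimately show ?thesis unfolding e by (simp add: lad_def algebra_simps)
  qed
qed

text \<open>The operator \<open>(x - d/dx) (x + d/dx)\<close> in direction \<open>i\<close> is twice
  the number operator. In terms of coefficients, the lower index is reached with factor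
  \<open>2 * ladder (n $ i)\<close> and left again with the same factor.\<close>

lemma coef_lad_lad:
  assumes "pd_seq i F"
  shows "coef (lad i (- 1) (lad i 1 F) 0) n = (2 * real (n $ i)) *\<^sub>R coef (F 0) n"
proof -
  have F: "decays (F b)" "has_pd i (F b) x (F (Suc b) x)" for b x
    using assms by (auto simp: pd_seq_def)
  have G: "decays (lad i 1 F b)" "has_pd i (lad i 1 F b) x (lad i 1 F (Suc b) x)" for b x
    using pd_seq_lad[OF assms, of 1] by (auto simp: pd_seq_def)
  have lad0: "lad i s H 0 = (\<lambda>x. (x $ i) *\<^sub>R H 0 x + s *\<^sub>R H (Suc 0) x)" for s and H :: "nat \<Rightarrow> real^'a \<Rightarrow> 'b"
    by (simp add: lad_def fun_eq_iff)
  have "coef (lad i (- 1) (lad i 1 F) 0) n = (2 * ladder (n $ i)) *\<^sub>R coef (lad i 1 F 0) (upd n i (n $ i - 1))"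
    unfolding lad0[of "- 1"] by (rule coef_raise[OF G(1) G(1) G(2)])
  also have "\<dots> = (2 * real (n $ i)) *\<^sub>R coef (F 0) n"
  proof (cases "n $ i")
    case (Suc l)
    have u: "upd n i (Suc l) = n" using Suc upd_same by metis
    have "coef (lad i 1 F 0) (upd n i (n $ i - 1)) = (2 * ladder (n $ i)) *\<^sub>R coef (F 0) n"
      unfolding lad0[of 1] using coef_lower[OF F(1)[of 0] F(1)[of "Suc 0"] F(2)[of 0], of "upd n i (n $ i - 1)"] Suc u
      by simp
    moreover have "2 * ladder (n $ i) * (2 * ladder (n $ i)) = 2 * real (n $ i)"
      using ladder_sq[of "n $ i"] by simp
    ultimately show ?thesis by simp
  qed simp
  finally show ?thesis .
qed

text \<open>One power of the weight pays for the factor \<open>x_i\<close> and one order of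
  differentiation for \<open>d_i\<close>. The three terms contribute \<open>B\<close>, at most
  \<open>real k * B\<close>, and \<open>B\<close>.\<close>

lemma lad_bound:
  assumes F: "\<And>b x. b \<le> Suc k \<Longrightarrow> wx x ^ Suc m * norm (F b x) \<le> B" and s: "\<bar>s\<bar> = 1" and b: "b \<le> k"
  shows "wx x ^ m * norm (lad i s F b x) \<le> (real k + 2) * B"
proof -
  have B: "0 \<le> B" using order.trans[OF _ F[of 0 x]] by simp
  have le: "wx x ^ m * norm (F c x) \<le> B" if "c \<le> Suc k" for c
  proof -
    have "wx x ^ m * norm (F c x) \<le> wx x ^ Suc m * norm (F c x)"
      by (intro mult_right_mono power_increasing) auto
    then show ?thesis using F[OF that, of x] by linarith
  qed
  have "norm (lad i s F b x) \<le> \<bar>x $ i\<bar> * norm (F b x) + real b * norm (F (b - 1) x) + norm (F (Suc b) x)"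
    unfolding lad_def
    by (intro order.trans[OF norm_triangle_ineq] add_mono order.refl) (simp_all add: s)
  also have "\<dots> \<le> wx x * norm (F b x) + real k * norm (F (b - 1) x) + norm (F (Suc b) x)"
    using b by (intro add_mono mult_right_mono component_le_wx) auto
  finally have "wx x ^ m * norm (lad i s F b x) \<le>
      wx x ^ m * (wx x * norm (F b x) + real k * norm (F (b - 1) x) + norm (F (Suc b) x))"
    by (intro mult_left_mono) auto
  also have "\<dots> = wx x ^ Suc m * norm (F b x) + real k * (wx x ^ m * norm (F (b - 1) x)) +
      wx x ^ m * norm (F (Suc b) x)" by (simp add: algebra_simps)
  also have "\<dots> \<le> B + real k * B + B"
    using b F[of b x] by (intro add_mono mult_left_mono le) auto
  finally show ?thesis by (simp add: algebra_simps)
qed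

definition number_op ::
  "'d::finite \<Rightarrow> (nat \<Rightarrow> real^'d \<Rightarrow> 'b::{banach, second_countable_topology}) \<Rightarrow> nat \<Rightarrow> real^'d \<Rightarrow> 'b" where
  "number_op i F = lad i (- 1) (lad i 1 F)"

lemma number_op_power:
  assumes "pd_seq i F"
  shows "pd_seq i ((number_op i ^^ J) F)"
    and "coef ((number_op i ^^ J) F 0) n = (2 * real (n $ i)) ^ J *\<^sub>R coef (F 0) n"
proof (induction J)
  case 0
  { case 1 show ?case using assms by simp next case 2 show ?case by simp }
next
  case (Suc J)
  {
    case 1
    show ?case using Suc(1) by (simp add: number_op_def pd_seq_lad)
  next
    case 2
    show ?case using coef_lad_lad[OF Suc(1), of n] Suc(2) by (simp add: number_op_def)
  }
qed

text \<open>Each application costs two derivatives and two powers of the weight. The constant is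
  chosen before the function, its bound and \<open>m\<close>, since it will be used for all
  functionals at once; the factors \<open>k + 2\<close> and \<open>k + 3\<close> come from the two
  uses of \<open>lad_bound\<close>.\<close>

lemma number_op_bound:
  fixes i :: "'d::finite"
  shows "\<exists>C\<ge>0. \<forall>(F :: nat \<Rightarrow> real^'d \<Rightarrow> 'b::{banach, second_countable_topology}) B m. (\<forall>b\<le>k + 2 * J. \<forall>x. wx x ^ (m + 2 * J) * norm (F b x) \<le> B) \<longrightarrow>
     (\<forall>b\<le>k. \<forall>x. wx x ^ m * norm ((number_op i ^^ J) F b x) \<le> C * B)"
proof (induction J arbitrary: k)
  case 0
  show ?case by (rule exI[of _ 1]) simp
next
  case (Suc J)
  obtain C where "0 \<le> C \<and> (\<forall>(F :: nat \<Rightarrow> real^'d \<Rightarrow> 'b) B m. (\<forall>b\<le>k + 2 + 2 * J. \<forall>x. wx x ^ (m + 2 * J) * norm (F b x) \<le> B) \<longrightarrow>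
     (\<forall>b\<le>k + 2. \<forall>x. wx x ^ m * norm ((number_op i ^^ J) F b x) \<le> C * B))"
    using Suc[of "k + 2"] ..
  then have C1: "0 \<le> C" and IH: "\<forall>(F :: nat \<Rightarrow> real^'d \<Rightarrow> 'b) B m. (\<forall>b\<le>k + 2 + 2 * J. \<forall>x. wx x ^ (m + 2 * J) * norm (F b x) \<le> B) \<longrightarrow>
     (\<forall>b\<le>k + 2. \<forall>x. wx x ^ m * norm ((number_op i ^^ J) F b x) \<le> C * B)"
    by (rule conjunct1, rule conjunct2)
  have C2: "wx x ^ m * norm ((number_op i ^^ J) F b x) \<le> C * B"
    if "\<And>b x. b \<le> k + 2 + 2 * J \<Longrightarrow> wx x ^ (m + 2 * J) * norm (F b x) \<le> B" "b \<le> k + 2" for F :: "nat \<Rightarrow> real^'d \<Rightarrow> 'b" and B m b x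
    using IH[THEN spec[of _ F], THEN spec[of _ B], THEN spec[of _ m]] that by blast
  have "wx x ^ m * norm ((number_op i ^^ Suc J) F b x) \<le> (real k + 2) * (real k + 3) * C * B"
    if F: "\<forall>b\<le>k + 2 * Suc J. \<forall>x. wx x ^ (m + 2 * Suc J) * norm (F b x) \<le> B" and b: "b \<le> k" for F :: "nat \<Rightarrow> real^'d \<Rightarrow> 'b" and B m b x
  proof -
    have 1: "wx x ^ Suc (Suc m) * norm ((number_op i ^^ J) F b x) \<le> C * B" if "b \<le> Suc (Suc k)" for b x
      using C2[of "Suc (Suc m)" F B b x] F that by simp
    have 2: "wx x ^ Suc m * norm (lad i 1 ((number_op i ^^ J) F) b x) \<le> (real (Suc k) + 2) * (C * B)"
      if "b \<le> Suc k" for b x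
      by (rule lad_bound[OF 1]) (use that in auto)
    have "wx x ^ m * norm (lad i (- 1) (lad i 1 ((number_op i ^^ J) F)) b x) \<le>
        (real k + 2) * ((real (Suc k) + 2) * (C * B))"
      by (rule lad_bound[OF 2]) (use b in auto)
    then show ?thesis by (simp add: number_op_def algebra_simps)
  qed
  then show ?case using C1 by (intro exI[of _ "(real k + 2) * (real k + 3) * C"]) auto
qed

text \<open>The largest entry of \<open>n\<close> controls the weight. The factor 2 is inserted to
  match the eigenvalue in \<open>coef_lad_lad\<close>.\<close>

lemma wt_power_le:
  "\<exists>i. wt (n :: nat^'d::finite) ^ j \<le> (1 + real CARD('d)) ^ j * (1 + (2 * real (n $ i)) ^ (2 * j))"
proof -
  have "Max (range (($) n)) \<in> range (($) n)" by (rule Max_in) auto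
  then obtain i where max: "Max (range (($) n)) = n $ i" by (rule rangeE)
  have i: "n $ l \<le> n $ i" for l unfolding max[symmetric] by (rule Max_ge) auto
  have "(\<Sum>l\<in>UNIV. (real (n $ l))\<^sup>2) \<le> (\<Sum>l\<in>(UNIV :: 'd set). (real (n $ i))\<^sup>2)"
    using i by (intro sum_mono power_mono) auto
  then have w: "wt n \<le> 1 + real CARD('d) * (real (n $ i))\<^sup>2" by (simp add: wt_def)
  have "wt n ^ j \<le> (1 + real CARD('d)) ^ j * (1 + (2 * real (n $ i)) ^ (2 * j))"
  proof (cases "n $ i")
    case 0
    then have "wt n ^ j \<le> 1 ^ j" using w by (intro power_mono) auto
    also have "\<dots> \<le> (1 + real CARD('d)) ^ j * 1" by simp
    also have "\<dots> \<le> (1 + real CARD('d)) ^ j * (1 + (2 * real (n $ i)) ^ (2 * j))"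
      by (intro mult_left_mono) auto
    finally show ?thesis .
  next
    case (Suc l)
    have "1 \<le> (real (n $ i))\<^sup>2" using Suc by (simp add: one_le_power)
    then have "wt n \<le> (1 + real CARD('d)) * (real (n $ i))\<^sup>2" using w by (simp add: algebra_simps)
    also have "\<dots> \<le> (1 + real CARD('d)) * (2 * real (n $ i))\<^sup>2"
      by (intro mult_left_mono power_mono) auto
    finally have "wt n ^ j \<le> ((1 + real CARD('d)) * (2 * real (n $ i))\<^sup>2) ^ j" by (intro power_mono) auto
    also have "\<dots> = (1 + real CARD('d)) ^ j * (2 * real (n $ i)) ^ (2 * j)"
      by (simp add: power_mult_distrib power_mult)
    also have "\<dots> \<le> (1 + real CARD('d)) ^ j * (1 + (2 * real (n $ i)) ^ (2 * j))"
      by (intro mult_left_mono) auto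
    finally show ?thesis .
  qed
  then show ?thesis by blast
qed

text \<open>The operator of the direction in which \<open>n\<close> is largest, applied
  \<open>2 * j\<close> times, multiplies the coefficient by \<open>(2 n_i) ^ (2 * j)\<close>; hence
  the \<open>4 * j\<close> derivatives and powers of the weight. That direction varies with
  \<open>n\<close>, so derivative sequences are assumed in all directions and the constants are
  summed over them.\<close>

theorem coef_decay:
  "\<exists>C\<ge>0. \<forall>(\<phi> :: real^'d::finite \<Rightarrow> 'b::{banach, second_countable_topology}) B n.
     (\<forall>i. \<exists>F. pd_seq i F \<and> F 0 = \<phi> \<and> (\<forall>b\<le>4 * j. \<forall>x. wx x ^ (CARD('d) + 4 * j) * norm (F b x) \<le> B)) \<longrightarrow>
     wt n ^ j * norm (coef \<phi> n) \<le> C * B"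
proof -
  have "\<exists>C\<ge>0. \<forall>(F :: nat \<Rightarrow> real^'d \<Rightarrow> 'b) B m. (\<forall>b\<le>0 + 2 * (2 * j). \<forall>x. wx x ^ (m + 2 * (2 * j)) * norm (F b x) \<le> B) \<longrightarrow>
     (\<forall>b\<le>0. \<forall>x. wx x ^ m * norm ((number_op i ^^ (2 * j)) F b x) \<le> C * B)" for i :: 'd
    by (rule number_op_bound)
  then obtain D where D: "\<And>i :: 'd. 0 \<le> D i"
    "\<And>(i :: 'd) (F :: nat \<Rightarrow> real^'d \<Rightarrow> 'b) B m x. (\<And>b x. b \<le> 4 * j \<Longrightarrow> wx x ^ (m + 4 * j) * norm (F b x) \<le> B) \<Longrightarrow>
     wx x ^ m * norm ((number_op i ^^ (2 * j)) F 0 x) \<le> D i * B"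
    by (simp add: mult.assoc[symmetric]) metis
  define K where "K = coef_const TYPE('d)"
  have K: "0 \<le> K" by (simp add: K_def coef_const_nonneg)
  define C where "C = (1 + real CARD('d)) ^ j * (K + K * sum D UNIV)"
  have "wt n ^ j * norm (coef \<phi> n) \<le> C * B"
    if \<phi>: "\<forall>i. \<exists>F. pd_seq i F \<and> F 0 = \<phi> \<and> (\<forall>b\<le>4 * j. \<forall>x. wx x ^ (CARD('d) + 4 * j) * norm (F b x) \<le> B)"
    for \<phi> :: "real^'d \<Rightarrow> 'b" and B and n :: "nat^'d"
  proof -
    obtain i where i: "wt n ^ j \<le> (1 + real CARD('d)) ^ j * (1 + (2 * real (n $ i)) ^ (2 * j))"
      using wt_power_le by blast
    obtain F where F: "pd_seq i F" "F 0 = \<phi>" "\<And>b x. b \<le> 4 * j \<Longrightarrow> wx x ^ (CARD('d) + 4 * j) * norm (F b x) \<le> B"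
      using \<phi> by blast
    have B: "0 \<le> B" using order.trans[OF _ F(3)[of 0 0]] by simp
    have c1: "norm (coef \<phi> n) \<le> K * B"
      unfolding K_def
    proof (rule coef_bound)
      show "continuous_on UNIV \<phi>" using F(1,2) by (auto simp: pd_seq_def decays_def)
      fix x
      have "wx x ^ CARD('d) * norm (\<phi> x) \<le> wx x ^ (CARD('d) + 4 * j) * norm (\<phi> x)"
        by (intro mult_right_mono power_increasing) auto
      then show "wx x ^ CARD('d) * norm (\<phi> x) \<le> B" using F(3)[of 0 x] F(2) by simp
    qed
    have "norm (coef ((number_op i ^^ (2 * j)) F 0) n) \<le> K * (D i * B)"
      unfolding K_def
    proof (rule coef_bound)
      show "continuous_on UNIV ((number_op i ^^ (2 * j)) F 0)"
        using number_op_power(1)[OF F(1)] by (auto simp: pd_seq_def decays_def)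
    qed (rule D(2), rule F(3))
    then have c2: "(2 * real (n $ i)) ^ (2 * j) * norm (coef \<phi> n) \<le> K * (D i * B)"
      using number_op_power(2)[OF F(1)] F(2) by simp
    have "D i \<le> sum D UNIV" using D(1) by (intro member_le_sum) auto
    then have c3: "K * (D i * B) \<le> K * (sum D UNIV * B)"
      using K B by (intro mult_left_mono mult_right_mono)
    have "wt n ^ j * norm (coef \<phi> n) \<le>
        (1 + real CARD('d)) ^ j * (1 + (2 * real (n $ i)) ^ (2 * j)) * norm (coef \<phi> n)"
      using i by (rule mult_right_mono) simp
    also have "\<dots> = (1 + real CARD('d)) ^ j * (norm (coef \<phi> n) + (2 * real (n $ i)) ^ (2 * j) * norm (coef \<phi> n))"
      by (simp add: algebra_simps)
    also have "\<dots> \<le> (1 + real CARD('d)) ^ j * (K * B + K * (sum D UNIV * B))"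
      using c1 c2 c3 by (intro mult_left_mono add_mono) auto
    also have "\<dots> = C * B" by (simp add: C_def algebra_simps)
    finally show ?thesis .
  qed
  moreover have "0 \<le> C" using K D(1) by (simp add: C_def sum_nonneg)
  ultimately show ?thesis by blast
qed

text \<open>The functions all of whose Hermite coefficients vanish are stable under multiplication by
  coordinates, hence, expanding the exponential series, by \<open>exp (- |x - a|\<^sup>2 / 8)\<close>. Powers
  of this factor concentrate at \<open>a\<close>.\<close>

definition hermite_null :: "(real^'d::finite \<Rightarrow> 'b::{banach, second_countable_topology}) \<Rightarrow> bool" where
  "hermite_null \<psi> \<longleftrightarrow> decays \<psi> \<and> (\<forall>n. coef \<psi> n = 0)"

lemma hermite_null_add: "hermite_null \<phi> \<Longrightarrow> hermite_null \<psi> \<Longrightarrow> hermite_null (\<lambda>x. \<phi> x + \<psi> x)"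
  by (simp add: hermite_null_def decays_add coef_add)

lemma hermite_null_scaleR: "hermite_null \<phi> \<Longrightarrow> hermite_null (\<lambda>x. c *\<^sub>R \<phi> x)"
  by (simp add: hermite_null_def decays_scaleR coef_scaleR)

lemma hermite_null_zero: "hermite_null (\<lambda>x. 0)"
  by (auto simp: hermite_null_def coef_def intro!: decaysI)

lemma hermite_null_shifted_coordinate: "hermite_null \<psi> \<Longrightarrow> hermite_null (\<lambda>x. (x $ i - a) *\<^sub>R \<psi> x)"
proof -
  assume \<psi>: "hermite_null \<psi>"
  have "hermite_null (\<lambda>x. (x $ i) *\<^sub>R \<psi> x)"
    using \<psi> by (simp add: hermite_null_def decays_mult_x coef_mult_x)
  then have "hermite_null (\<lambda>x. (x $ i) *\<^sub>R \<psi> x + (- a) *\<^sub>R \<psi> x)"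
    by (intro hermite_null_add hermite_null_scaleR \<psi>)
  then show ?thesis by (simp add: scaleR_diff_left)
qed

lemma hermite_null_sum:
  "(\<And>i. i \<in> S \<Longrightarrow> hermite_null (f i)) \<Longrightarrow> hermite_null (\<lambda>x. \<Sum>i\<in>S. f i x)"
proof (induction S rule: infinite_finite_induct)
  case (insert i S)
  then show ?case by (simp add: hermite_null_add)
qed (simp_all add: hermite_null_zero)

lemma hermite_null_dist_power: "hermite_null \<psi> \<Longrightarrow> hermite_null (\<lambda>x. ((norm (x - a))\<^sup>2) ^ k *\<^sub>R \<psi> x)"
proof (induction k)
  case (Suc k)
  have eq: "((norm (x - a))\<^sup>2) ^ Suc k *\<^sub>R \<psi> x =
      (\<Sum>i\<in>UNIV. (x $ i - a $ i) *\<^sub>R (x $ i - a $ i) *\<^sub>R (((norm (x - a))\<^sup>2) ^ k *\<^sub>R \<psi> x))" for x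
  proof -
    have "(norm (x - a))\<^sup>2 = (\<Sum>i\<in>UNIV. (x $ i - a $ i) * (x $ i - a $ i))"
      by (simp add: norm_vec_def L2_set_def sum_nonneg power2_eq_square)
    then show ?thesis by (simp add: scaleR_sum_left[symmetric] sum_distrib_right mult.assoc)
  qed
  show ?case unfolding eq
    by (intro hermite_null_sum hermite_null_shifted_coordinate Suc)
qed simp

lemma hermite_gauss_bound:
  "\<exists>C\<ge>0. \<forall>x. \<bar>hermite n x\<bar> \<le> C * exp (- (3 / 8) * (norm (x :: real^'d::finite))\<^sup>2)"
proof -
  have "\<forall>i. \<exists>C\<ge>0. \<forall>t. \<bar>hermite1 (n $ i) t\<bar> \<le> C * exp (- (3 / 8) * t\<^sup>2)"
    using hermite1_gauss_bound by blast
  then obtain C where C: "\<And>i. 0 \<le> C i" "\<And>i t. \<bar>hermite1 (n $ i) t\<bar> \<le> C i * exp (- (3 / 8) * t\<^sup>2)"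
    by metis
  have "\<bar>hermite n x\<bar> \<le> prod C UNIV * exp (- (3 / 8) * (norm x)\<^sup>2)" for x
  proof -
    have "\<bar>hermite n x\<bar> = (\<Prod>i\<in>UNIV. \<bar>hermite1 (n $ i) (x $ i)\<bar>)" by (simp add: hermite_def abs_prod)
    also have "\<dots> \<le> (\<Prod>i\<in>UNIV. C i * exp (- (3 / 8) * (x $ i)\<^sup>2))"
      using C by (intro prod_mono) auto
    also have "\<dots> = prod C UNIV * exp (\<Sum>i\<in>UNIV. - (3 / 8) * (x $ i)\<^sup>2)"
      by (simp add: prod.distrib exp_sum)
    also have "(\<Sum>i\<in>UNIV. - (3 / 8) * (x $ i)\<^sup>2) = - (3 / 8) * (norm x)\<^sup>2"
      by (simp add: norm_vec_def L2_set_def sum_nonneg sum_distrib_left sum_negf)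
    finally show ?thesis .
  qed
  then show ?thesis using C(1) by (intro exI[of _ "prod C UNIV"]) (simp add: prod_nonneg)
qed

lemma exp_le_wx: "\<exists>C\<ge>0. \<forall>x::'a::real_normed_vector. exp (- (1 / 8) * (norm x)\<^sup>2) \<le> C * (1 / wx x ^ m)"
proof -
  have key: "(1 + t) ^ m * exp (- (1 / 8) * t) \<le> (8 * (real m + 1)) ^ m" if "0 \<le> t" for t :: real
  proof -
    \<comment> \<open>Chosen so that \<open>m * (t / c) \<le> t / 8\<close>; with
      \<open>m + 1\<close> in place of \<open>m\<close> it stays positive at
      \<open>m = 0\<close>.\<close>
    define c where "c = 8 * (real m + 1)"
    have c: "8 \<le> c" by (simp add: c_def)
    have "1 + t \<le> c * (1 + t / c)" using c that by (simp add: field_simps)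
    also have "\<dots> \<le> c * exp (t / c)" using c by (intro mult_left_mono exp_ge_add_one_self) auto
    finally have "(1 + t) ^ m \<le> (c * exp (t / c)) ^ m" using that by (intro power_mono) auto
    also have "\<dots> = c ^ m * exp (real m * (t / c))" by (simp only: power_mult_distrib exp_of_nat_mult)
    also have "\<dots> \<le> c ^ m * exp (t / 8)"
    proof -
      have "real m * (t / c) \<le> t / 8" using that by (simp add: c_def field_simps)
      then show ?thesis using c by (intro mult_left_mono) auto
    qed
    finally have "(1 + t) ^ m * exp (- (1 / 8) * t) \<le> c ^ m * exp (t / 8) * exp (- (1 / 8) * t)"
      by (rule mult_right_mono) simp
    also have "\<dots> = c ^ m" by (simp add: mult.assoc flip: exp_add)
    finally show ?thesis by (simp add: c_def)
  qed
  have "exp (- (1 / 8) * (norm x)\<^sup>2) \<le> (8 * (real m + 1)) ^ m * (1 / wx x ^ m)" for x :: 'a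
    using key[OF zero_le_power2, of "norm x", folded wx_def]
    by (simp add: pos_le_divide_eq mult.commute)
  then show ?thesis by (intro exI[of _ "(8 * (real m + 1)) ^ m"]) auto
qed

lemma hermite_null_gauss:
  fixes \<psi> :: "real^'d::finite \<Rightarrow> 'b::{banach, second_countable_topology}"
  assumes \<psi>: "hermite_null \<psi>"
  shows "hermite_null (\<lambda>x. exp (- (norm (x - a))\<^sup>2 / 8) *\<^sub>R \<psi> x)"
  unfolding hermite_null_def
proof (intro conjI allI)
  have dec: "decays \<psi>" using \<psi> by (simp add: hermite_null_def)
  show "decays (\<lambda>x. exp (- (norm (x - a))\<^sup>2 / 8) *\<^sub>R \<psi> x)"
    by (rule decays_mult[OF dec, of _ 1 0]) (auto intro!: continuous_intros)
  fix n :: "nat^'d"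
  define q where "q x = - (norm (x - a))\<^sup>2 / 8" for x
  define g where "g K x = (\<Sum>k<K. q x ^ k / fact k)" for K x
  have qc: "continuous_on UNIV q" unfolding q_def by (intro continuous_intros) auto
  have null: "hermite_null (\<lambda>x. g K x *\<^sub>R \<psi> x)" for K
  proof -
    have "g K x *\<^sub>R \<psi> x = (\<Sum>k<K. ((- 1 / 8) ^ k / fact k) *\<^sub>R (((norm (x - a))\<^sup>2) ^ k *\<^sub>R \<psi> x))" for x
    proof -
      have "q x ^ k / fact k = (- 1 / 8) ^ k / fact k * ((norm (x - a))\<^sup>2) ^ k" for k
        unfolding q_def power_mult_distrib[symmetric, of "- 1 / 8 :: real"] by (simp flip: power_mult_distrib)
      then show ?thesis by (simp add: g_def scaleR_sum_left)
    qed
    then show ?thesis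
      by (simp only:) (intro hermite_null_sum hermite_null_scaleR hermite_null_dist_power \<psi>)
  qed
  obtain P where P: "0 \<le> P" "\<And>x. wx x ^ 0 * norm (\<psi> x) \<le> P" using decays_bound[OF dec] by blast
  obtain C where C: "0 \<le> C" "\<And>x. \<bar>hermite n x\<bar> \<le> C * exp (- (3 / 8) * (norm x)\<^sup>2)"
    using hermite_gauss_bound by blast
  obtain A where A: "0 \<le> A" "\<And>x::real^'d. exp (- (1 / 8) * (norm x)\<^sup>2) \<le> A * (1 / wx x ^ CARD('d))"
    using exp_le_wx by blast
  define M where "M = P * C * exp ((norm a)\<^sup>2 / 4) * A"
  \<comment> \<open>All partial sums are at most \<open>exp |q x|\<close>, hence at most
    \<open>exp (|x|^2 / 4 + |a|^2 / 4)\<close>. The factor \<open>exp (- 3/8 |x|^2)\<close> of the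
    Hermite function leaves \<open>exp (- 1/8 |x|^2)\<close>, which is integrable independently of
    \<open>K\<close>.\<close>
  have bound: "norm (hermite n x *\<^sub>R (g K x *\<^sub>R \<psi> x)) \<le> M * (1 / wx x ^ CARD('d))" for K x
  proof -
    have "\<bar>g K x\<bar> \<le> (\<Sum>k<K. \<bar>q x\<bar> ^ k / fact k)"
      unfolding g_def by (rule order.trans[OF sum_abs]) (simp add: power_abs)
    also have "\<dots> \<le> exp \<bar>q x\<bar>"
    proof -
      have "summable (\<lambda>k. \<bar>q x\<bar> ^ k / fact k)" using summable_exp[of "\<bar>q x\<bar>"] by (simp add: field_simps)
      then have "(\<Sum>k<K. \<bar>q x\<bar> ^ k / fact k) \<le> (\<Sum>k. \<bar>q x\<bar> ^ k / fact k)"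
        by (rule sum_le_suminf) auto
      then show ?thesis by (simp add: exp_def field_simps)
    qed
    also have "\<dots> \<le> exp ((norm x)\<^sup>2 / 4 + (norm a)\<^sup>2 / 4)"
    proof -
      have "(norm (x - a))\<^sup>2 \<le> (norm x + norm a)\<^sup>2" by (intro power_mono norm_triangle_ineq4) auto
      also have "\<dots> \<le> 2 * (norm x)\<^sup>2 + 2 * (norm a)\<^sup>2"
        using zero_le_power2[of "norm x - norm a"] by (simp add: power2_eq_square algebra_simps)
      finally show ?thesis by (simp add: q_def)
    qed
    finally have gK: "\<bar>g K x\<bar> \<le> exp ((norm x)\<^sup>2 / 4 + (norm a)\<^sup>2 / 4)" .
    have "norm (hermite n x *\<^sub>R (g K x *\<^sub>R \<psi> x)) = \<bar>hermite n x\<bar> * (\<bar>g K x\<bar> * norm (\<psi> x))"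
      by (simp add: abs_mult)
    also have "\<dots> \<le> (C * exp (- (3 / 8) * (norm x)\<^sup>2)) * (exp ((norm x)\<^sup>2 / 4 + (norm a)\<^sup>2 / 4) * P)"
      using C P(1) P(2)[of x] gK by (intro mult_mono) auto
    also have "\<dots> = P * C * exp ((norm a)\<^sup>2 / 4) * exp (- (1 / 8) * (norm x)\<^sup>2)"
      by (simp add: mult_ac flip: exp_add)
    also have "\<dots> \<le> P * C * exp ((norm a)\<^sup>2 / 4) * (A * (1 / wx x ^ CARD('d)))"
      using A P(1) C(1) by (intro mult_left_mono) auto
    finally show ?thesis by (simp add: M_def)
  qed
  have lim: "(\<lambda>K. hermite n x *\<^sub>R (g K x *\<^sub>R \<psi> x)) \<longlonglongrightarrow> hermite n x *\<^sub>R (exp (q x) *\<^sub>R \<psi> x)" for x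
  proof -
    have "(\<lambda>k. q x ^ k / fact k) sums exp (q x)"
      using exp_converges[of "q x"] by (simp add: field_simps)
    then have "(\<lambda>K. g K x) \<longlonglongrightarrow> exp (q x)" by (simp add: sums_def g_def)
    then show ?thesis by (intro tendsto_intros)
  qed
  have "(\<lambda>K. coef (\<lambda>x. g K x *\<^sub>R \<psi> x) n) \<longlonglongrightarrow> coef (\<lambda>x. exp (q x) *\<^sub>R \<psi> x) n"
    unfolding coef_def
  proof (rule integral_dominated_convergence)
    have "continuous_on UNIV (\<lambda>x. hermite n x *\<^sub>R (exp (q x) *\<^sub>R \<psi> x))"
      by (intro continuous_intros qc decays_continuous dec)
    then show "(\<lambda>x. hermite n x *\<^sub>R (exp (q x) *\<^sub>R \<psi> x)) \<in> borel_measurable lborel"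
      using borel_measurable_continuous_onI by auto
    show "(\<lambda>x. hermite n x *\<^sub>R (g K x *\<^sub>R \<psi> x)) \<in> borel_measurable lborel" for K
      by (rule borel_measurable_integrable, rule integrable_hermite) (use null[of K] in \<open>simp add: hermite_null_def\<close>)
    show "integrable lborel (\<lambda>x::real^'d. M * (1 / wx x ^ CARD('d)))"
      using integrable_wx by (rule integrable_mult_right)
  qed (use bound lim in auto)
  then show "coef (\<lambda>x. exp (- (norm (x - a))\<^sup>2 / 8) *\<^sub>R \<psi> x) n = 0"
    using null by (simp add: hermite_null_def q_def LIMSEQ_const_iff)
qed

theorem hermite_null_eq_0:
  fixes \<psi> :: "real^'d::finite \<Rightarrow> 'k::real_or_complex"
  assumes \<psi>: "hermite_null \<psi>"
  shows "\<psi> a = 0"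
proof (rule ccontr)
  assume neq: "\<psi> a \<noteq> 0"
  have dec: "decays \<psi>" using \<psi> by (simp add: hermite_null_def)
  define q where "q x = (norm (x - a))\<^sup>2 / 8" for x
  have null: "hermite_null (\<lambda>x. exp (- real k * q x) *\<^sub>R \<psi> x)" for k
  proof (induction k)
    case (Suc k)
    have eq: "exp (- real (Suc k) * q x) *\<^sub>R \<psi> x = exp (- (norm (x - a))\<^sup>2 / 8) *\<^sub>R (exp (- real k * q x) *\<^sub>R \<psi> x)" for x
    proof -
      have "- real (Suc k) * q x = - (norm (x - a))\<^sup>2 / 8 + - real k * q x"
        by (simp add: q_def field_simps)
      then show ?thesis by (simp only: exp_add scaleR_scaleR)
    qed
    show ?case unfolding eq by (rule hermite_null_gauss[OF Suc])
  qed (simp add: \<psi>)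
  have h0: "hermite 0 a \<noteq> 0" by (simp add: hermite_def hermite1_eq)
  define c where "c = of_real (hermite 0 a) * \<psi> a"
  have c: "c \<noteq> 0" using neq h0 by (simp add: c_def)
  \<comment> \<open>Normalised to the value 1 at \<open>a\<close>. The factor
    \<open>hermite 0\<close>, which is nonzero at \<open>a\<close>, turns the integrals against
    powers of the Gaussian into coefficients at index 0, and these vanish.\<close>
  define \<Phi> where "\<Phi> x = (hermite 0 x *\<^sub>R \<psi> x) / c" for x
  have \<Phi>c: "continuous_on UNIV \<Phi>"
    unfolding \<Phi>_def using c by (intro continuous_intros decays_continuous dec) auto
  have \<Phi>i: "integrable lborel \<Phi>"
    unfolding \<Phi>_def using integrable_hermite[OF dec, of 0] by (rule integrable_divide)
  have \<Phi>a: "\<Phi> a = 1" using c by (simp add: \<Phi>_def c_def scaleR_conv_of_real)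
  have zero: "(\<integral>x. exp (- real k * q x) *\<^sub>R \<Phi> x \<partial>lborel) = 0" for k
  proof -
    have "(\<integral>x. exp (- real k * q x) *\<^sub>R \<Phi> x \<partial>lborel) = (\<integral>x. (hermite 0 x *\<^sub>R (exp (- real k * q x) *\<^sub>R \<psi> x)) / c \<partial>lborel)"
      unfolding \<Phi>_def by (simp add: scaleR_conv_of_real mult.left_commute)
    also have "\<dots> = coef (\<lambda>x. exp (- real k * q x) *\<^sub>R \<psi> x) 0 / c"
      unfolding coef_def by (rule integral_divide_zero)
    finally show ?thesis using null[of k] by (simp add: hermite_null_def)
  qed
  obtain \<delta> where \<delta>: "0 < \<delta>" "\<And>x. norm (x - a) < \<delta> \<Longrightarrow> norm (\<Phi> x - 1) < 1 / 2"
  proof -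
    have "isCont \<Phi> a" using \<Phi>c by (simp add: continuous_on_eq_continuous_at)
    then obtain d where "0 < d" "\<forall>x. dist x a < d \<longrightarrow> dist (\<Phi> x) (\<Phi> a) < 1 / 2"
      unfolding continuous_at_eps_delta by (metis half_gt_zero_iff zero_less_one)
    then show thesis by (intro that[of d]) (auto simp: dist_norm \<Phi>a)
  qed
  define e where "e k x = exp (- real k * q x)" for k x
  have e: "0 < e k x" "e k x \<le> 1" for k x by (auto simp: e_def q_def)
  have ec: "continuous_on UNIV (e k)" for k unfolding e_def q_def by (intro continuous_intros) auto
  have em: "e k \<in> borel_measurable borel" for k by (rule borel_measurable_continuous_onI[OF ec])
  have \<Phi>m: "\<Phi> \<in> borel_measurable borel" by (rule borel_measurable_continuous_onI[OF \<Phi>c])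
  let ?B = "ball a \<delta>"
  have Bfin: "emeasure lborel (ball a r) < \<infinity>" for r by (rule emeasure_bounded_finite) simp
  have iB: "integrable lborel (\<lambda>x. indicator ?B x * e k x)" for k
    by (rule Bochner_Integration.integrable_bound[of lborel "indicator ?B :: _ \<Rightarrow> real"])
       (use Bfin[of \<delta>] em e[of k] in \<open>auto simp: indicator_def less_imp_le\<close>)
  have i1: "integrable lborel (\<lambda>x. e k x *\<^sub>R \<Phi> x)" for k
    by (rule Bochner_Integration.integrable_bound[OF \<Phi>i])
       (use em \<Phi>m e[of k] in \<open>auto simp: abs_of_pos mult_left_le_one_le less_imp_le\<close>)
  define A where "A = (\<integral>x. norm (\<Phi> x) \<partial>lborel)"
  \<comment> \<open>The vanishing integral is split at the ball. Inside, \<open>\<Phi>\<close>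
    differs from 1 by at most 1/2, so half of the mass of \<open>e k\<close> survives; it must be
    compensated from outside, where \<open>e k\<close> is at most
    \<open>exp (- k \<delta>^2 / 8)\<close>.\<close>
  have main: "(1 / 2) * (\<integral>x. indicator ?B x * e k x \<partial>lborel) \<le> exp (- real k * (\<delta>\<^sup>2 / 8)) * A" for k
  proof -
    have eq: "indicator ?B x *\<^sub>R (of_real (e k x) :: 'k) =
        e k x *\<^sub>R \<Phi> x - (indicator ?B x * e k x) *\<^sub>R (\<Phi> x - 1) - (1 - indicator ?B x) *\<^sub>R (e k x *\<^sub>R \<Phi> x)" for x
      by (cases "x \<in> ?B") (auto simp: scaleR_conv_of_real algebra_simps)
    have "integrable lborel (\<lambda>x. (indicator ?B x * e k x) *\<^sub>R (\<Phi> x - 1))"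
    proof (rule Bochner_Integration.integrable_bound[OF iB[of k]])
      have "(\<lambda>x. \<Phi> x - 1) \<in> borel_measurable lborel"
        using borel_measurable_continuous_onI[OF continuous_on_diff[OF \<Phi>c continuous_on_const]] by simp
      then show "(\<lambda>x. (indicator ?B x * e k x) *\<^sub>R (\<Phi> x - 1)) \<in> borel_measurable lborel"
        by (rule borel_measurable_scaleR[OF borel_measurable_integrable[OF iB[of k]]])
      have "norm ((indicator ?B x * e k x) *\<^sub>R (\<Phi> x - 1)) \<le> norm (indicator ?B x * e k x)" for x
      proof (cases "x \<in> ?B")
        case True
        then have "norm (\<Phi> x - 1) < 1 / 2" by (intro \<delta>(2)) (simp add: dist_norm norm_minus_commute)
        then have "norm (\<Phi> x - 1) \<le> 1" by linarith
        then show ?thesis by (simp add: abs_mult mult_left_le)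
      qed simp
      then show "AE x in lborel. norm ((indicator ?B x * e k x) *\<^sub>R (\<Phi> x - 1)) \<le> norm (indicator ?B x * e k x)"
        by (rule AE_I2)
    qed
    note i2 = this
    have i3: "integrable lborel (\<lambda>x. (1 - indicator ?B x) *\<^sub>R (e k x *\<^sub>R \<Phi> x))"
      by (rule Bochner_Integration.integrable_bound[OF i1[of k]])
         (use em \<Phi>m in \<open>auto simp: indicator_def\<close>)
    have "(\<integral>x. indicator ?B x * e k x \<partial>lborel) = norm (of_real (\<integral>x. indicator ?B x * e k x \<partial>lborel) :: 'k)"
      using e[of k] by (simp add: integral_nonneg_AE less_imp_le)
    also have "(of_real (\<integral>x. indicator ?B x * e k x \<partial>lborel) :: 'k) = (\<integral>x. indicator ?B x *\<^sub>R of_real (e k x) \<partial>lborel)"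
      using integral_bounded_linear[OF bounded_linear_of_real[where 'a = 'k] iB[of k]] by (simp add: scaleR_conv_of_real)
    also have "\<dots> = - (\<integral>x. (indicator ?B x * e k x) *\<^sub>R (\<Phi> x - 1) \<partial>lborel) - (\<integral>x. (1 - indicator ?B x) *\<^sub>R (e k x *\<^sub>R \<Phi> x) \<partial>lborel)"
      unfolding eq using i1[of k] i2 i3 zero[of k] by (simp add: e_def)
    also have "norm \<dots> \<le> norm (\<integral>x. (indicator ?B x * e k x) *\<^sub>R (\<Phi> x - 1) \<partial>lborel) + norm (\<integral>x. (1 - indicator ?B x) *\<^sub>R (e k x *\<^sub>R \<Phi> x) \<partial>lborel)"
      using norm_triangle_ineq4[of "- (\<integral>x. (indicator ?B x * e k x) *\<^sub>R (\<Phi> x - 1) \<partial>lborel)"] by simp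
    also have "norm (\<integral>x. (indicator ?B x * e k x) *\<^sub>R (\<Phi> x - 1) \<partial>lborel) \<le> (\<integral>x. (1 / 2) * (indicator ?B x * e k x) \<partial>lborel)"
    proof (rule order.trans[OF integral_norm_bound], rule integral_mono[OF integrable_norm[OF i2]])
      show "integrable lborel (\<lambda>x. (1 / 2) * (indicator ?B x * e k x))" using iB[of k] by simp
      show "norm ((indicator ?B x * e k x) *\<^sub>R (\<Phi> x - 1)) \<le> (1 / 2) * (indicator ?B x * e k x)" for x
        using \<delta>(2)[of x] e[of k x]
        by (cases "x \<in> ?B") (auto simp: dist_norm norm_minus_commute abs_of_pos)
    qed
    also have "norm (\<integral>x. (1 - indicator ?B x) *\<^sub>R (e k x *\<^sub>R \<Phi> x) \<partial>lborel) \<le> (\<integral>x. exp (- real k * (\<delta>\<^sup>2 / 8)) * norm (\<Phi> x) \<partial>lborel)"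
    proof (rule order.trans[OF integral_norm_bound], rule integral_mono[OF integrable_norm[OF i3]])
      show "integrable lborel (\<lambda>x. exp (- real k * (\<delta>\<^sup>2 / 8)) * norm (\<Phi> x))" using \<Phi>i by simp
      show "norm ((1 - indicator ?B x) *\<^sub>R (e k x *\<^sub>R \<Phi> x)) \<le> exp (- real k * (\<delta>\<^sup>2 / 8)) * norm (\<Phi> x)" for x
      proof (cases "x \<in> ?B")
        case False
        then have "\<delta>\<^sup>2 \<le> (norm (x - a))\<^sup>2"
          using \<delta>(1) by (intro power_mono) (auto simp: dist_norm norm_minus_commute)
        then have "e k x \<le> exp (- real k * (\<delta>\<^sup>2 / 8))"
          unfolding e_def q_def by (auto intro!: mult_left_mono divide_right_mono)
        then show ?thesis using False e[of k x] by (auto simp: abs_of_pos intro!: mult_right_mono)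
      qed simp
    qed
    finally show ?thesis unfolding integral_mult_right_zero A_def by simp
  qed
  \<comment> \<open>On the ball of half the radius \<open>e k\<close> is at least
    \<open>exp (- k \<delta>^2 / 32)\<close>, a slower decay than the one outside the full
    ball.\<close>
  define v where "v = measure lborel (ball a (\<delta> / 2))"
  have v: "0 < v" unfolding v_def using \<delta>(1) by (intro content_ball_pos) auto
  have low: "v * exp (- real k * (\<delta>\<^sup>2 / 32)) \<le> (\<integral>x. indicator ?B x * e k x \<partial>lborel)" for k
  proof -
    have "v * exp (- real k * (\<delta>\<^sup>2 / 32)) = (\<integral>x. indicator (ball a (\<delta> / 2)) x * exp (- real k * (\<delta>\<^sup>2 / 32)) \<partial>lborel)"
      by (simp add: v_def)
    also have "\<dots> \<le> (\<integral>x. indicator ?B x * e k x \<partial>lborel)"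
    proof (rule integral_mono[OF _ iB])
      show "integrable lborel (\<lambda>x. indicator (ball a (\<delta> / 2)) x * exp (- real k * (\<delta>\<^sup>2 / 32)))"
        by (use Bfin[of "\<delta> / 2"] in \<open>auto intro!: integrable_mult_left\<close>)
      show "indicator (ball a (\<delta> / 2)) x * exp (- real k * (\<delta>\<^sup>2 / 32)) \<le> indicator ?B x * e k x" for x
      proof (cases "x \<in> ball a (\<delta> / 2)")
        case True
        then have "(norm (x - a))\<^sup>2 \<le> (\<delta> / 2)\<^sup>2"
          by (intro power_mono) (auto simp: dist_norm norm_minus_commute)
        then have "real k * ((norm (x - a))\<^sup>2 / 8) \<le> real k * (\<delta>\<^sup>2 / 32)"
          by (intro mult_left_mono) (auto simp: power_divide)
        then have "exp (- real k * (\<delta>\<^sup>2 / 32)) \<le> e k x"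
          unfolding e_def q_def by simp
        then show ?thesis using True \<delta>(1) by auto
      qed (use e[of k x] in \<open>auto simp: indicator_def\<close>)
    qed
    finally show ?thesis .
  qed
  \<comment> \<open>The exponent is the gap \<open>1/8 - 1/32 = 3/32\<close>; letting
    \<open>k\<close> tend to infinity contradicts \<open>v > 0\<close>.\<close>
  have "v / 2 \<le> exp (- real k * (3 * \<delta>\<^sup>2 / 32)) * A" for k
  proof -
    have "(v / 2) * exp (- real k * (\<delta>\<^sup>2 / 32)) \<le> exp (- real k * (\<delta>\<^sup>2 / 8)) * A"
      using main[of k] low[of k] by linarith
    also have "exp (- real k * (\<delta>\<^sup>2 / 8)) = exp (- real k * (3 * \<delta>\<^sup>2 / 32)) * exp (- real k * (\<delta>\<^sup>2 / 32))"
      by (simp add: algebra_simps flip: exp_add)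
    finally have "(v / 2) * exp (- real k * (\<delta>\<^sup>2 / 32)) \<le>
        (exp (- real k * (3 * \<delta>\<^sup>2 / 32)) * A) * exp (- real k * (\<delta>\<^sup>2 / 32))" by (simp add: mult_ac)
    then show ?thesis by (rule mult_right_le_imp_le) simp
  qed
  moreover have "(\<lambda>k. exp (- real k * (3 * \<delta>\<^sup>2 / 32)) * A) \<longlonglongrightarrow> 0"
    using \<delta>(1) by real_asymp
  ultimately have "v / 2 \<le> 0" by (intro LIMSEQ_le_const) auto
  then show False using v by simp
qed

section \<open>Riemann sums\<close>

text \<open>The point is moved from \<open>x\<close> to \<open>y\<close> one coordinate at a time.
  All intermediate points stay in the cube around \<open>x\<close>, where the partial derivatives
  are bounded by \<open>K\<close>.\<close>

lemma coordinate_path_bound: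
  fixes \<phi> :: "real^'d::finite \<Rightarrow> 'b::real_normed_vector"
  assumes d: "\<And>i z. has_pd i \<phi> z (\<phi>' i z)"
    and K: "\<And>i z. (\<And>j. \<bar>z $ j - x $ j\<bar> \<le> r) \<Longrightarrow> norm (\<phi>' i z) \<le> K"
    and r: "\<And>j. \<bar>y $ j - x $ j\<bar> \<le> r"
  shows "norm (\<phi> y - \<phi> x) \<le> K * (\<Sum>i\<in>UNIV. \<bar>y $ i - x $ i\<bar>)"
proof -
  have r0: "0 \<le> r" using order.trans[OF abs_ge_zero r] .
  define z where "z S = (\<chi> j. if j \<in> S then y $ j else x $ j)" for S
  have "norm (\<phi> (z S) - \<phi> x) \<le> K * (\<Sum>i\<in>S. \<bar>y $ i - x $ i\<bar>)" if "finite S" for S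
    using that
  proof induction
    case empty
    have "z {} = x" by (simp add: z_def vec_eq_iff)
    then show ?case by simp
  next
    case (insert i S)
    have zi: "z (insert i S) = z S + axis i (y $ i - x $ i)"
      using insert by (auto simp: z_def vec_eq_iff axis_def)
    have "norm (\<phi> (z S + axis i (y $ i - x $ i)) - \<phi> (z S)) \<le> K * \<bar>y $ i - x $ i\<bar>"
    proof (rule has_pd_bound[OF d])
      fix t assume t: "\<bar>t\<bar> \<le> \<bar>y $ i - x $ i\<bar>"
      show "norm (\<phi>' i (z S + axis i t)) \<le> K"
        by (rule K) (use insert t r r0 in \<open>auto simp: z_def axis_def intro: order.trans\<close>)
    qed
    then have "norm (\<phi> (z (insert i S)) - \<phi> x) \<le> K * \<bar>y $ i - x $ i\<bar> + norm (\<phi> (z S) - \<phi> x)"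
      unfolding zi using norm_triangle_ineq[of "\<phi> (z S + axis i (y $ i - x $ i)) - \<phi> (z S)" "\<phi> (z S) - \<phi> x"]
      by simp
    then show ?case using insert by (simp add: distrib_left)
  qed
  from this[of UNIV] show ?thesis by (simp add: z_def)
qed

definition grid_pt :: "nat \<Rightarrow> real^'d::finite \<Rightarrow> real^'d" where
  "grid_pt N x = (\<chi> i. real_of_int \<lfloor>2 ^ N * x $ i\<rfloor> / 2 ^ N)"

text \<open>The box grows at the rate at which the mesh shrinks, so that truncation and
  discretisation both cost an error of order \<open>2 ^ -N\<close>.\<close>

definition grid_box :: "nat \<Rightarrow> (real^'d::finite) set" where
  "grid_box N = {x. \<forall>i. \<bar>x $ i\<bar> \<le> 2 ^ N}"

definition riemann_pts :: "nat \<Rightarrow> (real^'d::finite) set" where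
  "riemann_pts N = grid_pt N ` grid_box N"

definition riemann_cell :: "nat \<Rightarrow> real^'d::finite \<Rightarrow> (real^'d) set" where
  "riemann_cell N v = {x \<in> grid_box N. grid_pt N x = v}"

text \<open>Cells on the upper faces of the closed box are degenerate, so the weight is the actual
  measure of a cell and not a power of the mesh.\<close>

definition riemann_wt :: "nat \<Rightarrow> real^'d::finite \<Rightarrow> real" where
  "riemann_wt N v = measure lborel (riemann_cell N v)"

definition riemann_sum :: "nat \<Rightarrow> (real^'d::finite \<Rightarrow> 'b::real_vector) \<Rightarrow> 'b" where
  "riemann_sum N \<phi> = (\<Sum>v\<in>riemann_pts N. riemann_wt N v *\<^sub>R \<phi> v)"

lemma finite_riemann_pts: "finite (riemann_pts N :: (real^'d::finite) set)"
proof (rule finite_subset)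
  show "riemann_pts N \<subseteq> (\<lambda>k. \<chi> i. real_of_int (k i) / 2 ^ N) ` (PiE (UNIV :: 'd set) (\<lambda>_. {- (4 ^ N)..4 ^ N}))"
  proof
    fix v :: "real^'d" assume "v \<in> riemann_pts N"
    then obtain x where x: "\<And>i. \<bar>x $ i\<bar> \<le> 2 ^ N" "v = grid_pt N x"
      by (auto simp: riemann_pts_def grid_box_def)
    have "\<lfloor>2 ^ N * x $ i\<rfloor> \<in> {- (4 ^ N)..4 ^ N}" for i
    proof -
      have p: "(4 :: real) ^ N = 2 ^ N * 2 ^ N" by (simp flip: power_mult_distrib)
      have "\<bar>2 ^ N * x $ i\<bar> \<le> 2 ^ N * 2 ^ N" using x(1)[of i] by (simp add: abs_mult)
      then have "- (4 ^ N) \<le> 2 ^ N * x $ i" "2 ^ N * x $ i \<le> 4 ^ N" unfolding p by (auto simp: abs_le_iff)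
      then have "- (4 ^ N) \<le> \<lfloor>2 ^ N * x $ i\<rfloor>" "\<lfloor>2 ^ N * x $ i\<rfloor> \<le> 4 ^ N"
        by (auto simp: le_floor_iff floor_le_iff)
      then show ?thesis by simp
    qed
    then show "v \<in> (\<lambda>k. \<chi> i. real_of_int (k i) / 2 ^ N) ` (PiE UNIV (\<lambda>_. {- (4 ^ N)..4 ^ N}))"
      by (intro image_eqI[of _ _ "\<lambda>i. \<lfloor>2 ^ N * x $ i\<rfloor>"]) (auto simp: x(2) grid_pt_def)
  qed
qed (intro finite_imageI finite_PiE, auto)

lemma riemann_cell_borel: "riemann_cell N v \<in> sets borel"
  and riemann_cell_finite: "emeasure lborel (riemann_cell N v) < \<infinity>"
proof -
  have c: "(\<lambda>x::real^'a. x $ i) \<in> borel_measurable borel" for i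
    by (intro borel_measurable_continuous_onI continuous_intros)
  have eq: "riemann_cell N v =
      (\<Inter>i. (\<lambda>x. x $ i) -` {t. \<bar>t\<bar> \<le> 2 ^ N \<and> real_of_int \<lfloor>2 ^ N * t\<rfloor> / 2 ^ N = v $ i})"
    by (auto simp: riemann_cell_def grid_box_def grid_pt_def vec_eq_iff)
  have "{t :: real. \<bar>t\<bar> \<le> 2 ^ N \<and> real_of_int \<lfloor>2 ^ N * t\<rfloor> / 2 ^ N = s} \<in> sets borel" for s by measurable
  then show "riemann_cell N v \<in> sets borel"
    unfolding eq using measurable_sets[OF c] by (intro sets.countable_INT) auto
  have "bounded (riemann_cell N v)"
  proof (rule boundedI)
    fix x assume "x \<in> riemann_cell N v"
    then have "(\<Sum>i\<in>UNIV. \<bar>x $ i\<bar>) \<le> (\<Sum>i\<in>(UNIV :: 'a set). 2 ^ N)"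
      by (intro sum_mono) (auto simp: riemann_cell_def grid_box_def)
    then show "norm x \<le> (\<Sum>i\<in>(UNIV :: 'a set). 2 ^ N)" using norm_le_l1_cart[of x] by linarith
  qed
  then show "emeasure lborel (riemann_cell N v) < \<infinity>" by (rule emeasure_bounded_finite)
qed

lemma grid_pt_near: "\<bar>grid_pt N x $ i - x $ i\<bar> \<le> (1 / 2) ^ N"
proof -
  have "\<bar>real_of_int \<lfloor>2 ^ N * x $ i\<rfloor> - 2 ^ N * x $ i\<bar> \<le> 1" by linarith
  then have "\<bar>real_of_int \<lfloor>2 ^ N * x $ i\<rfloor> - 2 ^ N * x $ i\<bar> / 2 ^ N \<le> 1 / 2 ^ N"
    by (intro divide_right_mono) auto
  moreover have "\<bar>grid_pt N x $ i - x $ i\<bar> = \<bar>real_of_int \<lfloor>2 ^ N * x $ i\<rfloor> - 2 ^ N * x $ i\<bar> / 2 ^ N"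
  proof -
    have "grid_pt N x $ i - x $ i = (real_of_int \<lfloor>2 ^ N * x $ i\<rfloor> - 2 ^ N * x $ i) / 2 ^ N"
      by (simp add: grid_pt_def diff_divide_distrib)
    then show ?thesis by (simp add: abs_divide)
  qed
  ultimately show ?thesis by (simp add: power_one_over)
qed

definition riemann_const :: "'d::finite itself \<Rightarrow> real" where
  "riemann_const d = (real CARD('d) * (2 + 2 * (real CARD('d))\<^sup>2) ^ CARD('d) + 1) * wx_mass d"

text \<open>The sum is the integral of a step function. Inside the box the mean value inequality
  gives an error proportional to the mesh; outside, one surplus power of the weight of
  \<open>\<phi>\<close> is at least \<open>2 ^ N\<close>. This is why \<open>\<phi>\<close> needs
  one power more than its derivatives.\<close>

theorem riemann_sum_error:
  fixes \<phi> :: "real^'d::finite \<Rightarrow> 'b::{banach, second_countable_topology}"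
  assumes cont: "continuous_on UNIV \<phi>" and d: "\<And>i x. has_pd i \<phi> x (\<phi>' i x)"
    and B: "\<And>x. wx x ^ Suc CARD('d) * norm (\<phi> x) \<le> B"
    and B': "\<And>i x. wx x ^ CARD('d) * norm (\<phi>' i x) \<le> B"
  shows "norm (riemann_sum N \<phi> - integral\<^sup>L lborel \<phi>) \<le> riemann_const TYPE('d) * B * (1 / 2) ^ N"
proof -
  define D where "D = real CARD('d)"
  \<comment> \<open>Compares the weights of two points at distance at most \<open>D\<close>; points
    whose coordinates differ by at most 1 are that close.\<close>
  define Q where "Q = (2 + 2 * D\<^sup>2) ^ CARD('d)"
  have D: "1 \<le> D" by (simp add: D_def Suc_leI)
  have Q: "1 \<le> Q" unfolding Q_def by (rule one_le_power) simp
  have B0: "0 \<le> B" using order.trans[OF _ B[of 0]] by simp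
  have Bw: "wx x ^ CARD('d) * norm (\<phi> x) \<le> B" for x
  proof -
    have "wx x ^ CARD('d) * norm (\<phi> x) \<le> wx x ^ Suc CARD('d) * norm (\<phi> x)"
      by (intro mult_right_mono power_increasing) auto
    then show ?thesis using B[of x] by linarith
  qed
  have int: "integrable lborel \<phi>" by (rule integral_decay(1)[OF cont Bw])
  define s where "s x = (\<Sum>v\<in>riemann_pts N. indicator (riemann_cell N v) x *\<^sub>R \<phi> v)" for x
  have int_cell: "integrable lborel (\<lambda>x. indicator (riemann_cell N v) x *\<^sub>R \<phi> v)" for v
    using riemann_cell_borel riemann_cell_finite by (intro integrable_scaleR_left integrable_real_indicator) auto
  have int_s: "integrable lborel s" unfolding s_def by (intro Bochner_Integration.integrable_sum int_cell)
  have "integral\<^sup>L lborel s = (\<Sum>v\<in>riemann_pts N. (\<integral>x. indicator (riemann_cell N v) x *\<^sub>R \<phi> v \<partial>lborel))"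
    unfolding s_def by (intro Bochner_Integration.integral_sum int_cell)
  also have "\<dots> = riemann_sum N \<phi>"
    unfolding riemann_sum_def riemann_wt_def
  proof (rule sum.cong[OF refl])
    fix v
    have "integrable lborel (indicator (riemann_cell N v) :: real^'d \<Rightarrow> real)"
      using riemann_cell_borel riemann_cell_finite by (intro integrable_real_indicator) auto
    then show "(\<integral>x. indicator (riemann_cell N v) x *\<^sub>R \<phi> v \<partial>lborel) = measure lborel (riemann_cell N v) *\<^sub>R \<phi> v"
      by (simp add: integral_scaleR_left)
  qed
  finally have is_eq: "integral\<^sup>L lborel s = riemann_sum N \<phi>" .
  have s_eq: "s x = (if x \<in> grid_box N then \<phi> (grid_pt N x) else 0)" for x
  proof (cases "x \<in> grid_box N")
    case True
    have "s x = (\<Sum>v\<in>{grid_pt N x}. indicator (riemann_cell N v) x *\<^sub>R \<phi> v)"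
      unfolding s_def using True
      by (intro sum.mono_neutral_right finite_riemann_pts)
         (auto simp: riemann_pts_def riemann_cell_def indicator_def)
    then show ?thesis using True by (simp add: riemann_cell_def)
  next
    case False
    then show ?thesis unfolding s_def by (auto simp: riemann_cell_def indicator_def intro!: sum.neutral)
  qed
  have err: "norm (s x - \<phi> x) \<le> ((D * Q + 1) * B * (1 / 2) ^ N) * (1 / wx x ^ CARD('d))" for x
  proof (cases "x \<in> grid_box N")
    case True
    define r :: real where "r = (1 / 2) ^ N"
    have r: "0 < r" "r \<le> 1" by (auto simp: r_def power_le_one)
    have "norm (\<phi> (grid_pt N x) - \<phi> x) \<le> B * Q / wx x ^ CARD('d) * (\<Sum>i\<in>UNIV. \<bar>grid_pt N x $ i - x $ i\<bar>)"
    proof (rule coordinate_path_bound[OF d])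
      show "\<bar>grid_pt N x $ j - x $ j\<bar> \<le> r" for j unfolding r_def by (rule grid_pt_near)
      fix i z assume z: "\<And>j. \<bar>z $ j - x $ j\<bar> \<le> r"
      have "norm (x - z) \<le> (\<Sum>j\<in>UNIV. \<bar>(x - z) $ j\<bar>)" by (rule norm_le_l1_cart)
      also have "\<dots> \<le> (\<Sum>j\<in>(UNIV :: 'd set). 1)"
        using z r by (intro sum_mono) (auto simp: abs_minus_commute intro: order.trans)
      finally have "norm (x - z) \<le> D" by (simp add: D_def)
      then have "wx x ^ CARD('d) \<le> ((2 + 2 * D\<^sup>2) * wx z) ^ CARD('d)"
        by (intro power_mono wx_near) auto
      then have "wx x ^ CARD('d) * norm (\<phi>' i z) \<le> (Q * wx z ^ CARD('d)) * norm (\<phi>' i z)"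
        unfolding Q_def power_mult_distrib by (rule mult_right_mono) simp
      also have "\<dots> \<le> Q * B" using B'[of z i] Q by (simp add: mult.assoc)
      finally show "norm (\<phi>' i z) \<le> B * Q / wx x ^ CARD('d)" by (simp add: field_simps)
    qed
    also have "\<dots> \<le> B * Q / wx x ^ CARD('d) * (\<Sum>i\<in>(UNIV :: 'd set). r)"
      unfolding r_def using B0 Q by (intro mult_left_mono sum_mono grid_pt_near) auto
    also have "\<dots> = (D * Q * B * r) * (1 / wx x ^ CARD('d))" by (simp add: D_def)
    also have "\<dots> \<le> ((D * Q + 1) * B * r) * (1 / wx x ^ CARD('d))"
      using B0 r by (intro mult_right_mono) (auto simp: algebra_simps)
    finally show ?thesis using True by (simp add: s_eq r_def)
  next
    case False
    then obtain i where "2 ^ N < \<bar>x $ i\<bar>" by (auto simp: grid_box_def not_le)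
    then have w: "2 ^ N \<le> wx x" using component_le_wx[of x i] by linarith
    have "2 ^ N * (wx x ^ CARD('d) * norm (\<phi> x)) \<le> wx x * (wx x ^ CARD('d) * norm (\<phi> x))"
      using w by (rule mult_right_mono) simp
    also have "\<dots> \<le> B" using B[of x] by (simp add: mult.assoc)
    finally have "norm (\<phi> x) \<le> (1 * B * (1 / 2) ^ N) * (1 / wx x ^ CARD('d))"
      by (simp add: field_simps power_one_over)
    also have "\<dots> \<le> ((D * Q + 1) * B * (1 / 2) ^ N) * (1 / wx x ^ CARD('d))"
      using B0 D Q by (intro mult_right_mono) auto
    finally show ?thesis using False by (simp add: s_eq)
  qed
  have "riemann_sum N \<phi> - integral\<^sup>L lborel \<phi> = (\<integral>x. s x - \<phi> x \<partial>lborel)"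
    using int_s int is_eq by simp
  also have "norm \<dots> \<le> (\<integral>x. norm (s x - \<phi> x) \<partial>lborel)" by (rule integral_norm_bound)
  also have "\<dots> \<le> integral\<^sup>L lborel (\<lambda>x::real^'d. ((D * Q + 1) * B * (1 / 2) ^ N) * (1 / wx x ^ CARD('d)))"
    by (rule integral_mono[OF integrable_norm[OF Bochner_Integration.integrable_diff[OF int_s int]]
          integrable_mult_right[OF integrable_wx]]) (rule err)
  also have "\<dots> = riemann_const TYPE('d) * B * (1 / 2) ^ N"
    unfolding integral_mult_right_zero by (simp add: riemann_const_def wx_mass_def D_def Q_def)
  finally show ?thesis .
qed

section \<open>Vector-valued Schwartz functions\<close>

context lcspace
begin

lemma continuous_map_euclidean_iff:
  fixes f :: "'a::topological_space \<Rightarrow> 'v"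
  shows "continuous_map euclidean (lctop X) f \<longleftrightarrow>
    (\<forall>x. f x \<in> car X) \<and> (\<forall>p\<in>sn X. \<forall>x. ((\<lambda>z. p (f z - f x)) \<longlongrightarrow> 0) (at x))"
proof -
  have "atin euclidean x = at x" for x :: 'a
    by (auto simp: filter_eq_iff eventually_atin eventually_at_topological)
  then show ?thesis unfolding continuous_map_atin limitin_lctop_iff by auto
qed

lemma has_partial_iff:
  assumes "\<And>x. f x \<in> car X"
  shows "has_partial X i f x l \<longleftrightarrow> l \<in> car X \<and>
    (\<forall>p\<in>sn X. ((\<lambda>h. p (scl X (of_real (1 / h)) (f (x + axis i h) - f x) - l)) \<longlongrightarrow> 0) (at 0))"
  unfolding has_partial_def limitin_lctop_iff using assms by simp

lemma has_partial_unique: "has_partial X i f x l \<Longrightarrow> has_partial X i f x m \<Longrightarrow> l = m"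
  unfolding has_partial_def by (rule limitin_Hausdorff_unique[OF _ _ _ Hausdorff]) auto

lemma partial_eqI: "has_partial X i f x l \<Longrightarrow> partial X i f x = l"
  unfolding partial_def by (rule the_equality) (auto intro: has_partial_unique)

lemma has_partial_add:
  assumes f: "\<And>x. f x \<in> car X" and g: "\<And>x. g x \<in> car X"
    and "has_partial X i f x l" "has_partial X i g x m"
  shows "has_partial X i (f + g) x (l + m)"
proof -
  have fg: "(f + g) x \<in> car X" for x using f g by simp
  have l: "l \<in> car X" and m: "m \<in> car X" using assms has_partial_iff by blast+
  show ?thesis
    unfolding has_partial_iff[of "f + g", OF fg]
  proof (intro conjI ballI)
    fix p assume p: "p \<in> sn X"
    note sp = sn_seminorm[OF p]
    let ?D = "\<lambda>f l h. scl X (of_real (1 / h)) (f (x + axis i h) - f x) - l"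
    show "((\<lambda>h. p (?D (f + g) (l + m) h)) \<longlongrightarrow> 0) (at 0)"
    proof (rule Lim_null_comparison)
      have D: "?D (f + g) (l + m) h = ?D f l h + ?D g m h" for h
        by (simp add: scl_rules)
      have "norm (p (?D (f + g) (l + m) h)) \<le> p (?D f l h) + p (?D g m h)" for h
      proof -
        have "?D f l h \<in> car X" "?D g m h \<in> car X" using f g l m by auto
        then show ?thesis
          unfolding D using p_triangle[OF sp, of "?D f l h" "?D g m h"] p_nonneg[OF sp, of "?D f l h + ?D g m h"]
          by (simp only: real_norm_def abs_of_nonneg add_in)
      qed
      then show "\<forall>\<^sub>F h in at 0. norm (p (?D (f + g) (l + m) h)) \<le> p (?D f l h) + p (?D g m h)" by simp
      have "((\<lambda>h. p (?D f l h)) \<longlongrightarrow> 0) (at 0)" "((\<lambda>h. p (?D g m h)) \<longlongrightarrow> 0) (at 0)"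
        using assms(3,4) p has_partial_iff[of f, OF f] has_partial_iff[of g, OF g] by blast+
      then show "((\<lambda>h. p (?D f l h) + p (?D g m h)) \<longlongrightarrow> 0) (at 0)"
        by (rule tendsto_add_zero)
    qed
  qed (use l m in simp)
qed

lemma has_partial_scl:
  assumes f: "\<And>x. f x \<in> car X" and d: "has_partial X i f x l"
  shows "has_partial X i (\<lambda>x. scl X a (f x)) x (scl X a l)"
proof -
  have l: "l \<in> car X" using assms has_partial_iff by blast
  have af: "scl X a (f x) \<in> car X" for x using f by simp
  show ?thesis
    unfolding has_partial_iff[of "\<lambda>x. scl X a (f x)", OF af]
  proof (intro conjI ballI)
    fix p assume p: "p \<in> sn X"
    let ?D = "\<lambda>h. scl X (of_real (1 / h)) (f (x + axis i h) - f x) - l"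
    have "scl X (of_real (1 / h)) (scl X a (f (x + axis i h)) - scl X a (f x)) - scl X a l = scl X a (?D h)" for h
      by (simp add: scl_rules mult.commute)
    then have "p (scl X (of_real (1 / h)) (scl X a (f (x + axis i h)) - scl X a (f x)) - scl X a l) = norm a * p (?D h)" for h
      using p_scl[OF sn_seminorm[OF p], of "?D h" a] f l by simp
    moreover have "((\<lambda>h. p (?D h)) \<longlongrightarrow> 0) (at 0)" using d p has_partial_iff[of f, OF f] by blast
    ultimately show "((\<lambda>h. p (scl X (of_real (1 / h)) (scl X a (f (x + axis i h)) - scl X a (f x)) - scl X a l)) \<longlongrightarrow> 0) (at 0)"
      by (simp add: tendsto_mult_right_zero)
  qed (use l in simp)
qed

lemma has_partial_dual:
  assumes f: "\<And>x. f x \<in> car X" and d: "has_partial X i f x l" and u: "u \<in> dual X"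
  shows "has_pd i (\<lambda>x. u (f x)) x (u l)"
proof -
  have l: "l \<in> car X" using assms has_partial_iff by blast
  obtain p C where p: "p \<in> sn X" and C: "\<And>x. x \<in> car X \<Longrightarrow> norm (u x) \<le> C * p x"
    using dual_bound[OF u] by blast
  let ?D = "\<lambda>h. scl X (of_real (1 / h)) (f (x + axis i h) - f x) - l"
  have "((\<lambda>h. u (?D h)) \<longlongrightarrow> 0) (at 0)"
  proof (rule Lim_null_comparison)
    show "\<forall>\<^sub>F h in at 0. norm (u (?D h)) \<le> C * p (?D h)" using C f l by simp
    show "((\<lambda>h. C * p (?D h)) \<longlongrightarrow> 0) (at 0)"
      using d p has_partial_iff[of f, OF f] by (intro tendsto_mult_right_zero) blast
  qed
  moreover have "u (?D h) = (1 / h) *\<^sub>R (u (f (x + axis i h)) - u (f x)) - u l" for h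
    using f l by (simp add: dualD[OF u] scaleR_conv_of_real)
  ultimately show ?thesis unfolding has_pd_iff by (simp add: LIM_zero_iff)
qed

lemma continuous_dual:
  fixes f :: "'a::topological_space \<Rightarrow> 'v"
  assumes "continuous_map euclidean (lctop X) f" "u \<in> dual X"
  shows "continuous_on UNIV (\<lambda>x. u (f x))"
proof -
  have "continuous_map (lctop X) euclidean u" using assms(2) by (simp add: dual_iff cont_linear_lcs_def)
  from continuous_map_compose[OF assms(1) this] show ?thesis by (simp add: o_def)
qed

lemma Cinf_continuous: "f \<in> Cinf X \<Longrightarrow> continuous_map euclidean (lctop X) f"
proof -
  assume "f \<in> Cinf X"
  then have "f \<in> Ck X 0" unfolding Cinf_def by blast
  then show ?thesis by simp
qed

lemma Cinf_in: "f \<in> Cinf X \<Longrightarrow> f x \<in> car X"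
  using Cinf_continuous continuous_map_euclidean_iff by blast

lemma Cinf_has_partial: "f \<in> Cinf X \<Longrightarrow> has_partial X i f x (partial X i f x)"
proof -
  assume "f \<in> Cinf X"
  then have "f \<in> Ck X (Suc 0)" unfolding Cinf_def by blast
  then obtain l where "has_partial X i f x l" unfolding Ck.simps by blast
  then show ?thesis using partial_eqI by metis
qed

lemma Cinf_partial: "f \<in> Cinf X \<Longrightarrow> partial X i f \<in> Cinf X"
  unfolding Cinf_def
proof
  fix k assume "f \<in> (\<Inter>k. Ck X k)"
  then have "f \<in> Ck X (Suc k)" by blast
  then show "partial X i f \<in> Ck X k" by simp
qed

text \<open>Smoothness is a greatest fixed point. Sums, multiples and Hermite series are shown
  smooth by exhibiting a family of continuous functions that is closed under partial
  derivatives.\<close>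

lemma Cinf_coinduct:
  assumes "f \<in> S" "\<And>g. g \<in> S \<Longrightarrow> continuous_map euclidean (lctop X) g"
    and "\<And>g i x. g \<in> S \<Longrightarrow> \<exists>l. has_partial X i g x l" "\<And>g i. g \<in> S \<Longrightarrow> partial X i g \<in> S"
  shows "f \<in> Cinf X"
proof -
  have "g \<in> Ck X k" if "g \<in> S" for g k
    using that by (induction k arbitrary: g) (use assms in auto)
  then show ?thesis using assms(1) by (auto simp: Cinf_def)
qed

lemma partial_add:
  assumes "f \<in> Cinf X" "g \<in> Cinf X"
  shows "partial X i (f + g) = partial X i f + partial X i g"
  using has_partial_add[OF Cinf_in Cinf_in Cinf_has_partial Cinf_has_partial] assms
  by (auto intro!: partial_eqI simp: fun_eq_iff)

lemma partial_scl: "f \<in> Cinf X \<Longrightarrow> partial X i (\<lambda>x. scl X a (f x)) = (\<lambda>x. scl X a (partial X i f x))"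
  using has_partial_scl[OF Cinf_in Cinf_has_partial] by (auto intro!: partial_eqI simp: fun_eq_iff)

lemma Cinf_add:
  assumes "f \<in> Cinf X" "g \<in> Cinf X"
  shows "f + g \<in> Cinf X"
proof (rule Cinf_coinduct[where S = "{f + g | f g. f \<in> Cinf X \<and> g \<in> Cinf X}"])
  show "f + g \<in> {f + g | f g. f \<in> Cinf X \<and> g \<in> Cinf X}" using assms by blast
next
  fix h :: "real^'a \<Rightarrow> 'v" and i
  assume "h \<in> {f + g | f g. f \<in> Cinf X \<and> g \<in> Cinf X}"
  then obtain f g where h: "h = f + g" and f: "f \<in> Cinf X" and g: "g \<in> Cinf X" by blast
  show "\<exists>l. has_partial X i h x l" for x
    unfolding h using has_partial_add[OF Cinf_in[OF f] Cinf_in[OF g] Cinf_has_partial[OF f] Cinf_has_partial[OF g]] by blast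
  show "partial X i h \<in> {f + g | f g. f \<in> Cinf X \<and> g \<in> Cinf X}"
    unfolding h partial_add[OF f g] using f g Cinf_partial by blast
  have "((\<lambda>z. p (h z - h x)) \<longlongrightarrow> 0) (at x)" if p: "p \<in> sn X" for p x
  proof (rule Lim_null_comparison)
    have "h z - h x = (f z - f x) + (g z - g x)" for z by (simp add: h)
    then show "\<forall>\<^sub>F z in at x. norm (p (h z - h x)) \<le> p (f z - f x) + p (g z - g x)"
      using p_triangle[OF sn_seminorm[OF p]] p_nonneg[OF sn_seminorm[OF p]] Cinf_in[OF f] Cinf_in[OF g] by simp
    show "((\<lambda>z. p (f z - f x) + p (g z - g x)) \<longlongrightarrow> 0) (at x)"
      using Cinf_continuous[OF f] Cinf_continuous[OF g] p unfolding continuous_map_euclidean_iff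
      by (intro tendsto_add_zero) blast+
  qed
  then show "continuous_map euclidean (lctop X) h"
    unfolding continuous_map_euclidean_iff using Cinf_in[OF f] Cinf_in[OF g] by (simp add: h)
qed

lemma Cinf_scl:
  assumes "f \<in> Cinf X"
  shows "(\<lambda>x. scl X a (f x)) \<in> Cinf X"
proof (rule Cinf_coinduct[where S = "{\<lambda>x. scl X a (f x) | f. f \<in> Cinf X}"])
  show "(\<lambda>x. scl X a (f x)) \<in> {\<lambda>x. scl X a (f x) | f. f \<in> Cinf X}" using assms by blast
next
  fix h :: "real^'a \<Rightarrow> 'v" and i
  assume "h \<in> {\<lambda>x. scl X a (f x) | f. f \<in> Cinf X}"
  then obtain f where h: "h = (\<lambda>x. scl X a (f x))" and f: "f \<in> Cinf X" by blast
  show "\<exists>l. has_partial X i h x l" for x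
    unfolding h using has_partial_scl[OF Cinf_in[OF f] Cinf_has_partial[OF f]] by blast
  show "partial X i h \<in> {\<lambda>x. scl X a (f x) | f. f \<in> Cinf X}"
    unfolding h partial_scl[OF f] using f Cinf_partial by blast
  have "((\<lambda>z. p (h z - h x)) \<longlongrightarrow> 0) (at x)" if p: "p \<in> sn X" for p x
  proof -
    have "p (h z - h x) = norm a * p (f z - f x)" for z
      unfolding h using p_scl[OF sn_seminorm[OF p], of "f z - f x" a] Cinf_in[OF f] by (simp add: scl_rules)
    then show ?thesis
      using Cinf_continuous[OF f] p unfolding continuous_map_euclidean_iff by (simp add: tendsto_mult_right_zero)
  qed
  then show "continuous_map euclidean (lctop X) h"
    unfolding continuous_map_euclidean_iff using Cinf_in[OF f] by (simp add: h)
qed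

lemma Cinf_partial_power: "f \<in> Cinf X \<Longrightarrow> (partial X i ^^ b) f \<in> Cinf X"
  by (induction b) (auto intro: Cinf_partial)

lemma partial_power_add:
  "f \<in> Cinf X \<Longrightarrow> g \<in> Cinf X \<Longrightarrow> (partial X i ^^ b) (f + g) = (partial X i ^^ b) f + (partial X i ^^ b) g"
  by (induction b) (auto simp: partial_add Cinf_partial_power)

lemma partial_power_scl:
  "f \<in> Cinf X \<Longrightarrow> (partial X i ^^ b) (\<lambda>x. scl X a (f x)) = (\<lambda>x. scl X a ((partial X i ^^ b) f x))"
  by (induction b) (auto simp: partial_scl Cinf_partial_power)

lemma multi_partial_Cinf:
  assumes f: "f \<in> Cinf X"
  shows "multi_partial X \<beta> f \<in> Cinf X"
    and "g \<in> Cinf X \<Longrightarrow> multi_partial X \<beta> (f + g) = multi_partial X \<beta> f + multi_partial X \<beta> g"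
    and "multi_partial X \<beta> (\<lambda>x. scl X a (f x)) = (\<lambda>x. scl X a (multi_partial X \<beta> f x))"
proof -
  let ?F = "\<lambda>xs. foldr (\<lambda>i. partial X i ^^ (\<beta> $ i)) xs"
  have C: "?F xs h \<in> Cinf X" if "h \<in> Cinf X" for xs h
    using that by (induction xs) (auto intro: Cinf_partial_power)
  have "?F xs (f + g) = ?F xs f + ?F xs g" if g: "g \<in> Cinf X" for xs
    by (induction xs) (simp_all only: foldr.simps id_apply o_apply partial_power_add[OF C[OF f] C[OF g]])
  moreover have "?F xs (\<lambda>x. scl X a (f x)) = (\<lambda>x. scl X a (?F xs f x))" for xs
    by (induction xs) (auto simp: partial_power_scl C[OF f])
  ultimately show "multi_partial X \<beta> f \<in> Cinf X"
    and "g \<in> Cinf X \<Longrightarrow> multi_partial X \<beta> (f + g) = multi_partial X \<beta> f + multi_partial X \<beta> g"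
    and "multi_partial X \<beta> (\<lambda>x. scl X a (f x)) = (\<lambda>x. scl X a (multi_partial X \<beta> f x))"
    by (auto simp: multi_partial_def C[OF f])
qed

lemma multi_partial_0 [simp]:
  fixes f :: "(real, 'd::{finite,linorder}) vec \<Rightarrow> 'v"
  shows "multi_partial X 0 f = f"
proof -
  have "foldr (\<lambda>i. partial X i ^^ ((0 :: (nat, 'd) vec) $ i)) xs f = f" for xs by (induction xs) auto
  then show ?thesis by (simp add: multi_partial_def)
qed

text \<open>Pure derivatives in one direction are among the derivatives measured by the Schwartz
  seminorms, and they are the only ones the coefficient estimates ask for.\<close>

lemma multi_partial_single: "multi_partial X (upd 0 i b) f = (partial X i ^^ b) f"
proof -
  have "foldr (\<lambda>j. partial X j ^^ (upd 0 i b $ j)) xs f = (if i \<in> set xs then (partial X i ^^ b) f else f)"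
    if "distinct xs" for xs
    using that by (induction xs) auto
  from this[of "sorted_list_of_set UNIV"] show ?thesis by (simp add: multi_partial_def)
qed

end

section \<open>Seminorms of the Schwartz space\<close>

definition schwartz_seminorm ::
  "('k::real_or_complex, 'e::ab_group_add) lcs \<Rightarrow> nat \<Rightarrow> ('e \<Rightarrow> real) \<Rightarrow> ((real, 'd::{finite,linorder}) vec \<Rightarrow> 'e) \<Rightarrow> real" where
  "schwartz_seminorm E m p f = Sup (schwartz_values E m p f)"

lemma schwartz_simps [simp]:
  "scl (schwartz E) = (\<lambda>a f x. scl E a (f x))"
  "sn (schwartz E) = {schwartz_seminorm E m p | m p. p \<in> sn E}"
  by (auto simp: schwartz_def schwartz_seminorm_def[abs_def])

lemma schwartz_car_iff:
  "f \<in> car (schwartz E) \<longleftrightarrow> f \<in> Cinf E \<and> (\<forall>m. \<forall>p\<in>sn E. \<exists>B. \<forall>\<beta> x. mlength \<beta> \<le> m \<longrightarrow>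
     p (multi_partial E \<beta> f x) * wx x powr (real m / 2) \<le> B)"
proof -
  have "bdd_above (schwartz_values E m p f) \<longleftrightarrow> (\<exists>B. \<forall>\<beta> x. mlength \<beta> \<le> m \<longrightarrow>
     p (multi_partial E \<beta> f x) * wx x powr (real m / 2) \<le> B)" for m p
    unfolding bdd_above_def schwartz_values_def wx_def by auto
  then show ?thesis by (simp add: schwartz_def)
qed

lemma schwartz_Cinf: "f \<in> car (schwartz E) \<Longrightarrow> f \<in> Cinf E"
  by (simp add: schwartz_car_iff)

lemma schwartz_value_le:
  assumes "f \<in> car (schwartz E)" "p \<in> sn E" "mlength \<beta> \<le> m"
  shows "p (multi_partial E \<beta> f x) * wx x powr (real m / 2) \<le> schwartz_seminorm E m p f"
  unfolding schwartz_seminorm_def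
proof (rule cSup_upper)
  show "bdd_above (schwartz_values E m p f)" using assms by (simp add: schwartz_def)
qed (use assms(3) in \<open>auto simp: schwartz_values_def wx_def\<close>)

lemma schwartz_seminorm_least:
  fixes f :: "(real, 'd::{finite,linorder}) vec \<Rightarrow> 'e::ab_group_add"
  assumes "\<And>\<beta> x. mlength \<beta> \<le> m \<Longrightarrow> p (multi_partial E \<beta> f x) * wx x powr (real m / 2) \<le> B"
  shows "schwartz_seminorm E m p f \<le> B"
  unfolding schwartz_seminorm_def
proof (rule cSup_least)
  have "mlength (0 :: (nat, 'd) vec) \<le> m" by (simp add: mlength_def)
  then show "schwartz_values E m p f \<noteq> {}" unfolding schwartz_values_def by blast
qed (use assms in \<open>auto simp: schwartz_values_def wx_def\<close>)

context lcspace
begin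

lemma schwartz_in: "f \<in> car (schwartz X) \<Longrightarrow> f x \<in> car X"
  using schwartz_Cinf Cinf_in by blast

lemma schwartz_value_0:
  fixes f :: "(real, 'd::{finite,linorder}) vec \<Rightarrow> 'v"
  assumes "f \<in> car (schwartz X)" "p \<in> sn X"
  shows "p (f x) \<le> schwartz_seminorm X m p f"
proof -
  have "1 \<le> wx x powr (real m / 2)" by (rule ge_one_powr_ge_zero) auto
  then have "p (f x) * 1 \<le> p (f x) * wx x powr (real m / 2)"
    using p_nonneg[OF sn_seminorm[OF assms(2)] schwartz_in[OF assms(1)]] by (rule mult_left_mono)
  also have "\<dots> \<le> schwartz_seminorm X m p f"
    using schwartz_value_le[OF assms, of 0 m x] by (simp add: mlength_def)
  finally show ?thesis by simp
qed

lemma schwartz_seminorm_nonneg: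
  assumes "f \<in> car (schwartz X)" "p \<in> sn X"
  shows "0 \<le> schwartz_seminorm X m p f"
  using p_nonneg[OF sn_seminorm[OF assms(2)] schwartz_in[OF assms(1)]] schwartz_value_0[OF assms]
  by (rule order.trans)

lemma seminormed_schwartz: "seminormed (schwartz X :: ('k, (real, 'd::{finite,linorder}) vec \<Rightarrow> 'v) lcs)"
proof (rule seminormed.intro)
  let ?S = "schwartz X :: ('k, (real, 'd) vec \<Rightarrow> 'v) lcs"
  interpret V: vector_space "scl X" by (rule vs)
  show vs: "vector_space (scl ?S)"
    by unfold_locales (auto simp: fun_eq_iff V.scale_right_distrib V.scale_left_distrib)
  then interpret W: vector_space "scl ?S" .
  have sum: "f + g \<in> car ?S \<and> schwartz_seminorm X m p (f + g) \<le> schwartz_seminorm X m p f + schwartz_seminorm X m p g"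
    if f: "f \<in> car ?S" and g: "g \<in> car ?S" and p: "p \<in> sn X" for f g m p
  proof -
    have b: "p (multi_partial X \<beta> (f + g) x) * wx x powr (real m / 2) \<le> schwartz_seminorm X m p f + schwartz_seminorm X m p g"
      if "p \<in> sn X" "mlength \<beta> \<le> m" for \<beta> x m p
    proof -
      have "p (multi_partial X \<beta> (f + g) x) \<le> p (multi_partial X \<beta> f x) + p (multi_partial X \<beta> g x)"
        using p_triangle[OF sn_seminorm[OF that(1)] Cinf_in[OF multi_partial_Cinf(1)] Cinf_in[OF multi_partial_Cinf(1)],
            OF schwartz_Cinf[OF f] schwartz_Cinf[OF g]]
        by (simp add: multi_partial_Cinf(2)[OF schwartz_Cinf[OF f] schwartz_Cinf[OF g]])
      then have "p (multi_partial X \<beta> (f + g) x) * wx x powr (real m / 2) \<le>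
          (p (multi_partial X \<beta> f x) + p (multi_partial X \<beta> g x)) * wx x powr (real m / 2)"
        by (rule mult_right_mono) simp
      then show ?thesis
        using schwartz_value_le[OF f that, of x] schwartz_value_le[OF g that, of x] by (simp add: distrib_right)
    qed
    have "f + g \<in> car ?S"
      unfolding schwartz_car_iff using f g b by (blast intro: Cinf_add schwartz_Cinf)
    moreover have "schwartz_seminorm X m p (f + g) \<le> schwartz_seminorm X m p f + schwartz_seminorm X m p g"
      by (rule schwartz_seminorm_least) (rule b[OF p])
    ultimately show ?thesis by blast
  qed
  have scl: "(\<lambda>x. scl X a (f x)) \<in> car ?S \<and> schwartz_seminorm X m p (\<lambda>x. scl X a (f x)) \<le> norm a * schwartz_seminorm X m p f"
    if f: "f \<in> car ?S" and p: "p \<in> sn X" for a f m p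
  proof -
    have b: "p (multi_partial X \<beta> (\<lambda>x. scl X a (f x)) x) * wx x powr (real m / 2) \<le> norm a * schwartz_seminorm X m p f"
      if "p \<in> sn X" "mlength \<beta> \<le> m" for \<beta> x m p
    proof -
      have "p (multi_partial X \<beta> (\<lambda>x. scl X a (f x)) x) = norm a * p (multi_partial X \<beta> f x)"
        using p_scl[OF sn_seminorm[OF that(1)] Cinf_in[OF multi_partial_Cinf(1)[OF schwartz_Cinf[OF f]]]]
        by (simp add: multi_partial_Cinf(3)[OF schwartz_Cinf[OF f]])
      then show ?thesis
        using mult_left_mono[OF schwartz_value_le[OF f that, of x] norm_ge_zero[of a]] by (simp add: mult.assoc)
    qed
    have "(\<lambda>x. scl X a (f x)) \<in> car ?S"
      unfolding schwartz_car_iff using f b by (blast intro: Cinf_scl schwartz_Cinf)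
    moreover have "schwartz_seminorm X m p (\<lambda>x. scl X a (f x)) \<le> norm a * schwartz_seminorm X m p f"
      by (rule schwartz_seminorm_least) (rule b[OF p])
    ultimately show ?thesis by blast
  qed
  obtain p0 where p0: "p0 \<in> sn X" using sn_nonempty by blast
  have zero: "(0 :: (real, 'd) vec \<Rightarrow> 'v) \<in> car ?S"
  proof -
    have hp: "has_partial X i (0 :: (real, 'd) vec \<Rightarrow> 'v) x 0" for i x
      by (simp add: has_partial_iff p_zero[OF sn_seminorm])
    have pz: "partial X i (0 :: (real, 'd) vec \<Rightarrow> 'v) = 0" for i
      using partial_eqI[OF hp] by (simp add: fun_eq_iff)
    have "(0 :: (real, 'd) vec \<Rightarrow> 'v) \<in> Cinf X"
      by (rule Cinf_coinduct[of _ "{0}"])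
         (use hp pz in \<open>auto simp: continuous_map_euclidean_iff p_zero[OF sn_seminorm]\<close>)
    moreover have pp: "(partial X i ^^ b) (0 :: (real, 'd) vec \<Rightarrow> 'v) = 0" for i b
      by (induction b) (simp_all only: funpow.simps id_apply o_apply pz)
    have "foldr (\<lambda>i. partial X i ^^ (\<beta> $ i)) xs (0 :: (real, 'd) vec \<Rightarrow> 'v) = 0" for \<beta> :: "(nat, 'd) vec" and xs
      by (induction xs) (simp_all only: foldr.simps id_apply o_apply pp)
    then have "multi_partial X \<beta> (0 :: (real, 'd) vec \<Rightarrow> 'v) = 0" for \<beta>
      by (simp add: multi_partial_def)
    ultimately show ?thesis by (auto simp: schwartz_car_iff p_zero[OF sn_seminorm])
  qed
  show "module.subspace (scl ?S) (car ?S)"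
    unfolding W.subspace_def using zero sum scl p0 by simp
  fix q assume "q \<in> sn ?S"
  then obtain m p where q: "q = schwartz_seminorm X m p" and p: "p \<in> sn X" by auto
  \<comment> \<open>Only one inequality has been shown so far; applied to the scalar
    \<open>1 / a\<close> it yields the other.\<close>
  have "schwartz_seminorm X m p (\<lambda>x. scl X a (f x)) = norm a * schwartz_seminorm X m p f" if f: "f \<in> car ?S" for a f
  proof (cases "a = 0")
    case True
    have "schwartz_seminorm X m p (\<lambda>x. scl X a (f x)) \<le> 0" using scl[OF f p, of a m] True by simp
    moreover have "0 \<le> schwartz_seminorm X m p (\<lambda>x. scl X a (f x))"
      using scl[OF f p, of a] by (intro schwartz_seminorm_nonneg p) blast
    ultimately show ?thesis using True by simp
  next
    case False
    have af: "(\<lambda>x. scl X a (f x)) \<in> car ?S" using scl[OF f p] by blast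
    have "(\<lambda>x. scl X (1 / a) (scl X a (f x))) = f" using False by (simp add: scl_rules)
    then have "schwartz_seminorm X m p f \<le> norm (1 / a) * schwartz_seminorm X m p (\<lambda>x. scl X a (f x))"
      using scl[OF af p, of "1 / a" m] by simp
    then have "norm a * schwartz_seminorm X m p f \<le> schwartz_seminorm X m p (\<lambda>x. scl X a (f x))"
      using False by (simp add: norm_divide field_simps)
    then show ?thesis using scl[OF f p, of a m] by simp
  qed
  then show "seminorm_on ?S q"
    unfolding seminorm_on_def q using sum p by simp
qed

lemma partial_power_bound:
  fixes f :: "(real, 'd::{finite,linorder}) vec \<Rightarrow> 'v"
  assumes f: "f \<in> car (schwartz X)" and p: "p \<in> sn X" and "b \<le> M" "2 * m \<le> M"
  shows "wx x ^ m * p ((partial X i ^^ b) f x) \<le> schwartz_seminorm X M p f"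
proof -
  have in_car: "(partial X i ^^ b) f x \<in> car X"
    by (intro Cinf_in Cinf_partial_power schwartz_Cinf f)
  have "mlength (upd 0 i b :: (nat, 'd) vec) = b"
    unfolding mlength_def by (simp add: if_distrib sum.delta cong: if_cong)
  then have "p ((partial X i ^^ b) f x) * wx x powr (real M / 2) \<le> schwartz_seminorm X M p f"
    using schwartz_value_le[OF f p, of "upd 0 i b" M x] assms(3) by (simp add: multi_partial_single)
  moreover have "wx x ^ m \<le> wx x powr (real M / 2)"
  proof -
    have "wx x ^ m = wx x powr real m" by (simp add: powr_realpow)
    also have "\<dots> \<le> wx x powr (real M / 2)" using assms(4) by (intro powr_mono) auto
    finally show ?thesis .
  qed
  then have "wx x ^ m * p ((partial X i ^^ b) f x) \<le> p ((partial X i ^^ b) f x) * wx x powr (real M / 2)"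
    using p_nonneg[OF sn_seminorm[OF p] in_car] by (subst mult.commute) (rule mult_left_mono)
  ultimately show ?thesis by linarith
qed

lemma dual_partial_power_bound:
  fixes f :: "(real, 'd::{finite,linorder}) vec \<Rightarrow> 'v"
  assumes f: "f \<in> car (schwartz X)" and p: "p \<in> sn X" and "b \<le> M" "2 * m \<le> M"
    and C: "0 \<le> C" "\<And>z. z \<in> car X \<Longrightarrow> norm (u z) \<le> C * p z"
  shows "wx x ^ m * norm (u ((partial X i ^^ b) f x)) \<le> C * schwartz_seminorm X M p f"
proof -
  have "norm (u ((partial X i ^^ b) f x)) \<le> C * p ((partial X i ^^ b) f x)"
    by (intro C Cinf_in Cinf_partial_power schwartz_Cinf f)
  then have "wx x ^ m * norm (u ((partial X i ^^ b) f x)) \<le> C * (wx x ^ m * p ((partial X i ^^ b) f x))"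
    using mult_left_mono[of "norm (u ((partial X i ^^ b) f x))" _ "wx x ^ m"] by (simp add: mult.left_commute)
  also have "\<dots> \<le> C * schwartz_seminorm X M p f"
    using partial_power_bound[OF f p assms(3,4)] C(1) by (rule mult_left_mono)
  finally show ?thesis .
qed

lemma pd_seq_dual:
  fixes f :: "(real, 'd::{finite,linorder}) vec \<Rightarrow> 'v"
  assumes f: "f \<in> car (schwartz X)" and u: "u \<in> dual X"
  shows "pd_seq i (\<lambda>b x. u ((partial X i ^^ b) f x))"
  unfolding pd_seq_def
proof (intro conjI allI)
  fix b
  have C: "(partial X i ^^ b) f \<in> Cinf X" by (intro Cinf_partial_power schwartz_Cinf f)
  obtain p C where p: "p \<in> sn X" and pC: "0 \<le> C" "\<And>x. x \<in> car X \<Longrightarrow> norm (u x) \<le> C * p x"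
    using dual_bound[OF u] by blast
  show "decays (\<lambda>x. u ((partial X i ^^ b) f x))"
  proof (rule decaysI)
    show "continuous_on UNIV (\<lambda>x. u ((partial X i ^^ b) f x))"
      using Cinf_continuous[OF C] u by (rule continuous_dual)
    show "\<exists>B. \<forall>x. wx x ^ m * norm (u ((partial X i ^^ b) f x)) \<le> B" for m
      using dual_partial_power_bound[OF f p, of b "b + 2 * m" m, OF _ _ pC] by auto
  qed
  show "has_pd i (\<lambda>x. u ((partial X i ^^ b) f x)) x (u ((partial X i ^^ Suc b) f x))" for x
    using has_partial_dual[OF Cinf_in[OF C] Cinf_has_partial[OF C] u] by simp
qed

lemma decays_dual:
  fixes f :: "(real, 'd::{finite,linorder}) vec \<Rightarrow> 'v"
  assumes "f \<in> car (schwartz X)" "u \<in> dual X"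
  shows "decays (\<lambda>x. u (f x))"
proof -
  have "pd_seq i (\<lambda>b x. u ((partial X i ^^ b) f x))" for i by (rule pd_seq_dual[OF assms])
  \<comment> \<open>Any direction serves, since only the derivative of order 0 is used.\<close>
  then have "decays (\<lambda>x. u ((partial X undefined ^^ 0) f x))" unfolding pd_seq_def by blast
  then show ?thesis by simp
qed

text \<open>The constants precede the functional, as required for
  \<open>seminorm_le_by_dual\<close>.\<close>

lemma dual_coef_decay:
  "\<exists>C\<ge>0. \<exists>M. \<forall>f\<in>car (schwartz X :: ('k, (real, 'd::{finite,linorder}) vec \<Rightarrow> 'v) lcs). \<forall>p\<in>sn X. \<forall>u\<in>dual X.
     (\<forall>z\<in>car X. norm (u z) \<le> p z) \<longrightarrow>
     (\<forall>n. wt n ^ j * norm (coef (\<lambda>x. u (f x)) n) \<le> C * schwartz_seminorm X M p f)"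
proof -
  \<comment> \<open>The seminorm of index \<open>M\<close> carries the weight \<open>wx\<close> to
    the power \<open>M / 2\<close>, and \<open>coef_decay\<close> asks for the power
    \<open>CARD('d) + 4 * j\<close>.\<close>
  define M where "M = 2 * (CARD('d) + 4 * j)"
  obtain C where C0: "0 \<le> C" and C: "\<And>(\<phi> :: (real, 'd) vec \<Rightarrow> 'k) B n.
     (\<forall>i. \<exists>F. pd_seq i F \<and> F 0 = \<phi> \<and> (\<forall>b\<le>4 * j. \<forall>x. wx x ^ (CARD('d) + 4 * j) * norm (F b x) \<le> B)) \<Longrightarrow>
     wt n ^ j * norm (coef \<phi> n) \<le> C * B"
    using coef_decay[of j, where 'b = 'k and 'd = 'd] by blast
  have "wt n ^ j * norm (coef (\<lambda>x. u (f x)) n) \<le> C * schwartz_seminorm X M p f"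
    if f: "f \<in> car (schwartz X :: ('k, (real, 'd) vec \<Rightarrow> 'v) lcs)" and p: "p \<in> sn X" and u: "u \<in> dual X"
      and le: "\<forall>z\<in>car X. norm (u z) \<le> p z" for f p u n
  proof (rule C, rule allI)
    fix i
    have "wx x ^ (CARD('d) + 4 * j) * norm (u ((partial X i ^^ b) f x)) \<le> schwartz_seminorm X M p f"
      if "b \<le> 4 * j" for b x
      using dual_partial_power_bound[OF f p, of b M "CARD('d) + 4 * j" 1 u x i] that le
      by (simp add: M_def)
    then show "\<exists>F. pd_seq i F \<and> F 0 = (\<lambda>x. u (f x)) \<and>
        (\<forall>b\<le>4 * j. \<forall>x. wx x ^ (CARD('d) + 4 * j) * norm (F b x) \<le> schwartz_seminorm X M p f)"
      using pd_seq_dual[OF f u, of i]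
      by (intro exI[of _ "\<lambda>b x. u ((partial X i ^^ b) f x)"]) auto
  qed
  then show ?thesis using C0 by blast
qed

end

section \<open>Hermite coefficients as Pettis integrals\<close>

text \<open>A finite combination of values of \<open>f\<close>, hence defined before any integral is
  known to exist. The same combination of point evaluations reappears in the dual of the test
  functions.\<close>

definition (in lcspace) scl_riemann :: "nat \<Rightarrow> (nat, 'd::finite) vec \<Rightarrow> ((real, 'd) vec \<Rightarrow> 'v) \<Rightarrow> 'v" where
  "scl_riemann N n f = (\<Sum>v\<in>riemann_pts N. scl X (of_real (riemann_wt N v * hermite n v)) (f v))"

context lcspace
begin

lemma scl_riemann_in: "(\<And>x. f x \<in> car X) \<Longrightarrow> scl_riemann N n f \<in> car X"
  by (simp add: scl_riemann_def)

lemma dual_scl_riemann: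
  assumes f: "\<And>x. f x \<in> car X" and u: "u \<in> dual X"
  shows "u (scl_riemann N n f) = riemann_sum N (\<lambda>x. hermite n x *\<^sub>R u (f x))"
  unfolding scl_riemann_def riemann_sum_def
  using f by (subst dualD(6)[OF u]) (auto simp: dualD(2)[OF u] scaleR_conv_of_real mult.assoc)

text \<open>\<open>riemann_sum_error\<close> for the product of \<open>u o f\<close> with
  \<open>hermite n\<close>. Here \<open>A\<close> bounds \<open>hermite n\<close> and its first
  derivatives, and the factor 2 accounts for the two terms of the product rule.\<close>

lemma riemann_coef_error:
  "\<exists>K\<ge>0. \<exists>M. \<forall>f\<in>car (schwartz X :: ('k, (real, 'd::{finite,linorder}) vec \<Rightarrow> 'v) lcs). \<forall>p\<in>sn X. \<forall>u\<in>dual X. \<forall>C\<ge>0.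
     (\<forall>z\<in>car X. norm (u z) \<le> C * p z) \<longrightarrow>
     (\<forall>N. norm (u (scl_riemann N n f) - coef (\<lambda>x. u (f x)) n) \<le> K * (C * schwartz_seminorm X M p f) * (1 / 2) ^ N)"
proof -
  define M where "M = 2 * Suc CARD('d)"
  have "\<forall>i. \<exists>A\<ge>0. \<forall>x. wx x ^ 0 * \<bar>hermite_d (upd 0 i (Suc 0)) n x\<bar> \<le> A"
    using hermite_d_bounded by blast
  then obtain A' where A': "\<And>i. 0 \<le> A' i" "\<And>i x. \<bar>hermite_d (upd 0 i (Suc 0)) n x\<bar> \<le> A' i"
    unfolding power_0 mult_1 by metis
  obtain A0 where A0: "0 \<le> A0" "\<And>x. wx x ^ 0 * \<bar>hermite_d 0 n x\<bar> \<le> A0"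
    using hermite_d_bounded by meson
  define A where "A = A0 + sum A' UNIV"
  have A: "0 \<le> A" "\<And>x. \<bar>hermite n x\<bar> \<le> A" "\<And>i x. \<bar>hermite_d (upd 0 i (Suc 0)) n x\<bar> \<le> A"
  proof -
    have s: "A' i \<le> sum A' UNIV" for i using A'(1) by (intro member_le_sum) auto
    have s0: "0 \<le> sum A' UNIV" using A'(1) by (intro sum_nonneg) auto
    show "0 \<le> A" using A0 s0 by (simp add: A_def)
    show "\<bar>hermite n x\<bar> \<le> A" for x using A0(2)[of x] s0 by (simp add: A_def)
    show "\<bar>hermite_d (upd 0 i (Suc 0)) n x\<bar> \<le> A" for i x
      using A'(2)[of i x] s[of i] A0(1) by (simp add: A_def)
  qed
  have rc: "0 \<le> riemann_const TYPE('d)"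
    unfolding riemann_const_def using wx_mass_nonneg[where 'd = 'd] by simp
  have "norm (u (scl_riemann N n f) - coef (\<lambda>x. u (f x)) n) \<le>
      (riemann_const TYPE('d) * (2 * A)) * (C * schwartz_seminorm X M p f) * (1 / 2) ^ N"
    if f: "f \<in> car (schwartz X :: ('k, (real, 'd) vec \<Rightarrow> 'v) lcs)" and p: "p \<in> sn X" and u: "u \<in> dual X"
      and C: "0 \<le> C" "\<forall>z\<in>car X. norm (u z) \<le> C * p z" for f p u C N
  proof -
    define B where "B = C * schwartz_seminorm X M p f"
    have B: "0 \<le> B" using C(1) schwartz_seminorm_nonneg[OF f p] by (simp add: B_def)
    have uf: "wx x ^ Suc CARD('d) * norm (u (f x)) \<le> B" for x
      using dual_partial_power_bound[OF f p, of 0 M "Suc CARD('d)" C u x] C by (simp add: M_def B_def)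
    have uf0: "wx x ^ CARD('d) * norm (u (f x)) \<le> B" for x
    proof -
      have "wx x ^ CARD('d) * norm (u (f x)) \<le> wx x ^ Suc CARD('d) * norm (u (f x))"
        by (intro mult_right_mono power_increasing) auto
      then show ?thesis using uf[of x] by linarith
    qed
    have uf': "wx x ^ CARD('d) * norm (u (partial X i f x)) \<le> B" for x i
      using dual_partial_power_bound[OF f p, of 1 M "CARD('d)" C u x i] C by (simp add: M_def B_def)
    have "norm (riemann_sum N (\<lambda>x. hermite n x *\<^sub>R u (f x)) - integral\<^sup>L lborel (\<lambda>x. hermite n x *\<^sub>R u (f x))) \<le>
        riemann_const TYPE('d) * (2 * A * B) * (1 / 2) ^ N"
    proof (rule riemann_sum_error)
      show "continuous_on UNIV (\<lambda>x. hermite n x *\<^sub>R u (f x))"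
        by (intro continuous_intros decays_continuous decays_dual f u)
      show "has_pd i (\<lambda>x. hermite n x *\<^sub>R u (f x)) x
          (hermite_d (upd 0 i (Suc 0)) n x *\<^sub>R u (f x) + hermite n x *\<^sub>R u (partial X i f x))" for i x
        using hermite_d_has_pd[of i 0 n x] has_partial_dual[OF schwartz_in[OF f] Cinf_has_partial[OF schwartz_Cinf[OF f]] u]
        by (intro has_pd_scaleR) auto
      have *: "W * norm (a *\<^sub>R z) \<le> A * B" if "\<bar>a\<bar> \<le> A" "W * norm z \<le> B" "0 \<le> W" for a W and z :: 'k
      proof -
        have "W * norm (a *\<^sub>R z) = \<bar>a\<bar> * (W * norm z)" by simp
        also have "\<dots> \<le> A * B" using that A(1) by (intro mult_mono) auto
        finally show ?thesis .
      qed
      have "0 \<le> A * B" using A B by simp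
      then show "wx x ^ Suc CARD('d) * norm (hermite n x *\<^sub>R u (f x)) \<le> 2 * A * B" for x
        using *[OF A(2)[of x] uf[of x]] by simp
      show "wx x ^ CARD('d) * norm (hermite_d (upd 0 i (Suc 0)) n x *\<^sub>R u (f x) + hermite n x *\<^sub>R u (partial X i f x)) \<le> 2 * A * B" for i x
      proof -
        have "wx x ^ CARD('d) * norm (hermite_d (upd 0 i (Suc 0)) n x *\<^sub>R u (f x) + hermite n x *\<^sub>R u (partial X i f x)) \<le>
            wx x ^ CARD('d) * (norm (hermite_d (upd 0 i (Suc 0)) n x *\<^sub>R u (f x)) + norm (hermite n x *\<^sub>R u (partial X i f x)))"
          by (intro mult_left_mono norm_triangle_ineq) auto
        then show ?thesis
          using *[OF A(3)[of i x] uf0[of x]] *[OF A(2)[of x] uf'[of x i]] by (simp add: distrib_left)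
      qed
    qed
    then show ?thesis
      using dual_scl_riemann[of f, OF schwartz_in[OF f] u] by (simp add: coef_def B_def mult_ac)
  qed
  moreover have "0 \<le> riemann_const TYPE('d) * (2 * A)" using rc A by simp
  ultimately show ?thesis by blast
qed

lemma has_pettis_integral_hermite_iff:
  assumes f: "f \<in> car (schwartz X :: ('k, (real, 'd::{finite,linorder}) vec \<Rightarrow> 'v) lcs)"
  shows "has_pettis_integral X (\<lambda>x. scl X (of_real (hermite n x)) (f x)) y \<longleftrightarrow>
    y \<in> car X \<and> (\<forall>u\<in>dual X. u y = coef (\<lambda>x. u (f x)) n)"
proof -
  have "(\<lambda>x. u (scl X (of_real (hermite n x)) (f x))) = (\<lambda>x. hermite n x *\<^sub>R u (f x))" if "u \<in> dual X" for u
    using that schwartz_in[OF f] by (simp add: dualD scaleR_conv_of_real)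
  then show ?thesis
    using integrable_hermite[OF decays_dual[OF f]] by (simp add: has_pettis_integral_def coef_def)
qed

lemma hermite_coeff_eqI:
  assumes "f \<in> car (schwartz X :: ('k, (real, 'd::{finite,linorder}) vec \<Rightarrow> 'v) lcs)"
    and "y \<in> car X" "\<And>u. u \<in> dual X \<Longrightarrow> u y = coef (\<lambda>x. u (f x)) n"
  shows "hermite_coeff X n f = y"
  unfolding hermite_coeff_def
  by (rule the_equality) (use assms in \<open>auto simp: has_pettis_integral_hermite_iff intro: dual_separates\<close>)

end

section \<open>Differences and tails of unordered sums\<close>

lemma has_sum_minus:
  fixes f g :: "'i \<Rightarrow> 'b::real_normed_vector"
  assumes "(f has_sum a) A" "(g has_sum b) A"
  shows "((\<lambda>x. f x - g x) has_sum (a - b)) A"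
proof -
  have "sum (\<lambda>x. f x - g x) = (\<lambda>F. sum f F - sum g F)" by (rule ext) (rule sum_subtractf)
  then show ?thesis using assms by (simp add: has_sum_def tendsto_diff)
qed

lemma tail_sum_tendsto_0:
  fixes g :: "'i \<Rightarrow> real"
  assumes "g summable_on UNIV"
  shows "((\<lambda>F. \<Sum>\<^sub>\<infinity>n. if n \<in> F then 0 else g n) \<longlongrightarrow> 0) (finite_subsets_at_top UNIV)"
proof -
  have "((\<lambda>F. infsum g UNIV - sum g F) \<longlongrightarrow> infsum g UNIV - infsum g UNIV) (finite_subsets_at_top UNIV)"
    using infsum_tendsto[OF assms] by (intro tendsto_diff tendsto_const)
  moreover have "\<forall>\<^sub>F F in finite_subsets_at_top UNIV. infsum g UNIV - sum g F = (\<Sum>\<^sub>\<infinity>n. if n \<in> F then 0 else g n)"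
  proof (rule eventually_finite_subsets_at_top_weakI)
    fix F :: "'i set" assume F: "finite F"
    have "((\<lambda>n. if n \<in> F then g n else 0) has_sum sum g F) UNIV"
    proof -
      have "(g has_sum sum g F) F \<longleftrightarrow> ((\<lambda>n. if n \<in> F then g n else 0) has_sum sum g F) UNIV"
        by (rule has_sum_cong_neutral) auto
      then show ?thesis using F by simp
    qed
    then have "((\<lambda>n. g n - (if n \<in> F then g n else 0)) has_sum (infsum g UNIV - sum g F)) UNIV"
      using has_sum_infsum[OF assms] by (rule has_sum_minus[rotated])
    moreover have "(\<lambda>n. g n - (if n \<in> F then g n else 0)) = (\<lambda>n. if n \<in> F then 0 else g n)" by auto
    ultimately show "infsum g UNIV - sum g F = (\<Sum>\<^sub>\<infinity>n. if n \<in> F then 0 else g n)"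
      by (simp add: infsumI)
  qed
  ultimately show ?thesis by (simp add: tendsto_cong)
qed

section \<open>Existence and decay of vector-valued coefficients\<close>

context fc_space
begin

text \<open>Under each functional below \<open>p\<close>, consecutive Riemann sums are both within
  the error bound of the same scalar coefficient; so their difference is geometrically small in
  \<open>p\<close> although no candidate for the limit is known.\<close>

lemma pettis_hermite_exists:
  assumes f: "f \<in> car (schwartz X :: ('k, (real, 'd::{finite,linorder}) vec \<Rightarrow> 'v) lcs)"
  shows "\<exists>y\<in>car X. \<forall>u\<in>dual X. u y = coef (\<lambda>x. u (f x)) n"
proof -
  obtain K M where K: "0 \<le> K" and err: "\<And>f p u C N. f \<in> car (schwartz X :: ('k, (real, 'd) vec \<Rightarrow> 'v) lcs) \<Longrightarrow>
     p \<in> sn X \<Longrightarrow> u \<in> dual X \<Longrightarrow> 0 \<le> C \<Longrightarrow> (\<And>z. z \<in> car X \<Longrightarrow> norm (u z) \<le> C * p z) \<Longrightarrow>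
     norm (u (scl_riemann N n f) - coef (\<lambda>x. u (f x)) n) \<le> K * (C * schwartz_seminorm X M p f) * (1 / 2) ^ N"
    using riemann_coef_error[of n] by blast
  let ?R = "\<lambda>N. scl_riemann N n f"
  have R_in: "?R N \<in> car X" for N by (intro scl_riemann_in schwartz_in f)
  have inc: "\<exists>C. \<forall>N. p (?R (Suc N) - ?R N) \<le> C * (1 / 2) ^ N" if p: "p \<in> sn X" for p
  proof (intro exI allI)
    fix N
    let ?B = "K * schwartz_seminorm X M p f"
    have B: "0 \<le> ?B" using K schwartz_seminorm_nonneg[OF f p] by simp
    show "p (?R (Suc N) - ?R N) \<le> (2 * ?B) * (1 / 2) ^ N"
    proof (rule seminorm_le_by_dual[OF p])
      fix u assume u: "u \<in> dual X" and le: "\<And>z. z \<in> car X \<Longrightarrow> norm (u z) \<le> p z"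
      let ?c = "coef (\<lambda>x. u (f x)) n"
      have e: "norm (u (?R N) - ?c) \<le> ?B * (1 / 2) ^ N" for N
        using err[OF f p u, of 1 N] le by simp
      have "u (?R (Suc N) - ?R N) = (u (?R (Suc N)) - ?c) - (u (?R N) - ?c)"
        using R_in by (simp add: dualD[OF u])
      then have "norm (u (?R (Suc N) - ?R N)) \<le> norm (u (?R (Suc N)) - ?c) + norm (u (?R N) - ?c)"
        using norm_triangle_ineq4 by metis
      also have "\<dots> \<le> ?B * (1 / 2) ^ Suc N + ?B * (1 / 2) ^ N" by (intro add_mono e)
      also have "\<dots> \<le> ?B * (1 / 2) ^ N + ?B * (1 / 2) ^ N"
        using B by (intro add_mono mult_left_mono) auto
      finally show "norm (u (?R (Suc N) - ?R N)) \<le> (2 * ?B) * (1 / 2) ^ N" by simp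
    qed (use R_in in simp)
  qed
  have "range ?R \<subseteq> car X" using R_in by auto
  moreover have "\<forall>p\<in>sn X. \<exists>C. \<forall>N. p (?R (Suc N) - ?R N) \<le> C * (1 / 2) ^ N" using inc by blast
  ultimately have "\<exists>y\<in>car X. \<forall>p\<in>sn X. (\<lambda>N. p (?R N - y)) \<longlonglongrightarrow> 0"
    using fast_complete[unfolded fast_complete_def, THEN spec[of _ ?R]] by blast
  then obtain y where y: "y \<in> car X" "\<And>p. p \<in> sn X \<Longrightarrow> (\<lambda>N. p (?R N - y)) \<longlonglongrightarrow> 0" by blast
  have "u y = coef (\<lambda>x. u (f x)) n" if u: "u \<in> dual X" for u
  proof -
    obtain p C where p: "p \<in> sn X" and C: "0 \<le> C" "\<And>x. x \<in> car X \<Longrightarrow> norm (u x) \<le> C * p x"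
      using dual_bound[OF u] by blast
    have lim0: "(\<lambda>N. u (?R N) - u y) \<longlonglongrightarrow> 0"
    proof (rule Lim_null_comparison)
      show "\<forall>\<^sub>F N in sequentially. norm (u (?R N) - u y) \<le> C * p (?R N - y)"
        using C(2)[of "?R _ - y"] R_in y(1) by (simp add: dualD(5)[OF u])
      show "(\<lambda>N. C * p (?R N - y)) \<longlonglongrightarrow> 0" by (rule tendsto_mult_right_zero[OF y(2)[OF p]])
    qed
    have lim1: "(\<lambda>N. u (?R N) - coef (\<lambda>x. u (f x)) n) \<longlonglongrightarrow> 0"
    proof (rule Lim_null_comparison)
      show "\<forall>\<^sub>F N in sequentially. norm (u (?R N) - coef (\<lambda>x. u (f x)) n) \<le> K * (C * schwartz_seminorm X M p f) * (1 / 2) ^ N"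
        using err[OF f p u C] by simp
      show "(\<lambda>N. K * (C * schwartz_seminorm X M p f) * (1 / 2) ^ N) \<longlonglongrightarrow> 0"
        by (intro tendsto_mult_right_zero LIMSEQ_power_zero) simp
    qed
    show ?thesis by (rule LIMSEQ_unique[OF LIM_zero_cancel[OF lim0] LIM_zero_cancel[OF lim1]])
  qed
  then show ?thesis using y(1) by blast
qed

context
  fixes f :: "(real, 'd::{finite,linorder}) vec \<Rightarrow> 'v"
  assumes f: "f \<in> car (schwartz X)"
begin

lemma hermite_coeff_in: "hermite_coeff X n f \<in> car X"
  and dual_hermite_coeff: "u \<in> dual X \<Longrightarrow> u (hermite_coeff X n f) = coef (\<lambda>x. u (f x)) n"
proof -
  obtain y where "y \<in> car X" "\<forall>u\<in>dual X. u y = coef (\<lambda>x. u (f x)) n"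
    using pettis_hermite_exists[OF f] by blast
  moreover from this have "hermite_coeff X n f = y" by (intro hermite_coeff_eqI f) auto
  ultimately show "hermite_coeff X n f \<in> car X"
    and "u \<in> dual X \<Longrightarrow> u (hermite_coeff X n f) = coef (\<lambda>x. u (f x)) n" by auto
qed

end

lemma hermite_coeff_decay:
  "\<exists>C\<ge>0. \<exists>M. \<forall>f\<in>car (schwartz X :: ('k, (real, 'd::{finite,linorder}) vec \<Rightarrow> 'v) lcs). \<forall>p\<in>sn X. \<forall>n.
     wt n ^ j * p (hermite_coeff X n f) \<le> C * schwartz_seminorm X M p f"
proof -
  obtain C M where C: "0 \<le> C" "\<And>f p u n. f \<in> car (schwartz X :: ('k, (real, 'd) vec \<Rightarrow> 'v) lcs) \<Longrightarrow> p \<in> sn X \<Longrightarrow>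
     u \<in> dual X \<Longrightarrow> (\<And>z. z \<in> car X \<Longrightarrow> norm (u z) \<le> p z) \<Longrightarrow>
     wt n ^ j * norm (coef (\<lambda>x. u (f x)) n) \<le> C * schwartz_seminorm X M p f"
    using dual_coef_decay[of j] by blast
  have "wt n ^ j * p (hermite_coeff X n f) \<le> C * schwartz_seminorm X M p f"
    if f: "f \<in> car (schwartz X :: ('k, (real, 'd) vec \<Rightarrow> 'v) lcs)" and p: "p \<in> sn X" for f p n
  proof -
    have "p (hermite_coeff X n f) \<le> C * schwartz_seminorm X M p f / wt n ^ j"
    proof (rule seminorm_le_by_dual[OF p hermite_coeff_in[OF f]])
      fix u assume u: "u \<in> dual X" and le: "\<And>z. z \<in> car X \<Longrightarrow> norm (u z) \<le> p z"
      show "norm (u (hermite_coeff X n f)) \<le> C * schwartz_seminorm X M p f / wt n ^ j"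
        using C(2)[OF f p u le, of n] by (simp add: dual_hermite_coeff[OF f u] field_simps)
    qed
    then show ?thesis by (simp add: field_simps)
  qed
  then show ?thesis using C(1) by blast
qed

lemma hermite_transform_rapid:
  "f \<in> car (schwartz X :: ('k, (real, 'd::{finite,linorder}) vec \<Rightarrow> 'v) lcs) \<Longrightarrow> hermite_transform X f \<in> car (rapid X)"
  unfolding rapid_iff hermite_transform_def
proof (intro conjI allI ballI)
  fix p j assume f: "f \<in> car (schwartz X :: ('k, (real, 'd) vec \<Rightarrow> 'v) lcs)" and p: "p \<in> sn X"
  obtain C M where "\<forall>f\<in>car (schwartz X :: ('k, (real, 'd) vec \<Rightarrow> 'v) lcs). \<forall>p\<in>sn X. \<forall>n.
     wt n ^ j * p (hermite_coeff X n f) \<le> C * schwartz_seminorm X M p f"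
    using hermite_coeff_decay[of j] by blast
  then show "\<exists>C. \<forall>n. p (hermite_coeff X n f) * wt n ^ j \<le> C" using f p by (metis mult.commute)
qed (rule hermite_coeff_in)

text \<open>The common shape of values, difference quotients and derivatives of a Hermite series:
  the sequence \<open>y\<close> is fixed and real coefficients vary. By \<open>real_wsum_le\<close>
  every estimate becomes a bound of \<open>a n\<close> by a power of \<open>wt n\<close>.\<close>

definition real_wsum :: "((nat, 'd::finite) vec \<Rightarrow> 'v) \<Rightarrow> ((nat, 'd) vec \<Rightarrow> real) \<Rightarrow> 'v" where
  "real_wsum y a = wsum (\<lambda>n. scl X (of_real (a n)) (y n))"

context
  fixes y :: "(nat, 'd::finite) vec \<Rightarrow> 'v"
  assumes y: "y \<in> car (rapid X)"
begin

lemma rapid_real_mult: "(\<And>n. \<bar>a n\<bar> \<le> C * wt n ^ k) \<Longrightarrow> (\<lambda>n. scl X (of_real (a n)) (y n)) \<in> car (rapid X)"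
  by (rule rapid_mult[OF y, of _ C k]) simp

context
  fixes a :: "(nat, 'd) vec \<Rightarrow> real" and C k
  assumes a: "\<And>n. \<bar>a n\<bar> \<le> C * wt n ^ k"
begin

lemma real_wsum_in: "real_wsum y a \<in> car X"
  unfolding real_wsum_def by (rule wsum_in[OF rapid_real_mult[OF a]])

lemma real_wsum_dual: "u \<in> dual X \<Longrightarrow> ((\<lambda>n. a n *\<^sub>R u (y n)) has_sum u (real_wsum y a)) UNIV"
  using wsum_dual[OF rapid_real_mult[OF a]] rapid_in[OF y]
  by (simp add: real_wsum_def dualD scaleR_conv_of_real)

lemma real_wsum_le:
  assumes p: "p \<in> sn X"
  shows "p (real_wsum y a) \<le> C * (\<Sum>\<^sub>\<infinity>n. wt n ^ k * p (y n))"
proof -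
  have "p (real_wsum y a) \<le> (\<Sum>\<^sub>\<infinity>n. p (scl X (of_real (a n)) (y n)))"
    unfolding real_wsum_def by (rule wsum_seminorm_le[OF rapid_real_mult[OF a] p])
  also have "\<dots> \<le> (\<Sum>\<^sub>\<infinity>n. C * (wt n ^ k * p (y n)))"
  proof (rule infsum_mono)
    show "(\<lambda>n. p (scl X (of_real (a n)) (y n))) summable_on UNIV"
      using rapid_summable[OF rapid_real_mult[OF a] p, of 0] by simp
    show "(\<lambda>n. C * (wt n ^ k * p (y n))) summable_on UNIV"
      by (intro summable_on_cmult_right rapid_summable y p)
    show "p (scl X (of_real (a n)) (y n)) \<le> C * (wt n ^ k * p (y n))" for n
      using mult_right_mono[OF a p_nonneg[OF sn_seminorm[OF p] rapid_in[OF y]], of n n]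
      by (simp add: p_scl[OF sn_seminorm[OF p] rapid_in[OF y]] mult.assoc)
  qed
  also have "\<dots> = C * (\<Sum>\<^sub>\<infinity>n. wt n ^ k * p (y n))" by (rule infsum_cmult_right')
  finally show ?thesis .
qed

lemma real_wsum_cmult: "real_wsum y (\<lambda>n. c * a n) = scl X (of_real c) (real_wsum y a)"
  using wsum_scl[OF rapid_real_mult[OF a], of "of_real c"] by (simp add: real_wsum_def scl_rules)

lemma real_wsum_diff:
  assumes b: "\<And>n. \<bar>b n\<bar> \<le> D * wt n ^ l"
  shows "real_wsum y (\<lambda>n. a n - b n) = real_wsum y a - real_wsum y b"
proof -
  have b_in: "real_wsum y b \<in> car X" unfolding real_wsum_def by (rule wsum_in[OF rapid_real_mult[OF b]])
  have b_sum: "((\<lambda>n. b n *\<^sub>R u (y n)) has_sum u (real_wsum y b)) UNIV" if "u \<in> dual X" for u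
    using wsum_dual[OF rapid_real_mult[OF b]] rapid_in[OF y] that
    by (simp add: real_wsum_def dualD scaleR_conv_of_real)
  show ?thesis
    unfolding real_wsum_def[of y "\<lambda>n. a n - b n"]
  proof (rule wsum_eqI)
    show "((\<lambda>n. u (scl X (of_real (a n - b n)) (y n))) has_sum u (real_wsum y a - real_wsum y b)) UNIV"
      if u: "u \<in> dual X" for u
      using has_sum_minus[OF real_wsum_dual[OF u] b_sum[OF u]] rapid_in[OF y] real_wsum_in b_in
      by (simp add: dualD[OF u] scaleR_conv_of_real left_diff_distrib)
  qed (use real_wsum_in b_in in simp)
qed

end

end

end

section \<open>Hermite series\<close>

text \<open>The mean value inequality is used twice, for the derivative and for the function minus
  its linear part at \<open>x\<close>.\<close>

lemma hermite_d_taylor: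
  assumes K: "\<And>z. \<bar>hermite_d (upd \<beta> i (Suc (Suc (\<beta> $ i)))) n z\<bar> \<le> K"
  shows "\<bar>hermite_d \<beta> n (x + axis i h) - hermite_d \<beta> n x - h * hermite_d (upd \<beta> i (Suc (\<beta> $ i))) n x\<bar> \<le> K * \<bar>h\<bar> * \<bar>h\<bar>"
proof -
  let ?g = "hermite_d \<beta> n" and ?g' = "hermite_d (upd \<beta> i (Suc (\<beta> $ i))) n"
  have K0: "0 \<le> K" using order.trans[OF abs_ge_zero K] .
  have g'': "has_pd i ?g' z (hermite_d (upd \<beta> i (Suc (Suc (\<beta> $ i)))) n z)" for z
    using hermite_d_has_pd[of i "upd \<beta> i (Suc (\<beta> $ i))" n z] by simp
  have "norm ((?g (x + axis i h) + (- ?g' x) *\<^sub>R ((x + axis i h) $ i)) - (?g x + (- ?g' x) *\<^sub>R (x $ i))) \<le> K * \<bar>h\<bar> * \<bar>h\<bar>"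
  proof (rule has_pd_bound[where \<phi> = "\<lambda>z. ?g z + (- ?g' x) *\<^sub>R (z $ i)"])
    show "has_pd i (\<lambda>z. ?g z + (- ?g' x) *\<^sub>R (z $ i)) z (?g' z + (- ?g' x) *\<^sub>R 1)" for z
      by (intro has_pd_add hermite_d_has_pd has_pd_scaleR_const has_pd_component)
    fix t assume t: "\<bar>t\<bar> \<le> \<bar>h\<bar>"
    have "norm (?g' (x + axis i t) - ?g' x) \<le> K * \<bar>t\<bar>"
      by (rule has_pd_bound[OF g'']) (simp add: K)
    also have "\<dots> \<le> K * \<bar>h\<bar>" using t K0 by (rule mult_left_mono)
    finally show "norm (?g' (x + axis i t) + (- ?g' x) *\<^sub>R 1) \<le> K * \<bar>h\<bar>" by simp
  qed
  then show ?thesis by (simp add: axis_def algebra_simps)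
qed

lemma coef_hermite_sum:
  fixes a :: "(nat, 'd::finite) vec \<Rightarrow> 'b::{banach, second_countable_topology}"
  shows "coef (\<lambda>x. \<Sum>m\<in>F. hermite m x *\<^sub>R a m) n = (\<Sum>m\<in>F. if m = n then a m else 0)"
proof -
  have i: "integrable lborel (\<lambda>x. hermite n x * hermite m x)" for m
    using integrable_hermite[OF decays_hermite, of n m] by simp
  have "coef (\<lambda>x. \<Sum>m\<in>F. hermite m x *\<^sub>R a m) n = (\<integral>x. (\<Sum>m\<in>F. (hermite n x * hermite m x) *\<^sub>R a m) \<partial>lborel)"
    unfolding coef_def by (simp add: scaleR_sum_right)
  also have "\<dots> = (\<Sum>m\<in>F. (\<integral>x. (hermite n x * hermite m x) *\<^sub>R a m \<partial>lborel))"
    by (rule Bochner_Integration.integral_sum) (rule integrable_scaleR_left, rule i)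
  also have "\<dots> = (\<Sum>m\<in>F. coef (hermite m) n *\<^sub>R a m)"
    unfolding coef_def by (simp add: integral_scaleR_left[OF i])
  also have "\<dots> = (\<Sum>m\<in>F. if m = n then a m else 0)"
    by (rule sum.cong) (auto simp: coef_hermite)
  finally show ?thesis .
qed

section \<open>Seminorms of the space of rapidly decreasing sequences\<close>

definition rapid_seminorm :: "nat \<Rightarrow> ('e \<Rightarrow> real) \<Rightarrow> ((nat, 'd::finite) vec \<Rightarrow> 'e) \<Rightarrow> real" where
  "rapid_seminorm j p y = Sup (rapid_values j p y)"

lemma rapid_simps [simp]:
  "scl (rapid E) = (\<lambda>a y n. scl E a (y n))"
  "sn (rapid E) = {rapid_seminorm j p | j p. 1 \<le> j \<and> p \<in> sn E}"
  by (auto simp: rapid_def rapid_seminorm_def[abs_def])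

lemma rapid_seminorm_least:
  assumes "\<And>n. p (y n) * wt n powr (real j / 2) \<le> B"
  shows "rapid_seminorm j p y \<le> B"
  unfolding rapid_seminorm_def rapid_values_def wt_enorm by (rule cSUP_least) (use assms in auto)

lemma rapid_value_le:
  assumes "y \<in> car (rapid E)" "p \<in> sn E" "1 \<le> j"
  shows "p (y n) * wt n powr (real j / 2) \<le> rapid_seminorm j p y"
  unfolding rapid_seminorm_def
  by (rule cSup_upper) (use assms in \<open>auto simp: rapid_values_def rapid_def wt_enorm\<close>)

context lcspace
begin

text \<open>Passing from a supremum to a sum costs \<open>CARD('d)\<close> powers of the weight, by
  \<open>summable_wt\<close>.\<close>

lemma rapid_sum_le:
  fixes y :: "(nat, 'd::finite) vec \<Rightarrow> 'v"
  assumes y: "y \<in> car (rapid X)" and p: "p \<in> sn X"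
  shows "(\<Sum>\<^sub>\<infinity>n. wt n ^ k * p (y n)) \<le>
    (\<Sum>\<^sub>\<infinity>n::(nat, 'd) vec. 1 / wt n ^ CARD('d)) * rapid_seminorm (2 * (k + CARD('d))) p y"
proof -
  let ?r = "rapid_seminorm (2 * (k + CARD('d))) p y"
  have "(\<Sum>\<^sub>\<infinity>n. wt n ^ k * p (y n)) \<le> (\<Sum>\<^sub>\<infinity>n::(nat, 'd) vec. (1 / wt n ^ CARD('d)) * ?r)"
  proof (rule infsum_mono[OF rapid_summable[OF y p]])
    show "(\<lambda>n::(nat, 'd) vec. (1 / wt n ^ CARD('d)) * ?r) summable_on UNIV"
      by (intro summable_on_cmult_left summable_wt)
    fix n :: "(nat, 'd) vec"
    have e: "real (2 * (k + CARD('d))) / 2 = real (k + CARD('d))" by simp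
    have "p (y n) * wt n ^ (k + CARD('d)) \<le> ?r"
    proof -
      have "1 \<le> 2 * (k + CARD('d))" using zero_less_card_finite[where 'a = 'd] by (simp add: Suc_le_eq)
      from rapid_value_le[OF y p this, of n] show ?thesis unfolding e powr_realpow[OF wt_pos] .
    qed
    then show "wt n ^ k * p (y n) \<le> (1 / wt n ^ CARD('d)) * ?r"
      by (simp add: power_add field_simps)
  qed
  then show ?thesis unfolding infsum_cmult_left' .
qed

lemma seminormed_rapid: "seminormed (rapid X :: ('k, (nat, 'd::finite) vec \<Rightarrow> 'v) lcs)"
proof (rule seminormed.intro)
  let ?S = "rapid X :: ('k, (nat, 'd) vec \<Rightarrow> 'v) lcs"
  interpret V: vector_space "scl X" by (rule vs)
  show vs: "vector_space (scl ?S)"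
    by unfold_locales (auto simp: fun_eq_iff V.scale_right_distrib V.scale_left_distrib)
  then interpret W: vector_space "scl ?S" .
  have zero: "(0 :: (nat, 'd) vec \<Rightarrow> 'v) \<in> car ?S"
    by (auto simp: rapid_iff p_zero[OF sn_seminorm])
  show "module.subspace (scl ?S) (car ?S)"
    by (rule W.subspaceI) (use zero rapid_add rapid_scl in simp_all)
  fix q assume "q \<in> sn ?S"
  then obtain j p where q: "q = rapid_seminorm j p" and j: "1 \<le> j" and p: "p \<in> sn X" by auto
  note sp = sn_seminorm[OF p]
  have add: "q (y + z) \<le> q y + q z" if y: "y \<in> car ?S" and z: "z \<in> car ?S" for y z
    unfolding q
  proof (rule rapid_seminorm_least)
    fix n
    have "p ((y + z) n) * wt n powr (real j / 2) \<le> (p (y n) + p (z n)) * wt n powr (real j / 2)"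
      using p_triangle[OF sp rapid_in[OF y] rapid_in[OF z]] by (intro mult_right_mono) auto
    then show "p ((y + z) n) * wt n powr (real j / 2) \<le> rapid_seminorm j p y + rapid_seminorm j p z"
      using rapid_value_le[OF y p j, of n] rapid_value_le[OF z p j, of n] by (simp add: distrib_right)
  qed
  have le: "q (\<lambda>n. scl X a (y n)) \<le> norm a * q y" if y: "y \<in> car ?S" for a y
    unfolding q
  proof (rule rapid_seminorm_least)
    fix n
    show "p (scl X a (y n)) * wt n powr (real j / 2) \<le> norm a * rapid_seminorm j p y"
      using mult_left_mono[OF rapid_value_le[OF y p j, of n] norm_ge_zero[of a]]
      by (simp add: p_scl[OF sp rapid_in[OF y]] mult.assoc)
  qed
  have nonneg: "0 \<le> q y" if y: "y \<in> car ?S" for y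
  proof -
    have "0 \<le> p (y 0) * wt (0 :: (nat, 'd) vec) powr (real j / 2)" using p_nonneg[OF sp rapid_in[OF y]] by simp
    then show ?thesis using rapid_value_le[OF y p j, of 0] unfolding q by linarith
  qed
  have "q (\<lambda>n. scl X a (y n)) = norm a * q y" if y: "y \<in> car ?S" for a y
  proof (cases "a = 0")
    case True
    then show ?thesis using le[OF y, of a] nonneg[OF rapid_scl[OF y], of a] by simp
  next
    case False
    have "(\<lambda>n. scl X (1 / a) (scl X a (y n))) = y" using False by (simp add: scl_rules)
    then have "q y \<le> norm (1 / a) * q (\<lambda>n. scl X a (y n))"
      using le[OF rapid_scl[OF y], of "1 / a" a] by simp
    then have "norm a * q y \<le> q (\<lambda>n. scl X a (y n))" using False by (simp add: norm_divide field_simps)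
    then show ?thesis using le[OF y, of a] by simp
  qed
  then show "seminorm_on ?S q" unfolding seminorm_on_def using add by simp
qed

end

section \<open>The Hermite series as a smooth function\<close>

context fc_space
begin

text \<open>The index \<open>\<beta>\<close> makes the family closed under partial derivatives; the
  case \<open>\<beta> = 0\<close> is the inverse transform.\<close>

definition hermite_series :: "(nat, 'd::finite) vec \<Rightarrow> ((nat, 'd) vec \<Rightarrow> 'v) \<Rightarrow> (real, 'd) vec \<Rightarrow> 'v" where
  "hermite_series \<beta> y x = real_wsum y (\<lambda>n. hermite_d \<beta> n x)"

lemma hermite_series_add:
  assumes y: "y \<in> car (rapid X)" and z: "z \<in> car (rapid X)"
  shows "hermite_series \<beta> (y + z) x = hermite_series \<beta> y x + hermite_series \<beta> z x"
proof -
  obtain C k where C: "\<And>n x. wx x ^ 0 * \<bar>hermite_d \<beta> n x\<bar> \<le> C * wt n ^ k" using hermite_d_bound by meson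
  have "(\<lambda>n. scl X (of_real (hermite_d \<beta> n x)) (y n)) \<in> car (rapid X)"
    "(\<lambda>n. scl X (of_real (hermite_d \<beta> n x)) (z n)) \<in> car (rapid X)"
    using C by (auto intro!: rapid_real_mult[OF y] rapid_real_mult[OF z])
  from wsum_add[OF this] show ?thesis by (simp add: hermite_series_def real_wsum_def scl_rules)
qed

lemma hermite_series_scl:
  assumes y: "y \<in> car (rapid X)"
  shows "hermite_series \<beta> (\<lambda>n. scl X a (y n)) x = scl X a (hermite_series \<beta> y x)"
proof -
  obtain C k where C: "\<And>n x. wx x ^ 0 * \<bar>hermite_d \<beta> n x\<bar> \<le> C * wt n ^ k" using hermite_d_bound by meson
  have "(\<lambda>n. scl X (of_real (hermite_d \<beta> n x)) (y n)) \<in> car (rapid X)"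
    using C by (auto intro!: rapid_real_mult[OF y])
  from wsum_scl[OF this, of a] show ?thesis
    by (simp add: hermite_series_def real_wsum_def scl_rules mult.commute)
qed

lemma hermite_series_finite:
  assumes "finite F" "\<And>n. n \<in> F \<Longrightarrow> y n \<in> car X" "\<And>n. n \<notin> F \<Longrightarrow> y n = 0"
  shows "hermite_series 0 y x = (\<Sum>n\<in>F. scl X (of_real (hermite n x)) (y n))"
  unfolding hermite_series_def real_wsum_def hermite_d_0
  by (rule wsum_finite[OF assms(1)]) (use assms in auto)

lemma hermite_series_bound:
  "\<exists>C\<ge>0. \<exists>k. \<forall>y\<in>car (rapid X :: ('k, (nat, 'd::finite) vec \<Rightarrow> 'v) lcs). \<forall>p\<in>sn X. \<forall>x.
     wx x ^ m * p (hermite_series \<beta> y x) \<le> C * (\<Sum>\<^sub>\<infinity>n. wt n ^ k * p (y n))"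
proof -
  obtain C k where C: "0 \<le> C" "\<And>(n :: (nat, 'd) vec) x. wx x ^ m * \<bar>hermite_d \<beta> n x\<bar> \<le> C * wt n ^ k"
    using hermite_d_bound[of m \<beta>] by blast
  have "wx x ^ m * p (hermite_series \<beta> y x) \<le> C * (\<Sum>\<^sub>\<infinity>n. wt n ^ k * p (y n))"
    if y: "y \<in> car (rapid X)" and p: "p \<in> sn X" for y p x
  proof -
    have "\<bar>hermite_d \<beta> n x\<bar> \<le> C / wx x ^ m * wt n ^ k" for n
      using C(2)[of x n] by (simp add: field_simps)
    from real_wsum_le[OF y this p] show ?thesis by (simp add: hermite_series_def field_simps)
  qed
  then show ?thesis using C(1) by blast
qed

context
  fixes y :: "(nat, 'd::finite) vec \<Rightarrow> 'v"
  assumes y: "y \<in> car (rapid X)"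
begin

lemma hermite_series_in: "hermite_series \<beta> y x \<in> car X"
proof -
  obtain C k where C: "\<And>n x. wx x ^ 0 * \<bar>hermite_d \<beta> n x\<bar> \<le> C * wt n ^ k" using hermite_d_bound by meson
  then have "\<bar>hermite_d \<beta> n x\<bar> \<le> C * wt n ^ k" for n by simp
  then show ?thesis unfolding hermite_series_def by (rule real_wsum_in[OF y])
qed

text \<open>Difference quotient minus termwise derivative is again such a sum, and by
  \<open>hermite_d_taylor\<close> its coefficients are at most \<open>C2 * |h|\<close> times a power
  of the weight, so that it is of order \<open>h\<close> in every seminorm.\<close>

lemma hermite_series_has_partial:
  "has_partial X i (hermite_series \<beta> y) x (hermite_series (upd \<beta> i (Suc (\<beta> $ i))) y x)"
  unfolding has_partial_iff[of "hermite_series \<beta> y", OF hermite_series_in]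
proof (intro conjI ballI hermite_series_in)
  fix p assume p: "p \<in> sn X"
  let ?g = "hermite_d \<beta>" and ?g' = "hermite_d (upd \<beta> i (Suc (\<beta> $ i)))"
  obtain C0 k0 where C0: "\<And>n x. \<bar>?g n x\<bar> \<le> C0 * wt n ^ k0" using hermite_d_bound[of 0] unfolding power_0 mult_1 by meson
  obtain C1 k1 where C1: "\<And>n x. \<bar>?g' n x\<bar> \<le> C1 * wt n ^ k1" using hermite_d_bound[of 0] unfolding power_0 mult_1 by meson
  obtain C2 k2 where C2: "\<And>n x. \<bar>hermite_d (upd \<beta> i (Suc (Suc (\<beta> $ i)))) n x\<bar> \<le> C2 * wt n ^ k2"
    using hermite_d_bound[of 0] unfolding power_0 mult_1 by meson
  define S where "S = (\<Sum>\<^sub>\<infinity>n. wt n ^ k2 * p (y n))"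
  let ?D = "\<lambda>h. scl X (of_real (1 / h)) (hermite_series \<beta> y (x + axis i h) - hermite_series \<beta> y x) -
      hermite_series (upd \<beta> i (Suc (\<beta> $ i))) y x"
  have le: "p (?D h) \<le> (C2 * \<bar>h\<bar>) * S" if h: "h \<noteq> 0" for h
  proof -
    \<comment> \<open>The crude bounds \<open>k01\<close> and \<open>k02\<close> only license the
      linearity rules, which require polynomially bounded coefficients; the sharp bound comes from
      the Taylor estimate below.\<close>
    have k01: "\<bar>?g n (x + axis i h) - ?g n x\<bar> \<le> (2 * C0) * wt n ^ k0" for n
      using C0[of n x] C0[of n "x + axis i h"] by linarith
    have k02: "\<bar>(1 / h) * (?g n (x + axis i h) - ?g n x)\<bar> \<le> (\<bar>1 / h\<bar> * (2 * C0)) * wt n ^ k0" for n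
      using mult_left_mono[OF k01[of n] abs_ge_zero[of "1 / h"]] by (simp add: abs_mult mult.assoc)
    have "?D h = real_wsum y (\<lambda>n. (1 / h) * (?g n (x + axis i h) - ?g n x) - ?g' n x)"
      unfolding hermite_series_def
        real_wsum_diff[OF y k02 C1] real_wsum_cmult[OF y k01] real_wsum_diff[OF y C0 C0] ..
    also have "p \<dots> \<le> (C2 * \<bar>h\<bar>) * S"
      unfolding S_def
    proof (rule real_wsum_le[OF y _ p])
      fix n
      have "\<bar>?g n (x + axis i h) - ?g n x - h * ?g' n x\<bar> \<le> C2 * wt n ^ k2 * \<bar>h\<bar> * \<bar>h\<bar>"
        by (rule hermite_d_taylor[OF C2])
      moreover have "(1 / h) * (?g n (x + axis i h) - ?g n x) - ?g' n x = (?g n (x + axis i h) - ?g n x - h * ?g' n x) / h"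
        using h by (simp add: field_simps)
      ultimately show "\<bar>(1 / h) * (?g n (x + axis i h) - ?g n x) - ?g' n x\<bar> \<le> C2 * \<bar>h\<bar> * wt n ^ k2"
        using h by (simp add: abs_divide field_simps)
    qed
    finally show ?thesis .
  qed
  show "((\<lambda>h. p (?D h)) \<longlongrightarrow> 0) (at 0)"
  proof (rule Lim_null_comparison)
    have "\<forall>\<^sub>F h in at 0. h \<noteq> (0 :: real)" by (rule eventually_neq_at_within)
    then show "\<forall>\<^sub>F h in at 0. norm (p (?D h)) \<le> (C2 * \<bar>h\<bar>) * S"
    proof eventually_elim
      case (elim h)
      have "?D h \<in> car X" using hermite_series_in by simp
      then show ?case using le[OF elim] p_nonneg[OF sn_seminorm[OF p]] by simp
    qed
    have "((\<lambda>h::real. (C2 * \<bar>h\<bar>) * S) \<longlongrightarrow> (C2 * \<bar>0\<bar>) * S) (at 0)" by (intro tendsto_intros)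
    then show "((\<lambda>h::real. (C2 * \<bar>h\<bar>) * S) \<longlongrightarrow> 0) (at 0)" by simp
  qed
qed

text \<open>The terms are Lipschitz in the coordinates with constants of polynomial growth in
  \<open>n\<close>. The bounds for the various directions are merged into a single \<open>A\<close>
  and exponent \<open>K\<close>.\<close>

lemma hermite_series_continuous: "continuous_map euclidean (lctop X) (hermite_series \<beta> y)"
  unfolding continuous_map_euclidean_iff
proof (intro conjI allI ballI hermite_series_in)
  fix p x assume p: "p \<in> sn X"
  let ?g = "hermite_d \<beta>"
  have "\<forall>i. \<exists>C k. \<forall>n x. wx x ^ 0 * \<bar>hermite_d (upd \<beta> i (Suc (\<beta> $ i))) n x\<bar> \<le> C * wt n ^ k"
    using hermite_d_bound by meson
  then obtain C k where C: "\<And>i n x. wx x ^ 0 * \<bar>hermite_d (upd \<beta> i (Suc (\<beta> $ i))) n x\<bar> \<le> C i * wt n ^ k i" by metis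
  obtain C0 k0 where C0: "\<And>n x. \<bar>?g n x\<bar> \<le> C0 * wt n ^ k0" using hermite_d_bound[of 0] unfolding power_0 mult_1 by meson
  define A K where "A = sum C UNIV" and "K = sum k UNIV"
  have Cn: "0 \<le> C i" for i
  proof -
    have "0 \<le> C i * wt (0 :: (nat, 'd) vec) ^ k i" using C[of 0 i 0] by (rule order.trans[rotated]) simp
    moreover have "0 < wt (0 :: (nat, 'd) vec) ^ k i" by simp
    ultimately show ?thesis by (meson linorder_not_le mult_neg_pos)
  qed
  have AK: "\<bar>hermite_d (upd \<beta> i (Suc (\<beta> $ i))) n z\<bar> \<le> A * wt n ^ K" for i n z
  proof -
    have "C i \<le> A" unfolding A_def using Cn by (intro member_le_sum) auto
    moreover have "k i \<le> K" unfolding K_def by (rule member_le_sum) auto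
    ultimately have "C i * wt n ^ k i \<le> A * wt n ^ K"
      using Cn[of i] by (intro mult_mono power_increasing) auto
    then show ?thesis using C[of z i n] by simp
  qed
  define S where "S = (\<Sum>\<^sub>\<infinity>n. wt n ^ K * p (y n))"
  show "((\<lambda>z. p (hermite_series \<beta> y z - hermite_series \<beta> y x)) \<longlongrightarrow> 0) (at x)"
  proof (rule Lim_null_comparison)
    have "p (hermite_series \<beta> y z - hermite_series \<beta> y x) \<le> (A * (\<Sum>i\<in>UNIV. \<bar>z $ i - x $ i\<bar>)) * S" for z
    proof -
      have "hermite_series \<beta> y z - hermite_series \<beta> y x = real_wsum y (\<lambda>n. ?g n z - ?g n x)"
        unfolding hermite_series_def real_wsum_diff[OF y C0 C0] ..
      also have "p \<dots> \<le> (A * (\<Sum>i\<in>UNIV. \<bar>z $ i - x $ i\<bar>)) * S"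
        unfolding S_def
      proof (rule real_wsum_le[OF y _ p])
        fix n
        have "norm (?g n z - ?g n x) \<le> A * wt n ^ K * (\<Sum>i\<in>UNIV. \<bar>z $ i - x $ i\<bar>)"
          by (rule coordinate_path_bound[where \<phi>' = "\<lambda>i. hermite_d (upd \<beta> i (Suc (\<beta> $ i))) n" and r = "\<Sum>i\<in>UNIV. \<bar>z $ i - x $ i\<bar>"])
             (auto intro: hermite_d_has_pd AK member_le_sum)
        then show "\<bar>?g n z - ?g n x\<bar> \<le> A * (\<Sum>i\<in>UNIV. \<bar>z $ i - x $ i\<bar>) * wt n ^ K" by (simp add: mult_ac)
      qed
      finally show ?thesis .
    qed
    then show "\<forall>\<^sub>F z in at x. norm (p (hermite_series \<beta> y z - hermite_series \<beta> y x)) \<le> (A * (\<Sum>i\<in>UNIV. \<bar>z $ i - x $ i\<bar>)) * S"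
      using p_nonneg[OF sn_seminorm[OF p]] hermite_series_in by simp
    have "((\<lambda>z. (A * (\<Sum>i\<in>UNIV. \<bar>z $ i - x $ i\<bar>)) * S) \<longlongrightarrow> (A * (\<Sum>i\<in>UNIV. \<bar>x $ i - x $ i\<bar>)) * S) (at x)"
      by (intro tendsto_intros)
    then show "((\<lambda>z. (A * (\<Sum>i\<in>UNIV. \<bar>z $ i - x $ i\<bar>)) * S) \<longlongrightarrow> 0) (at x)" by simp
  qed
qed

lemma hermite_series_partial: "partial X i (hermite_series \<beta> y) = hermite_series (upd \<beta> i (Suc (\<beta> $ i))) y"
  by (rule ext) (rule partial_eqI[OF hermite_series_has_partial])

lemma hermite_series_Cinf: "hermite_series \<beta> y \<in> Cinf X"
  by (rule Cinf_coinduct[of _ "range (\<lambda>\<beta>. hermite_series \<beta> y)"])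
     (auto simp: hermite_series_continuous hermite_series_partial intro: hermite_series_has_partial)

lemma hermite_series_partial_power: "(partial X i ^^ b) (hermite_series \<beta> y) = hermite_series (upd \<beta> i (\<beta> $ i + b)) y"
  by (induction b) (simp_all add: hermite_series_partial)

end

lemma hermite_series_multi_partial:
  fixes y :: "(nat, 'd::{finite,linorder}) vec \<Rightarrow> 'v"
  assumes y: "y \<in> car (rapid X)"
  shows "multi_partial X \<gamma> (hermite_series 0 y) = hermite_series \<gamma> y"
proof -
  \<comment> \<open>Generalised to the part of the coordinate list already processed. Distinctness
    ensures that each entry is raised from 0 exactly once.\<close>
  have "foldr (\<lambda>i. partial X i ^^ (\<gamma> $ i)) xs (hermite_series 0 y) =
      hermite_series (\<chi> i. if i \<in> set xs then \<gamma> $ i else 0) y" if "distinct xs" for xs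
    using that
  proof (induction xs)
    case Nil
    have "(\<chi> i. 0) = (0 :: (nat, 'd) vec)" by (simp add: vec_eq_iff)
    then show ?case by simp
  next
    case (Cons j xs)
    have "upd (\<chi> i. if i \<in> set xs then \<gamma> $ i else 0) j (0 + \<gamma> $ j) = (\<chi> i. if i \<in> set (j # xs) then \<gamma> $ i else 0)"
      by (auto simp: vec_eq_iff)
    then show ?case using Cons by (simp add: hermite_series_partial_power[OF y])
  qed
  from this[of "sorted_list_of_set UNIV"] show ?thesis by (simp add: multi_partial_def)
qed

text \<open>There are finitely many derivatives of order at most \<open>m\<close>, so constants and
  exponents may be summed to become uniform in \<open>\<beta>\<close>.\<close>

lemma hermite_series_schwartz_bound:
  "\<exists>C\<ge>0. \<exists>k. \<forall>y\<in>car (rapid X :: ('k, (nat, 'd::{finite,linorder}) vec \<Rightarrow> 'v) lcs). \<forall>p\<in>sn X. \<forall>\<beta> x. mlength \<beta> \<le> m \<longrightarrow>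
     p (multi_partial X \<beta> (hermite_series 0 y) x) * wx x powr (real m / 2) \<le> C * (\<Sum>\<^sub>\<infinity>n. wt n ^ k * p (y n))"
proof -
  let ?B = "{\<beta> :: (nat, 'd) vec. mlength \<beta> \<le> m}"
  have "\<beta> $ i \<le> mlength \<beta>" for \<beta> :: "(nat, 'd) vec" and i
    unfolding mlength_def by (rule member_le_sum) auto
  then have "?B \<subseteq> {n. \<forall>i. n $ i \<le> m}" by (auto intro: order.trans)
  then have fin: "finite ?B" using finite_box by (rule finite_subset)
  define Q where "Q \<beta> C k \<longleftrightarrow> 0 \<le> C \<and> (\<forall>y\<in>car (rapid X :: ('k, (nat, 'd) vec \<Rightarrow> 'v) lcs). \<forall>p\<in>sn X. \<forall>x.
     wx x ^ m * p (hermite_series \<beta> y x) \<le> C * (\<Sum>\<^sub>\<infinity>n. wt n ^ k * p (y n)))" for \<beta> C k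
  have "\<exists>C k. Q \<beta> C k" for \<beta> unfolding Q_def using hermite_series_bound[of m \<beta>] by blast
  then obtain C k where "\<And>\<beta>. Q \<beta> (C \<beta>) (k \<beta>)" by metis
  then have C0: "\<And>\<beta> :: (nat, 'd) vec. 0 \<le> C \<beta>"
    and C: "\<And>(\<beta> :: (nat, 'd) vec) y p x. y \<in> car (rapid X) \<Longrightarrow> p \<in> sn X \<Longrightarrow>
     wx x ^ m * p (hermite_series \<beta> y x) \<le> C \<beta> * (\<Sum>\<^sub>\<infinity>n. wt n ^ k \<beta> * p (y n))"
    unfolding Q_def by blast+
  have "p (multi_partial X \<beta> (hermite_series 0 y) x) * wx x powr (real m / 2) \<le> sum C ?B * (\<Sum>\<^sub>\<infinity>n. wt n ^ sum k ?B * p (y n))"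
    if y: "y \<in> car (rapid X)" and p: "p \<in> sn X" and \<beta>: "mlength \<beta> \<le> m" for y :: "(nat, 'd) vec \<Rightarrow> 'v" and p \<beta> x
  proof -
    have nn: "0 \<le> p (hermite_series \<beta> y x)" using p_nonneg[OF sn_seminorm[OF p] hermite_series_in[OF y]] .
    have ny: "0 \<le> p (y n)" for n using p_nonneg[OF sn_seminorm[OF p] rapid_in[OF y]] .
    have "wx x powr (real m / 2) \<le> wx x powr real m" by (intro powr_mono) auto
    also have "\<dots> = wx x ^ m" by (simp add: powr_realpow)
    finally have "p (hermite_series \<beta> y x) * wx x powr (real m / 2) \<le> p (hermite_series \<beta> y x) * wx x ^ m"
      by (rule mult_left_mono[OF _ nn])
    also have "\<dots> \<le> C \<beta> * (\<Sum>\<^sub>\<infinity>n. wt n ^ k \<beta> * p (y n))" using C[OF y p, of x \<beta>] by (simp add: mult.commute)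
    also have "\<dots> \<le> sum C ?B * (\<Sum>\<^sub>\<infinity>n. wt n ^ sum k ?B * p (y n))"
    proof (rule mult_mono)
      show "C \<beta> \<le> sum C ?B" using C0 \<beta> fin by (intro member_le_sum) auto
      have "k \<beta> \<le> sum k ?B" using \<beta> fin by (intro member_le_sum) auto
      then show "(\<Sum>\<^sub>\<infinity>n. wt n ^ k \<beta> * p (y n)) \<le> (\<Sum>\<^sub>\<infinity>n. wt n ^ sum k ?B * p (y n))"
        using ny by (intro infsum_mono rapid_summable y p mult_right_mono power_increasing) auto
      show "0 \<le> sum C ?B" using C0 by (intro sum_nonneg) auto
      show "0 \<le> (\<Sum>\<^sub>\<infinity>n. wt n ^ k \<beta> * p (y n))" using ny by (intro infsum_nonneg) auto
    qed
    finally show ?thesis by (simp add: hermite_series_multi_partial[OF y])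
  qed
  moreover have "0 \<le> sum C ?B" using C0 by (intro sum_nonneg) auto
  ultimately show ?thesis by blast
qed

lemma hermite_series_schwartz:
  fixes y :: "(nat, 'd::{finite,linorder}) vec \<Rightarrow> 'v"
  assumes "y \<in> car (rapid X)"
  shows "hermite_series 0 y \<in> car (schwartz X)"
  unfolding schwartz_car_iff using assms hermite_series_schwartz_bound hermite_series_Cinf by meson

lemma hermite_series_seminorm_le:
  "\<exists>C\<ge>0. \<exists>k. \<forall>y\<in>car (rapid X :: ('k, (nat, 'd::{finite,linorder}) vec \<Rightarrow> 'v) lcs). \<forall>p\<in>sn X.
     schwartz_seminorm X m p (hermite_series 0 y) \<le> C * (\<Sum>\<^sub>\<infinity>n. wt n ^ k * p (y n))"
proof -
  obtain C k where "0 \<le> C" and C: "\<And>y p \<beta> x. y \<in> car (rapid X :: ('k, (nat, 'd) vec \<Rightarrow> 'v) lcs) \<Longrightarrow> p \<in> sn X \<Longrightarrow> mlength \<beta> \<le> m \<Longrightarrow>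
     p (multi_partial X \<beta> (hermite_series 0 y) x) * wx x powr (real m / 2) \<le> C * (\<Sum>\<^sub>\<infinity>n. wt n ^ k * p (y n))"
    using hermite_series_schwartz_bound[of m] by blast
  then show ?thesis by (intro exI[of _ C] conjI exI[of _ k] ballI schwartz_seminorm_least) auto
qed

lemma hermite_series_tail:
  fixes y :: "(nat, 'd::finite) vec \<Rightarrow> 'v"
  assumes y: "y \<in> car (rapid X)"
  shows "hermite_series 0 y x - hermite_series 0 (\<lambda>n. if n \<in> F then y n else 0) x =
    hermite_series 0 (\<lambda>n. if n \<in> F then 0 else y n) x"
proof -
  have "(\<lambda>n. if n \<in> F then 0 else y n) = (\<lambda>n. if n \<in> - F then y n else 0)" by auto
  then have "(\<lambda>n. if n \<in> F then 0 else y n) \<in> car (rapid X)" using rapid_restrict[OF y, of "- F"] by simp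
  moreover have "y = (\<lambda>n. if n \<in> F then y n else 0) + (\<lambda>n. if n \<in> F then 0 else y n)" by (auto simp: fun_eq_iff)
  ultimately show ?thesis
    using hermite_series_add[OF rapid_restrict[OF y, of F], of "\<lambda>n. if n \<in> F then 0 else y n" 0 x] by simp
qed

lemma rapid_tail_tendsto_0:
  fixes y :: "(nat, 'd::finite) vec \<Rightarrow> 'v"
  assumes y: "y \<in> car (rapid X)" and p: "p \<in> sn X"
  shows "((\<lambda>F. C * (\<Sum>\<^sub>\<infinity>n. wt n ^ k * p (if n \<in> F then 0 else y n))) \<longlongrightarrow> 0) (finite_subsets_at_top UNIV)"
proof -
  have "(\<lambda>n. wt n ^ k * p (if n \<in> F then 0 else y n)) = (\<lambda>n. if n \<in> F then 0 else wt n ^ k * p (y n))" for F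
    by (auto simp: p_zero[OF sn_seminorm[OF p]])
  then show ?thesis
    using tendsto_mult_right_zero[OF tail_sum_tendsto_0[OF rapid_summable[OF y p]]] by simp
qed

lemma rapid_tail: "y \<in> car (rapid X) \<Longrightarrow> (\<lambda>n. if n \<in> F then 0 else y n) \<in> car (rapid X)"
proof -
  have "(\<lambda>n. if n \<in> F then 0 else y n) = (\<lambda>n. if n \<in> - F then y n else 0)" by auto
  then show "y \<in> car (rapid X) \<Longrightarrow> (\<lambda>n. if n \<in> F then 0 else y n) \<in> car (rapid X)"
    using rapid_restrict[of y "- F"] by simp
qed

text \<open>For a finite part of the sequence this is orthonormality. The coefficient of the rest is
  bounded by \<open>coef_bound\<close> through a weighted tail sum that tends to 0, with a constant
  independent of the finite part.\<close>

theorem hermite_transform_series: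
  fixes y :: "(nat, 'd::{finite,linorder}) vec \<Rightarrow> 'v"
  assumes y: "y \<in> car (rapid X)"
  shows "hermite_transform X (hermite_series 0 y) = y"
proof (rule ext)
  fix n
  show "hermite_transform X (hermite_series 0 y) n = y n"
    unfolding hermite_transform_def
  proof (rule hermite_coeff_eqI[OF hermite_series_schwartz[OF y] rapid_in[OF y]])
    fix u assume u: "u \<in> dual X"
    obtain p C where p: "p \<in> sn X" and C: "0 \<le> C" "\<And>x. x \<in> car X \<Longrightarrow> norm (u x) \<le> C * p x"
      using dual_bound[OF u] by blast
    obtain A k where A: "0 \<le> A" "\<And>y p x. y \<in> car (rapid X :: ('k, (nat, 'd) vec \<Rightarrow> 'v) lcs) \<Longrightarrow> p \<in> sn X \<Longrightarrow>
        wx x ^ CARD('d) * p (hermite_series 0 y x) \<le> A * (\<Sum>\<^sub>\<infinity>n. wt n ^ k * p (y n))"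
      using hermite_series_bound[of "CARD('d)" 0] by blast
    let ?c = "coef (\<lambda>x. u (hermite_series 0 y x)) n"
    let ?K = "coef_const TYPE('d) * C * A"
    let ?T = "\<lambda>F. \<Sum>\<^sub>\<infinity>n. wt n ^ k * p (if n \<in> F then 0 else y n)"
    have le: "norm (?c - u (y n)) \<le> ?K * ?T F" if F: "finite F" "n \<in> F" for F
    proof -
      let ?yF = "\<lambda>n. if n \<in> F then y n else 0" and ?yT = "\<lambda>n. if n \<in> F then 0 else y n"
      have yF: "?yF \<in> car (rapid X)" and yT: "?yT \<in> car (rapid X)"
        using rapid_restrict[OF y] rapid_tail[OF y] by auto
      have hF: "hermite_series 0 ?yF x = (\<Sum>m\<in>F. scl X (of_real (hermite m x)) (y m))" for x
        by (subst hermite_series_finite[OF F(1)]) (use rapid_in[OF y] in auto)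
      have uF: "u (hermite_series 0 ?yF x) = (\<Sum>m\<in>F. hermite m x *\<^sub>R u (y m))" for x
        unfolding hF using rapid_in[OF y] by (subst dualD(6)[OF u]) (auto simp: dualD(2)[OF u] scaleR_conv_of_real)
      have cF: "coef (\<lambda>x. u (hermite_series 0 ?yF x)) n = u (y n)"
        unfolding uF coef_hermite_sum using F by simp
      have "(\<lambda>x. u (hermite_series 0 y x)) = (\<lambda>x. u (hermite_series 0 ?yF x) + u (hermite_series 0 ?yT x))"
      proof
        fix x
        have "hermite_series 0 y x = hermite_series 0 ?yF x + hermite_series 0 ?yT x"
          using hermite_series_tail[OF y, of x F] by (simp add: algebra_simps)
        then show "u (hermite_series 0 y x) = u (hermite_series 0 ?yF x) + u (hermite_series 0 ?yT x)"
          using dualD(1)[OF u hermite_series_in[OF yF] hermite_series_in[OF yT]] by simp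
      qed
      then have "?c = u (y n) + coef (\<lambda>x. u (hermite_series 0 ?yT x)) n"
        using coef_add[OF decays_dual[OF hermite_series_schwartz[OF yF] u] decays_dual[OF hermite_series_schwartz[OF yT] u]] cF
        by simp
      then have "norm (?c - u (y n)) = norm (coef (\<lambda>x. u (hermite_series 0 ?yT x)) n)" by simp
      also have "\<dots> \<le> coef_const TYPE('d) * (C * (A * ?T F))"
      proof (rule coef_bound)
        show "continuous_on UNIV (\<lambda>x. u (hermite_series 0 ?yT x))"
          by (intro decays_continuous decays_dual hermite_series_schwartz yT u)
        fix x
        have "wx x ^ CARD('d) * norm (u (hermite_series 0 ?yT x)) \<le> wx x ^ CARD('d) * (C * p (hermite_series 0 ?yT x))"
          by (intro mult_left_mono C(2) hermite_series_in[OF yT]) auto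
        also have "\<dots> = C * (wx x ^ CARD('d) * p (hermite_series 0 ?yT x))" by simp
        also have "\<dots> \<le> C * (A * ?T F)" using A(2)[OF yT p, of x] C(1) by (rule mult_left_mono)
        finally show "wx x ^ CARD('d) * norm (u (hermite_series 0 ?yT x)) \<le> C * (A * ?T F)" .
      qed
      finally show ?thesis by (simp add: mult.assoc)
    qed
    have "norm (?c - u (y n)) \<le> 0"
    proof (rule tendsto_le[OF finite_subsets_at_top_neq_bot rapid_tail_tendsto_0[OF y p, of ?K k] tendsto_const])
      show "\<forall>\<^sub>F F in finite_subsets_at_top UNIV. norm (?c - u (y n)) \<le> ?K * ?T F"
        unfolding eventually_finite_subsets_at_top by (intro exI[of _ "{n}"]) (use le in auto)
    qed
    then show "u (y n) = ?c" by simp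
  qed
qed

text \<open>By the converse identity both functions have the same coefficients, so under every
  functional their difference falls to \<open>hermite_null_eq_0\<close>.\<close>

theorem hermite_series_transform:
  fixes f :: "(real, 'd::{finite,linorder}) vec \<Rightarrow> 'v"
  assumes f: "f \<in> car (schwartz X)"
  shows "hermite_series 0 (hermite_transform X f) = f"
proof (rule ext, rule dual_separates)
  let ?y = "hermite_transform X f"
  have y: "?y \<in> car (rapid X)" by (rule hermite_transform_rapid[OF f])
  have g: "hermite_series 0 ?y \<in> car (schwartz X)" by (rule hermite_series_schwartz[OF y])
  fix x
  show "hermite_series 0 ?y x \<in> car X" by (rule schwartz_in[OF g])
  show "f x \<in> car X" by (rule schwartz_in[OF f])
  fix u assume u: "u \<in> dual X"
  have c: "coef (\<lambda>x. u (hermite_series 0 ?y x)) n = coef (\<lambda>x. u (f x)) n" for n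
  proof -
    have "coef (\<lambda>x. u (hermite_series 0 ?y x)) n = u (hermite_coeff X n (hermite_series 0 ?y))"
      by (rule dual_hermite_coeff[OF g u, symmetric])
    also have "\<dots> = u (hermite_coeff X n f)"
      using hermite_transform_series[OF y] by (simp add: hermite_transform_def fun_eq_iff)
    also have "\<dots> = coef (\<lambda>x. u (f x)) n" by (rule dual_hermite_coeff[OF f u])
    finally show ?thesis .
  qed
  have "hermite_null (\<lambda>x. u (hermite_series 0 ?y x) + (- 1) *\<^sub>R u (f x))"
    unfolding hermite_null_def
    using decays_add[OF decays_dual[OF g u] decays_scaleR[OF decays_dual[OF f u], of "- 1"]]
      coef_add[OF decays_dual[OF g u] decays_scaleR[OF decays_dual[OF f u], of "- 1"]]
    by (simp only: coef_scaleR c) simp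
  from hermite_null_eq_0[OF this] show "u (hermite_series 0 ?y x) = u (f x)" by simp
qed

end

section \<open>The isomorphism and the Schauder decomposition\<close>

lemma sum_fun_apply: "sum f A x = (\<Sum>i\<in>A. f i x)"
  by (induction A rule: infinite_finite_induct) auto

lemma cont_linear_lcs_compose:
  "cont_linear_lcs X Y T \<Longrightarrow> cont_linear_lcs Y Z U \<Longrightarrow> cont_linear_lcs X Z (U \<circ> T)"
  unfolding cont_linear_lcs_def linear_lcs_def
  by (auto simp: image_subset_iff intro: continuous_map_compose)

lemma cont_linear_lcs_cong:
  assumes T: "cont_linear_lcs X Y T" and eq: "\<And>x. x \<in> car X \<Longrightarrow> U x = T x" and X: "seminormed X"
  shows "cont_linear_lcs X Y U"
proof -
  interpret X: seminormed X by (rule X)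
  have lin: "linear_lcs X Y T" and "continuous_map (lctop X) (lctop Y) T" using T by (auto simp: cont_linear_lcs_def)
  from this(2) have "continuous_map (lctop X) (lctop Y) U"
    by (rule continuous_map_eq) (simp add: eq)
  moreover have "U (x + y) = U x + U y" if "x \<in> car X" "y \<in> car X" for x y
    using lin that unfolding linear_lcs_def eq[OF that(1)] eq[OF that(2)] eq[OF X.add_in[OF that]] by blast
  moreover have "U (scl X a x) = scl Y a (U x)" if "x \<in> car X" for a x
    using lin that unfolding linear_lcs_def eq[OF that] eq[OF X.scl_in[OF that]] by blast
  moreover have "U ` car X \<subseteq> car Y"
    using lin eq unfolding linear_lcs_def by (metis image_cong)
  ultimately show ?thesis unfolding cont_linear_lcs_def linear_lcs_def by blast
qed

context fc_space
begin

lemma hermite_series_zero: "hermite_series 0 (\<lambda>_. 0) = (0 :: (real, 'd::finite) vec \<Rightarrow> 'v)"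
  by (rule ext) (subst hermite_series_finite[of "{}"], auto)

lemma lcspace_schwartz: "lcspace (schwartz X :: ('k, (real, 'd::{finite,linorder}) vec \<Rightarrow> 'v) lcs)"
proof -
  let ?S = "schwartz X :: ('k, (real, 'd) vec \<Rightarrow> 'v) lcs"
  interpret S: seminormed ?S by (rule seminormed_schwartz)
  show ?thesis
  proof
    obtain x0 where x0: "x0 \<in> car X" "x0 \<noteq> 0" using nontrivial by blast
    \<comment> \<open>A Hermite function times a nonzero vector is a nonzero element: its transform
      is this sequence.\<close>
    let ?y = "\<lambda>n. if n = (0 :: (nat, 'd) vec) then x0 else 0"
    have y: "?y \<in> car (rapid X)" by (rule rapid_single[OF x0(1)])
    have z: "(\<lambda>_::(nat, 'd) vec. 0) \<in> car (rapid X)" using rapid_restrict[OF y, of "{}"] by simp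
    have "hermite_series 0 ?y \<noteq> 0"
    proof
      assume "hermite_series 0 ?y = 0"
      then have "?y = (\<lambda>_. 0)"
        using hermite_transform_series[OF y] hermite_transform_series[OF z] hermite_series_zero[where 'd = 'd] by simp
      then show False using x0(2) by (metis)
    qed
    then show "\<exists>f\<in>car ?S. f \<noteq> 0" using hermite_series_schwartz[OF y] by blast
  next
    fix q1 q2 assume "q1 \<in> sn ?S" "q2 \<in> sn ?S"
    then obtain m1 p1 m2 p2 where q: "q1 = schwartz_seminorm X m1 p1" "q2 = schwartz_seminorm X m2 p2"
      and p: "p1 \<in> sn X" "p2 \<in> sn X" by auto
    obtain r C where r: "r \<in> sn X" and C: "\<And>x. x \<in> car X \<Longrightarrow> p1 x \<le> C * r x" "\<And>x. x \<in> car X \<Longrightarrow> p2 x \<le> C * r x"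
      using directed[OF p] by blast
    define D where "D = max C 0"
    define M where "M = max m1 m2"
    have le: "schwartz_seminorm X m p f \<le> D * schwartz_seminorm X M r f"
      if f: "f \<in> car ?S" and m: "m \<le> M" and pr: "\<And>x. x \<in> car X \<Longrightarrow> p x \<le> C * r x" for m p f
    proof (rule schwartz_seminorm_least)
      fix \<beta> :: "(nat, 'd) vec" and x assume \<beta>: "mlength \<beta> \<le> m"
      let ?z = "multi_partial X \<beta> f x"
      have z: "?z \<in> car X" by (intro Cinf_in multi_partial_Cinf(1) schwartz_Cinf f)
      have rz: "0 \<le> r ?z" by (rule p_nonneg[OF sn_seminorm[OF r] z])
      have "p ?z \<le> C * r ?z" by (rule pr[OF z])
      also have "\<dots> \<le> D * r ?z" using rz by (intro mult_right_mono) (auto simp: D_def)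
      finally have "p ?z * wx x powr (real m / 2) \<le> D * r ?z * wx x powr (real m / 2)"
        by (rule mult_right_mono) simp
      also have "\<dots> \<le> D * r ?z * wx x powr (real M / 2)"
        using m rz by (intro mult_left_mono powr_mono mult_nonneg_nonneg) (auto simp: D_def)
      also have "\<dots> = D * (r ?z * wx x powr (real M / 2))" by simp
      also have "\<dots> \<le> D * schwartz_seminorm X M r f"
        using schwartz_value_le[OF f r, of \<beta> M x] \<beta> m by (intro mult_left_mono) (auto simp: D_def)
      finally show "p ?z * wx x powr (real m / 2) \<le> D * schwartz_seminorm X M r f" .
    qed
    show "\<exists>q\<in>sn ?S. \<exists>C. \<forall>f\<in>car ?S. q1 f \<le> C * q f \<and> q2 f \<le> C * q f"
      using le[of _ m1 p1] le[of _ m2 p2] C r unfolding q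
      by (intro bexI[of _ "schwartz_seminorm X M r"] exI[of _ D] ballI conjI) (auto simp: M_def)
  next
    show "Hausdorff_space (lctop ?S)"
    proof (rule S.Hausdorff_lctop)
      fix f assume f: "f \<in> car ?S" and 0: "\<And>q. q \<in> sn ?S \<Longrightarrow> q f = 0"
      have "f x = 0" for x
      proof (rule separating[OF schwartz_in[OF f]])
        fix p assume p: "p \<in> sn X"
        have "schwartz_seminorm X 0 p f = 0" using 0[of "schwartz_seminorm X 0 p"] p by auto
        then show "p (f x) = 0"
          using schwartz_value_0[OF f p, of x 0] p_nonneg[OF sn_seminorm[OF p] schwartz_in[OF f], of x] by simp
      qed
      then show "f = 0" by (simp add: fun_eq_iff)
    qed
  qed
qed

lemma cont_linear_hermite_transform:
  "cont_linear_lcs (schwartz X :: ('k, (real, 'd::{finite,linorder}) vec \<Rightarrow> 'v) lcs) (rapid X) (hermite_transform X)"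
proof (rule cont_linear_lcsI[OF seminormed_schwartz seminormed_rapid])
  let ?S = "schwartz X :: ('k, (real, 'd) vec \<Rightarrow> 'v) lcs"
  interpret S: seminormed ?S by (rule seminormed_schwartz)
  have "hermite_coeff X n (f + g) = hermite_coeff X n f + hermite_coeff X n g"
    if f: "f \<in> car ?S" and g: "g \<in> car ?S" for f g n
  proof (rule hermite_coeff_eqI)
    show "f + g \<in> car ?S" using f g by simp
    show "hermite_coeff X n f + hermite_coeff X n g \<in> car X" using hermite_coeff_in[OF f] hermite_coeff_in[OF g] by (rule add_in)
    show "u (hermite_coeff X n f + hermite_coeff X n g) = coef (\<lambda>x. u ((f + g) x)) n" if u: "u \<in> dual X" for u
      using coef_add[OF decays_dual[OF f u] decays_dual[OF g u], of n]
      by (simp add: dualD(1)[OF u] hermite_coeff_in[OF f] hermite_coeff_in[OF g] dual_hermite_coeff[OF f u]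
          dual_hermite_coeff[OF g u] schwartz_in[OF f] schwartz_in[OF g])
  qed
  moreover have "hermite_coeff X n (\<lambda>x. scl X a (f x)) = scl X a (hermite_coeff X n f)" if f: "f \<in> car ?S" for f a n
  proof (rule hermite_coeff_eqI)
    show "(\<lambda>x. scl X a (f x)) \<in> car ?S" using S.scl_in[OF f, of a] by simp
    show "scl X a (hermite_coeff X n f) \<in> car X" using hermite_coeff_in[OF f] by simp
    show "u (scl X a (hermite_coeff X n f)) = coef (\<lambda>x. u (scl X a (f x))) n" if u: "u \<in> dual X" for u
    proof -
      have "coef (\<lambda>x. u (scl X a (f x))) n = (\<integral>x. a * (hermite n x *\<^sub>R u (f x)) \<partial>lborel)"
        unfolding coef_def by (simp add: dualD(2)[OF u] schwartz_in[OF f])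
      also have "\<dots> = a * coef (\<lambda>x. u (f x)) n" unfolding coef_def by (rule integral_mult_right_zero)
      finally show ?thesis by (simp add: dualD(2)[OF u] hermite_coeff_in[OF f] dual_hermite_coeff[OF f u])
    qed
  qed
  ultimately show "linear_lcs ?S (rapid X) (hermite_transform X)"
    unfolding linear_lcs_def using hermite_transform_rapid by (auto simp: hermite_transform_def fun_eq_iff)
  fix q assume "q \<in> sn (rapid X :: ('k, (nat, 'd) vec \<Rightarrow> 'v) lcs)"
  then obtain j p where q: "q = rapid_seminorm j p" and p: "p \<in> sn X" by auto
  obtain C M where C: "0 \<le> C" "\<And>f p n. f \<in> car ?S \<Longrightarrow> p \<in> sn X \<Longrightarrow>
     wt n ^ j * p (hermite_coeff X n f) \<le> C * schwartz_seminorm X M p f"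
    using hermite_coeff_decay[of j] by blast
  have "q (hermite_transform X f) \<le> C * schwartz_seminorm X M p f" if f: "f \<in> car ?S" for f
    unfolding q
  proof (rule rapid_seminorm_least)
    fix n :: "(nat, 'd) vec"
    have "wt n powr (real j / 2) \<le> wt n powr real j" by (intro powr_mono) auto
    also have "\<dots> = wt n ^ j" by (simp add: powr_realpow)
    finally have "p (hermite_transform X f n) * wt n powr (real j / 2) \<le> p (hermite_transform X f n) * wt n ^ j"
      using p_nonneg[OF sn_seminorm[OF p] hermite_coeff_in[OF f]] by (intro mult_left_mono) (auto simp: hermite_transform_def)
    then show "p (hermite_transform X f n) * wt n powr (real j / 2) \<le> C * schwartz_seminorm X M p f"
      using C(2)[OF f p, of n] by (simp add: hermite_transform_def mult.commute)
  qed
  then show "\<exists>r\<in>sn ?S. \<exists>C. \<forall>f\<in>car ?S. q (hermite_transform X f) \<le> C * r f"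
    using p by (intro bexI[of _ "schwartz_seminorm X M p"]) auto
qed

lemma cont_linear_hermite_series:
  "cont_linear_lcs (rapid X) (schwartz X :: ('k, (real, 'd::{finite,linorder}) vec \<Rightarrow> 'v) lcs) (hermite_series 0)"
proof (rule cont_linear_lcsI[OF seminormed_rapid seminormed_schwartz])
  let ?S = "schwartz X :: ('k, (real, 'd) vec \<Rightarrow> 'v) lcs" and ?R = "rapid X :: ('k, (nat, 'd) vec \<Rightarrow> 'v) lcs"
  show "linear_lcs ?R ?S (hermite_series 0)"
    unfolding linear_lcs_def using hermite_series_schwartz
    by (auto simp: fun_eq_iff hermite_series_add hermite_series_scl)
  fix q assume "q \<in> sn ?S"
  then obtain m p where q: "q = schwartz_seminorm X m p" and p: "p \<in> sn X" by auto
  obtain C k where C: "0 \<le> C" "\<And>y p. y \<in> car ?R \<Longrightarrow> p \<in> sn X \<Longrightarrow>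
     schwartz_seminorm X m p (hermite_series 0 y) \<le> C * (\<Sum>\<^sub>\<infinity>n. wt n ^ k * p (y n))"
    using hermite_series_seminorm_le[of m] by blast
  let ?W = "\<Sum>\<^sub>\<infinity>n::(nat, 'd) vec. 1 / wt n ^ CARD('d)" and ?r = "rapid_seminorm (2 * (k + CARD('d))) p"
  have "q (hermite_series 0 y) \<le> C * ?W * ?r y" if y: "y \<in> car ?R" for y
  proof -
    have "q (hermite_series 0 y) \<le> C * (\<Sum>\<^sub>\<infinity>n. wt n ^ k * p (y n))" unfolding q by (rule C(2)[OF y p])
    also have "\<dots> \<le> C * (?W * ?r y)" by (rule mult_left_mono[OF rapid_sum_le[OF y p] C(1)])
    finally show ?thesis by simp
  qed
  moreover have "1 \<le> 2 * (k + CARD('d))" using zero_less_card_finite[where 'a = 'd] by (simp add: Suc_le_eq)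
  then have "?r \<in> sn ?R" using p by auto
  ultimately show "\<exists>r\<in>sn ?R. \<exists>C. \<forall>y\<in>car ?R. q (hermite_series 0 y) \<le> C * r y" by blast
qed

theorem hermite_transform_isomorphism:
  "isomorphism_lcs (schwartz X :: ('k, (real, 'd::{finite,linorder}) vec \<Rightarrow> 'v) lcs) (rapid X) (hermite_transform X)"
proof -
  have "homeomorphic_maps (lctop (schwartz X)) (lctop (rapid X)) (hermite_transform X)
      (hermite_series 0 :: _ \<Rightarrow> (real, 'd) vec \<Rightarrow> 'v)"
    unfolding homeomorphic_maps_def
    using cont_linear_hermite_transform[where 'd = 'd] cont_linear_hermite_series[where 'd = 'd]
    by (simp add: cont_linear_lcs_def hermite_transform_series hermite_series_transform)
  then show ?thesis
    using cont_linear_hermite_transform[where 'd = 'd] homeomorphic_maps_map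
    unfolding isomorphism_lcs_def cont_linear_lcs_def by blast
qed

text \<open>Under the isomorphism the partial sums of the expansion correspond to these coordinate
  projections; their continuity and their projection property are read off on the side of
  sequences.\<close>

lemma cont_linear_rapid_restrict:
  "cont_linear_lcs (rapid X) (rapid X :: ('k, (nat, 'd::finite) vec \<Rightarrow> 'v) lcs) (\<lambda>y n. if n \<in> A then y n else 0)"
proof (rule cont_linear_lcsI[OF seminormed_rapid seminormed_rapid])
  let ?R = "rapid X :: ('k, (nat, 'd) vec \<Rightarrow> 'v) lcs"
  interpret R: seminormed ?R by (rule seminormed_rapid)
  let ?T = "\<lambda>y n. if n \<in> A then y n else (0 :: 'v)"
  show "linear_lcs ?R ?R ?T"
    unfolding linear_lcs_def using rapid_restrict by (auto simp: fun_eq_iff)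
  fix q assume q: "q \<in> sn ?R"
  then obtain j p where qj: "q = rapid_seminorm j p" "1 \<le> j" and p: "p \<in> sn X" by auto
  have "q (?T y) \<le> 1 * q y" if y: "y \<in> car ?R" for y
    unfolding qj
  proof (rule rapid_seminorm_least)
    fix n
    have "0 \<le> p (y n) * wt n powr (real j / 2)" using p_nonneg[OF sn_seminorm[OF p] rapid_in[OF y]] by simp
    then show "p (?T y n) * wt n powr (real j / 2) \<le> 1 * rapid_seminorm j p y"
      using rapid_value_le[OF y p qj(2), of n] by (simp add: p_zero[OF sn_seminorm[OF p]])
  qed
  then show "\<exists>r\<in>sn ?R. \<exists>C. \<forall>y\<in>car ?R. q (?T y) \<le> C * r y" using q by blast
qed

lemma sum_hermite_component:
  assumes f: "f \<in> car (schwartz X :: ('k, (real, 'd::{finite,linorder}) vec \<Rightarrow> 'v) lcs)" and F: "finite F"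
  shows "(\<Sum>n\<in>F. hermite_component X n f) = hermite_series 0 (\<lambda>n. if n \<in> F then hermite_transform X f n else 0)"
proof (rule ext)
  fix x
  have "hermite_series 0 (\<lambda>n. if n \<in> F then hermite_transform X f n else 0) x =
      (\<Sum>n\<in>F. scl X (of_real (hermite n x)) (if n \<in> F then hermite_transform X f n else 0))"
    by (rule hermite_series_finite[OF F]) (use hermite_coeff_in[OF f] in \<open>auto simp: hermite_transform_def\<close>)
  then show "(\<Sum>n\<in>F. hermite_component X n f) x =
      hermite_series 0 (\<lambda>n. if n \<in> F then hermite_transform X f n else 0) x"
    by (simp add: sum_fun_apply hermite_component_def hermite_transform_def)
qed

text \<open>Convergence is along all finite index sets, hence unconditional; any sequence of finite
  sets exhausting the indices inherits it. The error is the Hermite series of the tail of the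
  coefficients.\<close>

theorem hermite_expansion:
  assumes f: "f \<in> car (schwartz X :: ('k, (real, 'd::{finite,linorder}) vec \<Rightarrow> 'v) lcs)"
  shows "limitin (lctop (schwartz X)) (\<lambda>F. \<Sum>n\<in>F. hermite_component X n f) f (finite_subsets_at_top UNIV)"
proof -
  let ?S = "schwartz X :: ('k, (real, 'd) vec \<Rightarrow> 'v) lcs"
  interpret S: seminormed ?S by (rule seminormed_schwartz)
  let ?y = "hermite_transform X f"
  have y: "?y \<in> car (rapid X)" by (rule hermite_transform_rapid[OF f])
  have P: "(\<Sum>n\<in>F. hermite_component X n f) \<in> car ?S" if "finite F" for F
    unfolding sum_hermite_component[OF f that] by (intro hermite_series_schwartz rapid_restrict y)
  have "((\<lambda>F. q ((\<Sum>n\<in>F. hermite_component X n f) - f)) \<longlongrightarrow> 0) (finite_subsets_at_top UNIV)" if q: "q \<in> sn ?S" for q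
  proof -
    obtain m p where qm: "q = schwartz_seminorm X m p" and p: "p \<in> sn X" using q by auto
    obtain C k where C: "0 \<le> C" "\<And>y p. y \<in> car (rapid X :: ('k, (nat, 'd) vec \<Rightarrow> 'v) lcs) \<Longrightarrow> p \<in> sn X \<Longrightarrow>
       schwartz_seminorm X m p (hermite_series 0 y) \<le> C * (\<Sum>\<^sub>\<infinity>n. wt n ^ k * p (y n))"
      using hermite_series_seminorm_le[of m] by blast
    show ?thesis
    proof (rule Lim_null_comparison[OF _ rapid_tail_tendsto_0[OF y p, of C k]], rule eventually_finite_subsets_at_top_weakI)
      fix F :: "(nat, 'd) vec set" assume F: "finite F"
      have "f - (\<Sum>n\<in>F. hermite_component X n f) = hermite_series 0 (\<lambda>n. if n \<in> F then 0 else ?y n)"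
        using hermite_series_tail[OF y, of _ F] hermite_series_transform[OF f]
        unfolding sum_hermite_component[OF f F] by (simp add: fun_eq_iff)
      then have "q ((\<Sum>n\<in>F. hermite_component X n f) - f) = q (hermite_series 0 (\<lambda>n. if n \<in> F then 0 else ?y n))"
        using S.p_diff_commute[OF S.sn_seminorm[OF q] P[OF F] f] by simp
      also have "\<dots> \<le> C * (\<Sum>\<^sub>\<infinity>n. wt n ^ k * p (if n \<in> F then 0 else ?y n))"
        unfolding qm by (rule C(2)[OF rapid_tail[OF y] p])
      finally show "norm (q ((\<Sum>n\<in>F. hermite_component X n f) - f)) \<le> C * (\<Sum>\<^sub>\<infinity>n. wt n ^ k * p (if n \<in> F then 0 else ?y n))"
        using S.p_nonneg[OF S.sn_seminorm[OF q], of "(\<Sum>n\<in>F. hermite_component X n f) - f"] P[OF F] f by simp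
    qed
  qed
  then show ?thesis
    unfolding S.limitin_lctop_iff using f P by (auto intro!: eventually_finite_subsets_at_top_weakI)
qed

lemma cont_linear_hermite_partial_sum:
  assumes F: "finite F"
  shows "cont_linear_lcs (schwartz X :: ('k, (real, 'd::{finite,linorder}) vec \<Rightarrow> 'v) lcs) (schwartz X) (\<lambda>f. \<Sum>n\<in>F. hermite_component X n f)"
proof (rule cont_linear_lcs_cong[OF _ _ seminormed_schwartz])
  show "cont_linear_lcs (schwartz X :: ('k, (real, 'd) vec \<Rightarrow> 'v) lcs) (schwartz X)
      (hermite_series 0 \<circ> ((\<lambda>y n. if n \<in> F then y n else 0) \<circ> hermite_transform X))"
    by (rule cont_linear_lcs_compose[OF cont_linear_lcs_compose[OF cont_linear_hermite_transform cont_linear_rapid_restrict] cont_linear_hermite_series])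
qed (simp add: sum_hermite_component F)

end

section \<open>Balls of indices and the Schauder decomposition\<close>

lemma finite_enorm_le: "finite {n :: (nat, 'd::finite) vec. enorm n \<le> c}"
proof (rule finite_subset[OF _ finite_wt_le[of "1 + c\<^sup>2"]], safe)
  fix n :: "(nat, 'd) vec" assume "enorm n \<le> c"
  moreover have "0 \<le> enorm n" by (simp add: enorm_def sum_nonneg)
  ultimately have "(enorm n)\<^sup>2 \<le> c\<^sup>2" by (intro power_mono)
  then show "wt n \<le> 1 + c\<^sup>2" by (simp add: wt_enorm[symmetric])
qed

lemma filterlim_enorm_le:
  "filterlim (\<lambda>k. {n :: (nat, 'd::finite) vec. enorm n \<le> real k}) (finite_subsets_at_top UNIV) sequentially"
proof (rule filterlim_finite_subsets_at_top[THEN iffD2], intro allI impI)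
  fix F :: "(nat, 'd) vec set" assume "finite F \<and> F \<subseteq> UNIV"
  then have F: "finite F" by simp
  have "\<forall>\<^sub>F k in sequentially. enorm n \<le> real k" for n :: "(nat, 'd) vec"
    using filterlim_real_sequentially by (auto simp: filterlim_at_top)
  then have "\<forall>\<^sub>F k in sequentially. \<forall>n\<in>F. enorm n \<le> real k"
    using F by (simp add: eventually_ball_finite)
  then show "\<forall>\<^sub>F k in sequentially. finite {n. enorm n \<le> real k} \<and> F \<subseteq> {n. enorm n \<le> real k} \<and> {n. enorm n \<le> real k} \<subseteq> UNIV"
    by eventually_elim (use finite_enorm_le in auto)
qed

context fc_space
begin

theorem hermite_schauder_decomposition:
  "schauder_decomposition (schwartz X :: ('k, (real, 'd::{finite,linorder}) vec \<Rightarrow> 'v) lcs)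
     (\<lambda>k f. \<Sum>n | enorm n \<le> real k. hermite_component X n f)"
proof -
  let ?S = "schwartz X :: ('k, (real, 'd) vec \<Rightarrow> 'v) lcs"
  define A where "A k = {n :: (nat, 'd) vec. enorm n \<le> real k}" for k :: nat
  define P where "P k f = (\<Sum>n\<in>A k. hermite_component X n f)" for k and f :: "(real, 'd) vec \<Rightarrow> 'v"
  have fin: "finite (A k)" for k unfolding A_def by (rule finite_enorm_le)
  have P_eq: "P k f = hermite_series 0 (\<lambda>n. if n \<in> A k then hermite_transform X f n else 0)" if "f \<in> car ?S" for k f
    unfolding P_def by (rule sum_hermite_component[OF that fin])
  have restr: "(\<lambda>n. if n \<in> A k then hermite_transform X f n else 0) \<in> car (rapid X)" if "f \<in> car ?S" for k f
    by (rule rapid_restrict[OF hermite_transform_rapid[OF that]])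
  have P_in: "P k f \<in> car ?S" if "f \<in> car ?S" for k f
    unfolding P_eq[OF that] by (rule hermite_series_schwartz[OF restr[OF that]])
  have P_transform: "hermite_transform X (P k f) = (\<lambda>n. if n \<in> A k then hermite_transform X f n else 0)" if "f \<in> car ?S" for k f
    unfolding P_eq[OF that] by (rule hermite_transform_series[OF restr[OF that]])
  have PP: "P k (P j f) = P (min j k) f" if f: "f \<in> car ?S" for j k f
  proof -
    have "(\<lambda>n. if n \<in> A k then hermite_transform X (P j f) n else 0) =
        (\<lambda>n. if n \<in> A (min j k) then hermite_transform X f n else 0)"
      unfolding P_transform[OF f] by (auto simp: A_def fun_eq_iff)
    then show ?thesis using P_eq[OF P_in[OF f], of k j] P_eq[OF f, of "min j k"] by simp
  qed
  have neq: "\<exists>f\<in>car ?S. P k f \<noteq> P j f" if "j < k" for j k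
  proof -
    obtain x0 where x0: "x0 \<in> car X" "x0 \<noteq> 0" using nontrivial by blast
    obtain i :: 'd where True by blast
    \<comment> \<open>This index has Euclidean length exactly \<open>k\<close>, so it is counted by
      the projection \<open>P k\<close> but not by \<open>P j\<close> with
      \<open>j < k\<close>.\<close>
    define m where "m = upd 0 i k"
    have "enorm m = real k"
      unfolding enorm_def m_def by (simp add: if_distrib[of "\<lambda>x. (real x)\<^sup>2"] sum.delta cong: if_cong)
    then have m: "m \<in> A k" "m \<notin> A j" using that by (auto simp: A_def)
    let ?y = "\<lambda>n. if n = m then x0 else 0"
    have y: "?y \<in> car (rapid X)" by (rule rapid_single[OF x0(1)])
    let ?f = "hermite_series 0 ?y"
    have f: "?f \<in> car ?S" by (rule hermite_series_schwartz[OF y])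
    have "hermite_transform X (P k ?f) m = x0" "hermite_transform X (P j ?f) m = 0"
      using m by (simp_all add: P_transform[OF f] hermite_transform_series[OF y])
    then show ?thesis using x0(2) f by metis
  qed
  have lim: "limitin (lctop ?S) (\<lambda>k. P k f) f sequentially" if f: "f \<in> car ?S" for f
    using hermite_expansion[OF f] filterlim_enorm_le[where 'd = 'd]
    unfolding limitin_def P_def A_def
    by (auto intro: eventually_compose_filterlim)
  have "schauder_decomposition ?S P"
    unfolding schauder_decomposition_def lcHs_iff_lcspace
  proof (intro conjI allI impI ballI)
    show "cont_linear_lcs ?S ?S (P k)" for k
      unfolding P_def[abs_def] by (rule cont_linear_hermite_partial_sum[OF fin])
    show "\<exists>x\<in>car ?S. P k x \<noteq> P j x" if "k \<noteq> j" for k j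
      using neq[of k j] neq[of j k] that by (metis linorder_neq_iff)
  qed (use lcspace_schwartz PP lim in auto)
  then show ?thesis unfolding P_def[abs_def] A_def by simp
qed

end

section \<open>The epsilon product\<close>

text \<open>Dominated convergence along an arbitrary filter: outside a finite set \<open>I\<close>
  the majorant has small sum, and on \<open>I\<close> finitely many limits suffice.\<close>

lemma infsum_dominated_tendsto_0:
  fixes g :: "'a \<Rightarrow> 'i \<Rightarrow> real"
  assumes h: "h summable_on UNIV"
    and dom: "\<forall>\<^sub>F a in F. \<forall>n. 0 \<le> g a n \<and> g a n \<le> h n"
    and lim: "\<And>n. ((\<lambda>a. g a n) \<longlongrightarrow> 0) F"
  shows "((\<lambda>a. \<Sum>\<^sub>\<infinity>n. g a n) \<longlongrightarrow> 0) F"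
proof (rule tendstoI)
  fix e :: real assume e: "0 < e"
  have "\<forall>\<^sub>F I in finite_subsets_at_top UNIV. (\<Sum>\<^sub>\<infinity>n. if n \<in> I then 0 else h n) < e / 2"
    using order_tendstoD(2)[OF tail_sum_tendsto_0[OF h], of "e / 2"] e by simp
  then obtain I where I: "finite I" "(\<Sum>\<^sub>\<infinity>n. if n \<in> I then 0 else h n) < e / 2"
    unfolding eventually_finite_subsets_at_top by blast
  have "((\<lambda>a. \<Sum>n\<in>I. g a n) \<longlongrightarrow> 0) F" using tendsto_sum[of I "\<lambda>n a. g a n" "\<lambda>_. 0" F] lim by simp
  then have "\<forall>\<^sub>F a in F. (\<Sum>n\<in>I. g a n) < e / 2" using e by (intro order_tendstoD(2)) auto
  then show "\<forall>\<^sub>F a in F. dist (\<Sum>\<^sub>\<infinity>n. g a n) 0 < e"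
    using dom
  proof eventually_elim
    fix a assume s: "(\<Sum>n\<in>I. g a n) < e / 2" and d: "\<forall>n. 0 \<le> g a n \<and> g a n \<le> h n"
    have summ: "g a summable_on A" for A
      using d by (intro summable_on_comparison_test[OF summable_on_subset_banach[OF h subset_UNIV]]) auto
    have "(\<Sum>\<^sub>\<infinity>n. g a n) = (\<Sum>\<^sub>\<infinity>n\<in>I. g a n) + (\<Sum>\<^sub>\<infinity>n\<in>-I. g a n)"
      using infsum_Un_disjoint[OF summ summ, of I "- I"] by (simp add: Compl_partition)
    also have "\<dots> \<le> (\<Sum>n\<in>I. g a n) + (\<Sum>\<^sub>\<infinity>n\<in>-I. h n)"
      using I(1) d by (intro add_mono infsum_mono summ summable_on_subset_banach[OF h]) auto
    also have "(\<Sum>\<^sub>\<infinity>n\<in>-I. h n) = (\<Sum>\<^sub>\<infinity>n. if n \<in> I then 0 else h n)"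
      by (rule infsum_cong_neutral) auto
    finally show "dist (\<Sum>\<^sub>\<infinity>n. g a n) 0 < e"
      using I(2) s d infsum_nonneg[of UNIV "g a"] by simp
  qed
qed

section \<open>Uniform convergence on compact disks\<close>

definition kappa_seminorm :: "'v set \<Rightarrow> ('v \<Rightarrow> 'k::real_or_complex) \<Rightarrow> real" where
  "kappa_seminorm K y = (SUP x\<in>K. norm (y x))"

lemma dual_kappa_simps [simp]:
  "car (dual_kappa X) = dual X" "scl (dual_kappa X) = (\<lambda>a y x. a * y x)"
  "sn (dual_kappa X) = {kappa_seminorm K | K. absconvex X K \<and> compactin (lctop X) K}"
  by (auto simp: dual_kappa_def kappa_seminorm_def[abs_def])

lemma eps_product_car [simp]: "car (eps_product X E) = ops (dual_kappa X) E"
  by (simp add: eps_product_def)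

lemma kappa_value_le:
  assumes "y \<in> dual X" "compactin (lctop X) K" "x \<in> K"
  shows "norm (y x) \<le> kappa_seminorm K y"
  unfolding kappa_seminorm_def
proof (rule cSUP_upper[OF assms(3)])
  have "continuous_map (lctop X) euclidean y" using assms(1) by (simp add: dual_iff cont_linear_lcs_def)
  then have "compactin euclidean (y ` K)" using assms(2) by (rule image_compactin[rotated])
  then show "bdd_above ((\<lambda>x. norm (y x)) ` K)"
    using compact_imp_bounded[of "y ` K"] bounded_norm_comp[of y K] by (auto intro: bounded_imp_bdd_above)
qed

lemma kappa_seminorm_least: "absconvex X K \<Longrightarrow> (\<And>x. x \<in> K \<Longrightarrow> norm (y x) \<le> B) \<Longrightarrow> kappa_seminorm K y \<le> B"
  unfolding kappa_seminorm_def absconvex_def by (intro cSUP_least) auto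

context lcspace
begin

lemma dual_zero: "(\<lambda>_. 0) \<in> dual X"
proof -
  obtain p where "p \<in> sn X" using sn_nonempty by blast
  then show ?thesis by (intro dualI[where p = p and C = 0]) auto
qed

lemma dual_add:
  assumes y: "y \<in> dual X" and z: "z \<in> dual X"
  shows "(\<lambda>x. y x + z x) \<in> dual X"
proof -
  obtain p C where p: "p \<in> sn X" "0 \<le> C" "\<And>x. x \<in> car X \<Longrightarrow> norm (y x) \<le> C * p x" using dual_bound[OF y] by blast
  obtain q D where q: "q \<in> sn X" "0 \<le> D" "\<And>x. x \<in> car X \<Longrightarrow> norm (z x) \<le> D * q x" using dual_bound[OF z] by blast
  obtain r B where r: "r \<in> sn X" "\<And>x. x \<in> car X \<Longrightarrow> p x \<le> B * r x \<and> q x \<le> B * r x"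
    using directed[OF p(1) q(1)] by blast
  have "norm (y x + z x) \<le> (C * B + D * B) * r x" if x: "x \<in> car X" for x
  proof -
    have "norm (y x + z x) \<le> C * p x + D * q x"
      using p(3)[OF x] q(3)[OF x] norm_triangle_ineq[of "y x" "z x"] by linarith
    also have "\<dots> \<le> C * (B * r x) + D * (B * r x)"
      using r(2)[OF x] p(2) q(2) by (intro add_mono mult_left_mono) auto
    finally show ?thesis by (simp add: algebra_simps)
  qed
  then show ?thesis
    by (intro dualI[where p = r and C = "C * B + D * B"]) (auto simp: r(1) dualD[OF y] dualD[OF z] distrib_left)
qed

lemma dual_mult:
  assumes y: "y \<in> dual X"
  shows "(\<lambda>x. a * y x) \<in> dual X"
proof -
  obtain p C where p: "p \<in> sn X" "0 \<le> C" "\<And>x. x \<in> car X \<Longrightarrow> norm (y x) \<le> C * p x" using dual_bound[OF y] by blast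
  have "norm (a * y x) \<le> norm a * C * p x" if "x \<in> car X" for x
    using mult_left_mono[OF p(3)[OF that], of "norm a"] by (simp add: norm_mult)
  then show ?thesis by (intro dualI[where p = p and C = "norm a * C"]) (auto simp: p(1) dualD[OF y] distrib_left)
qed

lemma seminormed_dual_kappa: "seminormed (dual_kappa X)"
proof (rule seminormed.intro)
  let ?D = "dual_kappa X"
  show vs: "vector_space (scl ?D)" by unfold_locales (auto simp: fun_eq_iff algebra_simps)
  then interpret W: vector_space "scl ?D" .
  show "module.subspace (scl ?D) (car ?D)"
    unfolding W.subspace_def using dual_zero dual_add dual_mult by (simp add: zero_fun_def plus_fun_def)
  fix q assume "q \<in> sn ?D"
  then obtain K where q: "q = kappa_seminorm K" and K: "absconvex X K" "compactin (lctop X) K" by auto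
  note le = kappa_value_le[OF _ K(2)] and least = kappa_seminorm_least[OF K(1)]
  show "seminorm_on ?D q"
    unfolding seminorm_on_def q
  proof (intro conjI ballI allI)
    fix y z assume yz: "y \<in> car ?D" "z \<in> car ?D"
    show "kappa_seminorm K (y + z) \<le> kappa_seminorm K y + kappa_seminorm K z"
    proof (rule least)
      show "norm ((y + z) x) \<le> kappa_seminorm K y + kappa_seminorm K z" if "x \<in> K" for x
        using le[of y x] le[of z x] yz that norm_triangle_ineq[of "y x" "z x"] by simp
    qed
  next
    fix a y assume y: "y \<in> car ?D"
    have ay: "(\<lambda>x. a * y x) \<in> dual X" using dual_mult y by simp
    have "kappa_seminorm K (\<lambda>x. a * y x) \<le> norm a * kappa_seminorm K y"
      by (rule least) (use le[of y] y in \<open>simp add: norm_mult mult_left_mono\<close>)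
    moreover have "norm a * kappa_seminorm K y \<le> kappa_seminorm K (\<lambda>x. a * y x)"
    proof (cases "a = 0")
      case False
      have "kappa_seminorm K y \<le> kappa_seminorm K (\<lambda>x. a * y x) / norm a"
        by (rule least) (use le[OF ay] False in \<open>simp add: norm_mult field_simps\<close>)
      then show ?thesis using False by (simp add: field_simps)
    next
      case True
      obtain x where "x \<in> K" using K(1) by (auto simp: absconvex_def)
      then show ?thesis using le[OF ay, of x] True by simp
    qed
    ultimately show "kappa_seminorm K (scl ?D a y) = norm a * kappa_seminorm K y" by simp
  qed
qed

lemma transp_dual:
  assumes T: "cont_linear_lcs X Y T" and y: "y \<in> dual Y"
  shows "transp X T y \<in> dual X"
  unfolding dual_iff
proof
  have "cont_linear_lcs X scalar_lcs (y \<circ> T)"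
    using y cont_linear_lcs_compose[OF T, of scalar_lcs y] unfolding dual_iff by blast
  then show "cont_linear_lcs X scalar_lcs (transp X T y)"
    by (rule cont_linear_lcs_cong) (auto simp: transp_def seminormed_axioms)
qed (simp add: transp_def)

end

text \<open>Convergence in the topology itself and not only under functionals: it has to be compared
  with a limit produced by the continuity of an element of the epsilon product.\<close>

lemma (in fc_space) scl_riemann_tendsto:
  assumes f: "f \<in> car (schwartz X :: ('k, (real, 'd::{finite,linorder}) vec \<Rightarrow> 'v) lcs)"
  shows "limitin (lctop X) (\<lambda>N. scl_riemann N n f) (hermite_coeff X n f) sequentially"
  unfolding limitin_lctop_iff
proof (intro conjI ballI hermite_coeff_in[OF f] always_eventually allI scl_riemann_in schwartz_in[OF f])
  fix p assume p: "p \<in> sn X"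
  obtain K M where K: "0 \<le> K" and err: "\<And>f p u C N. f \<in> car (schwartz X :: ('k, (real, 'd) vec \<Rightarrow> 'v) lcs) \<Longrightarrow>
     p \<in> sn X \<Longrightarrow> u \<in> dual X \<Longrightarrow> 0 \<le> C \<Longrightarrow> (\<And>z. z \<in> car X \<Longrightarrow> norm (u z) \<le> C * p z) \<Longrightarrow>
     norm (u (scl_riemann N n f) - coef (\<lambda>x. u (f x)) n) \<le> K * (C * schwartz_seminorm X M p f) * (1 / 2) ^ N"
    using riemann_coef_error[of n] by blast
  have in_car: "scl_riemann N n f \<in> car X" for N by (intro scl_riemann_in schwartz_in[OF f])
  have le: "p (scl_riemann N n f - hermite_coeff X n f) \<le> K * (1 * schwartz_seminorm X M p f) * (1 / 2) ^ N" for N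
  proof (rule seminorm_le_by_dual[OF p diff_in[OF in_car hermite_coeff_in[OF f]]])
    fix u assume u: "u \<in> dual X" and ule: "\<And>z. z \<in> car X \<Longrightarrow> norm (u z) \<le> p z"
    show "norm (u (scl_riemann N n f - hermite_coeff X n f)) \<le> K * (1 * schwartz_seminorm X M p f) * (1 / 2) ^ N"
      using err[OF f p u, of 1 N] ule
      by (simp add: dualD(5)[OF u in_car hermite_coeff_in[OF f]] dual_hermite_coeff[OF f u])
  qed
  show "(\<lambda>N. p (scl_riemann N n f - hermite_coeff X n f)) \<longlonglongrightarrow> 0"
  proof (rule Lim_null_comparison)
    show "\<forall>\<^sub>F N in sequentially. norm (p (scl_riemann N n f - hermite_coeff X n f)) \<le>
        K * (1 * schwartz_seminorm X M p f) * (1 / 2) ^ N"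
      using le p_nonneg[OF sn_seminorm[OF p] diff_in[OF in_car hermite_coeff_in[OF f]]] by (simp add: always_eventually)
    show "(\<lambda>N. K * (1 * schwartz_seminorm X M p f) * (1 / 2) ^ N) \<longlonglongrightarrow> 0"
      by (intro tendsto_mult_right_zero LIMSEQ_power_zero) auto
  qed
qed

section \<open>Scalar test functions and evaluation functionals\<close>

interpretation scalar: fc_space "scalar_lcs :: ('k::real_or_complex, 'k) lcs"
  by (rule fc_space_scalar)

interpretation test: lcspace "schwartz scalar_lcs :: ('k::real_or_complex, (real, 'd::{finite,linorder}) vec \<Rightarrow> 'k) lcs"
  by (rule scalar.lcspace_schwartz)

lemma scalar_id_dual: "(\<lambda>x. x) \<in> dual (scalar_lcs :: ('k::real_or_complex, 'k) lcs)"
  by (rule scalar.dualI[where p = norm and C = 1]) auto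

lemma point_eval_schwartz_dual:
  "point_eval (schwartz scalar_lcs) x \<in> dual (schwartz scalar_lcs :: ('k::real_or_complex, (real, 'd::{finite,linorder}) vec \<Rightarrow> 'k) lcs)"
proof (rule test.dualI[where p = "schwartz_seminorm scalar_lcs 0 norm" and C = 1])
  fix f g :: "(real, 'd) vec \<Rightarrow> 'k" assume fg: "f \<in> car (schwartz scalar_lcs)" "g \<in> car (schwartz scalar_lcs)"
  then show "point_eval (schwartz scalar_lcs) x (f + g) = point_eval (schwartz scalar_lcs) x f + point_eval (schwartz scalar_lcs) x g"
    using test.add_in[OF fg] by (simp add: point_eval_def)
next
  fix a and f :: "(real, 'd) vec \<Rightarrow> 'k" assume f: "f \<in> car (schwartz scalar_lcs)"
  then show "point_eval (schwartz scalar_lcs) x (scl (schwartz scalar_lcs) a f) = a * point_eval (schwartz scalar_lcs) x f"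
    using test.scl_in[OF f, of a] by (simp add: point_eval_def)
next
  fix f :: "(real, 'd) vec \<Rightarrow> 'k" assume f: "f \<in> car (schwartz scalar_lcs)"
  then show "norm (point_eval (schwartz scalar_lcs) x f) \<le> 1 * schwartz_seminorm scalar_lcs 0 norm f"
    using scalar.schwartz_value_0[OF f, of norm x 0] by (simp add: point_eval_def)
qed (auto simp: point_eval_def)

lemma point_eval_rapid_dual:
  "point_eval (rapid scalar_lcs) n \<in> dual (rapid scalar_lcs :: ('k::real_or_complex, (nat, 'd::{finite,linorder}) vec \<Rightarrow> 'k) lcs)"
proof -
  let ?R = "rapid scalar_lcs :: ('k, (nat, 'd) vec \<Rightarrow> 'k) lcs"
  interpret R: seminormed ?R by (rule scalar.seminormed_rapid)
  show ?thesis
  proof (rule R.dualI[where p = "rapid_seminorm 1 norm" and C = 1])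
    fix f g assume fg: "f \<in> car ?R" "g \<in> car ?R"
    then show "point_eval ?R n (f + g) = point_eval ?R n f + point_eval ?R n g"
      using R.add_in[OF fg] by (simp add: point_eval_def)
  next
    fix a f assume f: "f \<in> car ?R"
    then show "point_eval ?R n (scl ?R a f) = a * point_eval ?R n f"
      using R.scl_in[OF f, of a] by (simp add: point_eval_def)
  next
    fix f assume f: "f \<in> car ?R"
    have "1 \<le> wt n powr (real 1 / 2)" by (rule ge_one_powr_ge_zero) auto
    then have "norm (f n) * 1 \<le> norm (f n) * wt n powr (real 1 / 2)" by (intro mult_left_mono) auto
    also have "\<dots> \<le> rapid_seminorm 1 norm f" by (rule rapid_value_le[OF f]) auto
    finally show "norm (point_eval ?R n f) \<le> 1 * rapid_seminorm 1 norm f" using f by (simp add: point_eval_def)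
  qed (auto simp: point_eval_def)
qed

lemma seminorm_bdd_on_compact:
  assumes q: "q \<in> sn Y" and Y: "seminormed Y" and K: "compactin (lctop Y) K"
  obtains B where "0 \<le> B" "\<And>x. x \<in> K \<Longrightarrow> q x \<le> B"
proof -
  have "compactin euclideanreal (q ` K)"
    by (rule image_compactin[OF K seminormed.continuous_map_seminorm[OF Y q]])
  then have "bounded (q ` K)" by (simp add: compact_imp_bounded)
  then obtain B where "\<And>x. x \<in> K \<Longrightarrow> norm (q x) \<le> B" by (auto simp: bounded_iff)
  then show thesis by (intro that[of "max B 0"]) (force simp: le_max_iff_disj)+
qed

lemma scalar_coef:
  assumes "g \<in> car (schwartz scalar_lcs :: ('k::real_or_complex, (real, 'd::{finite,linorder}) vec \<Rightarrow> 'k) lcs)"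
  shows "coef g n = hermite_coeff scalar_lcs n g"
  using scalar.dual_hermite_coeff[OF assms scalar_id_dual, of n] by simp

text \<open>Riemann sums converge to the Hermite coefficient uniformly on compact sets, so the coefficient
  functional is the limit of combinations of point evaluations in the topology of \<^const>\<open>dual_kappa\<close>.\<close>

lemma hermite_functional_limit:
  fixes n :: "(nat, 'd::{finite,linorder}) vec"
  defines "S \<equiv> schwartz scalar_lcs :: ('k::real_or_complex, (real, 'd) vec \<Rightarrow> 'k) lcs"
  defines "F \<equiv> transp S (hermite_transform scalar_lcs) (point_eval (rapid scalar_lcs) n)"
  shows "F \<in> dual S"
    and "limitin (lctop (dual_kappa S))
      (\<lambda>N. \<Sum>v\<in>riemann_pts N. scl (dual_kappa S) (of_real (riemann_wt N v * hermite n v)) (point_eval S v)) F sequentially"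
proof -
  interpret D: seminormed "dual_kappa S" unfolding S_def by (rule test.seminormed_dual_kappa)
  show F: "F \<in> dual S"
    unfolding F_def S_def by (rule test.transp_dual[OF scalar.cont_linear_hermite_transform point_eval_rapid_dual])
  let ?c = "\<lambda>N v. of_real (riemann_wt N v * hermite n v) :: 'k"
  define R where "R N = (\<Sum>v\<in>riemann_pts N. scl (dual_kappa S) (?c N v) (point_eval S v))" for N
  have pe: "point_eval S v \<in> car (dual_kappa S)" for v unfolding S_def dual_kappa_simps by (rule point_eval_schwartz_dual)
  have R_in: "R N \<in> dual S" for N
    using D.sum_in[OF D.scl_in[OF pe]] unfolding R_def by simp
  have R_val: "R N g = scalar.scl_riemann N n g" and F_val: "F g = coef g n" if g: "g \<in> car S" for g N
  proof -
    show "R N g = scalar.scl_riemann N n g"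
      unfolding R_def sum_fun_apply scalar.scl_riemann_def using g by (simp add: point_eval_def)
    show "F g = coef g n"
      using g scalar.hermite_transform_rapid[of g] unfolding F_def transp_def point_eval_def
      by (simp add: S_def hermite_transform_def scalar_coef)
  qed
  have "(\<lambda>N. kappa_seminorm K (R N - F)) \<longlonglongrightarrow> 0" if K: "absconvex S K" "compactin (lctop S) K" for K
  proof -
    obtain A M where A: "0 \<le> A" and err: "\<And>f p u C N. f \<in> car S \<Longrightarrow>
       p \<in> sn scalar_lcs \<Longrightarrow> u \<in> dual scalar_lcs \<Longrightarrow> 0 \<le> C \<Longrightarrow> (\<And>z. z \<in> car scalar_lcs \<Longrightarrow> norm (u z) \<le> C * p z) \<Longrightarrow>
       norm (u (scalar.scl_riemann N n f) - coef (\<lambda>x. u (f x)) n) \<le> A * (C * schwartz_seminorm scalar_lcs M p f) * (1 / 2) ^ N"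
      using scalar.riemann_coef_error[where 'd = 'd and 'k = 'k, of n] unfolding S_def by blast
    have sub: "K \<subseteq> car S" using K(1) by (auto simp: absconvex_def)
    \<comment> \<open>The error involves a single seminorm of the test function, and this is bounded
      on the compact set \<open>K\<close>; that is the source of the uniformity.\<close>
    have "schwartz_seminorm scalar_lcs M norm \<in> sn S" by (auto simp: S_def)
    then obtain B where B: "0 \<le> B" "\<And>g. g \<in> K \<Longrightarrow> schwartz_seminorm scalar_lcs M norm g \<le> B"
      by (rule seminorm_bdd_on_compact[OF _ _ K(2)]) (simp_all add: S_def test.seminormed_axioms)
    have le: "kappa_seminorm K (R N - F) \<le> A * B * (1 / 2) ^ N" for N
    proof (rule kappa_seminorm_least[OF K(1)])
      fix g assume gK: "g \<in> K"
      then have g: "g \<in> car S" using sub by blast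
      have "norm ((R N - F) g) \<le> A * (1 * schwartz_seminorm scalar_lcs M norm g) * (1 / 2) ^ N"
        using err[OF g _ scalar_id_dual, of norm 1 N] by (simp add: R_val[OF g] F_val[OF g])
      also have "\<dots> \<le> A * (1 * B) * (1 / 2) ^ N"
        using A B(2)[OF gK] by (intro mult_right_mono mult_left_mono) auto
      finally show "norm ((R N - F) g) \<le> A * B * (1 / 2) ^ N" by simp
    qed
    have Ks: "kappa_seminorm K \<in> sn (dual_kappa S)" using K by auto
    have "R N - F \<in> car (dual_kappa S)" for N by (rule D.diff_in) (simp_all add: R_in F)
    then have nn: "0 \<le> kappa_seminorm K (R N - F)" for N using D.p_nonneg[OF D.sn_seminorm[OF Ks]] by blast
    show ?thesis
    proof (rule Lim_null_comparison[where g = "\<lambda>N. A * B * (1 / 2) ^ N"])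
      show "\<forall>\<^sub>F N in sequentially. norm (kappa_seminorm K (R N - F)) \<le> A * B * (1 / 2) ^ N"
        using le nn by (simp add: always_eventually)
      show "(\<lambda>N. A * B * (1 / 2) ^ N) \<longlonglongrightarrow> 0"
        by (intro tendsto_mult_right_zero LIMSEQ_power_zero) auto
    qed
  qed
  then have "limitin (lctop (dual_kappa S)) R F sequentially"
    unfolding D.limitin_lctop_iff using F R_in by auto
  then show "limitin (lctop (dual_kappa S))
      (\<lambda>N. \<Sum>v\<in>riemann_pts N. scl (dual_kappa S) (?c N v) (point_eval S v)) F sequentially"
    unfolding R_def[abs_def] .
qed

lemma linear_lcs_sum:
  assumes X: "seminormed X" and Y: "seminormed Y" and T: "linear_lcs X Y T"
    and x: "\<And>i. i \<in> A \<Longrightarrow> x i \<in> car X"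
  shows "T (\<Sum>i\<in>A. x i) = (\<Sum>i\<in>A. T (x i))"
proof -
  interpret X: seminormed X by (rule X)
  interpret Y: seminormed Y by (rule Y)
  have add: "T (v + w) = T v + T w" if "v \<in> car X" "w \<in> car X" for v w
    using T that by (simp add: linear_lcs_def)
  have "T (0 + 0) = T 0 + T 0" by (rule add) auto
  then have 0: "T 0 = 0" by simp
  show ?thesis using x
    by (induction A rule: infinite_finite_induct) (auto simp: 0 add X.sum_in)
qed

text \<open>The right-hand side depends on \<open>u\<close> only through \<open>S_map S u\<close>,
  so the identity is valid for whichever preimage \<open>inv_into\<close> selects.\<close>

lemma (in fc_space) eps_product_hermite_coeff:
  fixes n :: "(nat, 'd::{finite,linorder}) vec"
  defines "S \<equiv> schwartz scalar_lcs :: ('k, (real, 'd) vec \<Rightarrow> 'k) lcs"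
  assumes u: "u \<in> car (eps_product S X)" and f: "S_map S u \<in> car (schwartz X)"
  shows "u (transp S (hermite_transform scalar_lcs) (point_eval (rapid scalar_lcs) n)) = hermite_coeff X n (S_map S u)"
proof -
  let ?F = "transp S (hermite_transform scalar_lcs) (point_eval (rapid scalar_lcs) n)"
  let ?D = "dual_kappa S"
  interpret D: seminormed ?D unfolding S_def by (rule test.seminormed_dual_kappa)
  let ?c = "\<lambda>N v. of_real (riemann_wt N v * hermite n v) :: 'k"
  have lin: "linear_lcs ?D X u" and cont: "continuous_map (lctop ?D) (lctop X) u"
    using u by (auto simp: ops_def cont_linear_lcs_def)
  have pe: "point_eval S v \<in> car ?D" for v unfolding S_def dual_kappa_simps by (rule point_eval_schwartz_dual)
  have "u (\<Sum>v\<in>riemann_pts N. scl ?D (?c N v) (point_eval S v)) = scl_riemann N n (S_map S u)" for N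
  proof -
    have "u (\<Sum>v\<in>riemann_pts N. scl ?D (?c N v) (point_eval S v)) = (\<Sum>v\<in>riemann_pts N. u (scl ?D (?c N v) (point_eval S v)))"
      by (rule linear_lcs_sum[OF D.seminormed_axioms seminormed_axioms lin D.scl_in[OF pe]])
    also have "\<dots> = (\<Sum>v\<in>riemann_pts N. scl X (?c N v) (u (point_eval S v)))"
      using lin pe unfolding linear_lcs_def by (intro sum.cong) blast+
    finally show ?thesis by (simp add: scl_riemann_def S_map_def)
  qed
  then have "limitin (lctop X) (\<lambda>N. scl_riemann N n (S_map S u)) (u ?F) sequentially"
    using continuous_map_limit[OF cont hermite_functional_limit(2)[where n = n and 'k = 'k, folded S_def]]
    by (simp only: o_def)
  then show ?thesis
    using limitin_Hausdorff_unique[OF _ scl_riemann_tendsto[OF f] trivial_limit_sequentially Hausdorff] by blast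
qed

section \<open>Hermite functions as scalar test functions\<close>

definition hermite_fun :: "(nat, 'd::finite) vec \<Rightarrow> (real, 'd) vec \<Rightarrow> 'k::real_or_complex" where
  "hermite_fun n = (\<lambda>x. of_real (hermite n x))"

lemma hermite_fun_series:
  "hermite_fun n = scalar.hermite_series 0 (\<lambda>m. if m = n then 1 else 0 :: 'k::real_or_complex)"
  by (rule ext, subst scalar.hermite_series_finite[of "{n}"]) (auto simp: hermite_fun_def)

lemma single_rapid: "(\<lambda>m. if m = n then 1 else 0) \<in> car (rapid scalar_lcs :: ('k::real_or_complex, (nat, 'd::finite) vec \<Rightarrow> 'k) lcs)"
  by (rule scalar.rapid_single) simp

lemma hermite_fun_schwartz:
  "hermite_fun n \<in> car (schwartz scalar_lcs :: ('k::real_or_complex, (real, 'd::{finite,linorder}) vec \<Rightarrow> 'k) lcs)"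
  unfolding hermite_fun_series by (rule scalar.hermite_series_schwartz[OF single_rapid])

lemma dual_schwartz_expansion:
  fixes y :: "((real, 'd::{finite,linorder}) vec \<Rightarrow> 'k::real_or_complex) \<Rightarrow> 'k"
  assumes y: "y \<in> dual (schwartz scalar_lcs)" and g: "g \<in> car (schwartz scalar_lcs)"
  shows "((\<lambda>n. hermite_coeff scalar_lcs n g * y (hermite_fun n)) has_sum y g) UNIV"
proof -
  let ?S = "schwartz scalar_lcs :: ('k, (real, 'd) vec \<Rightarrow> 'k) lcs"
  have "continuous_map (lctop ?S) euclidean y" using y by (simp add: dual_iff cont_linear_lcs_def)
  from continuous_map_limit[OF this scalar.hermite_expansion[OF g]]
  have lim: "((\<lambda>F. y (\<Sum>n\<in>F. hermite_component scalar_lcs n g)) \<longlongrightarrow> y g) (finite_subsets_at_top UNIV)"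
    by (simp add: o_def)
  have "hermite_component scalar_lcs n g = scl ?S (hermite_coeff scalar_lcs n g) (hermite_fun n)" for n
    by (simp add: hermite_component_def hermite_fun_def mult.commute)
  then have "y (\<Sum>n\<in>F. hermite_component scalar_lcs n g) = (\<Sum>n\<in>F. hermite_coeff scalar_lcs n g * y (hermite_fun n))" for F
    using test.dualD(2)[OF y hermite_fun_schwartz]
    by (simp only:) (subst test.dualD(6)[OF y], rule test.scl_in[OF hermite_fun_schwartz], simp only:)
  with lim show ?thesis by (simp add: has_sum_def)
qed

text \<open>A functional is bounded by one Schwartz seminorm, and \<open>hermite_fun n\<close> is
  the series of a unit sequence, whose weighted sum is a power of \<open>wt n\<close>. Hence
  \<open>y (hermite_fun n)\<close> is an admissible multiplier of a rapidly decreasing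
  sequence.\<close>

lemma dual_hermite_fun_bound:
  fixes y :: "((real, 'd::{finite,linorder}) vec \<Rightarrow> 'k::real_or_complex) \<Rightarrow> 'k"
  assumes y: "y \<in> dual (schwartz scalar_lcs)"
  obtains C k where "\<And>n. norm (y (hermite_fun n)) \<le> C * wt n ^ k"
proof -
  let ?S = "schwartz scalar_lcs :: ('k, (real, 'd) vec \<Rightarrow> 'k) lcs"
  obtain q B where q: "q \<in> sn ?S" and B: "0 \<le> B" "\<And>g. g \<in> car ?S \<Longrightarrow> norm (y g) \<le> B * q g"
    using test.dual_bound[OF y] by blast
  obtain m where qm: "q = schwartz_seminorm scalar_lcs m norm" using q by auto
  obtain A k where A: "\<And>z p. z \<in> car (rapid scalar_lcs :: ('k, (nat, 'd) vec \<Rightarrow> 'k) lcs) \<Longrightarrow> p \<in> sn scalar_lcs \<Longrightarrow>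
     schwartz_seminorm scalar_lcs m p (scalar.hermite_series 0 z) \<le> A * (\<Sum>\<^sub>\<infinity>n. wt n ^ k * p (z n))"
    using scalar.hermite_series_seminorm_le[of m] by blast
  have "norm (y (hermite_fun n)) \<le> B * A * wt n ^ k" for n
  proof -
    have "norm (y (hermite_fun n)) \<le> B * q (hermite_fun n)" by (rule B(2)[OF hermite_fun_schwartz])
    also have "q (hermite_fun n) \<le> A * (\<Sum>\<^sub>\<infinity>m. wt m ^ k * norm (if m = n then 1 else 0 :: 'k))"
      unfolding qm hermite_fun_series by (rule A[OF single_rapid]) simp
    also have "(\<Sum>\<^sub>\<infinity>m. wt m ^ k * norm (if m = n then 1 else 0 :: 'k)) =
        (\<Sum>\<^sub>\<infinity>m\<in>{n}. wt m ^ k * norm (if m = n then 1 else 0 :: 'k))"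
      by (rule infsum_cong_neutral) auto
    also have "\<dots> = wt n ^ k" by simp
    finally show ?thesis using B(1) by (simp add: mult_left_mono mult.assoc)
  qed
  then show thesis by (rule that)
qed

text \<open>Sequences dominated by a rapidly decreasing one form a compact set in the product topology,
  on which the Hermite series is continuous by dominated convergence.\<close>

lemma hermite_series_dominated_compact:
  fixes b :: "(nat, 'd::{finite,linorder}) vec \<Rightarrow> real"
  assumes b: "\<And>n. 0 \<le> b n" "\<And>j. \<exists>C. \<forall>n. b n * wt n ^ j \<le> C"
  defines "A \<equiv> {a :: (nat, 'd) vec \<Rightarrow> 'k::real_or_complex. \<forall>n. norm (a n) \<le> b n}"
  shows "A \<subseteq> car (rapid scalar_lcs)"
    and "absconvex (schwartz scalar_lcs) (scalar.hermite_series 0 ` A)"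
    and "compactin (lctop (schwartz scalar_lcs)) (scalar.hermite_series 0 ` A)"
proof -
  let ?S = "schwartz scalar_lcs :: ('k, (real, 'd) vec \<Rightarrow> 'k) lcs"
  let ?R = "rapid scalar_lcs :: ('k, (nat, 'd) vec \<Rightarrow> 'k) lcs"
  let ?G = "scalar.hermite_series 0 :: ((nat, 'd) vec \<Rightarrow> 'k) \<Rightarrow> (real, 'd) vec \<Rightarrow> 'k"
  interpret R: seminormed ?R by (rule scalar.seminormed_rapid)
  show sub: "A \<subseteq> car ?R"
  proof
    fix a assume a: "a \<in> A"
    have "\<exists>C. \<forall>n. norm (a n) * wt n ^ j \<le> C" for j
    proof -
      obtain C where C: "\<And>n. b n * wt n ^ j \<le> C" using b(2) by blast
      have "norm (a n) * wt n ^ j \<le> b n * wt n ^ j" for n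
        using a by (intro mult_right_mono) (auto simp: A_def)
      then show ?thesis using C order.trans by blast
    qed
    then show "a \<in> car ?R" unfolding scalar.rapid_iff by simp
  qed
  have G_in: "?G a \<in> car ?S" if "a \<in> A" for a
    using sub that by (intro scalar.hermite_series_schwartz) blast
  show "absconvex ?S (?G ` A)"
    unfolding absconvex_def
  proof (intro conjI ballI allI impI)
    have "(\<lambda>_. 0) \<in> A" using b(1) by (simp add: A_def)
    then show "?G ` A \<noteq> {}" by blast
    show "?G ` A \<subseteq> car ?S" using G_in by blast
    fix f g and s t :: 'k assume "f \<in> ?G ` A" "g \<in> ?G ` A" and st: "norm s + norm t \<le> 1"
    then obtain a c where f: "f = ?G a" and g: "g = ?G c" and ac: "a \<in> A" "c \<in> A" by blast
    let ?h = "scl ?R s a + scl ?R t c"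
    have "norm (?h n) \<le> b n" for n
    proof -
      have "norm (?h n) \<le> norm s * norm (a n) + norm t * norm (c n)"
        using norm_triangle_ineq[of "s * a n" "t * c n"] by (simp add: norm_mult)
      also have "\<dots> \<le> norm s * b n + norm t * b n"
        using ac by (intro add_mono mult_left_mono) (auto simp: A_def)
      also have "\<dots> = (norm s + norm t) * b n" by (simp add: algebra_simps)
      also have "\<dots> \<le> 1 * b n" by (rule mult_right_mono[OF st b(1)])
      finally show ?thesis by simp
    qed
    then have h: "?h \<in> A" by (simp add: A_def)
    have a: "a \<in> car ?R" "c \<in> car ?R" using sub ac by auto
    have "?G ?h = scl ?S s f + scl ?S t g"
      unfolding f g
      using scalar.hermite_series_add[OF R.scl_in[OF a(1), of s] R.scl_in[OF a(2), of t], of 0]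
        scalar.hermite_series_scl[OF a(1), of 0 s] scalar.hermite_series_scl[OF a(2), of 0 t]
      by (simp add: fun_eq_iff)
    then show "scl ?S s f + scl ?S t g \<in> ?G ` A" using h by (metis image_eqI)
  qed
  let ?P = "product_topology (\<lambda>_. euclidean :: 'k topology) (UNIV :: (nat, 'd) vec set)"
  \<comment> \<open>Continuity for pointwise convergence of sequences is claimed only under the
    common majorant \<open>b\<close>, hence on the subspace \<open>A\<close>.\<close>
  let ?T = "subtopology ?P A"
  have "A = PiE UNIV (\<lambda>n. cball 0 (b n))" by (auto simp: A_def PiE_def)
  then have "compactin ?P A" by (simp add: compactin_PiE)
  then have compact: "compactin ?T A" by (simp add: compactin_subtopology)
  have "limitin (lctop ?S) ?G (?G a0) (atin ?T a0)" if "a0 \<in> topspace ?T" for a0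
  proof -
    have a0: "a0 \<in> A" using that by simp
    have evA: "\<forall>\<^sub>F a in atin ?T a0. a \<in> A"
      using openin_topspace[of ?T] a0 unfolding eventually_atin topspace_subtopology
      by (intro disjI2 exI[of _ A]) simp
    have pt: "((\<lambda>a. a n) \<longlongrightarrow> a0 n) (atin ?T a0)" for n
    proof -
      have "continuous_map ?T euclidean (\<lambda>a. a n)"
        by (intro continuous_map_from_subtopology continuous_map_product_projection) simp
      then show ?thesis using that by (simp add: continuous_map_atin)
    qed
    \<comment> \<open>Two members of \<open>A\<close> differ by at most \<open>2 * b n\<close>.
      Summability against any power of the weight holds because \<open>b\<close>, read as a scalar
      sequence, is itself a member of \<open>A\<close>.\<close>
    have bsum: "(\<lambda>n. 2 * (wt n ^ k * b n)) summable_on UNIV" for k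
    proof -
      have "(\<lambda>n. of_real (b n) :: 'k) \<in> car ?R" using sub b(1) by (auto simp: A_def)
      from scalar.rapid_summable[OF this, of norm k] show ?thesis
        using b(1) by (intro summable_on_cmult_right) simp
    qed
    show ?thesis
      unfolding test.limitin_lctop_iff
    proof (intro conjI ballI G_in[OF a0])
      show "\<forall>\<^sub>F a in atin ?T a0. ?G a \<in> car ?S" using evA by eventually_elim (rule G_in)
      fix q assume q: "q \<in> sn ?S"
      then obtain m where qm: "q = schwartz_seminorm scalar_lcs m norm" by auto
      obtain C k where C: "\<And>z p. z \<in> car ?R \<Longrightarrow> p \<in> sn scalar_lcs \<Longrightarrow>
         schwartz_seminorm scalar_lcs m p (?G z) \<le> C * (\<Sum>\<^sub>\<infinity>n. wt n ^ k * p (z n))"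
        using scalar.hermite_series_seminorm_le[of m] by blast
      have "((\<lambda>a. \<Sum>\<^sub>\<infinity>n. wt n ^ k * norm (a n - a0 n)) \<longlongrightarrow> 0) (atin ?T a0)"
      proof (rule infsum_dominated_tendsto_0[OF bsum[of k]])
        show "\<forall>\<^sub>F a in atin ?T a0. \<forall>n. 0 \<le> wt n ^ k * norm (a n - a0 n) \<and> wt n ^ k * norm (a n - a0 n) \<le> 2 * (wt n ^ k * b n)"
          using evA
        proof eventually_elim
          fix a assume a: "a \<in> A"
          have "norm (a n - a0 n) \<le> 2 * b n" for n
            using a a0 norm_triangle_ineq4[of "a n" "a0 n"] by (auto simp: A_def intro: order.trans add_mono dest!: spec[of _ n])
          then have "wt n ^ k * norm (a n - a0 n) \<le> wt n ^ k * (2 * b n)" for n by (intro mult_left_mono) auto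
          then show "\<forall>n. 0 \<le> wt n ^ k * norm (a n - a0 n) \<and> wt n ^ k * norm (a n - a0 n) \<le> 2 * (wt n ^ k * b n)"
            by (simp add: mult.left_commute)
        qed
        show "((\<lambda>a. wt n ^ k * norm (a n - a0 n)) \<longlongrightarrow> 0) (atin ?T a0)" for n
          using pt[of n] by (intro tendsto_mult_right_zero tendsto_norm_zero LIM_zero)
      qed
      from tendsto_mult_right_zero[OF this, of C]
      show "((\<lambda>a. q (?G a - ?G a0)) \<longlongrightarrow> 0) (atin ?T a0)"
      proof (rule Lim_null_comparison[rotated])
        show "\<forall>\<^sub>F a in atin ?T a0. norm (q (?G a - ?G a0)) \<le> C * (\<Sum>\<^sub>\<infinity>n. wt n ^ k * norm (a n - a0 n))"
          using evA
        proof eventually_elim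
          fix a assume a: "a \<in> A"
          have car: "a \<in> car ?R" "a0 \<in> car ?R" using sub a a0 by auto
          have "a - a0 \<in> car ?R" by (rule R.diff_in[OF car])
          have "?G (a - a0 + a0) = ?G (a - a0) + ?G a0"
            using scalar.hermite_series_add[OF R.diff_in[OF car] car(2), of 0] by (simp add: fun_eq_iff)
          then have "?G a - ?G a0 = ?G (a - a0)" by (simp only: diff_add_cancel add_diff_cancel_right')
          then have "q (?G a - ?G a0) \<le> C * (\<Sum>\<^sub>\<infinity>n. wt n ^ k * norm (a n - a0 n))"
            using C[OF R.diff_in[OF car], of norm] unfolding qm by simp
          then show "norm (q (?G a - ?G a0)) \<le> C * (\<Sum>\<^sub>\<infinity>n. wt n ^ k * norm (a n - a0 n))"
            using test.p_nonneg[OF test.sn_seminorm[OF q] test.diff_in[OF G_in[OF a] G_in[OF a0]]] by simp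
        qed
      qed
    qed
  qed
  then have "continuous_map ?T (lctop ?S) ?G" unfolding continuous_map_atin by blast
  from image_compactin[OF compact this] show "compactin (lctop ?S) (?G ` A)" .
qed

theorem (in fc_space) S_map_schwartz_surj:
  fixes f :: "(real, 'd::{finite,linorder}) vec \<Rightarrow> 'v"
  defines "S \<equiv> schwartz scalar_lcs :: ('k, (real, 'd) vec \<Rightarrow> 'k) lcs"
  assumes f: "f \<in> car (schwartz X)"
  shows "\<exists>u\<in>car (eps_product S X). S_map S u = f"
proof -
  let ?D = "dual_kappa S"
  define F where "F = hermite_transform X f"
  have F: "F \<in> car (rapid X)" unfolding F_def by (rule hermite_transform_rapid[OF f])
  \<comment> \<open>The value 0 off the dual is the normalisation demanded of members of
    \<open>ops\<close>.\<close>
  define u where "u y = (if y \<in> dual S then wsum (\<lambda>n. scl X (y (hermite_fun n)) (F n)) else 0)" for y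
  interpret D: seminormed ?D unfolding S_def by (rule test.seminormed_dual_kappa)
  have rap: "(\<lambda>n. scl X (y (hermite_fun n)) (F n)) \<in> car (rapid X)" if "y \<in> dual S" for y
    using dual_hermite_fun_bound[OF that[unfolded S_def]] rapid_mult[OF F, of "\<lambda>n. y (hermite_fun n)"] by metis
  have u_in: "u y \<in> car X" for y by (simp add: u_def wsum_in[OF rap])
  \<comment> \<open>Testing with a functional \<open>e\<close> below \<open>p\<close>: the value
    \<open>e (u y)\<close> equals \<open>y g\<close>, where \<open>g\<close> is the Hermite series
    of the scalars \<open>e (F n)\<close>. These are dominated by \<open>p (F n)\<close>, so
    \<open>g\<close> lies in \<open>K\<close> whatever \<open>e\<close> is.\<close>
  have bound: "p (u y) \<le> kappa_seminorm K y"
    if p: "p \<in> sn X" and y: "y \<in> dual S" and K: "K = scalar.hermite_series 0 ` {a. \<forall>n. norm (a n) \<le> p (F n)}"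
      "compactin (lctop S) K" "{a. \<forall>n. norm (a n) \<le> p (F n)} \<subseteq> car (rapid (scalar_lcs :: ('k, 'k) lcs))" for p y K
  proof (rule seminorm_le_by_dual[OF p u_in])
    fix e assume e: "e \<in> dual X" and le: "\<And>z. z \<in> car X \<Longrightarrow> norm (e z) \<le> p z"
    let ?a = "\<lambda>n. e (F n)"
    have a: "?a \<in> {a. \<forall>n. norm (a n) \<le> p (F n)}" using le rapid_in[OF F] by simp
    have ar: "?a \<in> car (rapid scalar_lcs)" by (rule subsetD[OF K(3) a])
    let ?g = "scalar.hermite_series 0 ?a :: (real, 'd) vec \<Rightarrow> 'k"
    have "((\<lambda>n. e (scl X (y (hermite_fun n)) (F n))) has_sum e (u y)) UNIV"
      using wsum_dual[OF rap[OF y] e] y by (simp add: u_def)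
    then have "((\<lambda>n. e (F n) * y (hermite_fun n)) has_sum e (u y)) UNIV"
      by (simp add: dualD(2)[OF e] rapid_in[OF F] mult.commute)
    moreover have "((\<lambda>n. e (F n) * y (hermite_fun n)) has_sum y ?g) UNIV"
      using dual_schwartz_expansion[OF y[unfolded S_def] scalar.hermite_series_schwartz[OF ar]]
        fun_cong[OF scalar.hermite_transform_series[OF ar]] by (simp add: hermite_transform_def)
    ultimately have "e (u y) = y ?g" by (rule has_sum_unique)
    moreover have "?g \<in> K" unfolding K(1) using a by (rule imageI)
    ultimately show "norm (e (u y)) \<le> kappa_seminorm K y" using kappa_value_le[OF y K(2)] by simp
  qed
  have "cont_linear_lcs ?D X u"
  proof (rule cont_linear_lcsI[OF D.seminormed_axioms seminormed_axioms])
    have "u (y + z) = u y + u z" if yz: "y \<in> dual S" "z \<in> dual S" for y z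
    proof -
      have "y + z \<in> dual S" using D.add_in[of y z] yz by simp
      then show ?thesis using yz wsum_add[OF rap rap, of y z] by (simp add: u_def scl_rules)
    qed
    moreover have "u (scl ?D a y) = scl X a (u y)" if y: "y \<in> dual S" for a y
    proof -
      have "scl ?D a y \<in> dual S" using D.scl_in[of y a] y by simp
      then show ?thesis using y wsum_scl[OF rap, of y a] by (simp add: u_def scl_rules)
    qed
    ultimately show "linear_lcs ?D X u" unfolding linear_lcs_def using u_in by auto
    fix p assume p: "p \<in> sn X"
    let ?A = "{a :: (nat, 'd) vec \<Rightarrow> 'k. \<forall>n. norm (a n) \<le> p (F n)}"
    let ?K = "scalar.hermite_series 0 ` ?A"
    have "0 \<le> p (F n)" for n by (rule p_nonneg[OF sn_seminorm[OF p] rapid_in[OF F]])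
    moreover have "\<exists>C. \<forall>n. p (F n) * wt n ^ j \<le> C" for j using F p unfolding rapid_iff by blast
    ultimately have A: "?A \<subseteq> car (rapid scalar_lcs)" and K: "absconvex S ?K" "compactin (lctop S) ?K"
      unfolding S_def by (rule hermite_series_dominated_compact)+
    have "kappa_seminorm ?K \<in> sn ?D" using K by auto
    moreover have "p (u y) \<le> 1 * kappa_seminorm ?K y" if "y \<in> car ?D" for y
      using bound[OF p _ refl K(2) A, of y] that by simp
    ultimately show "\<exists>q\<in>sn ?D. \<exists>C. \<forall>y\<in>car ?D. p (u y) \<le> C * q y" by blast
  qed
  then have "u \<in> car (eps_product S X)" by (simp add: ops_def u_def)
  moreover have "S_map S u = f"
  proof
    fix x
    have "point_eval S x (hermite_fun n) = of_real (hermite n x)" for n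
      using hermite_fun_schwartz[of n, where 'k = 'k, folded S_def] by (simp add: point_eval_def) (simp add: hermite_fun_def)
    then have "u (point_eval S x) = wsum (\<lambda>n. scl X (of_real (hermite n x)) (F n))"
      using point_eval_schwartz_dual[of x, where 'k = 'k, folded S_def] by (simp add: u_def)
    also have "\<dots> = hermite_series 0 F x" by (simp add: hermite_series_def real_wsum_def hermite_d_0)
    also have "\<dots> = f x" unfolding F_def hermite_series_transform[OF f] ..
    finally show "S_map S u x = f x" by (simp add: S_map_def)
  qed
  ultimately show ?thesis by blast
qed

theorem (in fc_space) hermite_transform_eps_product:
  fixes f :: "(real, 'd::{finite,linorder}) vec \<Rightarrow> 'v"
  assumes f: "f \<in> car (schwartz X)"
  shows "hermite_transform X f =
    (S_map (rapid scalar_lcs) \<circ>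
     eps_id (schwartz scalar_lcs) (rapid scalar_lcs) (hermite_transform scalar_lcs) \<circ>
     inv_into (car (eps_product (schwartz scalar_lcs) X)) (S_map (schwartz scalar_lcs))) f"
proof
  fix n
  let ?S = "schwartz scalar_lcs :: ('k, (real, 'd) vec \<Rightarrow> 'k) lcs"
  define u where "u = inv_into (car (eps_product ?S X)) (S_map ?S) f"
  \<comment> \<open>Surjectivity is what makes \<open>inv_into\<close> return an actual preimage of
    \<open>f\<close>.\<close>
  have "f \<in> S_map ?S ` car (eps_product ?S X)" using S_map_schwartz_surj[OF f] by auto
  then have u: "u \<in> car (eps_product ?S X)" "S_map ?S u = f"
    unfolding u_def by (rule inv_into_into, rule f_inv_into_f)
  have "u (transp ?S (hermite_transform scalar_lcs) (point_eval (rapid scalar_lcs) n)) = hermite_coeff X n f"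
    using eps_product_hermite_coeff[OF u(1), of n] u(2) f by simp
  then show "hermite_transform X f n =
    (S_map (rapid scalar_lcs) \<circ>
     eps_id ?S (rapid scalar_lcs) (hermite_transform scalar_lcs) \<circ>
     inv_into (car (eps_product ?S X)) (S_map ?S)) f n"
    using point_eval_rapid_dual[of n, where 'k = 'k]
    unfolding o_def u_def[symmetric] S_map_def eps_id_def hermite_transform_def by simp
qed

theorem theorem5p6p13:
  fixes E :: "('k::real_or_complex, 'e::ab_group_add) lcs"
  assumes "lcHs E" and "locally_complete E"
  shows
    "(schauder_decomposition
        (schwartz E :: ('k, real^'d::{finite,linorder} \<Rightarrow> 'e) lcs)
        (\<lambda>k f. \<Sum>n | enorm n \<le> real k. hermite_component E n f) \<and>
      (\<forall>f :: real^'d::{finite,linorder} \<Rightarrow> 'e. f \<in> car (schwartz E) \<longrightarrow>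
        limitin (lctop (schwartz E))
          (\<lambda>N. \<Sum>n\<in>N. hermite_component E n f) f (finite_subsets_at_top UNIV))) \<and>
     (isomorphism_lcs
        (schwartz E :: ('k, real^'d::{finite,linorder} \<Rightarrow> 'e) lcs) (rapid E) (hermite_transform E) \<and>
      (\<forall>f :: real^'d::{finite,linorder} \<Rightarrow> 'e. f \<in> car (schwartz E) \<longrightarrow>
        hermite_transform E f =
          (S_map (rapid scalar_lcs) \<circ>
           eps_id (schwartz scalar_lcs) (rapid scalar_lcs) (hermite_transform scalar_lcs) \<circ>
           inv_into (car (eps_product (schwartz scalar_lcs) E)) (S_map (schwartz scalar_lcs))) f))"
proof -
  interpret lcspace E using assms(1) by (simp add: lcHs_iff_lcspace)
  interpret fc_space E
    by unfold_locales (rule locally_complete_imp_fast_complete[OF lcspace_axioms assms(2)])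
  show ?thesis
    using hermite_schauder_decomposition hermite_expansion hermite_transform_isomorphism
      hermite_transform_eps_product by blast
qed

end
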